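(* Let $p\ge1$, $q,r\ge0$ be integers and $\mathcal{B}\in M_{q,p}(\mathbb{K})$. Let $a\in\mathbb{K}^r$ and $b\in\mathbb{K}^p$, and let $V_{a,b}$ be the group $(\mathbb{K}[[x_1,\dots,x_p,y_1,\dots,y_q]]_+,+)$. The group $V_0^r\rtimes\mathbf{G}_{\mathcal{B}}$ acts by automorphisms on $V_{a,b}$ by: $$(P_1,\dots,P_r,F)\hookrightarrow Q=Q\left(F,y\Big(\frac{F}{x}\Big)^{\mathcal{B}}\right)e^{a_1P_1+\dots+a_rP_r}\Big(\frac{F_1}{x_1}\Big)^{b_1}\cdots\Big(\frac{F_p}{x_p}\Big)^{b_p}.$$ If $a^{(1)},\dots,a^{(s)}\in\mathbb{K}^r$ and $b^{(1)},\dots,b^{(s)}\in\mathbb{K}^p$, the group $(V_{a^{(1)},b^{(1)}}\oplus\dots\oplus V_{a^{(s)},b^{(s)}})\rtimes(V_0^r\rtimes\mathbf{G}_{\mathcal{B}})$ is isomorphic to the character group of an $\mathbb{N}^{p+q}$-graded Hopf algebra $\mathcal{H}_{\mathcal{B},r,a,b}$, whose graded dual is the enveloping algebra of the fundamental deg1 pre-Lie algebra with basis $(f_i(\alpha))_{i\in[p+r+s],\alpha\in\mathbb{N}^{p+q}\setminus\{0\}}$ and product $$f_j(\beta)*f_i(\alpha)=(A^{(i,j)}\cdot\alpha+b^{(i,j)})f_i(\alpha+\beta),$$ where, for all $i,j\in[p+r+s]$: (i) $A^{(i,j)}=A_j$ if $1\le j\le p$ and $A^{(i,j)}=0$ if $j>p$,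 with $A_j\in\mathbb{K}^{p+q}$ the $j$-th column of $A=\begin{pmatrix}I_p\\\mathcal{B}\end{pmatrix}$; (ii) $b^{(i,j)}=0$ if $i\le p+r$; and for $i\geq p+r+1$: $b^{(i,j)}=b^{(i-p-r)}_j$ if $1\le j\le p$, $b^{(i,j)}=a^{(i-p-r)}_{j-p}$ if $p+1\le j\le p+r$, and $b^{(i,j)}=0$ if $j\ge p+r+1$.
   Context: $\mathbb{K}$ is a field of characteristic zero. $\mathbb{K}[[x_1,\dots,x_p,y_1,\dots,y_q]]_+$ is the set of formal series without constant term. For $i\in[p]=\{1,\dots,p\}$, $\mathbf{G}_i=\{x_i(1+F)\mid F\in\mathbb{K}[[x_1,\dots,x_p,y_1,\dots,y_q]]_+\}$. For $F_i=x_i(1+h)\in\mathbf{G}_i$ and $c\in\mathbb{K}$, $(F_i/x_i)^c=(1+h)^c=\sum_{n\ge0}\binom{c}{n}h^n$. For $F=(F_1,\dots,F_p)\in\mathbf{G}_1\times\dots\times\mathbf{G}_p$ and a series (or tuple of series) $P$, $P\left(F,y(F/x)^{\mathcal{B}}\right)$ denotes the result of substituting in $P$: $x_i\mapsto F_i$ for $i\in[p]$ and $y_m\mapsto y_m\prod_{i=1}^p(F_i/x_i)^{\mathcal{B}_{m,i}}$ for $m\in[q]$. $\mathbf{G}_{\mathcal{B}}$ is the group $\mathbf{G}_1\times\dots\times\mathbf{G}_p$ with product $F\bullet G=G\left(F,y(F/x)^{\mathcal{B}}\right)$. $V_0$ is the group $(\mathbb{K}[[x_1,\dots,x_p,y_1,\dots,y_q]]_+,+)$,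 on which $\mathbf{G}_{\mathcal{B}}$ acts by $F\hookrightarrow P=P\left(F,y(F/x)^{\mathcal{B}}\right)$; the semidirect product $V_0^r\rtimes\mathbf{G}_{\mathcal{B}}$ has product $(P_1,\dots,P_r,F)\bullet(Q_1,\dots,Q_r,G)=(P_1+F\hookrightarrow Q_1,\dots,P_r+F\hookrightarrow Q_r,F\bullet G)$. The semidirect product with the sum of the groups $V_{a^{(m)},b^{(m)}}$ is formed in the same way, with the action of the claim on each summand: $(Q,g)\bullet(Q',g')=(Q+g\hookrightarrow Q',g\bullet g')$. A (left) pre-Lie algebra is a vector space with a bilinear product $*$ such that $(x*y)*z-x*(y*z)=(y*x)*z-y*(x*z)$; $[x,y]=x*y-y*x$ is then a Lie bracket, and the enveloping algebra of a pre-Lie algebra is the enveloping algebra of this Lie algebra. A deg1 pre-Lie algebra with structure coefficients $A^{(i,j)}\in\mathbb{K}^N$, $b^{(i,j)}\in\mathbb{K}$ ($i,j\in[M]$) is a pre-Lie algebra with a basis $(f_i(\alpha))_{i\in[M],\alpha\in\mathbb{N}^N\setminus\{0\}}$ and product as displayed in the claim ($\cdot$ is the usual inner product). It is fundamental if there are a partition $[M]=I_0\sqcup\dots\sqcup I_k$ with $I_1,\dots,I_k\ne\emptyset$, vectors $A_1,\dots,A_k$, scalars $b_1,\dots,b_k$ and $b^{(i)}_m$ ($i\in I_0$, $m\in[k]$) such that $A^{(i,j)}=A_m$ if $j\in I_m$, $m\geq1$, and $0$ if $j\in I_0$; $b^{(i,j)}=\delta_{l,m}b_m$ if $j\in I_m$,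 $i\in I_l$, $l,m\ge1$; $b^{(i,j)}=0$ if $j\in I_0$; $b^{(i,j)}=b^{(i)}_m$ if $j\in I_m$, $m\ge1$, $i\in I_0$. The group of characters of a commutative Hopf algebra is the set of algebra morphisms to $\mathbb{K}$ with the convolution product. *)

theory Defs
  imports
    "HOL-Algebra.Bij"
    "HOL-Algebra.QuotRing"
    "HOL-Algebra.Product_Groups"
    "HOL-Library.Poly_Mapping"
    "HOL-Computational_Algebra.Formal_Power_Series"
    "Jordan_Normal_Form.Matrix"
begin

section \<open>Formal power series in several variables\<close>

text \<open>
  An exponent is a finitely supported map \<^typ>\<open>nat \<Rightarrow>\<^sub>0 nat\<close>; the variables are numbered
  from 0. The ring of series in \<open>n\<close> variables is the subring \<open>series n\<close> below.
\<close>

typedef 'a mfps = "UNIV :: ((nat \<Rightarrow>\<^sub>0 nat) \<Rightarrow> 'a) set"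
  morphisms mcoeff Abs_mfps ..

setup_lifting type_definition_mfps

lemma mfps_eqI: "(\<And>\<alpha>. mcoeff F \<alpha> = mcoeff G \<alpha>) \<Longrightarrow> F = G"
  by transfer auto

definition splits :: "(nat \<Rightarrow>\<^sub>0 nat) \<Rightarrow> ((nat \<Rightarrow>\<^sub>0 nat) \<times> (nat \<Rightarrow>\<^sub>0 nat)) set" where
  "splits \<alpha> = {(\<beta>, \<gamma>). \<beta> + \<gamma> = \<alpha>}"

lemma finite_exponents_below: "finite {\<beta>. \<exists>\<gamma>. \<beta> + \<gamma> = (\<alpha> :: nat \<Rightarrow>\<^sub>0 nat)}"
proof -
  let ?K = "Poly_Mapping.keys \<alpha>" and ?m = "Max (Poly_Mapping.lookup \<alpha> ` Poly_Mapping.keys \<alpha>)"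
  let ?S = "{f. \<forall>i. (i \<in> ?K \<longrightarrow> f i \<in> {..?m}) \<and> (i \<notin> ?K \<longrightarrow> f i = 0)}"
  have "Poly_Mapping.lookup \<beta> \<in> ?S" if "\<beta> + \<gamma> = \<alpha>" for \<beta> \<gamma>
  proof -
    have le: "Poly_Mapping.lookup \<beta> i \<le> Poly_Mapping.lookup \<alpha> i" for i
      using that by (auto simp: lookup_add)
    have "Poly_Mapping.lookup \<beta> i \<le> ?m" if "i \<in> ?K" for i
      using le[of i] that by (meson Max_ge finite_imageI finite_keys imageI le_trans)
    moreover have "Poly_Mapping.lookup \<beta> i = 0" if "i \<notin> ?K" for i
      using le[of i] that by (simp add: in_keys_iff)
    ultimately show ?thesis by simp
  qed
  then have "Poly_Mapping.lookup ` {\<beta>. \<exists>\<gamma>. \<beta> + \<gamma> = \<alpha>} \<subseteq> ?S" by (intro image_subsetI) blast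
  moreover have "finite ?S"
    by (rule finite_set_of_finite_funs) auto
  ultimately have "finite (Poly_Mapping.lookup ` {\<beta>. \<exists>\<gamma>. \<beta> + \<gamma> = \<alpha>})"
    by (rule finite_subset)
  moreover have "inj_on Poly_Mapping.lookup {\<beta>. \<exists>\<gamma>. \<beta> + \<gamma> = \<alpha>}"
    by (auto simp: inj_on_def intro: poly_mapping_eqI)
  ultimately show ?thesis
    by (rule finite_imageD)
qed

lemma finite_splits [simp]: "finite (splits \<alpha>)"
proof (rule finite_subset)
  show "splits \<alpha> \<subseteq> {\<beta>. \<exists>\<gamma>. \<beta> + \<gamma> = \<alpha>} \<times> {\<beta>. \<exists>\<gamma>. \<beta> + \<gamma> = \<alpha>}"
    by (auto simp: splits_def) (metis add.commute)
  show "finite ({\<beta>. \<exists>\<gamma>. \<beta> + \<gamma> = \<alpha>} \<times> {\<beta>. \<exists>\<gamma>. \<beta> + \<gamma> = \<alpha>})"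
    by (simp add: finite_exponents_below)
qed

instantiation mfps :: (comm_ring_1) comm_ring_1
begin

lift_definition zero_mfps :: "'a mfps" is "\<lambda>_. 0" .
lift_definition one_mfps :: "'a mfps" is "\<lambda>\<alpha>. if \<alpha> = 0 then 1 else 0" .
lift_definition plus_mfps :: "'a mfps \<Rightarrow> 'a mfps \<Rightarrow> 'a mfps" is "\<lambda>F G \<alpha>. F \<alpha> + G \<alpha>" .
lift_definition uminus_mfps :: "'a mfps \<Rightarrow> 'a mfps" is "\<lambda>F \<alpha>. - F \<alpha>" .
lift_definition minus_mfps :: "'a mfps \<Rightarrow> 'a mfps \<Rightarrow> 'a mfps" is "\<lambda>F G \<alpha>. F \<alpha> - G \<alpha>" .
lift_definition times_mfps :: "'a mfps \<Rightarrow> 'a mfps \<Rightarrow> 'a mfps"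
  is "\<lambda>F G \<alpha>. \<Sum>(\<beta>, \<gamma>)\<in>splits \<alpha>. F \<beta> * G \<gamma>" .

instance
proof
  fix F G H :: "'a mfps"
  show "F * G * H = F * (G * H)"
  proof (transfer, rule ext)
    fix F G H :: "(nat \<Rightarrow>\<^sub>0 nat) \<Rightarrow> 'a" and \<alpha>
    have "(\<Sum>(\<beta>, \<gamma>)\<in>splits \<alpha>. (\<Sum>(\<delta>, \<epsilon>)\<in>splits \<beta>. F \<delta> * G \<epsilon>) * H \<gamma>)
        = (\<Sum>x\<in>splits \<alpha>. \<Sum>y\<in>splits (fst x). F (fst y) * G (snd y) * H (snd x))"
      by (simp add: case_prod_beta sum_distrib_right)
    also have "\<dots> = (\<Sum>(x, y)\<in>Sigma (splits \<alpha>) (\<lambda>x. splits (fst x)). F (fst y) * G (snd y) * H (snd x))"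
      by (rule sum.Sigma) auto
    also have "\<dots> = (\<Sum>(x, y)\<in>Sigma (splits \<alpha>) (\<lambda>x. splits (snd x)). F (fst x) * (G (fst y) * H (snd y)))"
      by (rule sum.reindex_bij_witness[where
            i = "\<lambda>(x, y). ((fst x + fst y, snd y), (fst x, fst y))" and
            j = "\<lambda>(x, y). ((fst y, snd y + snd x), (snd y, snd x))"])
        (auto simp: splits_def ac_simps)
    also have "\<dots> = (\<Sum>x\<in>splits \<alpha>. \<Sum>y\<in>splits (snd x). F (fst x) * (G (fst y) * H (snd y)))"
      by (rule sum.Sigma[symmetric]) auto
    also have "\<dots> = (\<Sum>(\<beta>, \<gamma>)\<in>splits \<alpha>. F \<beta> * (\<Sum>(\<delta>, \<epsilon>)\<in>splits \<gamma>. G \<delta> * H \<epsilon>))"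
      by (simp add: case_prod_beta sum_distrib_left)
    finally show "(\<Sum>(\<beta>, \<gamma>)\<in>splits \<alpha>. (\<Sum>(\<delta>, \<epsilon>)\<in>splits \<beta>. F \<delta> * G \<epsilon>) * H \<gamma>)
      = (\<Sum>(\<beta>, \<gamma>)\<in>splits \<alpha>. F \<beta> * (\<Sum>(\<delta>, \<epsilon>)\<in>splits \<gamma>. G \<delta> * H \<epsilon>))" .
  qed
  show "F * G = G * F"
  proof (transfer, rule ext)
    fix F G :: "(nat \<Rightarrow>\<^sub>0 nat) \<Rightarrow> 'a" and \<alpha>
    show "(\<Sum>(\<beta>, \<gamma>)\<in>splits \<alpha>. F \<beta> * G \<gamma>) = (\<Sum>(\<beta>, \<gamma>)\<in>splits \<alpha>. G \<beta> * F \<gamma>)"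
      by (rule sum.reindex_bij_witness[where i = prod.swap and j = prod.swap])
        (auto simp: splits_def ac_simps)
  qed
  show "1 * F = F"
  proof (transfer, rule ext)
    fix F :: "(nat \<Rightarrow>\<^sub>0 nat) \<Rightarrow> 'a" and \<alpha>
    have "(\<Sum>(\<beta>, \<gamma>)\<in>splits \<alpha>. (if \<beta> = 0 then 1 else 0) * F \<gamma>)
      = (\<Sum>(\<beta>, \<gamma>)\<in>{(0 :: nat \<Rightarrow>\<^sub>0 nat, \<alpha>)}. (if \<beta> = 0 then 1 else 0) * F \<gamma>)"
    proof (rule sum.mono_neutral_right)
      show "{(0, \<alpha>)} \<subseteq> splits \<alpha>" by (simp add: splits_def)
      show "\<forall>x\<in>splits \<alpha> - {(0, \<alpha>)}. (case x of (\<beta>, \<gamma>) \<Rightarrow> (if \<beta> = 0 then 1 else 0) * F \<gamma>) = 0"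
        by (auto simp: splits_def split: if_splits)
    qed simp
    then show "(\<Sum>(\<beta>, \<gamma>)\<in>splits \<alpha>. (if \<beta> = 0 then 1 else 0) * F \<gamma>) = F \<alpha>" by simp
  qed
  show "(F + G) * H = F * H + G * H"
    by transfer (simp add: fun_eq_iff case_prod_beta distrib_right sum.distrib)
  show "(0 :: 'a mfps) \<noteq> 1"
    by transfer (metis zero_neq_one)
qed (transfer; simp add: fun_eq_iff algebra_simps)+

end

lift_definition mconst :: "'a::comm_ring_1 \<Rightarrow> 'a mfps" is "\<lambda>c \<alpha>. if \<alpha> = 0 then c else 0" .

lift_definition mvar :: "nat \<Rightarrow> 'a::comm_ring_1 mfps"
  is "\<lambda>i \<alpha>. if \<alpha> = Poly_Mapping.single i 1 then 1 else 0" .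

definition exponents :: "nat \<Rightarrow> (nat \<Rightarrow>\<^sub>0 nat) set" where
  "exponents n = {\<alpha>. Poly_Mapping.keys \<alpha> \<subseteq> {..<n}}"

definition series :: "nat \<Rightarrow> 'a::comm_ring_1 mfps set" where
  "series n = {F. \<forall>\<alpha>. mcoeff F \<alpha> \<noteq> 0 \<longrightarrow> \<alpha> \<in> exponents n}"

definition series_plus :: "nat \<Rightarrow> 'a::comm_ring_1 mfps set" where
  "series_plus n = {F \<in> series n. mcoeff F 0 = 0}"

text \<open>
  \<open>fps_apply f h\<close> is \<open>\<Sum>k. f\<^sub>k h\<^sup>k\<close>, computed coefficientwise; at each exponent only finitely many
  terms are nonzero if \<open>h\<close> has no constant term. The same holds for \<open>subst n \<sigma> P\<close>, in
  which \<open>\<sigma> i\<close> is substituted for the \<open>i\<close>-th variable, if no \<open>\<sigma> i\<close> has a constant term.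
\<close>

definition fps_apply :: "'a::comm_ring_1 fps \<Rightarrow> 'a mfps \<Rightarrow> 'a mfps" where
  "fps_apply f h = Abs_mfps (\<lambda>\<alpha>. Sum_any (\<lambda>k. fps_nth f k * mcoeff (h ^ k) \<alpha>))"

definition subst :: "nat \<Rightarrow> (nat \<Rightarrow> 'a::comm_ring_1 mfps) \<Rightarrow> 'a mfps \<Rightarrow> 'a mfps" where
  "subst n \<sigma> P = Abs_mfps (\<lambda>\<gamma>. Sum_any (\<lambda>\<alpha>. mcoeff P \<alpha> * mcoeff (\<Prod>i<n. \<sigma> i ^ Poly_Mapping.lookup \<alpha> i) \<gamma>))"

definition mexp :: "'a::field_char_0 mfps \<Rightarrow> 'a mfps" where
  "mexp h = fps_apply (fps_exp 1) h"

text \<open>\<open>mpow G c\<close> is \<open>G\<^sup>c\<close>, for \<open>G\<close> with constant term 1.\<close>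

definition mpow :: "'a::field_char_0 mfps \<Rightarrow> 'a \<Rightarrow> 'a mfps" where
  "mpow G c = fps_apply (fps_binomial c) (G - 1)"

text \<open>The quotient of \<open>F\<close> by the \<open>i\<close>-th variable, for \<open>F\<close> divisible by it.\<close>

definition div_var :: "nat \<Rightarrow> 'a mfps \<Rightarrow> 'a mfps" where
  "div_var i F = Abs_mfps (\<lambda>\<alpha>. mcoeff F (\<alpha> + Poly_Mapping.single i 1))"


section \<open>The groups\<close>

text \<open>
  Throughout, \<open>x\<^sub>1, \<dots>, x\<^sub>p, y\<^sub>1, \<dots>, y\<^sub>q\<close> are the variables \<open>0, \<dots>, p + q - 1\<close> in this order, and all
  other indices are shifted likewise to start from 0.
\<close>

definition G_factor :: "nat \<Rightarrow> nat \<Rightarrow> nat \<Rightarrow> 'k::field_char_0 mfps set" where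
  "G_factor p q i = {mvar i * (1 + h) | h. h \<in> series_plus (p + q)}"

definition B_subst :: "nat \<Rightarrow> nat \<Rightarrow> 'k::field_char_0 mat \<Rightarrow> (nat \<Rightarrow> 'k mfps) \<Rightarrow> 'k mfps \<Rightarrow> 'k mfps" where
  "B_subst p q B F = subst (p + q) (\<lambda>v.
     if v < p then F v
     else mvar v * (\<Prod>i<p. mpow (div_var i (F i)) (B $$ (v - p, i))))"

definition G_group :: "nat \<Rightarrow> nat \<Rightarrow> 'k::field_char_0 mat \<Rightarrow> (nat \<Rightarrow> 'k mfps) monoid" where
  "G_group p q B =
     \<lparr>carrier = (\<Pi>\<^sub>E i\<in>{..<p}. G_factor p q i),
      monoid.mult = (\<lambda>F G. \<lambda>i\<in>{..<p}. B_subst p q B F (G i)),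
      one = (\<lambda>i\<in>{..<p}. mvar i)\<rparr>"

definition V_group :: "nat \<Rightarrow> nat \<Rightarrow> 'k::field_char_0 mfps monoid" where
  "V_group p q = \<lparr>carrier = series_plus (p + q), monoid.mult = (+), one = 0\<rparr>"

definition semidirect ::
  "('n, 'a) monoid_scheme \<Rightarrow> ('g, 'b) monoid_scheme \<Rightarrow> ('g \<Rightarrow> 'n \<Rightarrow> 'n) \<Rightarrow> ('n \<times> 'g) monoid" where
  "semidirect N G act =
     \<lparr>carrier = carrier N \<times> carrier G,
      monoid.mult = (\<lambda>(n, g) (n', g'). (n \<otimes>\<^bsub>N\<^esub> act g n', g \<otimes>\<^bsub>G\<^esub> g')),
      one = (\<one>\<^bsub>N\<^esub>, \<one>\<^bsub>G\<^esub>)\<rparr>"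

text \<open>The group \<open>V\<^sub>0\<^sup>r \<rtimes> G\<^sub>B\<close>; its elements are written \<open>(P, F)\<close> with \<open>P\<close> the \<open>r\<close>-tuple of the \<open>P\<^sub>j\<close>.\<close>

definition VG_group ::
  "nat \<Rightarrow> nat \<Rightarrow> nat \<Rightarrow> 'k::field_char_0 mat \<Rightarrow> ((nat \<Rightarrow> 'k mfps) \<times> (nat \<Rightarrow> 'k mfps)) monoid" where
  "VG_group p q r B =
     semidirect (product_group {..<r} (\<lambda>_. V_group p q)) (G_group p q B)
       (\<lambda>F P. \<lambda>j\<in>{..<r}. B_subst p q B F (P j))"

definition V_action ::
  "nat \<Rightarrow> nat \<Rightarrow> nat \<Rightarrow> 'k::field_char_0 mat \<Rightarrow> 'k vec \<Rightarrow> 'k vec \<Rightarrow>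
   (nat \<Rightarrow> 'k mfps) \<times> (nat \<Rightarrow> 'k mfps) \<Rightarrow> 'k mfps \<Rightarrow> 'k mfps" where
  "V_action p q r B a b = (\<lambda>(P, F) Q.
     B_subst p q B F Q * mexp (\<Sum>j<r. mconst (a $ j) * P j) *
     (\<Prod>i<p. mpow (div_var i (F i)) (b $ i)))"

text \<open>
  The group \<open>(V\<^bsub>a(0),b(0)\<^esub> \<oplus> \<dots> \<oplus> V\<^bsub>a(s-1),b(s-1)\<^esub>) \<rtimes> (V\<^sub>0\<^sup>r \<rtimes> G\<^sub>B)\<close>.
\<close>

definition full_group ::
  "nat \<Rightarrow> nat \<Rightarrow> nat \<Rightarrow> 'k::field_char_0 mat \<Rightarrow> nat \<Rightarrow> (nat \<Rightarrow> 'k vec) \<Rightarrow> (nat \<Rightarrow> 'k vec) \<Rightarrow>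
   ((nat \<Rightarrow> 'k mfps) \<times> (nat \<Rightarrow> 'k mfps) \<times> (nat \<Rightarrow> 'k mfps)) monoid" where
  "full_group p q r B s a b =
     semidirect (product_group {..<s} (\<lambda>_. V_group p q)) (VG_group p q r B)
       (\<lambda>g Q. \<lambda>k\<in>{..<s}. V_action p q r B (a k) (b k) g (Q k))"


section \<open>Algebras, quotients and tensor products\<close>

text \<open>
  A vector space, with or without a bilinear product, is a \<^typ>\<open>('k, 'a) module\<close> record over the field
  \<open>'k\<close>, which itself is the record \<open>ground_field\<close>. The fields \<open>mult\<close> and \<open>one\<close> are not constrained
  by the locale \<^locale>\<open>Module.module\<close>.
\<close>

definition ground_field :: "('k::field, 'k) module" where
  "ground_field = \<lparr>carrier = UNIV, monoid.mult = (*), one = 1, ring.zero = 0, add = (+), smult = (*)\<rparr>"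

definition is_k_algebra :: "('k::field, 'a, 'm) module_scheme \<Rightarrow> bool" where
  "is_k_algebra A \<longleftrightarrow> Module.module (ground_field :: ('k, 'k) module) A \<and> ring A \<and>
     (\<forall>c. \<forall>x\<in>carrier A. \<forall>y\<in>carrier A.
        (c \<odot>\<^bsub>A\<^esub> x) \<otimes>\<^bsub>A\<^esub> y = c \<odot>\<^bsub>A\<^esub> (x \<otimes>\<^bsub>A\<^esub> y) \<and> x \<otimes>\<^bsub>A\<^esub> (c \<odot>\<^bsub>A\<^esub> y) = c \<odot>\<^bsub>A\<^esub> (x \<otimes>\<^bsub>A\<^esub> y))"

definition lin_hom :: "('k::field, 'a, 'm) module_scheme \<Rightarrow> ('k, 'b, 'n) module_scheme \<Rightarrow> ('a \<Rightarrow> 'b) set" where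
  "lin_hom A B = {\<phi> \<in> carrier A \<rightarrow> carrier B.
     (\<forall>x\<in>carrier A. \<forall>y\<in>carrier A. \<phi> (x \<oplus>\<^bsub>A\<^esub> y) = \<phi> x \<oplus>\<^bsub>B\<^esub> \<phi> y) \<and>
     (\<forall>c. \<forall>x\<in>carrier A. \<phi> (c \<odot>\<^bsub>A\<^esub> x) = c \<odot>\<^bsub>B\<^esub> \<phi> x)}"

definition alg_hom :: "('k::field, 'a, 'm) module_scheme \<Rightarrow> ('k, 'b, 'n) module_scheme \<Rightarrow> ('a \<Rightarrow> 'b) set" where
  "alg_hom A B = lin_hom A B \<inter> Ring.ring_hom A B"

definition pm_scale :: "'k::field \<Rightarrow> ('x \<Rightarrow>\<^sub>0 'k) \<Rightarrow> ('x \<Rightarrow>\<^sub>0 'k)" where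
  "pm_scale c z = Poly_Mapping.map (\<lambda>d. c * d) z"

text \<open>The algebra with basis the elements of a monoid.\<close>

definition monoid_algebra :: "('g, 'm) monoid_scheme \<Rightarrow> ('k::field, 'g \<Rightarrow>\<^sub>0 'k) module" where
  "monoid_algebra M =
     \<lparr>carrier = {z. Poly_Mapping.keys z \<subseteq> carrier M},
      monoid.mult = (\<lambda>z w. \<Sum>g\<in>Poly_Mapping.keys z. \<Sum>h\<in>Poly_Mapping.keys w.
        Poly_Mapping.single (g \<otimes>\<^bsub>M\<^esub> h) (Poly_Mapping.lookup z g * Poly_Mapping.lookup w h)),
      one = Poly_Mapping.single \<one>\<^bsub>M\<^esub> 1, ring.zero = 0, add = (+), smult = pm_scale\<rparr>"

definition quotient_algebra :: "('k::field, 'a) module \<Rightarrow> 'a set \<Rightarrow> ('k, 'a set) module" where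
  "quotient_algebra R I = ring.extend (R Quot I)
     (module.fields (\<lambda>c T. I +>\<^bsub>R\<^esub> (c \<odot>\<^bsub>R\<^esub> (SOME z. z \<in> T))))"

text \<open>
  The linear map on a quotient of a monoid algebra that is induced by the map \<open>f\<close> on the monoid;
  meaningful only if the linear extension of \<open>f\<close> vanishes on the ideal.
\<close>

definition induced :: "('k::field, 'w, 'm) module_scheme \<Rightarrow> ('g \<Rightarrow> 'w) \<Rightarrow> ('g \<Rightarrow>\<^sub>0 'k) set \<Rightarrow> 'w" where
  "induced W f X = (let z = (SOME z. z \<in> X) in \<Oplus>\<^bsub>W\<^esub>g\<in>Poly_Mapping.keys z. Poly_Mapping.lookup z g \<odot>\<^bsub>W\<^esub> f g)"

text \<open>
  The tensor product of the algebras \<open>A\<close> and \<open>B\<close> is spanned by the pairs \<open>(x, y)\<close>, subject to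
  bilinearity, with the product \<open>(x, y) (x', y') = (x x', y y')\<close>. The subspace spanned by the
  bilinearity relations is already an ideal, so that the underlying vector space is the usual one.
\<close>

definition tensor_relations ::
  "('k::field, 'a, 'm) module_scheme \<Rightarrow> ('k, 'b, 'n) module_scheme \<Rightarrow> ('a \<times> 'b \<Rightarrow>\<^sub>0 'k) set" where
  "tensor_relations A B = (let e = (\<lambda>x y. Poly_Mapping.single (x, y) 1) in
       {e (x \<oplus>\<^bsub>A\<^esub> x') y - e x y - e x' y | x x' y.
          x \<in> carrier A \<and> x' \<in> carrier A \<and> y \<in> carrier B}
     \<union> {e x (y \<oplus>\<^bsub>B\<^esub> y') - e x y - e x y' | x y y'.
          x \<in> carrier A \<and> y \<in> carrier B \<and> y' \<in> carrier B}
     \<union> {e (c \<odot>\<^bsub>A\<^esub> x) y - pm_scale c (e x y) | c x y. x \<in> carrier A \<and> y \<in> carrier B}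
     \<union> {e x (c \<odot>\<^bsub>B\<^esub> y) - pm_scale c (e x y) | c x y. x \<in> carrier A \<and> y \<in> carrier B})"

definition tensor_class ::
  "('k::field, 'a, 'm) module_scheme \<Rightarrow> ('k, 'b, 'n) module_scheme \<Rightarrow> ('a \<times> 'b \<Rightarrow>\<^sub>0 'k) \<Rightarrow>
   ('a \<times> 'b \<Rightarrow>\<^sub>0 'k) set" where
  "tensor_class A B z =
     (Idl\<^bsub>monoid_algebra (A \<times>\<times> B)\<^esub> (tensor_relations A B)) +>\<^bsub>monoid_algebra (A \<times>\<times> B) :: ('k, _) module\<^esub> z"

definition tensor ::
  "('k::field, 'a, 'm) module_scheme \<Rightarrow> ('k, 'b, 'n) module_scheme \<Rightarrow>
   ('k, ('a \<times> 'b \<Rightarrow>\<^sub>0 'k) set) module" where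
  "tensor A B = quotient_algebra (monoid_algebra (A \<times>\<times> B))
     (Idl\<^bsub>monoid_algebra (A \<times>\<times> B)\<^esub> (tensor_relations A B))"

definition pure_tensor ::
  "('k::field, 'a, 'm) module_scheme \<Rightarrow> ('k, 'b, 'n) module_scheme \<Rightarrow> 'a \<Rightarrow> 'b \<Rightarrow>
   ('a \<times> 'b \<Rightarrow>\<^sub>0 'k) set" where
  "pure_tensor A B x y = tensor_class A B (Poly_Mapping.single (x, y) 1)"

text \<open>\<open>tensor_lift W \<beta>\<close> is the linear map \<open>A \<otimes> B \<rightarrow> W\<close> with \<open>x \<otimes> y \<mapsto> \<beta> x y\<close>, for bilinear \<open>\<beta>\<close>.\<close>

definition tensor_lift ::
  "('k::field, 'w, 'm) module_scheme \<Rightarrow> ('a \<Rightarrow> 'b \<Rightarrow> 'w) \<Rightarrow> ('a \<times> 'b \<Rightarrow>\<^sub>0 'k) set \<Rightarrow> 'w" where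
  "tensor_lift W \<beta> t = induced W (\<lambda>(x, y). \<beta> x y) t"

definition tensor_map ::
  "('k::field, 'c, 'm) module_scheme \<Rightarrow> ('k, 'd, 'n) module_scheme \<Rightarrow> ('a \<Rightarrow> 'c) \<Rightarrow> ('b \<Rightarrow> 'd) \<Rightarrow>
   ('a \<times> 'b \<Rightarrow>\<^sub>0 'k) set \<Rightarrow> ('c \<times> 'd \<Rightarrow>\<^sub>0 'k) set" where
  "tensor_map C D \<phi> \<psi> = tensor_lift (tensor C D) (\<lambda>x y. pure_tensor C D (\<phi> x) (\<psi> y))"

text \<open>The isomorphism \<open>(A \<otimes> A) \<otimes> A \<rightarrow> A \<otimes> (A \<otimes> A)\<close>.\<close>

definition tensor_assoc ::
  "('k::field, 'a, 'm) module_scheme \<Rightarrow> (('a \<times> 'a \<Rightarrow>\<^sub>0 'k) set \<times> 'a \<Rightarrow>\<^sub>0 'k) set \<Rightarrow>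
   ('a \<times> ('a \<times> 'a \<Rightarrow>\<^sub>0 'k) set \<Rightarrow>\<^sub>0 'k) set" where
  "tensor_assoc A = tensor_lift (tensor A (tensor A A)) (\<lambda>t z.
     tensor_lift (tensor A (tensor A A)) (\<lambda>x y. pure_tensor A (tensor A A) x (pure_tensor A A y z)) t)"


section \<open>Hopf algebras\<close>

record (overloaded) ('k::zero, 'a) hopf = "('k, 'a) module" +
  comult :: "'a \<Rightarrow> ('a \<times> 'a \<Rightarrow>\<^sub>0 'k) set"
  counit :: "'a \<Rightarrow> 'k"
  antipode :: "'a \<Rightarrow> 'a"

definition hopf_algebra :: "('k::field, 'a) hopf \<Rightarrow> bool" where
  "hopf_algebra H \<longleftrightarrow>
     is_k_algebra H \<and>
     comult H \<in> alg_hom H (tensor H H) \<and>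
     counit H \<in> alg_hom H ground_field \<and>
     antipode H \<in> lin_hom H H \<and>
     (\<forall>h\<in>carrier H.
        tensor_assoc H (tensor_map (tensor H H) H (comult H) (\<lambda>x. x) (comult H h))
          = tensor_map H (tensor H H) (\<lambda>x. x) (comult H) (comult H h) \<and>
        tensor_lift H (\<lambda>x y. counit H x \<odot>\<^bsub>H\<^esub> y) (comult H h) = h \<and>
        tensor_lift H (\<lambda>x y. counit H y \<odot>\<^bsub>H\<^esub> x) (comult H h) = h \<and>
        tensor_lift H (\<lambda>x y. antipode H x \<otimes>\<^bsub>H\<^esub> y) (comult H h) = counit H h \<odot>\<^bsub>H\<^esub> \<one>\<^bsub>H\<^esub> \<and>
        tensor_lift H (\<lambda>x y. x \<otimes>\<^bsub>H\<^esub> antipode H y) (comult H h) = counit H h \<odot>\<^bsub>H\<^esub> \<one>\<^bsub>H\<^esub>)"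

definition commutative_hopf_algebra :: "('k::field, 'a) hopf \<Rightarrow> bool" where
  "commutative_hopf_algebra H \<longleftrightarrow> hopf_algebra H \<and> cring H"

text \<open>
  A grading by \<open>\<nat>\<^sup>n\<close> is given by its homogeneous components \<open>gr \<alpha>\<close> for \<open>\<alpha> \<in> exponents n\<close>.
\<close>

definition graded_hopf_algebra ::
  "nat \<Rightarrow> ('k::field, 'a) hopf \<Rightarrow> ((nat \<Rightarrow>\<^sub>0 nat) \<Rightarrow> 'a set) \<Rightarrow> bool" where
  "graded_hopf_algebra n H gr \<longleftrightarrow>
     hopf_algebra H \<and>
     (\<forall>\<alpha>\<in>exponents n. submodule (gr \<alpha>) (ground_field :: ('k, 'k) module) H) \<and>
     (\<forall>h\<in>carrier H. \<exists>!c. c \<in> (\<Pi>\<^sub>E \<alpha>\<in>exponents n. gr \<alpha>) \<and>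
        finite {\<alpha> \<in> exponents n. c \<alpha> \<noteq> \<zero>\<^bsub>H\<^esub>} \<and>
        h = (\<Oplus>\<^bsub>H\<^esub>\<alpha>\<in>{\<alpha> \<in> exponents n. c \<alpha> \<noteq> \<zero>\<^bsub>H\<^esub>}. c \<alpha>)) \<and>
     \<one>\<^bsub>H\<^esub> \<in> gr 0 \<and>
     (\<forall>\<alpha>\<in>exponents n. \<forall>\<beta>\<in>exponents n. \<forall>x\<in>gr \<alpha>. \<forall>y\<in>gr \<beta>. x \<otimes>\<^bsub>H\<^esub> y \<in> gr (\<alpha> + \<beta>)) \<and>
     (\<forall>\<alpha>\<in>exponents n. \<forall>x\<in>gr \<alpha>.
        comult H x \<in> tensor_class H H ` {z. Poly_Mapping.keys z \<subseteq> (\<Union>(\<beta>, \<gamma>)\<in>splits \<alpha>. gr \<beta> \<times> gr \<gamma>)}) \<and>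
     (\<forall>\<alpha>\<in>exponents n - {0}. \<forall>x\<in>gr \<alpha>. counit H x = 0) \<and>
     (\<forall>\<alpha>\<in>exponents n. \<forall>x\<in>gr \<alpha>. antipode H x \<in> gr \<alpha>)"

definition locally_finite ::
  "nat \<Rightarrow> ('k::field, 'a, 'm) module_scheme \<Rightarrow> ((nat \<Rightarrow>\<^sub>0 nat) \<Rightarrow> 'a set) \<Rightarrow> bool" where
  "locally_finite n H gr \<longleftrightarrow> (\<forall>\<alpha>\<in>exponents n. \<exists>E. finite E \<and> E \<subseteq> gr \<alpha> \<and>
     gr \<alpha> = {\<Oplus>\<^bsub>H\<^esub>e\<in>E. c e \<odot>\<^bsub>H\<^esub> e | c. True})"

text \<open>
  The graded dual of a locally finite graded Hopf algebra, with product dual to the coproduct: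
  \<open>(f g)(h) = (f \<otimes> g)(\<Delta> h)\<close>, and coproduct dual to the product: \<open>(\<Delta> f)(x \<otimes> y) = f (x y)\<close>.
  Functionals are \<open>undefined\<close> outside the carrier.
\<close>

definition graded_dual_algebra ::
  "nat \<Rightarrow> ('k::field, 'a) hopf \<Rightarrow> ((nat \<Rightarrow>\<^sub>0 nat) \<Rightarrow> 'a set) \<Rightarrow> ('k, 'a \<Rightarrow> 'k) module" where
  "graded_dual_algebra n H gr =
     \<lparr>carrier = {f \<in> lin_hom H ground_field \<inter> extensional (carrier H).
        finite {\<alpha> \<in> exponents n. \<exists>x\<in>gr \<alpha>. f x \<noteq> 0}},
      monoid.mult = (\<lambda>f g. \<lambda>h\<in>carrier H. tensor_lift ground_field (\<lambda>x y. f x * g y) (comult H h)),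
      one = (\<lambda>h\<in>carrier H. counit H h),
      ring.zero = (\<lambda>h\<in>carrier H. 0),
      add = (\<lambda>f g. \<lambda>h\<in>carrier H. f h + g h),
      smult = (\<lambda>c f. \<lambda>h\<in>carrier H. c * f h)\<rparr>"

definition graded_dual ::
  "nat \<Rightarrow> ('k::field, 'a) hopf \<Rightarrow> ((nat \<Rightarrow>\<^sub>0 nat) \<Rightarrow> 'a set) \<Rightarrow> ('k, 'a \<Rightarrow> 'k) hopf" where
  "graded_dual n H gr = (let D = graded_dual_algebra n H gr in module.extend D (hopf.fields
     (\<lambda>f. THE t. t \<in> carrier (tensor D D) \<and>
        (\<forall>x\<in>carrier H. \<forall>y\<in>carrier H.
           tensor_lift ground_field (\<lambda>f1 f2. f1 x * f2 y) t = f (x \<otimes>\<^bsub>H\<^esub> y)))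
     (\<lambda>f. f \<one>\<^bsub>H\<^esub>)
     (\<lambda>f. \<lambda>h\<in>carrier H. f (antipode H h))))"

definition dual_grading ::
  "nat \<Rightarrow> ('k::field, 'a) hopf \<Rightarrow> ((nat \<Rightarrow>\<^sub>0 nat) \<Rightarrow> 'a set) \<Rightarrow> (nat \<Rightarrow>\<^sub>0 nat) \<Rightarrow> ('a \<Rightarrow> 'k) set" where
  "dual_grading n H gr \<alpha> = {f \<in> carrier (graded_dual n H gr).
     \<forall>\<beta>\<in>exponents n - {\<alpha>}. \<forall>x\<in>gr \<beta>. f x = 0}"

definition graded_hopf_isomorphic ::
  "nat \<Rightarrow> ('k::field, 'a) hopf \<Rightarrow> ((nat \<Rightarrow>\<^sub>0 nat) \<Rightarrow> 'a set) \<Rightarrow>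
   ('k, 'b) hopf \<Rightarrow> ((nat \<Rightarrow>\<^sub>0 nat) \<Rightarrow> 'b set) \<Rightarrow> bool" where
  "graded_hopf_isomorphic n H gr H' gr' \<longleftrightarrow> (\<exists>\<Phi>\<in>alg_hom H H'.
     bij_betw \<Phi> (carrier H) (carrier H') \<and>
     (\<forall>h\<in>carrier H.
        comult H' (\<Phi> h) = tensor_map H' H' \<Phi> \<Phi> (comult H h) \<and>
        counit H' (\<Phi> h) = counit H h \<and>
        antipode H' (\<Phi> h) = \<Phi> (antipode H h)) \<and>
     (\<forall>\<alpha>\<in>exponents n. \<Phi> ` gr \<alpha> = gr' \<alpha>))"

definition character_group :: "('k::field, 'a) hopf \<Rightarrow> ('a \<Rightarrow> 'k) monoid" where
  "character_group H =
     \<lparr>carrier = alg_hom H ground_field \<inter> extensional (carrier H),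
      monoid.mult = (\<lambda>\<phi> \<psi>. \<lambda>h\<in>carrier H. tensor_lift ground_field (\<lambda>x y. \<phi> x * \<psi> y) (comult H h)),
      one = (\<lambda>h\<in>carrier H. counit H h)\<rparr>"


section \<open>Enveloping algebras\<close>

definition list_monoid :: "'x set \<Rightarrow> 'x list monoid" where
  "list_monoid X = \<lparr>carrier = lists X, monoid.mult = (@), one = []\<rparr>"

text \<open>
  The enveloping algebra of the Lie algebra \<open>L\<close> with bracket \<open>br\<close>: the free algebra on the set
  \<open>carrier L\<close>, modulo the linear relations of \<open>L\<close> (which yields the tensor algebra of the vector space
  \<open>L\<close>) and modulo \<open>x y - y x = [x, y]\<close>. The elements of \<open>L\<close> are primitive.
\<close>

definition env_relations ::
  "('k::field, 'x, 'm) module_scheme \<Rightarrow> ('x \<Rightarrow> 'x \<Rightarrow> 'x) \<Rightarrow> ('x list \<Rightarrow>\<^sub>0 'k) set" where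
  "env_relations L br = (let e = (\<lambda>w. Poly_Mapping.single w 1) in
       {e [x \<oplus>\<^bsub>L\<^esub> y] - e [x] - e [y] | x y. x \<in> carrier L \<and> y \<in> carrier L}
     \<union> {e [c \<odot>\<^bsub>L\<^esub> x] - pm_scale c (e [x]) | c x. x \<in> carrier L}
     \<union> {e [x, y] - e [y, x] - e [br x y] | x y. x \<in> carrier L \<and> y \<in> carrier L})"

definition env_class ::
  "('k::field, 'x, 'm) module_scheme \<Rightarrow> ('x \<Rightarrow> 'x \<Rightarrow> 'x) \<Rightarrow> ('x list \<Rightarrow>\<^sub>0 'k) \<Rightarrow> ('x list \<Rightarrow>\<^sub>0 'k) set" where
  "env_class L br z =
     (Idl\<^bsub>monoid_algebra (list_monoid (carrier L))\<^esub> (env_relations L br))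
       +>\<^bsub>monoid_algebra (list_monoid (carrier L)) :: ('k, _) module\<^esub> z"

definition env_algebra ::
  "('k::field, 'x, 'm) module_scheme \<Rightarrow> ('x \<Rightarrow> 'x \<Rightarrow> 'x) \<Rightarrow> ('k, ('x list \<Rightarrow>\<^sub>0 'k) set) module" where
  "env_algebra L br = quotient_algebra (monoid_algebra (list_monoid (carrier L)))
     (Idl\<^bsub>monoid_algebra (list_monoid (carrier L))\<^esub> (env_relations L br))"

definition enveloping_algebra ::
  "('k::field, 'x, 'm) module_scheme \<Rightarrow> ('x \<Rightarrow> 'x \<Rightarrow> 'x) \<Rightarrow> ('k, ('x list \<Rightarrow>\<^sub>0 'k) set) hopf" where
  "enveloping_algebra L br =
     (let U = env_algebra L br;
          \<iota> = (\<lambda>x. env_class L br (Poly_Mapping.single [x] 1));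
          prim = (\<lambda>x. pure_tensor U U (\<iota> x) \<one>\<^bsub>U\<^esub> \<oplus>\<^bsub>tensor U U\<^esub> pure_tensor U U \<one>\<^bsub>U\<^esub> (\<iota> x))
      in module.extend U (hopf.fields
        (induced (tensor U U) (\<lambda>w. foldr (\<lambda>x t. prim x \<otimes>\<^bsub>tensor U U\<^esub> t) w \<one>\<^bsub>tensor U U\<^esub>))
        (induced ground_field (\<lambda>w. if w = [] then 1 else 0))
        (induced U (\<lambda>w. env_class L br (Poly_Mapping.single (rev w) ((-1) ^ length w))))))"

text \<open>
  The grading of the enveloping algebra that is induced by homogeneous components \<open>gr \<alpha>\<close> of \<open>L\<close>.
\<close>

definition env_grading ::
  "('k::field, 'x, 'm) module_scheme \<Rightarrow> ('x \<Rightarrow> 'x \<Rightarrow> 'x) \<Rightarrow> ((nat \<Rightarrow>\<^sub>0 nat) \<Rightarrow> 'x set) \<Rightarrow>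
   (nat \<Rightarrow>\<^sub>0 nat) \<Rightarrow> ('x list \<Rightarrow>\<^sub>0 'k) set set" where
  "env_grading L br gr \<alpha> = env_class L br `
     {z. \<forall>w\<in>Poly_Mapping.keys z. \<exists>ds. list_all2 (\<lambda>x d. x \<in> gr d) w ds \<and> sum_list ds = \<alpha>}"


section \<open>Pre-Lie algebras\<close>

definition pre_lie_algebra :: "('k::field, 'x, 'm) module_scheme \<Rightarrow> bool" where
  "pre_lie_algebra L \<longleftrightarrow>
     Module.module (ground_field :: ('k, 'k) module) L \<and>
     (\<forall>x\<in>carrier L. (\<lambda>y. x \<otimes>\<^bsub>L\<^esub> y) \<in> lin_hom L L \<and> (\<lambda>y. y \<otimes>\<^bsub>L\<^esub> x) \<in> lin_hom L L) \<and>
     (\<forall>x\<in>carrier L. \<forall>y\<in>carrier L. \<forall>z\<in>carrier L.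
        (x \<otimes>\<^bsub>L\<^esub> y) \<otimes>\<^bsub>L\<^esub> z \<ominus>\<^bsub>L\<^esub> x \<otimes>\<^bsub>L\<^esub> (y \<otimes>\<^bsub>L\<^esub> z) = (y \<otimes>\<^bsub>L\<^esub> x) \<otimes>\<^bsub>L\<^esub> z \<ominus>\<^bsub>L\<^esub> y \<otimes>\<^bsub>L\<^esub> (x \<otimes>\<^bsub>L\<^esub> z))"

definition pre_lie_bracket :: "('k::field, 'x, 'm) module_scheme \<Rightarrow> 'x \<Rightarrow> 'x \<Rightarrow> 'x" where
  "pre_lie_bracket L x y = x \<otimes>\<^bsub>L\<^esub> y \<ominus>\<^bsub>L\<^esub> y \<otimes>\<^bsub>L\<^esub> x"

definition dot_exponent :: "'k::field vec \<Rightarrow> (nat \<Rightarrow>\<^sub>0 nat) \<Rightarrow> 'k" where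
  "dot_exponent v \<alpha> = v \<bullet> vec (dim_vec v) (\<lambda>l. of_nat (Poly_Mapping.lookup \<alpha> l))"

text \<open>
  The vector space with basis \<open>f\<^sub>i(\<alpha>)\<close>, for \<open>i < M\<close> and \<open>0 \<noteq> \<alpha> \<in> \<nat>\<^sup>N\<close>, where \<open>f\<^sub>i(\<alpha>)\<close> is
  \<open>Poly_Mapping.single (i, \<alpha>) 1\<close>, with the bilinear product such that
  \<open>f\<^sub>j(\<beta>) * f\<^sub>i(\<alpha>) = (A\<^bsup>(i,j)\<^esup> \<cdot> \<alpha> + b\<^bsup>(i,j)\<^esup>) f\<^sub>i(\<alpha> + \<beta>)\<close>. There is no unit.
\<close>

definition deg1_algebra ::
  "nat \<Rightarrow> nat \<Rightarrow> (nat \<Rightarrow> nat \<Rightarrow> 'k::field vec) \<Rightarrow> (nat \<Rightarrow> nat \<Rightarrow> 'k) \<Rightarrow>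
   ('k, (nat \<times> (nat \<Rightarrow>\<^sub>0 nat)) \<Rightarrow>\<^sub>0 'k) module" where
  "deg1_algebra N M A b =
     \<lparr>carrier = {z. Poly_Mapping.keys z \<subseteq> {..<M} \<times> (exponents N - {0})},
      monoid.mult = (\<lambda>z w. \<Sum>(j, \<beta>)\<in>Poly_Mapping.keys z. \<Sum>(i, \<alpha>)\<in>Poly_Mapping.keys w.
        Poly_Mapping.single (i, \<alpha> + \<beta>)
          (Poly_Mapping.lookup z (j, \<beta>) * Poly_Mapping.lookup w (i, \<alpha>) * (dot_exponent (A i j) \<alpha> + b i j))),
      one = undefined, ring.zero = 0, add = (+), smult = pm_scale\<rparr>"

definition deg1_grading ::
  "nat \<Rightarrow> nat \<Rightarrow> (nat \<Rightarrow>\<^sub>0 nat) \<Rightarrow> ((nat \<times> (nat \<Rightarrow>\<^sub>0 nat)) \<Rightarrow>\<^sub>0 'k::field) set" where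
  "deg1_grading N M \<alpha> = {z. Poly_Mapping.keys z \<subseteq> {..<M} \<times> (exponents N - {0}) \<and> Poly_Mapping.keys z \<subseteq> UNIV \<times> {\<alpha>}}"

text \<open>
  In the following definition \<open>I 0, \<dots>, I k\<close> are the blocks of the partition, \<open>A' m\<close> and \<open>b' m\<close> are the
  parameters of the blocks \<open>I m\<close> for \<open>m \<ge> 1\<close>, and \<open>c i m\<close> those of the elements \<open>i\<close> of \<open>I 0\<close>.
\<close>

definition fundamental_deg1 ::
  "nat \<Rightarrow> nat \<Rightarrow> (nat \<Rightarrow> nat \<Rightarrow> 'k::field vec) \<Rightarrow> (nat \<Rightarrow> nat \<Rightarrow> 'k) \<Rightarrow> bool" where
  "fundamental_deg1 N M A b \<longleftrightarrow>
     pre_lie_algebra (deg1_algebra N M A b) \<and>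
     (\<exists>(k :: nat) (I :: nat \<Rightarrow> nat set) A' b' c.
        disjoint_family_on I {0..k} \<and> (\<Union>m\<in>{0..k}. I m) = {..<M} \<and> (\<forall>m\<in>{1..k}. I m \<noteq> {}) \<and>
        (\<forall>m\<in>{1..k}. A' m \<in> carrier_vec N) \<and>
        (\<forall>i<M. \<forall>j\<in>I 0. A i j = 0\<^sub>v N \<and> b i j = 0) \<and>
        (\<forall>i<M. \<forall>m\<in>{1..k}. \<forall>j\<in>I m. A i j = A' m) \<and>
        (\<forall>l\<in>{1..k}. \<forall>i\<in>I l. \<forall>m\<in>{1..k}. \<forall>j\<in>I m. b i j = (if l = m then b' m else 0)) \<and>
        (\<forall>i\<in>I 0. \<forall>m\<in>{1..k}. \<forall>j\<in>I m. b i j = c i m))"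

text \<open>The structure coefficients; \<open>1\<^sub>m p @\<^sub>r B\<close> is the identity matrix on top of \<open>B\<close>.\<close>

definition coeff_A :: "nat \<Rightarrow> nat \<Rightarrow> 'k::field mat \<Rightarrow> nat \<Rightarrow> nat \<Rightarrow> 'k vec" where
  "coeff_A p q B i j = (if j < p then col (1\<^sub>m p @\<^sub>r B) j else 0\<^sub>v (p + q))"

definition coeff_b ::
  "nat \<Rightarrow> nat \<Rightarrow> (nat \<Rightarrow> 'k::field vec) \<Rightarrow> (nat \<Rightarrow> 'k vec) \<Rightarrow> nat \<Rightarrow> nat \<Rightarrow> 'k" where
  "coeff_b p r a b i j =
     (if i < p + r then 0
      else if j < p then b (i - (p + r)) $ j
      else if j < p + r then a (i - (p + r)) $ (j - p)
      else 0)"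

end

(*
  Reading off the coefficients of F_i / x_i, P_j and Q_k identifies the group with a set of points on
  which the product is given by polynomials that are homogeneous for the exponents. The polynomial
  functions on the points form the Hopf algebra; its axioms are checked by evaluation at points, which
  separate polynomials since distinct characters are linearly independent.

  A primitive element of the graded dual reads off the linear part of a polynomial, and the bracket is
  found from products of two points with one nonzero coordinate each. Convolution with a primitive
  functional is dual to a derivation that lowers the length of monomials by one, up to longer
  monomials. Hence the map from the enveloping algebra to the graded dual is triangular with respect to
  words and monomials, and it is bijective.
*)
theory Submission
  imports Defs "HOL-Computational_Algebra.Polynomial"
begin

text \<open>Evaluation can prove axioms in tensor powers only because products of separating
  families separate the tensor product. Tensors are cosets without a normal form, so this is shown
  by shortening a representing sum. Coproduct and antipode are then chosen by their values. That
  inversion is polynomial cannot be read off the group law; it follows from the degrees being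
  nonzero, by solving \<open>g^-1 g = 1\<close> one coordinate at a time. All substitutions multiply
  the variables by series with constant term 1, hence are given by finite coefficient formulas and
  are inverted by unipotent triangular systems. Apart from exponentials and binomial powers,
  characteristic zero serves to tell monomials apart by powers of 2 and to keep the diagonal of the
  triangular pairing, products of factorials, away from 0. This pairing takes the place of the
  independence half of the Poincare-Birkhoff-Witt theorem. The product of two points with one
  nonzero coordinate is not exactly the pre-Lie product: in the first p rows the law is
  multiplicative and produces an extra term, which is symmetric and drops out of the
  bracket.\<close>

abbreviation keys where "keys \<equiv> Poly_Mapping.keys"
abbreviation lookup where "lookup \<equiv> Poly_Mapping.lookup"
abbreviation single where "single \<equiv> Poly_Mapping.single"
type_synonym expo = "nat \<Rightarrow>\<^sub>0 nat"

section \<open>Vector spaces as module records, and linear maps\<close>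

lemma ground_field_simps [simp]:
 "carrier ground_field = UNIV"
 "x \<otimes>\<^bsub>ground_field\<^esub> y = x * y" "x \<oplus>\<^bsub>ground_field\<^esub> y = x + y" "x \<odot>\<^bsub>ground_field\<^esub> y = x * y"
 "\<one>\<^bsub>ground_field\<^esub> = 1" "\<zero>\<^bsub>ground_field\<^esub> = 0"
 by (auto simp: ground_field_def)

lemma cring_ground_field: "cring (ground_field :: ('k::field, 'k) module)"
proof (rule cringI)
 show "abelian_group (ground_field :: ('k, 'k) module)"
  by (rule abelian_groupI) (auto simp: algebra_simps intro: exI[of _ "- x" for x])
 show "Group.comm_monoid (ground_field :: ('k, 'k) module)"
  by (rule comm_monoidI) (auto simp: algebra_simps)
qed (auto simp: algebra_simps)

abbreviation kmod :: "('k::field, 'a, 'm) module_scheme => bool" where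
 "kmod W \<equiv> Module.module (ground_field :: ('k, 'k) module) W"

lemma kmodI:
 assumes "abelian_group W"
  "\<And>c x. x : carrier W ==> c \<odot>\<^bsub>W\<^esub> x : carrier W"
  "\<And>c d x. x : carrier W ==> (c + d) \<odot>\<^bsub>W\<^esub> x = c \<odot>\<^bsub>W\<^esub> x \<oplus>\<^bsub>W\<^esub> d \<odot>\<^bsub>W\<^esub> x"
  "\<And>c x y. x : carrier W ==> y : carrier W ==> c \<odot>\<^bsub>W\<^esub> (x \<oplus>\<^bsub>W\<^esub> y) = c \<odot>\<^bsub>W\<^esub> x \<oplus>\<^bsub>W\<^esub> c \<odot>\<^bsub>W\<^esub> y"
  "\<And>c d x. x : carrier W ==> (c * d) \<odot>\<^bsub>W\<^esub> x = c \<odot>\<^bsub>W\<^esub> (d \<odot>\<^bsub>W\<^esub> x)"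
  "\<And>x. x : carrier W ==> 1 \<odot>\<^bsub>W\<^esub> x = x"
 shows "kmod W"
 by (rule moduleI[OF cring_ground_field assms(1)]) (use assms in auto)

lemma kmod_ground: "kmod (ground_field :: ('k::field, 'k) module)"
 by (rule kmodI) (use cring_ground_field in \<open>auto simp: cring_def ring_def algebra_simps\<close>)

lemma kmodD:
 assumes "kmod W"
 shows "abelian_group W"
  "\<And>c x. x : carrier W ==> c \<odot>\<^bsub>W\<^esub> x : carrier W"
  "\<And>c d x. x : carrier W ==> (c + d) \<odot>\<^bsub>W\<^esub> x = c \<odot>\<^bsub>W\<^esub> x \<oplus>\<^bsub>W\<^esub> d \<odot>\<^bsub>W\<^esub> x"
  "\<And>c x y. x : carrier W ==> y : carrier W ==> c \<odot>\<^bsub>W\<^esub> (x \<oplus>\<^bsub>W\<^esub> y) = c \<odot>\<^bsub>W\<^esub> x \<oplus>\<^bsub>W\<^esub> c \<odot>\<^bsub>W\<^esub> y"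
  "\<And>c d x. x : carrier W ==> (c * d) \<odot>\<^bsub>W\<^esub> x = c \<odot>\<^bsub>W\<^esub> (d \<odot>\<^bsub>W\<^esub> x)"
  "\<And>x. x : carrier W ==> 1 \<odot>\<^bsub>W\<^esub> x = x"
  "\<And>x. x : carrier W ==> 0 \<odot>\<^bsub>W\<^esub> x = \<zero>\<^bsub>W\<^esub>"
  "\<And>c. c \<odot>\<^bsub>W\<^esub> \<zero>\<^bsub>W\<^esub> = \<zero>\<^bsub>W\<^esub>"
  "\<And>c d x. x : carrier W ==> c \<odot>\<^bsub>W\<^esub> (d \<odot>\<^bsub>W\<^esub> x) = d \<odot>\<^bsub>W\<^esub> (c \<odot>\<^bsub>W\<^esub> x)"
proof -
 have U: "x : carrier (ground_field :: ('a, 'a) module)" for x by simp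
 note d = module.smult_closed[OF assms U] module.smult_l_distr[OF assms U U] module.smult_r_distr[OF assms U]
  module.smult_assoc1[OF assms U U] module.smult_one[OF assms] module.smult_l_null[OF assms]
  module.smult_r_null[OF assms U]
 show "abelian_group W" using assms by (rule module.axioms)
 fix c d x y
 show "x : carrier W ==> c \<odot>\<^bsub>W\<^esub> x : carrier W" by (rule d)
 show "x : carrier W ==> (c + d) \<odot>\<^bsub>W\<^esub> x = c \<odot>\<^bsub>W\<^esub> x \<oplus>\<^bsub>W\<^esub> d \<odot>\<^bsub>W\<^esub> x"
  using d(2)[of x c d] by simp
 show "x : carrier W ==> y : carrier W ==> c \<odot>\<^bsub>W\<^esub> (x \<oplus>\<^bsub>W\<^esub> y) = c \<odot>\<^bsub>W\<^esub> x \<oplus>\<^bsub>W\<^esub> c \<odot>\<^bsub>W\<^esub> y" by (rule d)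
 show "x : carrier W ==> (c * d) \<odot>\<^bsub>W\<^esub> x = c \<odot>\<^bsub>W\<^esub> (d \<odot>\<^bsub>W\<^esub> x)"
  using d(4)[of x c d] by simp
 show "x : carrier W ==> 1 \<odot>\<^bsub>W\<^esub> x = x" using d(5)[of x] by simp
 show "x : carrier W ==> 0 \<odot>\<^bsub>W\<^esub> x = \<zero>\<^bsub>W\<^esub>" using d(6)[of x] by simp
 show "c \<odot>\<^bsub>W\<^esub> \<zero>\<^bsub>W\<^esub> = \<zero>\<^bsub>W\<^esub>" by (rule d)
 show "x : carrier W ==> c \<odot>\<^bsub>W\<^esub> (d \<odot>\<^bsub>W\<^esub> x) = d \<odot>\<^bsub>W\<^esub> (c \<odot>\<^bsub>W\<^esub> x)"
  using d(4)[of x c d] d(4)[of x d c] by (simp add: mult.commute)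
qed

lemma kmod_simps:
 assumes "kmod W"
 shows "\<zero>\<^bsub>W\<^esub> \<oplus>\<^bsub>W\<^esub> \<zero>\<^bsub>W\<^esub> = \<zero>\<^bsub>W\<^esub>" "\<zero>\<^bsub>W\<^esub> : carrier W"
  "x : carrier W ==> y : carrier W ==> x \<oplus>\<^bsub>W\<^esub> y : carrier W"
  "x : carrier W ==> x \<oplus>\<^bsub>W\<^esub> \<zero>\<^bsub>W\<^esub> = x" "x : carrier W ==> \<zero>\<^bsub>W\<^esub> \<oplus>\<^bsub>W\<^esub> x = x"
proof -
 interpret abelian_group W by (rule kmodD(1)[OF assms])
 show "\<zero>\<^bsub>W\<^esub> \<oplus>\<^bsub>W\<^esub> \<zero>\<^bsub>W\<^esub> = \<zero>\<^bsub>W\<^esub>" "\<zero>\<^bsub>W\<^esub> : carrier W"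
  "x : carrier W ==> y : carrier W ==> x \<oplus>\<^bsub>W\<^esub> y : carrier W"
  "x : carrier W ==> x \<oplus>\<^bsub>W\<^esub> \<zero>\<^bsub>W\<^esub> = x" "x : carrier W ==> \<zero>\<^bsub>W\<^esub> \<oplus>\<^bsub>W\<^esub> x = x" by simp_all
qed

lemma is_k_algebraD:
 assumes "is_k_algebra A"
 shows "kmod A" "ring A" "monoid A"
  "\<And>c x y. x : carrier A ==> y : carrier A ==> (c \<odot>\<^bsub>A\<^esub> x) \<otimes>\<^bsub>A\<^esub> y = c \<odot>\<^bsub>A\<^esub> (x \<otimes>\<^bsub>A\<^esub> y)"
  "\<And>c x y. x : carrier A ==> y : carrier A ==> x \<otimes>\<^bsub>A\<^esub> (c \<odot>\<^bsub>A\<^esub> y) = c \<odot>\<^bsub>A\<^esub> (x \<otimes>\<^bsub>A\<^esub> y)"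
 using assms by (auto simp: is_k_algebra_def ring_def)

lemma is_k_algebra_ground: "is_k_algebra (ground_field :: ('k::field, 'k) module)"
 using kmod_ground cring_ground_field by (auto simp: is_k_algebra_def cring_def)

lemma finsum_ground: "finsum (ground_field :: ('k::field, 'k) module) f S = sum f S"
proof -
 interpret cring "ground_field :: ('k, 'k) module" by (rule cring_ground_field)
 show ?thesis
  by (induction S rule: infinite_finite_induct) auto
qed

lemma lin_homI:
 assumes "\<And>x. x : carrier A ==> \<phi> x : carrier B"
  "\<And>x y. x : carrier A ==> y : carrier A ==> \<phi> (x \<oplus>\<^bsub>A\<^esub> y) = \<phi> x \<oplus>\<^bsub>B\<^esub> \<phi> y"
  "\<And>c x. x : carrier A ==> \<phi> (c \<odot>\<^bsub>A\<^esub> x) = c \<odot>\<^bsub>B\<^esub> \<phi> x"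
 shows "\<phi> : lin_hom A B"
 using assms by (auto simp: lin_hom_def)

lemma lin_homD:
 assumes "\<phi> : lin_hom A B"
 shows "x : carrier A ==> \<phi> x : carrier B"
  "x : carrier A ==> y : carrier A ==> \<phi> (x \<oplus>\<^bsub>A\<^esub> y) = \<phi> x \<oplus>\<^bsub>B\<^esub> \<phi> y"
  "x : carrier A ==> \<phi> (c \<odot>\<^bsub>A\<^esub> x) = c \<odot>\<^bsub>B\<^esub> \<phi> x"
 using assms by (auto simp: lin_hom_def)

lemma lin_hom_zero:
 assumes "\<phi> : lin_hom A B" "kmod A" "kmod B"
 shows "\<phi> \<zero>\<^bsub>A\<^esub> = \<zero>\<^bsub>B\<^esub>"
proof -
 interpret A: abelian_group A by (rule kmodD(1)[OF assms(2)])
 interpret B: abelian_group B by (rule kmodD(1)[OF assms(3)])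
 have "\<phi> (0 \<odot>\<^bsub>A\<^esub> \<zero>\<^bsub>A\<^esub>) = 0 \<odot>\<^bsub>B\<^esub> \<phi> \<zero>\<^bsub>A\<^esub>" by (rule lin_homD(3)[OF assms(1)]) simp
 then show ?thesis
  using kmodD(8)[OF assms(2), of 0] kmodD(7)[OF assms(3) lin_homD(1)[OF assms(1)]] by simp
qed

lemma lin_hom_comp: "\<phi> : lin_hom A B ==> \<psi> : lin_hom B C ==> (%x. \<psi> (\<phi> x)) : lin_hom A C"
 by (rule lin_homI) (auto simp: lin_homD)

lemma lin_hom_id: "(%x. x) : lin_hom A A"
 by (rule lin_homI) auto

text \<open>Linear maps are only required to respect sums and scalars; writing negatives as
  multiples by -1 makes them applicable to differences.\<close>

lemma kmod_uminus:
 assumes "kmod A" "x : carrier A" shows "\<ominus>\<^bsub>A\<^esub> x = (-1) \<odot>\<^bsub>A\<^esub> x"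
proof -
 interpret abelian_group A by (rule kmodD(1)[OF assms(1)])
 have "x \<oplus>\<^bsub>A\<^esub> (-1) \<odot>\<^bsub>A\<^esub> x = (1 + (-1)) \<odot>\<^bsub>A\<^esub> x"
  using kmodD(3)[OF assms, of 1 "-1"] kmodD(6)[OF assms] by simp
 also have "\<dots> = \<zero>\<^bsub>A\<^esub>" using kmodD(7)[OF assms] by simp
 finally show ?thesis using assms(2) kmodD(2)[OF assms, of "-1"] minus_equality[of "(-1) \<odot>\<^bsub>A\<^esub> x" x]
  by (simp add: a_comm)
qed

section \<open>Finitely supported functions and linear extension\<close>

lemma lookup_pm_scale [simp]: "lookup (pm_scale c z) x = c * lookup z x"
 by (simp add: pm_scale_def Poly_Mapping.map.rep_eq when_def)

lemma keys_pm_scale: "keys (pm_scale c z) <= keys z"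
 by (auto simp: in_keys_iff)

lemma keys_pm_scaleI: "keys z <= C ==> keys (pm_scale c z) <= C"
 by (auto simp: in_keys_iff)

lemma keys_addI: "keys z <= C ==> keys w <= C ==> keys (z + w) <= C"
 using keys_add[of z w] by (rule subset_trans) simp

lemma pm_scale_single [simp]: "pm_scale c (single x d) = single x (c * d)"
 by (rule poly_mapping_eqI) (simp add: lookup_single when_def)

lemma pm_scale_simps [simp]: "pm_scale c 0 = 0" "pm_scale 0 z = 0" "pm_scale 1 z = z"
 by (rule poly_mapping_eqI; simp)+

lemma pm_scale_distrib: "pm_scale c (z + w) = pm_scale c z + pm_scale c w"
  "pm_scale (c + d) z = pm_scale c z + pm_scale d z" "pm_scale c (pm_scale d z) = pm_scale (c * d) z"
 by (rule poly_mapping_eqI; simp add: lookup_add algebra_simps)+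

lemma uminus_eq_pm_scale: "- z = pm_scale (-1) z"
 by (rule poly_mapping_eqI) simp

lemma pm_eq_sum_singles:
 fixes z :: "'g \<Rightarrow>\<^sub>0 'b::comm_monoid_add"
 assumes "finite S" "keys z <= S"
 shows "z = (\<Sum>g\<in>S. single g (lookup z g))"
proof (rule poly_mapping_eqI)
 fix x
 have "(\<Sum>g\<in>S. lookup (single g (lookup z g)) x)
  = (\<Sum>g\<in>S. if g = x then lookup z x else 0)"
  by (intro sum.cong refl) (auto simp: lookup_single when_def)
 also have "\<dots> = lookup z x" using assms by (auto simp: in_keys_iff)
 finally show "lookup z x = lookup (\<Sum>g\<in>S. single g (lookup z g)) x"
  by (simp add: lookup_sum)
qed

lemma keys_sum_subset:
 fixes f :: "'i => 'g \<Rightarrow>\<^sub>0 'b::comm_monoid_add"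
 shows "(\<And>i. i : S ==> keys (f i) <= C) ==> keys (sum f S) <= C"
proof (induction S rule: infinite_finite_induct)
 case (insert x F)
 then show ?case by (simp add: keys_addI)
qed auto

text \<open>An element is the finite sum of its scaled basis elements. The rule reduces additive
  statements to these, and nested uses of it take care of bilinear ones.\<close>

lemma pm_induct [consumes 1, case_names zero single add]:
 fixes z :: "'g \<Rightarrow>\<^sub>0 'b::comm_monoid_add"
 assumes "keys z <= C" "P 0" "\<And>g c. g : C ==> P (single g c)"
  "\<And>z w. keys z <= C ==> keys w <= C ==> P z ==> P w ==> P (z + w)"
 shows "P z"
proof -
 have "P (\<Sum>g\<in>S. single g (lookup z g))" if "S <= C" "finite S" for S
  using that(2,1)
 proof induction
  case (insert x F)
  have "keys (\<Sum>g\<in>F. single g (lookup z g)) <= C"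
   by (rule keys_sum_subset) (use insert.prems in \<open>auto split: if_splits\<close>)
  with insert show ?case by (auto intro!: assms(3,4) split: if_splits)
 qed (simp add: assms(2))
 from this[OF assms(1) finite_keys] show ?thesis
  using pm_eq_sum_singles[OF finite_keys order_refl, of z] by simp
qed

text \<open>The linear extension of \<open>f\<close> to the free vector space.
  \<open>induced W f X\<close> is this map at a chosen representative of the class
  \<open>X\<close>.\<close>

definition lext :: "('k::field, 'w, 'm) module_scheme => ('g => 'w) => ('g \<Rightarrow>\<^sub>0 'k) => 'w" where
 "lext W f z = (\<Oplus>\<^bsub>W\<^esub>g\<in>keys z. lookup z g \<odot>\<^bsub>W\<^esub> f g)"

lemma lext_ground: "lext ground_field f z = (\<Sum>g\<in>keys z. lookup z g * f g)"
 by (simp add: lext_def finsum_ground)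

context
 fixes W :: "('k::field, 'w, 'm) module_scheme" and C :: "'g set" and f :: "'g => 'w"
 assumes W: "kmod W" and f: "\<And>g. g : C ==> f g : carrier W"
begin

interpretation W: abelian_group W by (rule kmodD(1)[OF W])

lemmas Wd = kmodD(2-)[OF W]

lemma lext_superset:
 assumes "finite S" "keys z <= S" "S <= C"
 shows "lext W f z = (\<Oplus>\<^bsub>W\<^esub>g\<in>S. lookup z g \<odot>\<^bsub>W\<^esub> f g)"
 unfolding lext_def
proof (rule W.add.finprod_mono_neutral_cong_left)
 fix g assume "g : S - keys z"
 then show "lookup z g \<odot>\<^bsub>W\<^esub> f g = \<zero>\<^bsub>W\<^esub>"
  using Wd(6)[OF f, of g] assms(3) by (auto simp: in_keys_iff)
qed (use assms Wd(1) f in auto)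

lemma lext_closed: "keys z <= C ==> lext W f z : carrier W"
 unfolding lext_def by (rule W.finsum_closed) (use Wd(1) f in auto)

lemma lext_zero: "lext W f 0 = \<zero>\<^bsub>W\<^esub>"
 by (simp add: lext_def)

lemma lext_single: "g : C ==> lext W f (single g c) = c \<odot>\<^bsub>W\<^esub> f g"
 using lext_superset[of "{g}" "single g c"] f Wd(1) by simp

lemma lext_add:
 assumes "keys z <= C" "keys w <= C"
 shows "lext W f (z + w) = lext W f z \<oplus>\<^bsub>W\<^esub> lext W f w"
proof -
 let ?S = "keys z \<union> keys w"
 have S: "finite ?S" "?S <= C" using assms by auto
 have "lext W f (z + w) = (\<Oplus>\<^bsub>W\<^esub>g\<in>?S. lookup (z + w) g \<odot>\<^bsub>W\<^esub> f g)"
  by (rule lext_superset) (use S keys_add[of z w] in auto)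
 also have "\<dots> = (\<Oplus>\<^bsub>W\<^esub>g\<in>?S. lookup z g \<odot>\<^bsub>W\<^esub> f g \<oplus>\<^bsub>W\<^esub> lookup w g \<odot>\<^bsub>W\<^esub> f g)"
 proof (rule W.finsum_cong')
  fix g assume "g : ?S"
  then show "lookup (z + w) g \<odot>\<^bsub>W\<^esub> f g = lookup z g \<odot>\<^bsub>W\<^esub> f g \<oplus>\<^bsub>W\<^esub> lookup w g \<odot>\<^bsub>W\<^esub> f g"
   using Wd(2)[OF f, of g] S by (auto simp: lookup_add)
 qed (use S Wd(1) f in auto)
 also have "\<dots> = lext W f z \<oplus>\<^bsub>W\<^esub> lext W f w"
  unfolding lext_superset[OF S(1) Un_upper1 S(2)] lext_superset[OF S(1) Un_upper2 S(2)]
  by (rule W.finsum_addf) (use S Wd(1) f in auto)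
 finally show ?thesis .
qed

lemma lext_scale:
 assumes "keys z <= C"
 shows "lext W f (pm_scale c z) = c \<odot>\<^bsub>W\<^esub> lext W f z"
 using assms
proof (induction rule: pm_induct)
 case zero then show ?case using Wd(7) by (simp add: lext_zero)
next
 case (single g d) then show ?case unfolding pm_scale_single lext_single[OF single] by (rule Wd(4)[OF f])
next
 case (add z w)
 have "keys (pm_scale c z) <= C" "keys (pm_scale c w) <= C"
  by (intro keys_pm_scaleI add.hyps)+
 then have "lext W f (pm_scale c (z + w)) = c \<odot>\<^bsub>W\<^esub> lext W f z \<oplus>\<^bsub>W\<^esub> c \<odot>\<^bsub>W\<^esub> lext W f w"
  unfolding pm_scale_distrib(1) add.IH[symmetric] by (rule lext_add)
 also have "\<dots> = c \<odot>\<^bsub>W\<^esub> lext W f (z + w)"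
  unfolding lext_add[OF add.hyps(1,2)]
  by (rule Wd(3)[symmetric]) (simp_all add: lext_closed add.hyps)
 finally show ?case .
qed

lemma lext_diff:
 assumes "keys z <= C" "keys w <= C"
 shows "lext W f (z - w) = lext W f z \<ominus>\<^bsub>W\<^esub> lext W f w"
proof -
 have k: "keys (pm_scale (-1) w) <= C" by (intro keys_pm_scaleI assms)
 have "lext W f (z - w) = lext W f (z + pm_scale (-1) w)"
  unfolding uminus_eq_pm_scale[symmetric] by simp
 also have "\<dots> = lext W f z \<oplus>\<^bsub>W\<^esub> (-1) \<odot>\<^bsub>W\<^esub> lext W f w"
  using lext_add[OF assms(1) k] lext_scale[OF assms(2)] by simp
 finally show ?thesis
  using kmod_uminus[OF W lext_closed[OF assms(2)]] by (simp add: a_minus_def)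
qed

lemma lin_hom_lext:
 assumes "\<phi> : lin_hom W W'" "kmod W'" "keys z <= C"
 shows "\<phi> (lext W f z) = lext W' (%g. \<phi> (f g)) z"
proof -
 interpret W': abelian_group W' by (rule kmodD(1)[OF assms(2)])
 have *: "\<phi> (\<Oplus>\<^bsub>W\<^esub>g\<in>S. c g \<odot>\<^bsub>W\<^esub> f g) = (\<Oplus>\<^bsub>W'\<^esub>g\<in>S. c g \<odot>\<^bsub>W'\<^esub> \<phi> (f g))" if "finite S" "S <= C" for S c
  using that
 proof induction
  case empty then show ?case using lin_hom_zero assms W by simp
 next
  case (insert x S)
  have "\<phi> (c x \<odot>\<^bsub>W\<^esub> f x) = c x \<odot>\<^bsub>W'\<^esub> \<phi> (f x)"
   using insert.prems f by (intro lin_homD(3)[OF assms(1)]) auto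
  moreover have "(\<Oplus>\<^bsub>W\<^esub>g\<in>S. c g \<odot>\<^bsub>W\<^esub> f g) : carrier W"
   by (rule W.finsum_closed) (use insert.prems Wd(1) f in auto)
  ultimately show ?case
   using insert lin_homD[OF assms(1)] Wd(1) kmodD(2)[OF assms(2)] f
   by (subst W.finsum_insert, auto, subst W'.finsum_insert) auto
 qed
 show ?thesis unfolding lext_def by (rule *) (use assms in auto)
qed

end

lemma lext_cong: "(\<And>g. g : keys z ==> f g = h g) ==> kmod W ==>
  (\<And>g. g : keys z ==> h g : carrier W) ==> lext W f z = lext W h z"
 unfolding lext_def
 by (rule abelian_monoid.finsum_cong')
  (auto simp: Module.module_def abelian_group_def intro!: module.smult_closed)

subsection \<open>Monoid algebras\<close>

lemma monoid_algebra_simps [simp]: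
 "carrier (monoid_algebra M) = {z. keys z <= carrier M}"
 "z \<oplus>\<^bsub>monoid_algebra M\<^esub> w = z + w" "c \<odot>\<^bsub>monoid_algebra M\<^esub> z = pm_scale c z"
 "\<one>\<^bsub>monoid_algebra M\<^esub> = single \<one>\<^bsub>M\<^esub> 1" "\<zero>\<^bsub>monoid_algebra M\<^esub> = 0"
 by (auto simp: monoid_algebra_def)

lemma ma_mult_superset:
 assumes "finite S" "finite T" "keys z <= S" "keys w <= T"
 shows "z \<otimes>\<^bsub>monoid_algebra M\<^esub> w = (\<Sum>g\<in>S. \<Sum>h\<in>T.
   single (g \<otimes>\<^bsub>M\<^esub> h) (lookup z g * lookup w h))"
proof -
 have "z \<otimes>\<^bsub>monoid_algebra M\<^esub> w = (\<Sum>g\<in>keys z. \<Sum>h\<in>T.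
   single (g \<otimes>\<^bsub>M\<^esub> h) (lookup z g * lookup w h))"
  unfolding monoid_algebra_def
  by (simp, intro sum.cong refl sum.mono_neutral_left) (use assms in \<open>auto simp: in_keys_iff\<close>)
 also have "\<dots> = (\<Sum>g\<in>S. \<Sum>h\<in>T.
   single (g \<otimes>\<^bsub>M\<^esub> h) (lookup z g * lookup w h))"
  by (intro sum.mono_neutral_left) (use assms in \<open>auto simp: in_keys_iff\<close>)
 finally show ?thesis .
qed

lemma ma_mult_single:
 "single g c \<otimes>\<^bsub>monoid_algebra M\<^esub> single h d = single (g \<otimes>\<^bsub>M\<^esub> h) (c * d)"
 using ma_mult_superset[of "{g}" "{h}" "single g c" "single h d" M] by simp

lemma ma_mult_0 [simp]: "0 \<otimes>\<^bsub>monoid_algebra M\<^esub> z = 0" "z \<otimes>\<^bsub>monoid_algebra M\<^esub> 0 = 0"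
 by (auto simp: monoid_algebra_def)

lemma ma_distrib:
 "(z + z') \<otimes>\<^bsub>monoid_algebra M\<^esub> w = z \<otimes>\<^bsub>monoid_algebra M\<^esub> w + z' \<otimes>\<^bsub>monoid_algebra M\<^esub> w"
 "w \<otimes>\<^bsub>monoid_algebra M\<^esub> (z + z') = w \<otimes>\<^bsub>monoid_algebra M\<^esub> z + w \<otimes>\<^bsub>monoid_algebra M\<^esub> z'"
proof -
 let ?S = "keys z \<union> keys z'"
 have S: "finite ?S" "keys (z + z') <= ?S" "keys z <= ?S" "keys z' <= ?S"
  using keys_add[of z z'] by auto
 show "(z + z') \<otimes>\<^bsub>monoid_algebra M\<^esub> w = z \<otimes>\<^bsub>monoid_algebra M\<^esub> w + z' \<otimes>\<^bsub>monoid_algebra M\<^esub> w"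
  by (subst (1 2 3) ma_mult_superset[OF S(1) finite_keys _ order_refl])
   (use S in \<open>auto simp: lookup_add distrib_right single_add sum.distrib\<close>)
 show "w \<otimes>\<^bsub>monoid_algebra M\<^esub> (z + z') = w \<otimes>\<^bsub>monoid_algebra M\<^esub> z + w \<otimes>\<^bsub>monoid_algebra M\<^esub> z'"
  by (subst (1 2 3) ma_mult_superset[OF finite_keys S(1) order_refl])
   (use S in \<open>auto simp: lookup_add distrib_left single_add sum.distrib\<close>)
qed

lemma ma_scale:
 "pm_scale c z \<otimes>\<^bsub>monoid_algebra M\<^esub> w = pm_scale c (z \<otimes>\<^bsub>monoid_algebra M\<^esub> w)"
 "z \<otimes>\<^bsub>monoid_algebra M\<^esub> pm_scale c w = pm_scale c (z \<otimes>\<^bsub>monoid_algebra M\<^esub> w)"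
proof -
 have sc: "pm_scale c (sum f S) = (\<Sum>x\<in>S. pm_scale c (f x))" for f :: "'z => 'a \<Rightarrow>\<^sub>0 'b" and S
  by (induction S rule: infinite_finite_induct) (auto simp: pm_scale_distrib)
 show "pm_scale c z \<otimes>\<^bsub>monoid_algebra M\<^esub> w = pm_scale c (z \<otimes>\<^bsub>monoid_algebra M\<^esub> w)"
  by (subst (1 2) ma_mult_superset[OF finite_keys[of z] finite_keys[of w]])
   (auto simp: keys_pm_scale[THEN subsetD] sc mult.assoc)
 show "z \<otimes>\<^bsub>monoid_algebra M\<^esub> pm_scale c w = pm_scale c (z \<otimes>\<^bsub>monoid_algebra M\<^esub> w)"
  by (subst (1 2) ma_mult_superset[OF finite_keys[of z] finite_keys[of w]])
   (auto simp: keys_pm_scale[THEN subsetD] sc ac_simps)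
qed

context
 fixes M :: "('g, 'm) monoid_scheme"
 assumes M: "monoid M"
begin

interpretation M: monoid M by (rule M)

lemma ma_mult_closed:
 "keys z <= carrier M ==> keys w <= carrier M ==>
  keys (z \<otimes>\<^bsub>monoid_algebra M :: ('k::field, _) module\<^esub> w) <= carrier M"
proof -
 assume z: "keys z <= carrier M" and w: "keys w <= carrier M"
 show ?thesis unfolding ma_mult_superset[OF finite_keys finite_keys order_refl order_refl]
  by (intro keys_sum_subset) (use z w in \<open>auto split: if_splits\<close>)
qed

lemma ring_monoid_algebra: "ring (monoid_algebra M :: ('k::field, _) module)"
proof (rule ringI)
 let ?R = "monoid_algebra M :: ('k, _) module"
 show "abelian_group ?R"
 proof (rule abelian_groupI)
  fix x assume x: "x : carrier ?R"
  then have "- x : carrier ?R" by (simp add: uminus_eq_pm_scale keys_pm_scaleI)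
  then show "\<exists>y\<in>carrier ?R. y \<oplus>\<^bsub>?R\<^esub> x = \<zero>\<^bsub>?R\<^esub>" by (intro bexI[of _ "- x"]) auto
 qed (auto simp: ac_simps keys_addI[THEN subsetD])
 show "monoid ?R"
 proof
  fix x y z assume xyz: "x : carrier ?R" "y : carrier ?R" "z : carrier ?R"
  show "x \<otimes>\<^bsub>?R\<^esub> y : carrier ?R" using xyz by (simp add: ma_mult_closed)
  have kx: "keys x <= carrier M" and ky: "keys y <= carrier M"
   and kz: "keys z <= carrier M" using xyz by auto
  have s1: "single g c \<otimes>\<^bsub>?R\<^esub> single h d \<otimes>\<^bsub>?R\<^esub> z
   = single g c \<otimes>\<^bsub>?R\<^esub> (single h d \<otimes>\<^bsub>?R\<^esub> z)" if "g : carrier M" "h : carrier M" for g h c d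
   using kz that by (induction rule: pm_induct) (auto simp: ma_mult_single ma_distrib M.m_assoc mult.assoc)
  have s2: "single g c \<otimes>\<^bsub>?R\<^esub> y \<otimes>\<^bsub>?R\<^esub> z
   = single g c \<otimes>\<^bsub>?R\<^esub> (y \<otimes>\<^bsub>?R\<^esub> z)" if "g : carrier M" for g c
   using ky that by (induction rule: pm_induct) (auto simp: s1 ma_distrib)
  show "x \<otimes>\<^bsub>?R\<^esub> y \<otimes>\<^bsub>?R\<^esub> z = x \<otimes>\<^bsub>?R\<^esub> (y \<otimes>\<^bsub>?R\<^esub> z)"
   using kx by (induction rule: pm_induct) (auto simp: s2 ma_distrib)
  show "\<one>\<^bsub>?R\<^esub> \<otimes>\<^bsub>?R\<^esub> x = x"
   using kx by (induction rule: pm_induct) (auto simp: ma_mult_single ma_distrib)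
  show "x \<otimes>\<^bsub>?R\<^esub> \<one>\<^bsub>?R\<^esub> = x"
   using kx by (induction rule: pm_induct) (auto simp: ma_mult_single ma_distrib)
 qed simp
qed (auto simp: ma_distrib)

lemma is_k_algebra_monoid_algebra: "is_k_algebra (monoid_algebra M :: ('k::field, _) module)"
 unfolding is_k_algebra_def
proof (intro conjI ballI allI)
 show "kmod (monoid_algebra M :: ('k::field, _) module)"
  by (rule kmodI) (use ring_monoid_algebra[where 'k = 'k] in
   \<open>auto simp: ring_def pm_scale_distrib keys_pm_scaleI[THEN subsetD]\<close>)
qed (use ring_monoid_algebra in \<open>auto simp: ma_scale\<close>)

text \<open>General multipliers are sums of scaled basis elements, so closure under the latter is
  enough; negatives are products with minus the unit.\<close>

lemma ma_idealI:
 fixes J :: "('g \<Rightarrow>\<^sub>0 'k::field) set"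
 assumes "J <= carrier (monoid_algebra M)" "0 : J" "\<And>z w. z : J ==> w : J ==> z + w : J"
  "\<And>g c z. g : carrier M ==> z : J ==> single g c \<otimes>\<^bsub>monoid_algebra M\<^esub> z : J"
  "\<And>g c z. g : carrier M ==> z : J ==> z \<otimes>\<^bsub>monoid_algebra M\<^esub> single g c : J"
 shows "ideal J (monoid_algebra M :: ('k::field, _) module)"
proof (rule idealI)
 let ?R = "monoid_algebra M :: ('k::field, _) module"
 interpret R: ring ?R by (rule ring_monoid_algebra)
 show "ring ?R" by (rule ring_monoid_algebra)
 have l: "x \<otimes>\<^bsub>?R\<^esub> a : J" if "a : J" "x : carrier ?R" for a x
 proof -
  have "keys x <= carrier M" using that by simp
  then show ?thesis by (induction rule: pm_induct) (use assms that in \<open>auto simp: ma_distrib\<close>)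
 qed
 have r: "a \<otimes>\<^bsub>?R\<^esub> x : J" if "a : J" "x : carrier ?R" for a x
 proof -
  have "keys x <= carrier M" using that by simp
  then show ?thesis by (induction rule: pm_induct) (use assms that in \<open>auto simp: ma_distrib\<close>)
 qed
 show "\<And>a x. a : J ==> x : carrier ?R ==> x \<otimes>\<^bsub>?R\<^esub> a : J" by (rule l)
 show "\<And>a x. a : J ==> x : carrier ?R ==> a \<otimes>\<^bsub>?R\<^esub> x : J" by (rule r)
 show "subgroup J (add_monoid ?R)"
 proof (rule R.add.subgroupI)
  fix a assume a: "a : J"
  have "(\<ominus>\<^bsub>?R\<^esub> \<one>\<^bsub>?R\<^esub>) \<otimes>\<^bsub>?R\<^esub> a : J" by (rule l[OF a R.a_inv_closed[OF R.one_closed]])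
  moreover have "(\<ominus>\<^bsub>?R\<^esub> \<one>\<^bsub>?R\<^esub>) \<otimes>\<^bsub>?R\<^esub> a = \<ominus>\<^bsub>?R\<^esub> a"
   using R.l_minus[OF R.one_closed subsetD[OF assms(1) a]] R.l_one[OF subsetD[OF assms(1) a]] by (rule trans[OF _ arg_cong])
  ultimately show "\<ominus>\<^bsub>?R\<^esub> a : J" by (rule rev_iffD1[OF _ arg_cong])
 qed (use assms in auto)
qed

text \<open>Multiplying by a basis element amounts to translating the function that is extended.
  Hence the common kernel of a translation-stable family is a two-sided ideal.\<close>

lemma ma_lext_single_mult:
 fixes W :: "('k::field, 'w, 'n) module_scheme"
 assumes "kmod W" "\<And>h. h : carrier M ==> f h : carrier W" "g : carrier M" "keys z <= carrier M"
 shows "lext W f (single g c \<otimes>\<^bsub>monoid_algebra M\<^esub> z) = c \<odot>\<^bsub>W\<^esub> lext W (%h. f (g \<otimes>\<^bsub>M\<^esub> h)) z"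
  and "lext W f (z \<otimes>\<^bsub>monoid_algebra M\<^esub> single g c) = c \<odot>\<^bsub>W\<^esub> lext W (%h. f (h \<otimes>\<^bsub>M\<^esub> g)) z"
proof -
 note l = lext_single[where C = "carrier M", OF assms(1)] lext_add[where C = "carrier M", OF assms(1)]
  lext_zero[where C = "carrier M", OF assms(1)] lext_closed[where C = "carrier M", OF assms(1)]
 have fl: "f (g \<otimes>\<^bsub>M\<^esub> h) : carrier W" and fr: "f (h \<otimes>\<^bsub>M\<^esub> g) : carrier W" if "h : carrier M" for h
  using that assms(2,3) by auto
 show "lext W f (single g c \<otimes>\<^bsub>monoid_algebra M\<^esub> z) = c \<odot>\<^bsub>W\<^esub> lext W (%h. f (g \<otimes>\<^bsub>M\<^esub> h)) z"
  using assms(4) by (induction rule: pm_induct)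
   (use assms(2,3) in \<open>auto simp: ma_mult_single ma_distrib l ma_mult_closed kmodD(4,8)[OF assms(1)] kmodD(5)[OF assms(1), symmetric]\<close>)
 show "lext W f (z \<otimes>\<^bsub>monoid_algebra M\<^esub> single g c) = c \<odot>\<^bsub>W\<^esub> lext W (%h. f (h \<otimes>\<^bsub>M\<^esub> g)) z"
  using assms(4) by (induction rule: pm_induct)
   (use assms(2,3) in \<open>auto simp: ma_mult_single ma_distrib l ma_mult_closed kmodD(4,8)[OF assms(1)] kmodD(5)[OF assms(1), symmetric] mult.commute\<close>)
qed

text \<open>A family of maps that is stable under translations and kills generators of an ideal kills the ideal.\<close>

lemma lext_vanishes_on_genideal:
 fixes W :: "('k::field, 'w, 'n) module_scheme"
 assumes W: "kmod W" and S: "S <= carrier (monoid_algebra M)"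
  and closed: "\<And>f h. f : \<F> ==> h : carrier M ==> f h : carrier W"
  and trans: "\<And>f g. f : \<F> ==> g : carrier M ==> (%h. f (g \<otimes>\<^bsub>M\<^esub> h)) : \<F>"
   "\<And>f g. f : \<F> ==> g : carrier M ==> (%h. f (h \<otimes>\<^bsub>M\<^esub> g)) : \<F>"
  and van: "\<And>f s. f : \<F> ==> s : S ==> lext W f s = \<zero>\<^bsub>W\<^esub>"
  and f: "f : \<F>" and z: "z : Idl\<^bsub>monoid_algebra M\<^esub> S"
 shows "lext W f z = \<zero>\<^bsub>W\<^esub>"
proof -
 let ?R = "monoid_algebra M :: ('k, _) module"
 \<comment> \<open>The common kernel of all extensions from the family; being an ideal that contains
   \<open>S\<close>, it contains the ideal generated by \<open>S\<close>.\<close>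
 let ?J = "{z : carrier ?R. \<forall>f\<in>\<F>. lext W f z = \<zero>\<^bsub>W\<^esub>}"
 have "ideal ?J ?R"
 proof (rule ma_idealI)
  show "0 : ?J" using lext_zero[OF W closed] by auto
  show "z + w : ?J" if "z : ?J" "w : ?J" for z w
  proof -
   have k: "keys z <= carrier M" "keys w <= carrier M" using that by auto
   have "lext W f (z + w) = \<zero>\<^bsub>W\<^esub>" if "f : \<F>" for f
    using lext_add[where C = "carrier M", OF W closed[OF that] k] that \<open>z : ?J\<close> \<open>w : ?J\<close> by (simp add: kmod_simps[OF W])
   with keys_addI[OF k] show ?thesis by simp
  qed
  fix g z and c :: 'k assume g: "g : carrier M" and z: "z : ?J"
  have k: "keys z <= carrier M" "keys (single g c) <= carrier M" using z g by auto
  have "lext W f (single g c \<otimes>\<^bsub>?R\<^esub> z) = \<zero>\<^bsub>W\<^esub>"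
     "lext W f (z \<otimes>\<^bsub>?R\<^esub> single g c) = \<zero>\<^bsub>W\<^esub>" if "f : \<F>" for f
   using ma_lext_single_mult[OF W closed[OF that] g k(1)] trans[OF that g] z by (auto simp: kmodD(8)[OF W])
  then show "single g c \<otimes>\<^bsub>?R\<^esub> z : ?J" "z \<otimes>\<^bsub>?R\<^esub> single g c : ?J"
   using ma_mult_closed[OF k(1,2)] ma_mult_closed[OF k(2,1)] by auto
 qed auto
 then have "Idl\<^bsub>?R\<^esub> S <= ?J"
  by (rule ring.genideal_minimal[OF ring_monoid_algebra]) (use S van in auto)
 with f z show ?thesis by auto
qed

end

subsection \<open>Quotients\<close>

text \<open>Being a ring depends only on these fields and not on what extends the record. This
  transfers the ring axioms from \<open>R Quot I\<close> to \<open>quotient_algebra R I\<close>,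
  which has a scalar multiplication in addition.\<close>

lemma ring_cong:
 assumes "carrier S = carrier R" "monoid.mult S = monoid.mult R" "add S = add R" "one S = one R" "ring.zero S = ring.zero R"
 shows "ring S = ring R"
 unfolding ring_def ring_axioms_def abelian_group_def abelian_monoid_def abelian_group_axioms_def comm_monoid_def comm_monoid_axioms_def
  comm_group_def group_def group_axioms_def monoid_def Units_def assms by simp

lemma quotient_algebra_simps:
 "carrier (quotient_algebra R I) = (%x. I +>\<^bsub>R\<^esub> x) ` carrier R"
 "x \<otimes>\<^bsub>quotient_algebra R I\<^esub> y = x \<otimes>\<^bsub>R Quot I\<^esub> y"
 "x \<oplus>\<^bsub>quotient_algebra R I\<^esub> y = x \<oplus>\<^bsub>R Quot I\<^esub> y"
 "\<one>\<^bsub>quotient_algebra R I\<^esub> = \<one>\<^bsub>R Quot I\<^esub>" "\<zero>\<^bsub>quotient_algebra R I\<^esub> = \<zero>\<^bsub>R Quot I\<^esub>"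
 "c \<odot>\<^bsub>quotient_algebra R I\<^esub> T = I +>\<^bsub>R\<^esub> (c \<odot>\<^bsub>R\<^esub> (SOME z. z : T))"
 by (auto simp: quotient_algebra_def ring.defs module.defs FactRing_def A_RCOSETS_def')

context
 fixes R :: "('k::field, 'a) module" and I
 assumes R: "is_k_algebra R" and I: "ideal I R"
begin

interpretation R: ring R by (rule is_k_algebraD[OF R])
interpretation I: ideal I R by (rule I)

lemma coset_eq_iff: "x : carrier R ==> y : carrier R ==> I +>\<^bsub>R\<^esub> x = I +>\<^bsub>R\<^esub> y \<longleftrightarrow> x \<ominus>\<^bsub>R\<^esub> y : I"
 using R.quotient_eq_iff_same_a_r_cos[OF I] by blast

text \<open>Scalars act through multiples of the unit, so a ring ideal is automatically a
  subspace.\<close>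

lemma ideal_smult_closed: "x : I ==> c \<odot>\<^bsub>R\<^esub> x : I"
proof -
 assume x: "x : I"
 then have xc: "x : carrier R" by (rule I.a_Hcarr)
 have "c \<odot>\<^bsub>R\<^esub> x = (c \<odot>\<^bsub>R\<^esub> \<one>\<^bsub>R\<^esub>) \<otimes>\<^bsub>R\<^esub> x"
  using is_k_algebraD(4)[OF R R.one_closed xc] xc by simp
 then show ?thesis using I.I_l_closed[OF x kmodD(2)[OF is_k_algebraD(1)[OF R] R.one_closed]] by simp
qed

text \<open>Scalar multiplication on a quotient and \<open>induced\<close> both work with a chosen
  representative; the choice affects it only by an element of the ideal.\<close>

lemma coset_some:
 assumes "x : carrier R"
 shows "(SOME z. z : I +>\<^bsub>R\<^esub> x) : carrier R" "(SOME z. z : I +>\<^bsub>R\<^esub> x) \<ominus>\<^bsub>R\<^esub> x : I"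
proof -
 have *: "(SOME z. z : I +>\<^bsub>R\<^esub> x) : I +>\<^bsub>R\<^esub> x"
  by (rule someI[of _ x]) (rule I.a_rcos_self[OF assms])
 show 1: "(SOME z. z : I +>\<^bsub>R\<^esub> x) : carrier R"
  using * R.a_r_coset_subset_G[OF I.a_subset assms] by blast
 show "(SOME z. z : I +>\<^bsub>R\<^esub> x) \<ominus>\<^bsub>R\<^esub> x : I"
  using I.a_rcos_module_imp[OF assms *] by (simp add: a_minus_def)
qed

lemma quotient_hom:
 assumes "x : carrier R" "y : carrier R"
 shows "(I +>\<^bsub>R\<^esub> x) \<oplus>\<^bsub>quotient_algebra R I\<^esub> (I +>\<^bsub>R\<^esub> y) = I +>\<^bsub>R\<^esub> (x \<oplus>\<^bsub>R\<^esub> y)"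
  "(I +>\<^bsub>R\<^esub> x) \<otimes>\<^bsub>quotient_algebra R I\<^esub> (I +>\<^bsub>R\<^esub> y) = I +>\<^bsub>R\<^esub> (x \<otimes>\<^bsub>R\<^esub> y)"
  "c \<odot>\<^bsub>quotient_algebra R I\<^esub> (I +>\<^bsub>R\<^esub> x) = I +>\<^bsub>R\<^esub> (c \<odot>\<^bsub>R\<^esub> x)"
proof -
 show "(I +>\<^bsub>R\<^esub> x) \<oplus>\<^bsub>quotient_algebra R I\<^esub> (I +>\<^bsub>R\<^esub> y) = I +>\<^bsub>R\<^esub> (x \<oplus>\<^bsub>R\<^esub> y)"
  "(I +>\<^bsub>R\<^esub> x) \<otimes>\<^bsub>quotient_algebra R I\<^esub> (I +>\<^bsub>R\<^esub> y) = I +>\<^bsub>R\<^esub> (x \<otimes>\<^bsub>R\<^esub> y)"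
  using ring_hom_memE[OF I.rcos_ring_hom] assms by (simp_all add: quotient_algebra_simps)
 let ?z = "SOME z. z : I +>\<^bsub>R\<^esub> x"
 note k = is_k_algebraD(1)[OF R]
 have "c \<odot>\<^bsub>R\<^esub> ?z \<ominus>\<^bsub>R\<^esub> c \<odot>\<^bsub>R\<^esub> x = c \<odot>\<^bsub>R\<^esub> ?z \<oplus>\<^bsub>R\<^esub> c \<odot>\<^bsub>R\<^esub> (\<ominus>\<^bsub>R\<^esub> x)"
  using kmod_uminus[OF k kmodD(2)[OF k assms(1)]] kmod_uminus[OF k assms(1)] kmodD(9)[OF k assms(1), of c "-1"]
  by (simp add: a_minus_def)
 also have "\<dots> = c \<odot>\<^bsub>R\<^esub> (?z \<ominus>\<^bsub>R\<^esub> x)"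
  unfolding a_minus_def by (rule kmodD(4)[OF k, symmetric]) (use coset_some(1)[OF assms(1)] assms(1) in auto)
 finally have "I +>\<^bsub>R\<^esub> c \<odot>\<^bsub>R\<^esub> ?z = I +>\<^bsub>R\<^esub> c \<odot>\<^bsub>R\<^esub> x"
  using coset_some[OF assms(1)] ideal_smult_closed[of "?z \<ominus>\<^bsub>R\<^esub> x" c]
  by (subst coset_eq_iff) (use kmodD(2)[OF k] assms in simp_all)
 then show "c \<odot>\<^bsub>quotient_algebra R I\<^esub> (I +>\<^bsub>R\<^esub> x) = I +>\<^bsub>R\<^esub> (c \<odot>\<^bsub>R\<^esub> x)"
  by (simp add: quotient_algebra_simps)
qed

lemma quotient_one_zero:
 "\<one>\<^bsub>quotient_algebra R I\<^esub> = I +>\<^bsub>R\<^esub> \<one>\<^bsub>R\<^esub>" "\<zero>\<^bsub>quotient_algebra R I\<^esub> = I +>\<^bsub>R\<^esub> \<zero>\<^bsub>R\<^esub>"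
 using R.a_rcos_zero[OF I I.zero_closed] by (auto simp: quotient_algebra_simps FactRing_def)

lemma is_k_algebra_quotient: "is_k_algebra (quotient_algebra R I)"
proof -
 note k = is_k_algebraD(1)[OF R]
 have "carrier (quotient_algebra R I) = carrier (R Quot I)"
  by (auto simp: quotient_algebra_simps FactRing_def A_RCOSETS_def')
 then have r: "ring (quotient_algebra R I)"
  by (subst ring_cong[of _ "R Quot I"]) (auto simp: quotient_algebra_simps fun_eq_iff I.quotient_is_ring)
 show ?thesis unfolding is_k_algebra_def
 proof (intro conjI allI ballI)
  show "kmod (quotient_algebra R I)"
  proof (rule kmodI)
   show "abelian_group (quotient_algebra R I)" using r by (simp add: ring_def)
  qed (use kmodD(2-6)[OF k] R.add.m_closed in \<open>auto simp: quotient_algebra_simps(1) quotient_hom\<close>)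
 next
  fix c x y assume "x : carrier (quotient_algebra R I)" "y : carrier (quotient_algebra R I)"
  then obtain a b where ab: "a : carrier R" "x = I +>\<^bsub>R\<^esub> a" "b : carrier R" "y = I +>\<^bsub>R\<^esub> b"
   by (auto simp: quotient_algebra_simps)
  then show "(c \<odot>\<^bsub>quotient_algebra R I\<^esub> x) \<otimes>\<^bsub>quotient_algebra R I\<^esub> y = c \<odot>\<^bsub>quotient_algebra R I\<^esub> (x \<otimes>\<^bsub>quotient_algebra R I\<^esub> y)"
   "x \<otimes>\<^bsub>quotient_algebra R I\<^esub> (c \<odot>\<^bsub>quotient_algebra R I\<^esub> y) = c \<odot>\<^bsub>quotient_algebra R I\<^esub> (x \<otimes>\<^bsub>quotient_algebra R I\<^esub> y)"
   using is_k_algebraD(4,5)[OF R] kmodD(2)[OF k] by (auto simp: quotient_hom)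
 qed (rule r)
qed

end

text \<open>The chosen representative and \<open>z\<close> differ by an element of \<open>I\<close>,
  where the linear extension vanishes.\<close>

lemma induced_coset:
 fixes W :: "('k::field, 'w, 'm) module_scheme"
 assumes M: "monoid M" and I: "ideal I (monoid_algebra M :: ('k, _) module)" and W: "kmod W"
  and f: "\<And>g. g : carrier M ==> f g : carrier W" and van: "\<And>i. i : I ==> lext W f i = \<zero>\<^bsub>W\<^esub>"
  and z: "keys z <= carrier M"
 shows "induced W f (I +>\<^bsub>monoid_algebra M\<^esub> z) = lext W f z"
proof -
 let ?R = "monoid_algebra M :: ('k, _) module"
 interpret R: ring ?R by (rule ring_monoid_algebra[OF M])
 interpret I: ideal I ?R by (rule I)
 interpret W: abelian_group W by (rule kmodD(1)[OF W])
 define w where "w = (SOME w. w : I +>\<^bsub>?R\<^esub> z)"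
 have w: "w : carrier ?R" "w \<ominus>\<^bsub>?R\<^esub> z : I"
  using coset_some[OF is_k_algebra_monoid_algebra[OF M] I, of z] z by (auto simp: w_def)
 have zc: "z : carrier ?R" using z by simp
 have "w = (w \<ominus>\<^bsub>?R\<^esub> z) \<oplus>\<^bsub>?R\<^esub> z"
  using w(1) zc by (simp add: a_minus_def R.add.m_assoc R.l_neg del: monoid_algebra_simps)
 then have "lext W f w = lext W f ((w \<ominus>\<^bsub>?R\<^esub> z) + z)" by simp
 also have "\<dots> = lext W f (w \<ominus>\<^bsub>?R\<^esub> z) \<oplus>\<^bsub>W\<^esub> lext W f z"
  by (rule lext_add[OF W f]) (use w z I.a_Hcarr in auto)
 also have "\<dots> = lext W f z" using van[OF w(2)] lext_closed[OF W f z] by simp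
 finally show ?thesis by (simp add: induced_def lext_def w_def Let_def)
qed

subsection \<open>Tensor products\<close>

definition bil :: "('k::field, 'a, 'm) module_scheme => ('k, 'b, 'n) module_scheme => ('k, 'w, 'l) module_scheme =>
  ('a => 'b => 'w) => bool" where
 "bil A B W \<beta> \<longleftrightarrow> (\<forall>y\<in>carrier B. (%x. \<beta> x y) : lin_hom A W) \<and> (\<forall>x\<in>carrier A. \<beta> x : lin_hom B W)"

lemma bilI:
 assumes "\<And>x y. x : carrier A ==> y : carrier B ==> \<beta> x y : carrier W"
  "\<And>x x' y. x : carrier A ==> x' : carrier A ==> y : carrier B ==> \<beta> (x \<oplus>\<^bsub>A\<^esub> x') y = \<beta> x y \<oplus>\<^bsub>W\<^esub> \<beta> x' y"
  "\<And>x y y'. x : carrier A ==> y : carrier B ==> y' : carrier B ==> \<beta> x (y \<oplus>\<^bsub>B\<^esub> y') = \<beta> x y \<oplus>\<^bsub>W\<^esub> \<beta> x y'"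
  "\<And>c x y. x : carrier A ==> y : carrier B ==> \<beta> (c \<odot>\<^bsub>A\<^esub> x) y = c \<odot>\<^bsub>W\<^esub> \<beta> x y"
  "\<And>c x y. x : carrier A ==> y : carrier B ==> \<beta> x (c \<odot>\<^bsub>B\<^esub> y) = c \<odot>\<^bsub>W\<^esub> \<beta> x y"
 shows "bil A B W \<beta>"
 using assms by (auto simp: bil_def intro!: lin_homI)

lemma bilD:
 assumes "bil A B W \<beta>"
 shows "x : carrier A ==> y : carrier B ==> \<beta> x y : carrier W"
  "x : carrier A ==> x' : carrier A ==> y : carrier B ==> \<beta> (x \<oplus>\<^bsub>A\<^esub> x') y = \<beta> x y \<oplus>\<^bsub>W\<^esub> \<beta> x' y"
  "x : carrier A ==> y : carrier B ==> y' : carrier B ==> \<beta> x (y \<oplus>\<^bsub>B\<^esub> y') = \<beta> x y \<oplus>\<^bsub>W\<^esub> \<beta> x y'"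
  "x : carrier A ==> y : carrier B ==> \<beta> (c \<odot>\<^bsub>A\<^esub> x) y = c \<odot>\<^bsub>W\<^esub> \<beta> x y"
  "x : carrier A ==> y : carrier B ==> \<beta> x (c \<odot>\<^bsub>B\<^esub> y) = c \<odot>\<^bsub>W\<^esub> \<beta> x y"
proof -
 note d = assms[unfolded bil_def]
 show "x : carrier A ==> y : carrier B ==> \<beta> x y : carrier W"
  "x : carrier A ==> y : carrier B ==> y' : carrier B ==> \<beta> x (y \<oplus>\<^bsub>B\<^esub> y') = \<beta> x y \<oplus>\<^bsub>W\<^esub> \<beta> x y'"
  "x : carrier A ==> y : carrier B ==> \<beta> x (c \<odot>\<^bsub>B\<^esub> y) = c \<odot>\<^bsub>W\<^esub> \<beta> x y"
  using lin_homD[OF bspec[OF conjunct2[OF d]]] by auto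
 show "x : carrier A ==> x' : carrier A ==> y : carrier B ==> \<beta> (x \<oplus>\<^bsub>A\<^esub> x') y = \<beta> x y \<oplus>\<^bsub>W\<^esub> \<beta> x' y"
  "x : carrier A ==> y : carrier B ==> \<beta> (c \<odot>\<^bsub>A\<^esub> x) y = c \<odot>\<^bsub>W\<^esub> \<beta> x y"
  using lin_homD[OF bspec[OF conjunct1[OF d]]] by auto
qed

lemma bil_lin_hom: "bil A B W \<beta> ==> \<phi> : lin_hom W W' ==> bil A B W' (%x y. \<phi> (\<beta> x y))"
 unfolding bil_def by (auto intro: lin_hom_comp)

context
 fixes A :: "('k::field, 'a, 'm) module_scheme" and B :: "('k, 'b, 'n) module_scheme"
 assumes A: "is_k_algebra A" and B: "is_k_algebra B"
begin

interpretation A: ring A by (rule is_k_algebraD[OF A])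
interpretation B: ring B by (rule is_k_algebraD[OF B])

abbreviation (input) TR where "TR \<equiv> monoid_algebra (A \<times>\<times> B) :: ('k, 'a \<times> 'b \<Rightarrow>\<^sub>0 'k) module"
abbreviation (input) TI where "TI \<equiv> Idl\<^bsub>TR\<^esub> (tensor_relations A B)"

lemma monoid_DirProd_k: "monoid (A \<times>\<times> B)"
 by (rule DirProd_monoid[OF is_k_algebraD(3)[OF A] is_k_algebraD(3)[OF B]])

lemmas kA = kmodD[OF is_k_algebraD(1)[OF A]] and kB = kmodD[OF is_k_algebraD(1)[OF B]]

lemma tensor_relations_cases:
 assumes "s : tensor_relations A B"
 obtains x x' y where "s = single (x \<oplus>\<^bsub>A\<^esub> x', y) 1 - single (x, y) 1 - single (x', y) 1"
   "x : carrier A" "x' : carrier A" "y : carrier B"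
  | x y y' where "s = single (x, y \<oplus>\<^bsub>B\<^esub> y') 1 - single (x, y) 1 - single (x, y') 1"
   "x : carrier A" "y : carrier B" "y' : carrier B"
  | c x y where "s = single (c \<odot>\<^bsub>A\<^esub> x, y) 1 - single (x, y) c" "x : carrier A" "y : carrier B"
  | c x y where "s = single (x, c \<odot>\<^bsub>B\<^esub> y) 1 - single (x, y) c" "x : carrier A" "y : carrier B"
 using assms unfolding tensor_relations_def Let_def pm_scale_single mult_1_right by blast

lemma tensor_relations_carrier: "tensor_relations A B <= carrier TR"
proof -
 have "keys (single (x, y) (c::'k)) <= carrier A \<times> carrier B"
  if "x : carrier A" "y : carrier B" for x y c using that by simp
 moreover have "keys (z - w) <= C" if "keys z <= C" "keys w <= C"
  for C and z w :: "'a \<times> 'b \<Rightarrow>\<^sub>0 'k"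
  using keys_addI[OF that(1) keys_pm_scaleI[OF that(2), of "-1"]] by (simp add: uminus_eq_pm_scale[symmetric])
 ultimately have r: "z - w : carrier TR" "z + w : carrier TR" "pm_scale c z : carrier TR" if "z : carrier TR" "w : carrier TR" for z w c
  using that keys_addI[of z _ w] keys_pm_scaleI[of z _ c] by simp_all
 have k: "single (x, y) (c::'k) : carrier TR" if "x : carrier A" "y : carrier B" for x y c using that by simp
 show ?thesis
 proof
  fix s assume "s : tensor_relations A B"
  then show "s : carrier TR"
   by (cases rule: tensor_relations_cases) (auto intro!: r(1) k kA(2) kB(2) simp del: monoid_algebra_simps(1))
 qed
qed

lemma ideal_TI: "ideal TI TR"
 by (rule ring.genideal_ideal[OF ring_monoid_algebra[OF monoid_DirProd_k] tensor_relations_carrier])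

lemmas TRI = is_k_algebra_monoid_algebra[OF monoid_DirProd_k] ideal_TI

lemma is_k_algebra_tensor: "is_k_algebra (tensor A B)"
 unfolding tensor_def by (rule is_k_algebra_quotient[OF TRI])

lemma kmod_tensor: "kmod (tensor A B)"
 by (rule is_k_algebraD[OF is_k_algebra_tensor])

lemma tensor_carrier: "carrier (tensor A B) = tensor_class A B ` {z. keys z <= carrier A \<times> carrier B}"
 by (auto simp: tensor_def quotient_algebra_simps tensor_class_def[abs_def])

lemma tensor_class_hom:
 assumes "keys z <= carrier A \<times> carrier B" "keys w <= carrier A \<times> carrier B"
 shows "tensor_class A B z \<oplus>\<^bsub>tensor A B\<^esub> tensor_class A B w = tensor_class A B (z + w)"
  "tensor_class A B z \<otimes>\<^bsub>tensor A B\<^esub> tensor_class A B w = tensor_class A B (z \<otimes>\<^bsub>TR\<^esub> w)"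
  "c \<odot>\<^bsub>tensor A B\<^esub> tensor_class A B z = tensor_class A B (pm_scale c z)"
 using quotient_hom[OF TRI, of z w] assms by (auto simp: tensor_def tensor_class_def)

lemma tensor_one_zero:
 "\<one>\<^bsub>tensor A B\<^esub> = pure_tensor A B \<one>\<^bsub>A\<^esub> \<one>\<^bsub>B\<^esub>" "\<zero>\<^bsub>tensor A B\<^esub> = tensor_class A B 0"
 using quotient_one_zero[OF TRI] by (auto simp: tensor_def tensor_class_def pure_tensor_def)

lemma tensor_class_rel:
 assumes "z - w : tensor_relations A B" "keys z <= carrier A \<times> carrier B" "keys w <= carrier A \<times> carrier B"
 shows "tensor_class A B z = tensor_class A B w"
proof -
 interpret R: ring TR by (rule ring_monoid_algebra[OF monoid_DirProd_k])
 have "z \<ominus>\<^bsub>TR\<^esub> w = z - w"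
 proof -
  have "\<ominus>\<^bsub>TR\<^esub> w = - w"
   using kmod_uminus[OF is_k_algebraD(1)[OF TRI(1)], of w] assms by (simp add: uminus_eq_pm_scale)
  then show ?thesis by (simp add: a_minus_def)
 qed
 then show ?thesis
  unfolding tensor_class_def
  using assms coset_eq_iff[OF TRI, of z w] R.genideal_self[OF tensor_relations_carrier] by auto
qed

lemma pure_tensor_closed: "x : carrier A ==> y : carrier B ==> pure_tensor A B x y : carrier (tensor A B)"
 by (auto simp: tensor_carrier pure_tensor_def)

lemma bil_pure_tensor: "bil A B (tensor A B) (pure_tensor A B)"
proof (rule bilI)
 let ?e = "%x y. single (x, y) (1::'k)"
 have k: "keys (single (x, y) (c::'k)) <= carrier A \<times> carrier B"
  if "x : carrier A" "y : carrier B" for x y c using that by simp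
 fix x y c assume x: "x : carrier A" and y: "y : carrier B"
 show "pure_tensor A B x y : carrier (tensor A B)" by (rule pure_tensor_closed[OF x y])
 have r1: "?e (c \<odot>\<^bsub>A\<^esub> x) y - pm_scale c (?e x y) : tensor_relations A B"
  and r2: "?e x (c \<odot>\<^bsub>B\<^esub> y) - pm_scale c (?e x y) : tensor_relations A B"
  unfolding tensor_relations_def Let_def using x y by blast+
 show "pure_tensor A B (c \<odot>\<^bsub>A\<^esub> x) y = c \<odot>\<^bsub>tensor A B\<^esub> pure_tensor A B x y"
  unfolding pure_tensor_def tensor_class_hom(3)[OF k[OF x y] k[OF x y]]
  by (rule tensor_class_rel[OF r1 k[OF kA(2)[OF x] y] keys_pm_scaleI[OF k[OF x y]]])
 show "pure_tensor A B x (c \<odot>\<^bsub>B\<^esub> y) = c \<odot>\<^bsub>tensor A B\<^esub> pure_tensor A B x y"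
  unfolding pure_tensor_def tensor_class_hom(3)[OF k[OF x y] k[OF x y]]
  by (rule tensor_class_rel[OF r2 k[OF x kB(2)[OF y]] keys_pm_scaleI[OF k[OF x y]]])
next
 let ?e = "%x y. single (x, y) (1::'k)"
 have k: "keys (single (x, y) (c::'k)) <= carrier A \<times> carrier B"
  if "x : carrier A" "y : carrier B" for x y c using that by simp
 fix x x' y assume x: "x : carrier A" "x' : carrier A" and y: "y : carrier B"
 have "?e (x \<oplus>\<^bsub>A\<^esub> x') y - ?e x y - ?e x' y : tensor_relations A B"
  unfolding tensor_relations_def Let_def using x y by blast
 then show "pure_tensor A B (x \<oplus>\<^bsub>A\<^esub> x') y = pure_tensor A B x y \<oplus>\<^bsub>tensor A B\<^esub> pure_tensor A B x' y"
  unfolding pure_tensor_def tensor_class_hom(1)[OF k[OF x(1) y] k[OF x(2) y]]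
  by (intro tensor_class_rel keys_addI k x y A.a_closed) (simp add: algebra_simps)
next
 let ?e = "%x y. single (x, y) (1::'k)"
 have k: "keys (single (x, y) (c::'k)) <= carrier A \<times> carrier B"
  if "x : carrier A" "y : carrier B" for x y c using that by simp
 fix x y y' assume x: "x : carrier A" and y: "y : carrier B" "y' : carrier B"
 have "?e x (y \<oplus>\<^bsub>B\<^esub> y') - ?e x y - ?e x y' : tensor_relations A B"
  unfolding tensor_relations_def Let_def using x y by blast
 then show "pure_tensor A B x (y \<oplus>\<^bsub>B\<^esub> y') = pure_tensor A B x y \<oplus>\<^bsub>tensor A B\<^esub> pure_tensor A B x y'"
  unfolding pure_tensor_def tensor_class_hom(1)[OF k[OF x y(1)] k[OF x y(2)]]
  by (intro tensor_class_rel keys_addI k x y B.a_closed) (simp add: algebra_simps)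
qed

lemma pure_tensor_mult:
 assumes "x : carrier A" "y : carrier B" "x' : carrier A" "y' : carrier B"
 shows "pure_tensor A B x y \<otimes>\<^bsub>tensor A B\<^esub> pure_tensor A B x' y' = pure_tensor A B (x \<otimes>\<^bsub>A\<^esub> x') (y \<otimes>\<^bsub>B\<^esub> y')"
 unfolding pure_tensor_def using assms by (subst tensor_class_hom(2)) (auto simp: ma_mult_single)

text \<open>Scalars can be absorbed into the first factor, so every tensor is a sum of pure tensors
  without coefficients.\<close>

lemma tensor_induct [consumes 1, case_names zero pure add]:
 assumes "t : carrier (tensor A B)" "P \<zero>\<^bsub>tensor A B\<^esub>"
  "\<And>x y. x : carrier A ==> y : carrier B ==> P (pure_tensor A B x y)"
  "\<And>t t'. t : carrier (tensor A B) ==> t' : carrier (tensor A B) ==> P t ==> P t' ==> P (t \<oplus>\<^bsub>tensor A B\<^esub> t')"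
 shows "P t"
proof -
 obtain z where z: "keys z <= carrier A \<times> carrier B" "t = tensor_class A B z"
  using assms(1) by (auto simp: tensor_carrier)
 have "P (tensor_class A B z)" using z(1)
 proof (induction rule: pm_induct)
  case zero then show ?case using assms(2) by (simp add: tensor_one_zero)
 next
  case (single g c)
  obtain x y where g: "g = (x, y)" "x : carrier A" "y : carrier B" using single by auto
  have "tensor_class A B (single g c) = pure_tensor A B (c \<odot>\<^bsub>A\<^esub> x) y"
   using tensor_class_hom(3)[of "single g 1" 0 c] g bilD(4)[OF bil_pure_tensor, of x y c]
   by (simp add: pure_tensor_def)
  then show ?case using assms(3) g kA(2) by simp
 next
  case (add z w)
  have "tensor_class A B z : carrier (tensor A B)" "tensor_class A B w : carrier (tensor A B)"
   using add by (auto simp: tensor_carrier)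
  then show ?case using assms(4) add tensor_class_hom(1)[of z w] by metis
 qed
 with z show ?thesis by simp
qed

context
 fixes W :: "('k, 'w, 'l) module_scheme" and \<beta>
 assumes W: "kmod W" and \<beta>: "bil A B W \<beta>"
begin

text \<open>Multiplication by fixed elements in both factors turns a bilinear map into a bilinear
  map. The family of all bilinear maps is therefore stable under translations and vanishes on the
  whole ideal, not only on its generators.\<close>

lemma lext_tensor_vanishes:
 assumes "z : TI" shows "lext W (%(x, y). \<beta> x y) z = \<zero>\<^bsub>W\<^esub>"
proof (rule lext_vanishes_on_genideal[OF monoid_DirProd_k W tensor_relations_carrier,
   where \<F> = "{%(x, y). \<beta> x y | \<beta>. bil A B W \<beta>}"])
 interpret W: abelian_group W by (rule kmodD(1)[OF W])
 note kW = kmodD(2-)[OF W]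
 fix f assume "f : {%(x, y). \<beta> x y | \<beta>. bil A B W \<beta>}"
 then obtain \<beta> where f: "f = (%(x, y). \<beta> x y)" and b: "bil A B W \<beta>" by auto
 show "f h : carrier W" if "h : carrier (A \<times>\<times> B)" for h
  using that bilD(1)[OF b] by (auto simp: f)
 fix g assume "g : carrier (A \<times>\<times> B)"
 then obtain a a' where g: "g = (a, a')" "a : carrier A" "a' : carrier B" by auto
 have "bil A B W (%x y. \<beta> (a \<otimes>\<^bsub>A\<^esub> x) (a' \<otimes>\<^bsub>B\<^esub> y))" "bil A B W (%x y. \<beta> (x \<otimes>\<^bsub>A\<^esub> a) (y \<otimes>\<^bsub>B\<^esub> a'))"
  by (auto intro!: bilI simp: bilD[OF b] g A.r_distr B.r_distr A.l_distr B.l_distr is_k_algebraD(4,5)[OF A] is_k_algebraD(4,5)[OF B] kA(2) kB(2))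
 moreover have "(%h. f (g \<otimes>\<^bsub>A \<times>\<times> B\<^esub> h)) = (%(x, y). \<beta> (a \<otimes>\<^bsub>A\<^esub> x) (a' \<otimes>\<^bsub>B\<^esub> y))"
  "(%h. f (h \<otimes>\<^bsub>A \<times>\<times> B\<^esub> g)) = (%(x, y). \<beta> (x \<otimes>\<^bsub>A\<^esub> a) (y \<otimes>\<^bsub>B\<^esub> a'))"
  by (auto simp: f g fun_eq_iff)
 ultimately show "(%h. f (g \<otimes>\<^bsub>A \<times>\<times> B\<^esub> h)) : {%(x, y). \<beta> x y | \<beta>. bil A B W \<beta>}"
  "(%h. f (h \<otimes>\<^bsub>A \<times>\<times> B\<^esub> g)) : {%(x, y). \<beta> x y | \<beta>. bil A B W \<beta>}" by auto
next
 interpret W: abelian_group W by (rule kmodD(1)[OF W])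
 fix f s assume "f : {%(x, y). \<beta> x y | \<beta>. bil A B W \<beta>}" and s: "s : tensor_relations A B"
 then obtain \<beta> where f: "f = (%(x, y). \<beta> x y)" and b: "bil A B W \<beta>" by auto
 have fc: "f g : carrier W" if "g : carrier A \<times> carrier B" for g using that bilD(1)[OF b] by (auto simp: f)
 have k: "keys (single (x, y) (c::'k)) <= carrier A \<times> carrier B"
  if "x : carrier A" "y : carrier B" for x y c using that by simp
 have kd: "keys (z - w) <= carrier A \<times> carrier B" if "keys z <= carrier A \<times> carrier B" "keys w <= carrier A \<times> carrier B"
  for z w :: "'a \<times> 'b \<Rightarrow>\<^sub>0 'k"
  using keys_addI[OF that(1) keys_pm_scaleI[OF that(2), of "-1"]] by (simp add: uminus_eq_pm_scale[symmetric])
 have ls: "lext W f (single (x, y) c) = c \<odot>\<^bsub>W\<^esub> \<beta> x y" if "x : carrier A" "y : carrier B" for x y c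
  using lext_single[of W "carrier A \<times> carrier B" f "(x, y)" c] W fc that by (simp add: f)
 have ld: "lext W f (z - w) = lext W f z \<ominus>\<^bsub>W\<^esub> lext W f w" if "keys z <= carrier A \<times> carrier B" "keys w <= carrier A \<times> carrier B" for z w
  by (rule lext_diff[OF W _ that]) (rule fc)
 have m: "a \<oplus>\<^bsub>W\<^esub> b \<ominus>\<^bsub>W\<^esub> a \<ominus>\<^bsub>W\<^esub> b = \<zero>\<^bsub>W\<^esub>" if "a : carrier W" "b : carrier W" for a b
 proof -
  have "a \<oplus>\<^bsub>W\<^esub> b \<ominus>\<^bsub>W\<^esub> a \<ominus>\<^bsub>W\<^esub> b = (a \<oplus>\<^bsub>W\<^esub> b) \<oplus>\<^bsub>W\<^esub> (\<ominus>\<^bsub>W\<^esub> a \<oplus>\<^bsub>W\<^esub> \<ominus>\<^bsub>W\<^esub> b)"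
   using that by (simp add: a_minus_def W.a_assoc)
  also have "\<dots> = (a \<oplus>\<^bsub>W\<^esub> b) \<oplus>\<^bsub>W\<^esub> \<ominus>\<^bsub>W\<^esub> (a \<oplus>\<^bsub>W\<^esub> b)" using that by (simp add: W.minus_add)
  also have "\<dots> = \<zero>\<^bsub>W\<^esub>" using that by (intro W.r_neg) simp
  finally show ?thesis .
 qed
 have m2: "a \<ominus>\<^bsub>W\<^esub> a = \<zero>\<^bsub>W\<^esub>" if "a : carrier W" for a using that by (simp add: a_minus_def W.r_neg)
 from s show "lext W f s = \<zero>\<^bsub>W\<^esub>"
  by (cases rule: tensor_relations_cases)
   (simp_all add: ld kd k ls bilD[OF b] kA(2) kB(2) kmodD(2,6)[OF W] m m2 del: keys_single)
qed (use assms \<beta> in auto)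

lemma tensor_lift_class:
 assumes "keys z <= carrier A \<times> carrier B"
 shows "tensor_lift W \<beta> (tensor_class A B z) = lext W (%(x, y). \<beta> x y) z"
 unfolding tensor_lift_def tensor_class_def
 by (rule induced_coset[OF monoid_DirProd_k ideal_TI W])
  (use lext_tensor_vanishes bilD(1)[OF \<beta>] assms in auto)

lemma tensor_lift_pure: "x : carrier A ==> y : carrier B ==> tensor_lift W \<beta> (pure_tensor A B x y) = \<beta> x y"
 unfolding pure_tensor_def
 by (subst tensor_lift_class, simp,
   subst lext_single[OF W, where C = "carrier A \<times> carrier B"])
  (use bilD(1)[OF \<beta>] kmodD(6)[OF W] in auto)

lemma tensor_lift_lin_hom: "tensor_lift W \<beta> : lin_hom (tensor A B) W"
proof (rule lin_homI)
 have fc: "(%(x, y). \<beta> x y) g : carrier W" if "g : carrier A \<times> carrier B" for g using that bilD(1)[OF \<beta>] by auto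
 note l = lext_add[OF W, of "carrier A \<times> carrier B"] lext_scale[OF W, of "carrier A \<times> carrier B"] lext_closed[OF W, of "carrier A \<times> carrier B"]
 fix x c assume "x : carrier (tensor A B)"
 then obtain z where z: "keys z <= carrier A \<times> carrier B" "x = tensor_class A B z" by (auto simp: tensor_carrier)
 show "tensor_lift W \<beta> x : carrier W" unfolding z(2) tensor_lift_class[OF z(1)] by (rule l(3)[OF fc z(1)])
 show "tensor_lift W \<beta> (c \<odot>\<^bsub>tensor A B\<^esub> x) = c \<odot>\<^bsub>W\<^esub> tensor_lift W \<beta> x"
  unfolding z(2) tensor_class_hom(3)[OF z(1) z(1)] tensor_lift_class[OF z(1)] tensor_lift_class[OF keys_pm_scaleI[OF z(1)]]
  by (rule l(2)[OF fc z(1)])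
 fix y assume "y : carrier (tensor A B)"
 then obtain w where w: "keys w <= carrier A \<times> carrier B" "y = tensor_class A B w" by (auto simp: tensor_carrier)
 show "tensor_lift W \<beta> (x \<oplus>\<^bsub>tensor A B\<^esub> y) = tensor_lift W \<beta> x \<oplus>\<^bsub>W\<^esub> tensor_lift W \<beta> y"
  unfolding z(2) w(2) tensor_class_hom(1)[OF z(1) w(1)] tensor_lift_class[OF z(1)] tensor_lift_class[OF w(1)]
   tensor_lift_class[OF keys_addI[OF z(1) w(1)]]
  by (rule l(1)[OF fc z(1) w(1)])
qed

end

text \<open>Linear maps out of a tensor product that agree on pure tensors are equal.\<close>

lemma lin_hom_tensor_eqI:
 assumes "\<phi> : lin_hom (tensor A B) W" "\<psi> : lin_hom (tensor A B) W" "kmod W"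
  "\<And>x y. x : carrier A ==> y : carrier B ==> \<phi> (pure_tensor A B x y) = \<psi> (pure_tensor A B x y)"
  "t : carrier (tensor A B)"
 shows "\<phi> t = \<psi> t"
 using assms(5)
proof (induction rule: tensor_induct)
 case zero show ?case using lin_hom_zero[OF assms(1) kmod_tensor assms(3)] lin_hom_zero[OF assms(2) kmod_tensor assms(3)] by simp
next
 case (pure x y) then show ?case by (rule assms(4))
next
 case (add t t') then show ?case by (simp add: lin_homD(2)[OF assms(1)] lin_homD(2)[OF assms(2)])
qed

lemma lin_hom_tensor_lift:
 assumes "kmod W" "bil A B W \<beta>" "\<phi> : lin_hom W W'" "kmod W'" "t : carrier (tensor A B)"
 shows "\<phi> (tensor_lift W \<beta> t) = tensor_lift W' (%x y. \<phi> (\<beta> x y)) t"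
 by (rule lin_hom_tensor_eqI[OF lin_hom_comp[OF tensor_lift_lin_hom[OF assms(1,2)] assms(3)]
    tensor_lift_lin_hom[OF assms(4) bil_lin_hom[OF assms(2,3)]] assms(4) _ assms(5)])
  (simp add: tensor_lift_pure[OF assms(1,2)] tensor_lift_pure[OF assms(4) bil_lin_hom[OF assms(2,3)]])

end

section \<open>Separating families of functionals\<close>

definition separates :: "('k::field, 'a, 'm) module_scheme => ('a => 'k) set => bool" where
 "separates A F \<longleftrightarrow> F <= lin_hom A ground_field \<and> (\<forall>x\<in>carrier A. (\<forall>f\<in>F. f x = 0) \<longrightarrow> x = \<zero>\<^bsub>A\<^esub>)"

text \<open>The functional \<open>f \<otimes> g\<close> on the tensor product, with values
  multiplied in the field.\<close>

abbreviation tev :: "('a => 'k::field) => ('b => 'k) => ('a \<times> 'b \<Rightarrow>\<^sub>0 'k) set => 'k" where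
 "tev f g \<equiv> tensor_lift ground_field (%x y. f x * g y)"

lemma bil_functionals:
 assumes "f : lin_hom A (ground_field :: ('k::field, 'k) module)" "g : lin_hom B (ground_field :: ('k, 'k) module)"
 shows "bil A B ground_field (%x y. f x * g y)"
 by (rule bilI) (auto simp: lin_homD[OF assms(1), simplified] lin_homD[OF assms(2), simplified] algebra_simps)

lemma separates_eqI:
 assumes "kmod A" "separates A F" "x : carrier A" "y : carrier A" "\<And>f. f : F ==> f x = f y"
 shows "x = y"
proof -
 interpret abelian_group A by (rule kmodD(1)[OF assms(1)])
 have "f (x \<oplus>\<^bsub>A\<^esub> (-1) \<odot>\<^bsub>A\<^esub> y) = 0" if "f : F" for f
 proof -
  have f: "f : lin_hom A ground_field" using that assms(2) by (auto simp: separates_def)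
  show ?thesis
   using lin_homD(2)[OF f assms(3) kmodD(2)[OF assms(1,4), of "-1"]] lin_homD(3)[OF f assms(4), of "-1"] assms(5)[OF that] by simp
 qed
 then have "x \<oplus>\<^bsub>A\<^esub> (-1) \<odot>\<^bsub>A\<^esub> y = \<zero>\<^bsub>A\<^esub>"
  using assms(2) assms(3) kmodD(2)[OF assms(1,4), of "-1"] by (auto simp: separates_def)
 then have "x \<ominus>\<^bsub>A\<^esub> y = \<zero>\<^bsub>A\<^esub>" using kmod_uminus[OF assms(1,4)] by (simp add: a_minus_def)
 then show ?thesis using assms(3,4) minus_equality[of x "\<ominus>\<^bsub>A\<^esub> y"] by (simp add: a_minus_def)
qed

context
 fixes A :: "('k::field, 'a, 'm) module_scheme" and B :: "('k, 'b, 'n) module_scheme"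
 assumes A: "is_k_algebra A" and B: "is_k_algebra B"
begin

lemmas T = kmod_tensor[OF A B]

interpretation T: abelian_group "tensor A B" by (rule kmodD(1)[OF T])
interpretation A: ring A by (rule is_k_algebraD[OF A])
interpretation B: ring B by (rule is_k_algebraD[OF B])

lemmas tev_lin_hom = tensor_lift_lin_hom[OF A B kmod_ground bil_functionals]
lemmas tev_pure = tensor_lift_pure[OF A B kmod_ground bil_functionals]

text \<open>Sums of pure tensors indexed by lists: the separation argument is an induction on the
  number of summands.\<close>

fun tsum :: "('a \<times> 'b) list => ('a \<times> 'b \<Rightarrow>\<^sub>0 'k) set" where
 "tsum [] = \<zero>\<^bsub>tensor A B\<^esub>"
| "tsum (p # ps) = pure_tensor A B (fst p) (snd p) \<oplus>\<^bsub>tensor A B\<^esub> tsum ps"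

lemma tsum_closed: "set ps <= carrier A \<times> carrier B ==> tsum ps : carrier (tensor A B)"
 by (induction ps) (auto intro!: pure_tensor_closed[OF A B])

lemma tsum_append: "set ps <= carrier A \<times> carrier B ==> set qs <= carrier A \<times> carrier B ==>
  tsum (ps @ qs) = tsum ps \<oplus>\<^bsub>tensor A B\<^esub> tsum qs"
 by (induction ps) (auto simp: tsum_closed T.a_assoc pure_tensor_closed[OF A B])

lemma tensor_tsum:
 assumes "t : carrier (tensor A B)"
 obtains ps where "set ps <= carrier A \<times> carrier B" "t = tsum ps"
proof -
 have "\<exists>ps. set ps <= carrier A \<times> carrier B \<and> t = tsum ps"
  using assms
 proof (induction rule: tensor_induct[OF A B, consumes 1])
  case 1 show ?case by (intro exI[of _ "[]"]) simp
 next
  case (2 x y) then show ?case by (intro exI[of _ "[(x, y)]"]) (simp add: pure_tensor_closed[OF A B])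
 next
  case (3 t t')
  then obtain ps qs where "set ps <= carrier A \<times> carrier B" "t = tsum ps" "set qs <= carrier A \<times> carrier B" "t' = tsum qs"
   by blast
  then show ?case by (intro exI[of _ "ps @ qs"]) (simp add: tsum_append)
 qed
 then show ?thesis using that by blast
qed

lemma tev_tsum:
 assumes "f : lin_hom A ground_field" "g : lin_hom B ground_field" "set ps <= carrier A \<times> carrier B"
 shows "tev f g (tsum ps) = (\<Sum>p\<leftarrow>ps. f (fst p) * g (snd p))"
 using assms(3)
proof (induction ps)
 case Nil show ?case using lin_hom_zero[OF tev_lin_hom[OF assms(1,2)] T kmod_ground] by simp
next
 case (Cons p ps)
 then show ?case
  using lin_homD(2)[OF tev_lin_hom[OF assms(1,2)] pure_tensor_closed[OF A B, of "fst p" "snd p"] tsum_closed[of ps]]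
  by (auto simp: tev_pure[OF assms(1,2)])
qed

fun lincomb :: "('a => 'k) => ('a \<times> 'b) list => 'b" where
 "lincomb c [] = \<zero>\<^bsub>B\<^esub>"
| "lincomb c (p # ps) = c (fst p) \<odot>\<^bsub>B\<^esub> snd p \<oplus>\<^bsub>B\<^esub> lincomb c ps"

lemma lincomb_closed: "set ps <= carrier A \<times> carrier B ==> lincomb c ps : carrier B"
 by (induction ps) (auto intro!: kmodD(2)[OF is_k_algebraD(1)[OF B]])

lemma lincomb_functional:
 assumes "g : lin_hom B ground_field" "set ps <= carrier A \<times> carrier B"
 shows "g (lincomb c ps) = (\<Sum>p\<leftarrow>ps. c (fst p) * g (snd p))"
 using assms(2)
proof (induction ps)
 case Nil then show ?case using lin_hom_zero[OF assms(1) is_k_algebraD(1)[OF B] kmod_ground] by simp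
next
 case (Cons p ps)
 then show ?case
  using lin_homD(2)[OF assms(1) kmodD(2)[OF is_k_algebraD(1)[OF B]] lincomb_closed[of ps c]] lin_homD(3)[OF assms(1)]
  by auto
qed

text \<open>If the second factor of a summand with first factor \<open>x0\<close> is a combination
  of the second factors of the others, bilinearity moves its coefficients to \<open>x0\<close> and
  distributes the summand over the others.\<close>

lemma tsum_eliminate:
 assumes "set ps <= carrier A \<times> carrier B" "x0 : carrier A"
 shows "pure_tensor A B x0 (lincomb c ps) \<oplus>\<^bsub>tensor A B\<^esub> tsum ps
  = tsum (map (%(x, y). (x \<oplus>\<^bsub>A\<^esub> c x \<odot>\<^bsub>A\<^esub> x0, y)) ps)"
 using assms(1)
proof (induction ps)
 case Nil
 have "pure_tensor A B x0 \<zero>\<^bsub>B\<^esub> = \<zero>\<^bsub>tensor A B\<^esub>"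
  using lin_hom_zero[OF _ is_k_algebraD(1)[OF B] T, of "pure_tensor A B x0"] bil_pure_tensor[OF A B] assms(2)
  by (auto simp: bil_def)
 then show ?case by simp
next
 case (Cons p ps)
 obtain x y where p: "p = (x, y)" by fastforce
 have xy: "x : carrier A" "y : carrier B" and ps: "set ps <= carrier A \<times> carrier B" using Cons.prems p by auto
 note b = bilD[OF bil_pure_tensor[OF A B]] and sA = kmodD(2)[OF is_k_algebraD(1)[OF A]] and sB = kmodD(2)[OF is_k_algebraD(1)[OF B]]
 let ?P = "pure_tensor A B"
 have "?P x0 (lincomb c (p # ps)) \<oplus>\<^bsub>tensor A B\<^esub> tsum (p # ps)
  = (?P x0 (c x \<odot>\<^bsub>B\<^esub> y) \<oplus>\<^bsub>tensor A B\<^esub> ?P x0 (lincomb c ps)) \<oplus>\<^bsub>tensor A B\<^esub> (?P x y \<oplus>\<^bsub>tensor A B\<^esub> tsum ps)"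
  using xy assms(2) ps by (simp add: p b(3) sB lincomb_closed)
 also have "\<dots> = (?P x y \<oplus>\<^bsub>tensor A B\<^esub> ?P x0 (c x \<odot>\<^bsub>B\<^esub> y)) \<oplus>\<^bsub>tensor A B\<^esub> (?P x0 (lincomb c ps) \<oplus>\<^bsub>tensor A B\<^esub> tsum ps)"
  using xy assms(2) ps by (simp add: b(1) sB lincomb_closed tsum_closed T.a_ac)
 also have "?P x0 (c x \<odot>\<^bsub>B\<^esub> y) = ?P (c x \<odot>\<^bsub>A\<^esub> x0) y" using xy assms(2) by (simp add: b(4,5))
 also have "?P x y \<oplus>\<^bsub>tensor A B\<^esub> ?P (c x \<odot>\<^bsub>A\<^esub> x0) y = ?P (x \<oplus>\<^bsub>A\<^esub> c x \<odot>\<^bsub>A\<^esub> x0) y"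
  using xy assms(2) by (simp add: b(2) sA)
 finally show ?case using Cons.IH[OF ps] p by simp
qed

text \<open>Eliminating one summand at a time from a tensor that all products of functionals kill.\<close>

lemma tensor_separates:
 assumes F: "separates A F" and G: "separates B G"
 shows "separates (tensor A B) {tev f g | f g. f : F \<and> g : G}"
 unfolding separates_def
proof (intro conjI ballI impI)
 have Fl: "f : lin_hom A ground_field" if "f : F" for f using F that by (auto simp: separates_def)
 have Gl: "g : lin_hom B ground_field" if "g : G" for g using G that by (auto simp: separates_def)
 show "{tev f g | f g. f : F \<and> g : G} <= lin_hom (tensor A B) ground_field"
  using tev_lin_hom Fl Gl by blast
 fix t assume t: "t : carrier (tensor A B)" and z: "\<forall>h\<in>{tev f g | f g. f : F \<and> g : G}. h t = 0"
 have van: "(\<forall>f\<in>F. \<forall>g\<in>G. tev f g (tsum ps) = 0) ==> tsum ps = \<zero>\<^bsub>tensor A B\<^esub>"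
  if "set ps <= carrier A \<times> carrier B" for ps
  using that
 proof (induction "length ps" arbitrary: ps rule: less_induct)
  case less
  show ?case
  proof (cases "\<exists>p\<in>set ps. fst p ~= \<zero>\<^bsub>A\<^esub>")
   case False
   have "pure_tensor A B \<zero>\<^bsub>A\<^esub> y = \<zero>\<^bsub>tensor A B\<^esub>" if "y : carrier B" for y
    using lin_hom_zero[OF _ is_k_algebraD(1)[OF A] T, of "%x. pure_tensor A B x y"] bil_pure_tensor[OF A B] that
    by (auto simp: bil_def)
   then show ?thesis using False less.prems(2) by (induction ps) auto
  next
   case True
   then obtain x0 y0 where p0: "(x0, y0) : set ps" "x0 ~= \<zero>\<^bsub>A\<^esub>" by fastforce
   obtain us vs where ps: "ps = us @ (x0, y0) # vs" using split_list[OF p0(1)] by auto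
   have c: "x0 : carrier A" "y0 : carrier B" "set us <= carrier A \<times> carrier B" "set vs <= carrier A \<times> carrier B"
    "set (us @ vs) <= carrier A \<times> carrier B"
    using less.prems(2) ps by auto
   obtain f where f: "f : F" "f x0 ~= 0" using F c(1) p0(2) unfolding separates_def by blast
   \<comment> \<open>Solving the relation \<open>f(x0) g(y0) + (rest) = 0\<close> for
     \<open>g(y0)\<close>: with these coefficients \<open>y0\<close> has the same value under every
     \<open>g\<close> in \<open>G\<close> as a combination of the other second factors, hence equals
     it.\<close>
   define k where "k x = - f x / f x0" for x
   define qs where "qs = map (%(x, y). (x \<oplus>\<^bsub>A\<^esub> k x \<odot>\<^bsub>A\<^esub> x0, y)) (us @ vs)"
   have y0: "y0 = lincomb k (us @ vs)"
   proof (rule separates_eqI[OF is_k_algebraD(1)[OF B] G c(2) lincomb_closed[OF c(5)]])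
    fix g assume g: "g : G"
    have "0 = (\<Sum>p\<leftarrow>ps. f (fst p) * g (snd p))"
     using less.prems f(1) g tev_tsum[OF Fl[OF f(1)] Gl[OF g] less.prems(2)] by simp
    also have "\<dots> = f x0 * g y0 + (\<Sum>p\<leftarrow>us @ vs. f (fst p) * g (snd p))" by (simp add: ps)
    also have "(\<Sum>p\<leftarrow>us @ vs. f (fst p) * g (snd p)) = - f x0 * (\<Sum>p\<leftarrow>us @ vs. k (fst p) * g (snd p))"
     unfolding sum_list_const_mult[symmetric] using f(2) by (simp add: k_def)
    finally have "f x0 * g y0 = f x0 * (\<Sum>p\<leftarrow>us @ vs. k (fst p) * g (snd p))" by simp
    then show "g y0 = g (lincomb k (us @ vs))"
     unfolding lincomb_functional[OF Gl[OF g] c(5)] using f(2) by simp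
   qed
   have "tsum ps = pure_tensor A B x0 y0 \<oplus>\<^bsub>tensor A B\<^esub> tsum (us @ vs)"
    unfolding ps using c by (simp add: tsum_append tsum_closed pure_tensor_closed[OF A B] T.a_ac)
   then have eq: "tsum ps = tsum qs"
    unfolding qs_def using tsum_eliminate[OF c(5) c(1), of k] y0 by simp
   have "length qs < length ps" by (simp add: qs_def ps)
   moreover have "set qs <= carrier A \<times> carrier B"
    using c by (auto simp: qs_def intro!: kmodD(2)[OF is_k_algebraD(1)[OF A]] A.a_closed)
   ultimately show ?thesis using less.hyps[of qs] less.prems(1) eq by simp
  qed
 qed
 obtain ps where ps: "set ps <= carrier A \<times> carrier B" "t = tsum ps" using tensor_tsum[OF t] .
 have "\<forall>f\<in>F. \<forall>g\<in>G. tev f g (tsum ps) = 0" using z ps(2) by auto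
 from van[OF ps(1) this] show "t = \<zero>\<^bsub>tensor A B\<^esub>" using ps(2) by simp
qed

end

lemma bil_tensor_map:
 assumes "is_k_algebra C" "is_k_algebra D" "\<phi> : lin_hom A C" "\<psi> : lin_hom B D"
 shows "bil A B (tensor C D) (%x y. pure_tensor C D (\<phi> x) (\<psi> y))"
 by (rule bilI) (auto simp: lin_homD[OF assms(3)] lin_homD[OF assms(4)] bilD[OF bil_pure_tensor[OF assms(1,2)]])

context
 fixes A :: "('k::field, 'a, 'm) module_scheme" and B :: "('k, 'b, 'n) module_scheme"
  and C :: "('k, 'c, 'o) module_scheme" and D :: "('k, 'd, 'p) module_scheme" and \<phi> \<psi>
 assumes A: "is_k_algebra A" and B: "is_k_algebra B" and C: "is_k_algebra C" and D: "is_k_algebra D"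
  and \<phi>: "\<phi> : lin_hom A C" and \<psi>: "\<psi> : lin_hom B D"
begin

lemmas bm = bil_tensor_map[OF C D \<phi> \<psi>]

lemma tensor_map_lin_hom: "tensor_map C D \<phi> \<psi> : lin_hom (tensor A B) (tensor C D)"
 unfolding tensor_map_def by (rule tensor_lift_lin_hom[OF A B kmod_tensor[OF C D] bm])

lemma tensor_map_pure:
 "x : carrier A ==> y : carrier B ==> tensor_map C D \<phi> \<psi> (pure_tensor A B x y) = pure_tensor C D (\<phi> x) (\<psi> y)"
 unfolding tensor_map_def by (rule tensor_lift_pure[OF A B kmod_tensor[OF C D] bm])

lemma tensor_lift_map:
 assumes W: "kmod W" "bil C D W \<beta>" and t: "t : carrier (tensor A B)"
 shows "tensor_lift W \<beta> (tensor_map C D \<phi> \<psi> t) = tensor_lift W (%x y. \<beta> (\<phi> x) (\<psi> y)) t"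
proof -
 have b: "bil A B W (%x y. \<beta> (\<phi> x) (\<psi> y))"
  by (rule bilI) (auto simp: lin_homD[OF \<phi>] lin_homD[OF \<psi>] bilD[OF W(2)])
 show ?thesis
  by (rule lin_hom_tensor_eqI[OF A B lin_hom_comp[OF tensor_map_lin_hom tensor_lift_lin_hom[OF C D W]]
     tensor_lift_lin_hom[OF A B W(1) b] W(1) _ t])
   (simp add: tensor_map_pure tensor_lift_pure[OF C D W] tensor_lift_pure[OF A B W(1) b] lin_homD(1)[OF \<phi>] lin_homD(1)[OF \<psi>])
qed

end

context
 fixes A :: "('k::field, 'a, 'm) module_scheme"
 assumes A: "is_k_algebra A"
begin

lemmas AA = is_k_algebra_tensor[OF A A]
lemmas kAA = kmod_tensor[OF A AA]

lemma bil_assoc_inner: "z : carrier A ==> bil A A (tensor A (tensor A A)) (%x y. pure_tensor A (tensor A A) x (pure_tensor A A y z))"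
 by (rule bilI) (auto simp: bilD[OF bil_pure_tensor[OF A A]] bilD[OF bil_pure_tensor[OF A AA]])

text \<open>Linearity in \<open>t\<close> holds because the inner map is itself a lift; linearity in
  \<open>z\<close> is compared on pure tensors \<open>t\<close>.\<close>

lemma bil_assoc: "bil (tensor A A) A (tensor A (tensor A A)) (%t z.
   tensor_lift (tensor A (tensor A A)) (%x y. pure_tensor A (tensor A A) x (pure_tensor A A y z)) t)"
proof -
 interpret A: ring A by (rule is_k_algebraD[OF A])
 note l = tensor_lift_lin_hom[OF A A kAA bil_assoc_inner] and p = tensor_lift_pure[OF A A kAA bil_assoc_inner]
 interpret T: abelian_group "tensor A (tensor A A)" by (rule kmodD(1)[OF kAA])
 let ?f = "%z. tensor_lift (tensor A (tensor A A)) (%x y. pure_tensor A (tensor A A) x (pure_tensor A A y z))"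
 note bA = bilD[OF bil_pure_tensor[OF A A]] bilD[OF bil_pure_tensor[OF A AA]] and sA = kmodD(2)[OF is_k_algebraD(1)[OF A]]
 show ?thesis
 proof (rule bilI)
  fix t z z' assume t: "t : carrier (tensor A A)" and z: "z : carrier A" "z' : carrier A"
  show "?f (z \<oplus>\<^bsub>A\<^esub> z') t = ?f z t \<oplus>\<^bsub>tensor A (tensor A A)\<^esub> ?f z' t"
  proof (rule lin_hom_tensor_eqI[OF A A l _ kAA _ t])
   show "(%t. ?f z t \<oplus>\<^bsub>tensor A (tensor A A)\<^esub> ?f z' t) : lin_hom (tensor A A) (tensor A (tensor A A))"
    using z by (intro lin_homI) (simp_all add: lin_homD[OF l] kmodD(2,4)[OF kAA] T.a_ac)
  qed (use z in \<open>simp_all add: p bA\<close>)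
 next
  fix c t z assume t: "t : carrier (tensor A A)" and z: "z : carrier A"
  show "?f (c \<odot>\<^bsub>A\<^esub> z) t = c \<odot>\<^bsub>tensor A (tensor A A)\<^esub> ?f z t"
  proof (rule lin_hom_tensor_eqI[OF A A l _ kAA _ t])
   show "(%t. c \<odot>\<^bsub>tensor A (tensor A A)\<^esub> ?f z t) : lin_hom (tensor A A) (tensor A (tensor A A))"
    using z by (intro lin_homI) (simp_all add: lin_homD[OF l] kmodD(2,4)[OF kAA] kmodD(5)[OF kAA, symmetric] mult.commute)
  qed (use z in \<open>simp_all add: p bA sA\<close>)
 qed (simp_all add: lin_homD[OF l])
qed

lemma tensor_assoc_lin_hom: "tensor_assoc A : lin_hom (tensor (tensor A A) A) (tensor A (tensor A A))"
 unfolding tensor_assoc_def by (rule tensor_lift_lin_hom[OF AA A kAA bil_assoc])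

text \<open>Checked on pure tensors of pure tensors. It translates coassociativity into an equality
  of values.\<close>

lemma tev_assoc:
 assumes f: "f : lin_hom A ground_field" and g: "g : lin_hom A ground_field" and h: "h : lin_hom A ground_field"
  and t: "t : carrier (tensor (tensor A A) A)"
 shows "tev f (tev g h) (tensor_assoc A t) = tev (tev f g) h t"
proof -
 note bA = bilD[OF bil_pure_tensor[OF A A]]
 note l = tev_lin_hom[OF A A g h] tev_lin_hom[OF A A f g]
 note l3 = tev_lin_hom[OF A AA f l(1)] tev_lin_hom[OF AA A l(2) h]
 show ?thesis
 proof (rule lin_hom_tensor_eqI[OF AA A lin_hom_comp[OF tensor_assoc_lin_hom l3(1)] l3(2) kmod_ground _ t])
  fix u z assume u: "u : carrier (tensor A A)" and z: "z : carrier A"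
  let ?f = "tensor_lift (tensor A (tensor A A)) (%x y. pure_tensor A (tensor A A) x (pure_tensor A A y z))"
  have "tev f (tev g h) (?f u) = tev f g u * h z"
  proof (rule lin_hom_tensor_eqI[OF A A lin_hom_comp[OF tensor_lift_lin_hom[OF A A kAA bil_assoc_inner[OF z]] l3(1)] _ kmod_ground _ u])
   show "(%u. tev f g u * h z) : lin_hom (tensor A A) ground_field"
    by (intro lin_homI) (auto simp: lin_homD[OF l(2)] algebra_simps)
  qed (simp add: tensor_lift_pure[OF A A kAA bil_assoc_inner[OF z]] tev_pure[OF A AA f l(1)] bA z tev_pure[OF A A g h] tev_pure[OF A A f g])
  then show "tev f (tev g h) (tensor_assoc A (pure_tensor (tensor A A) A u z)) = tev (tev f g) h (pure_tensor (tensor A A) A u z)"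
   unfolding tensor_assoc_def using u z
   by (simp add: tensor_lift_pure[OF AA A kAA bil_assoc] tev_pure[OF AA A l(2) h])
 qed
qed

end

text \<open>Both sides are additive in \<open>t\<close> and in \<open>u\<close>, so pure tensors
  suffice. The main use is that evaluation at a pair of points is multiplicative on the tensor
  square.\<close>

lemma tensor_lift_mult:
 fixes A :: "('k::field, 'a, 'm) module_scheme" and B :: "('k, 'b, 'n) module_scheme" and W :: "('k, 'w, 'l) module_scheme"
 assumes A: "is_k_algebra A" and B: "is_k_algebra B" and W: "is_k_algebra W" and b: "bil A B W \<beta>"
  and m: "\<And>x x' y y'. x : carrier A ==> x' : carrier A ==> y : carrier B ==> y' : carrier B ==>
   \<beta> (x \<otimes>\<^bsub>A\<^esub> x') (y \<otimes>\<^bsub>B\<^esub> y') = \<beta> x y \<otimes>\<^bsub>W\<^esub> \<beta> x' y'"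
  and t: "t : carrier (tensor A B)" and u: "u : carrier (tensor A B)"
 shows "tensor_lift W \<beta> (t \<otimes>\<^bsub>tensor A B\<^esub> u) = tensor_lift W \<beta> t \<otimes>\<^bsub>W\<^esub> tensor_lift W \<beta> u"
proof -
 interpret A: ring A by (rule is_k_algebraD[OF A])
 interpret B: ring B by (rule is_k_algebraD[OF B])
 interpret W: ring W by (rule is_k_algebraD[OF W])
 interpret T: ring "tensor A B" by (rule is_k_algebraD[OF is_k_algebra_tensor[OF A B]])
 note kW = is_k_algebraD(1)[OF W]
 note l = tensor_lift_lin_hom[OF A B kW b] and p = tensor_lift_pure[OF A B kW b] and pc = pure_tensor_closed[OF A B]
 have z: "tensor_lift W \<beta> \<zero>\<^bsub>tensor A B\<^esub> = \<zero>\<^bsub>W\<^esub>" by (rule lin_hom_zero[OF l kmod_tensor[OF A B] kW])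
 show ?thesis using t
 proof (induction rule: tensor_induct[OF A B, consumes 1])
  case 1 then show ?case using u lin_homD(1)[OF l u] by (simp add: z)
 next
  case (2 x y)
  show ?case using u
  proof (induction rule: tensor_induct[OF A B, consumes 1])
   case 1 then show ?case using 2 lin_homD(1)[OF l pc[OF 2]] pc[OF 2] by (simp add: z)
  next
   case (2 x' y')
   then show ?case using \<open>x : carrier A\<close> \<open>y : carrier B\<close> by (simp add: pure_tensor_mult[OF A B] p m)
  next
   case (3 u u')
   then show ?case using pc[OF \<open>x : carrier A\<close> \<open>y : carrier B\<close>] by (simp add: T.r_distr W.r_distr lin_homD[OF l])
  qed
 next
  case (3 t t')
  then show ?case using u by (simp add: T.l_distr W.l_distr lin_homD[OF l])
 qed
qed

subsection \<open>Monomials\<close>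

text \<open>The value type is general because the same sum gives the total degree (all weights 1)
  and the multidegree (weights that are exponents). In the latter case the product is convolution
  and \<open>of_nat k\<close> is k times its unit, so multiplication by it is k-fold
  addition.\<close>

definition msum :: "('v => 'c::comm_semiring_1) => ('v \<Rightarrow>\<^sub>0 nat) => 'c" where
 "msum f m = (\<Sum>v\<in>keys m. of_nat (lookup m v) * f v)"

definition mev :: "('v => 'c::comm_semiring_1) => ('v \<Rightarrow>\<^sub>0 nat) => 'c" where
 "mev g m = (\<Prod>v\<in>keys m. g v ^ lookup m v)"

lemma msum_superset: "finite S ==> keys m <= S ==> msum f m = (\<Sum>v\<in>S. of_nat (lookup m v) * f v)"
 unfolding msum_def by (rule sum.mono_neutral_left) (auto simp: in_keys_iff)

lemma mev_superset: "finite S ==> keys m <= S ==> mev g m = (\<Prod>v\<in>S. g v ^ lookup m v)"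
 unfolding mev_def by (rule prod.mono_neutral_left) (auto simp: in_keys_iff)

lemma msum_simps [simp]: "msum f 0 = 0" "msum f (single v k) = of_nat k * f v"
 by (auto simp: msum_def)

lemma mev_simps [simp]: "mev g 0 = 1" "mev g (single v k) = g v ^ k"
 by (auto simp: mev_def)

lemma msum_add [simp]: "msum f (m + m') = msum f m + msum f m'"
proof -
 let ?S = "keys m \<union> keys m'"
 have "keys (m + m') <= ?S" by (rule keys_add)
 then show ?thesis
  by (simp add: msum_superset[of ?S] lookup_add distrib_right sum.distrib)
qed

lemma mev_add [simp]: "mev g (m + m') = mev g m * mev g m'"
proof -
 let ?S = "keys m \<union> keys m'"
 have "keys (m + m') <= ?S" by (rule keys_add)
 then show ?thesis
  by (simp add: mev_superset[of ?S] lookup_add power_add prod.distrib)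
qed

abbreviation (input) mlen :: "('v \<Rightarrow>\<^sub>0 nat) => nat" where "mlen \<equiv> msum (%_. 1)"

lemma mlen_eq_0_iff [simp]: "mlen m = 0 \<longleftrightarrow> m = 0"
 by (auto simp: msum_def in_keys_iff intro!: poly_mapping_eqI)

lemma keys_add_nat [simp]: "keys (m + m' :: 'v \<Rightarrow>\<^sub>0 nat) = keys m \<union> keys m'"
 by (auto simp: in_keys_iff lookup_add)

lemma mono_decompose:
 fixes m :: "'v \<Rightarrow>\<^sub>0 nat"
 assumes "v : keys m"
 shows "single v 1 + (m - single v 1) = m"
 using assms by (intro poly_mapping_eqI) (auto simp: lookup_add lookup_minus lookup_single when_def in_keys_iff)

lemma mono_induct [consumes 1, case_names zero add]:
 fixes m :: "'v \<Rightarrow>\<^sub>0 nat"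
 assumes "keys m <= X" "P 0"
  "\<And>v m. v : X ==> keys m <= X ==> P m ==> P (single v 1 + m)"
 shows "P m"
 using assms(1)
proof (induction "mlen m" arbitrary: m rule: less_induct)
 case less
 show ?case
 proof (cases "m = 0")
  case False
  then obtain v where v: "v : keys m" by (metis keys_eq_empty ex_in_conv)
  let ?m = "m - single v 1"
  have m: "m = single v 1 + ?m" using mono_decompose[OF v] by simp
  have l: "mlen m = Suc (mlen ?m)" by (subst m) simp
  have k: "v : X" "keys ?m <= X" using less.prems v m keys_add_nat[of "single v 1" ?m] by auto
  show ?thesis by (subst m) (intro assms(3) k less.hyps, use l in simp)
 qed (simp add: assms(2))
qed

subsection \<open>Polynomials and their values\<close>

definition ev :: "('v => 'k::field) => (('v \<Rightarrow>\<^sub>0 nat) \<Rightarrow>\<^sub>0 'k) => 'k" where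
 "ev g z = lext ground_field (mev g) z"

lemma ev_simps [simp]:
 "ev g 0 = 0" "ev g (single m c) = c * mev g m" "ev g (z + w) = ev g z + ev g w" "ev g (pm_scale c z) = c * ev g z"
 using lext_single[OF kmod_ground, of UNIV "mev g" m c] lext_add[OF kmod_ground, of UNIV "mev g" z w]
  lext_scale[OF kmod_ground, of UNIV "mev g" z c] lext_zero[OF kmod_ground, of UNIV "mev g"]
 by (auto simp: ev_def)

lemma ev_one [simp]: "ev g 1 = 1"
 using ev_simps(2)[of g 0 1] by simp

lemma ev_uminus [simp]: "ev g (- z) = - ev g z"
 by (simp add: uminus_eq_pm_scale)

lemma ev_diff [simp]: "ev g (z - w) = ev g z - ev g w"
 using ev_simps(3)[of g z "- w"] by simp

lemma ev_mult [simp]: "ev g (z * w) = ev g z * ev g w"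
proof -
 have s: "ev g (single m c * w) = c * mev g m * ev g w" for m c
 proof -
  have "keys w <= UNIV" by simp
  then show ?thesis by (induction rule: pm_induct) (auto simp: mult_single distrib_left)
 qed
 have "keys z <= UNIV" by simp
 then show ?thesis by (induction rule: pm_induct) (auto simp: s distrib_right)
qed

lemma keys_mult_subset:
 assumes "keys z <= C" "keys w <= D" "\<And>a b. a : C ==> b : D ==> a + b : E"
 shows "keys (z * w :: ('a::monoid_add) \<Rightarrow>\<^sub>0 ('b::semiring_0)) <= E"
 using keys_mult[of z w] assms by (auto dest!: subsetD)

text \<open>Dedekind: distinct characters of the multiplicative monoid of points are linearly independent.\<close>

lemma ev_eq_0_imp:
 fixes z :: "('v \<Rightarrow>\<^sub>0 nat) \<Rightarrow>\<^sub>0 'k::field_char_0"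
 assumes z: "keys z <= {m. keys m <= X}" and van: "\<And>g. (\<forall>v. v \<notin> X \<longrightarrow> g v = 0) ==> ev g z = 0"
 shows "z = 0"
proof -
 define P where "P = {g :: 'v => 'k. \<forall>v. v \<notin> X \<longrightarrow> g v = 0}"
 have indep: "\<forall>m\<in>S. c m = 0"
  if "finite S" "S <= {m. keys m <= X}" "\<forall>g\<in>P. (\<Sum>m\<in>S. c m * mev g m) = 0" for S c
  using that
 proof (induction S arbitrary: c)
  case (insert m S)
  have sub: "keys m <= X" "\<And>k. k : S ==> keys k <= X" using insert.prems(1) by auto
  have c0: "c k = 0" if k: "k : S" for k
  proof -
   from k insert.hyps(2) have "k ~= m" by auto
   then obtain v where v: "lookup k v ~= lookup m v" by (metis poly_mapping_eqI)
   then have vX: "v : X" using sub(1) sub(2)[OF k] by (metis in_keys_iff subsetD)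
   \<comment> \<open>A point at which a monomial over \<open>X\<close> has the value 2 to the power
     of its exponent at \<open>v\<close>. Since powers of 2 are distinct in characteristic zero, it
     distinguishes \<open>k\<close> from \<open>m\<close>.\<close>
   define a :: "'v => 'k" where "a = (%u. if u = v then 2 else if u : X then 1 else 0)"
   have a: "mev a j = 2 ^ lookup j v" if "keys j <= X" for j
   proof -
    have "mev a j = (\<Prod>u\<in>insert v (keys j). a u ^ lookup j u)" by (rule mev_superset) auto
    also have "\<dots> = (\<Prod>u\<in>insert v (keys j). if u = v then 2 ^ lookup j v else 1)"
     using that by (intro prod.cong) (auto simp: a_def)
    finally show ?thesis by simp
   qed
   have mevm: "mev (%u. a u * g u) j = mev a j * mev g j" for g j
    by (simp add: mev_def power_mult_distrib prod.distrib)
   \<comment> \<open>The relation at the translated point \<open>a g\<close>, minus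
     \<open>mev a m\<close> times the relation at \<open>g\<close>, no longer contains the term of
     \<open>m\<close>.\<close>
   have "\<forall>g\<in>P. (\<Sum>j\<in>S. (c j * (mev a j - mev a m)) * mev g j) = 0"
   proof
    fix g assume g: "g : P"
    then have ag: "(%u. a u * g u) : P" by (auto simp: P_def)
    have 1: "c m * (mev a m * mev g m) + (\<Sum>j\<in>S. c j * (mev a j * mev g j)) = 0"
     using insert.prems(2) ag insert.hyps by (auto simp: mevm)
    have "c m * mev g m + (\<Sum>j\<in>S. c j * mev g j) = 0" using insert.prems(2) g insert.hyps by auto
    then have "mev a m * (c m * mev g m + (\<Sum>j\<in>S. c j * mev g j)) = 0" by simp
    then have "mev a m * (c m * mev g m) + (\<Sum>j\<in>S. mev a m * (c j * mev g j)) = 0"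
     unfolding distrib_left sum_distrib_left .
    moreover have "mev a m * (c m * mev g m) = c m * (mev a m * mev g m)" by (simp add: mult.left_commute)
    ultimately have "(\<Sum>j\<in>S. c j * (mev a j * mev g j)) = (\<Sum>j\<in>S. mev a m * (c j * mev g j))"
     using 1 by (metis add_left_cancel)
    then show "(\<Sum>j\<in>S. (c j * (mev a j - mev a m)) * mev g j) = 0"
     by (simp add: left_diff_distrib right_diff_distrib sum_subtractf mult.assoc mult.left_commute)
   qed
   from insert.IH[OF _ this] sub have "c k * (mev a k - mev a m) = 0" using k by auto
   moreover have "mev a k ~= mev a m" unfolding a[OF sub(1)] a[OF sub(2)[OF k]]
   proof -
    have "of_nat (2 ^ lookup k v) ~= (of_nat (2 ^ lookup m v) :: 'k)"
     unfolding of_nat_eq_iff using v by simp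
    then show "2 ^ lookup k v ~= (2 ^ lookup m v :: 'k)" by simp
   qed
   ultimately show ?thesis by simp
  qed
  \<comment> \<open>At the point whose coordinates on \<open>X\<close> are all 1 every monomial
    takes the value 1, so only the coefficient of \<open>m\<close> remains.\<close>
  have "(%u. if u : X then 1 else 0) : P" by (auto simp: P_def)
  then have "(\<Sum>j\<in>insert m S. c j * mev (%u. if u : X then 1 else 0) j) = 0"
   using insert.prems(2) by blast
  moreover have "mev (%u. if u : X then 1 else (0::'k)) j = 1" if "j : insert m S" for j
   unfolding mev_def by (rule prod.neutral) (use that sub in auto)
  then have "(\<Sum>j\<in>insert m S. c j * mev (%u. if u : X then 1 else (0::'k)) j) = sum c (insert m S)"
   by (intro sum.cong refl) simp
  ultimately have "(\<Sum>j\<in>insert m S. c j) = 0" by argo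
  with c0 insert.hyps show ?case by simp
 qed simp
 have "\<forall>m\<in>keys z. lookup z m = 0"
  by (rule indep) (use z van in \<open>auto simp: P_def ev_def lext_ground\<close>)
 then show ?thesis by (intro poly_mapping_eqI) (auto simp: in_keys_iff)
qed

text \<open>\<open>pf G d f\<close>: the function \<open>f\<close> is a homogeneous polynomial of degree \<open>d\<close> in the functions \<open>G\<close>, given with their degrees.\<close>

inductive pf :: "(expo \<times> ('o => 'k::comm_ring_1)) set => expo => ('o => 'k) => bool" for G where
 gen: "(d, f) : G ==> pf G d f"
| const: "pf G 0 (%_. c)"
| zero: "pf G d (%_. 0)"
| add: "pf G d f ==> pf G d f' ==> pf G d (%\<omega>. f \<omega> + f' \<omega>)"
| mult: "pf G d f ==> pf G d' f' ==> pf G (d + d') (%\<omega>. f \<omega> * f' \<omega>)"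

text \<open>The coordinates of two points. Homogeneous polynomials in them are the functions on
  pairs of points that homogeneous elements of the tensor square will realize.\<close>

definition pgens :: "'v set => ('v => expo) => (expo \<times> (('v => 'k) \<times> ('v => 'k) => 'k)) set" where
 "pgens X deg = {(deg v, %(g, g'). g v) | v. v : X} \<union> {(deg v, %(g, g'). g' v) | v. v : X}"

text \<open>A Hopf record and its underlying algebra record have different types and cannot be
  equal. All constructions on algebras look only at these fields, so they are computed once for the
  plain algebra and transferred.\<close>

definition same_alg :: "('k, 'a, 'm) module_scheme => ('k, 'a, 'n) module_scheme => bool" where
 "same_alg A A' \<longleftrightarrow> carrier A = carrier A' \<and> monoid.mult A = monoid.mult A' \<and> one A = one A' \<and>
   ring.zero A = ring.zero A' \<and> add A = add A' \<and> module.smult A = module.smult A'"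

lemma tensor_same:
 assumes "same_alg A A'" "same_alg B B'"
 shows "tensor A B = tensor A' B'" "tensor_class A B = tensor_class A' B'" "pure_tensor A B = pure_tensor A' B'"
proof -
 have "A \<times>\<times> B = A' \<times>\<times> B'" using assms by (simp add: DirProd_def same_alg_def)
 moreover have "tensor_relations A B = tensor_relations A' B'" using assms by (simp add: tensor_relations_def same_alg_def)
 ultimately show "tensor A B = tensor A' B'" "tensor_class A B = tensor_class A' B'" "pure_tensor A B = pure_tensor A' B'"
  by (simp_all add: tensor_def tensor_class_def fun_eq_iff pure_tensor_def)
qed

lemma finsum_same: "same_alg A A' ==> finsum A f S = finsum A' f S"
 unfolding finsum_def finprod_def same_alg_def by simp

lemma induced_same: "same_alg W W' ==> induced W f = induced W' f"
 using finsum_same[of W W'] by (intro ext) (simp add: induced_def Let_def same_alg_def)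

lemma lin_hom_same: "same_alg A A' ==> same_alg B B' ==> lin_hom A B = lin_hom A' B'"
 by (simp add: lin_hom_def same_alg_def)

lemma alg_hom_same: "same_alg A A' ==> same_alg B B' ==> alg_hom A B = alg_hom A' B'"
 unfolding alg_hom_def using lin_hom_same[of A A' B B'] by (simp add: same_alg_def Ring.ring_hom_def)

lemma kmod_same: "same_alg A A' ==> kmod A = kmod A'"
 unfolding module_def module_axioms_def abelian_group_def abelian_monoid_def abelian_group_axioms_def
  comm_monoid_def comm_monoid_axioms_def comm_group_def group_def group_axioms_def monoid_def Units_def
 by (simp add: same_alg_def)

lemma is_k_algebra_same: "same_alg A A' ==> is_k_algebra A = is_k_algebra A'"
 unfolding is_k_algebra_def using kmod_same[of A A'] ring_cong[of A A'] by (simp add: same_alg_def)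

lemma tensor_lift_same: "same_alg W W' ==> tensor_lift W = tensor_lift W'"
 unfolding tensor_lift_def by (intro ext) (rule fun_cong[OF induced_same])

lemma same_alg_refl: "same_alg A A"
 by (simp add: same_alg_def)

lemma tensor_map_same:
 assumes "same_alg A A'" "same_alg B B'"
 shows "tensor_map A B = tensor_map A' B'"
 using tensor_same[OF assms] by (simp add: tensor_map_def fun_eq_iff)

lemma tensor_assoc_same:
 assumes s: "same_alg A A'" shows "tensor_assoc A = tensor_assoc A'"
 unfolding tensor_assoc_def unfolding tensor_same(1,3)[OF s s] unfolding tensor_same(1,3)[OF s same_alg_refl] ..

text \<open>Bilinear maps often agree only on the carriers, in particular when functionals are
  restricted to be extensional; lifts are determined by pure tensors of carrier elements.\<close>

lemma tensor_lift_cong: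
 assumes A: "is_k_algebra A" and B: "is_k_algebra B" and W: "kmod W" and b: "bil A B W \<beta>"
  and eq: "\<And>x y. x : carrier A ==> y : carrier B ==> \<beta> x y = \<beta>' x y"
  and t: "t : carrier (tensor A B)"
 shows "tensor_lift W \<beta> t = tensor_lift W \<beta>' t"
proof -
 interpret A: ring A by (rule is_k_algebraD[OF A])
 interpret B: ring B by (rule is_k_algebraD[OF B])
 have b': "bil A B W \<beta>'"
  by (rule bilI) (auto simp: bilD[OF b] eq[symmetric] kmodD(2)[OF is_k_algebraD(1)[OF A]] kmodD(2)[OF is_k_algebraD(1)[OF B]])
 show ?thesis
  by (rule lin_hom_tensor_eqI[OF A B tensor_lift_lin_hom[OF A B W b] tensor_lift_lin_hom[OF A B W b'] W _ t])
   (simp add: tensor_lift_pure[OF A B W b] tensor_lift_pure[OF A B W b'] eq)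
qed

section \<open>The polynomial algebra\<close>

definition poly_algebra :: "'v set => ('k::field, ('v \<Rightarrow>\<^sub>0 nat) \<Rightarrow>\<^sub>0 'k) module" where
 "poly_algebra X = \<lparr>carrier = {z. keys z <= {m. keys m <= X}},
   monoid.mult = (*), one = 1, ring.zero = 0, add = (+), module.smult = pm_scale\<rparr>"

lemma poly_algebra_simps [simp]:
 "carrier (poly_algebra X) = {z. keys z <= {m. keys m <= X}}"
 "x \<otimes>\<^bsub>poly_algebra X\<^esub> y = x * y" "x \<oplus>\<^bsub>poly_algebra X\<^esub> y = x + y" "c \<odot>\<^bsub>poly_algebra X\<^esub> x = pm_scale c x"
 "\<one>\<^bsub>poly_algebra X\<^esub> = 1" "\<zero>\<^bsub>poly_algebra X\<^esub> = 0"
 by (auto simp: poly_algebra_def)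

lemma pm_scale_eq_mult: "pm_scale c z = single 0 c * (z :: ('v::monoid_add) \<Rightarrow>\<^sub>0 'k::field)"
proof -
 have "keys z <= UNIV" by simp
 then show ?thesis by (induction rule: pm_induct) (auto simp: mult_single distrib_left pm_scale_distrib)
qed

lemma pm_scale_mult:
 "pm_scale c z * w = pm_scale c (z * w :: ('v::comm_monoid_add) \<Rightarrow>\<^sub>0 'k::field)" "z * pm_scale c w = pm_scale c (z * w)"
 by (simp_all add: pm_scale_eq_mult ac_simps)

lemma keys_multI:
 "keys z <= {m. keys m <= X} ==> keys w <= {m. keys m <= X} ==>
  keys (z * w :: ('v \<Rightarrow>\<^sub>0 nat) \<Rightarrow>\<^sub>0 'k::field) <= {m. keys m <= X}"
 by (erule keys_mult_subset, assumption) simp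

lemma cring_poly_algebra: "cring (poly_algebra X :: ('k::field, ('v \<Rightarrow>\<^sub>0 nat) \<Rightarrow>\<^sub>0 'k) module)"
proof (rule cringI)
 let ?H = "poly_algebra X :: ('k, ('v \<Rightarrow>\<^sub>0 nat) \<Rightarrow>\<^sub>0 'k) module"
 show "abelian_group ?H"
 proof (rule abelian_groupI)
  fix x assume x: "x : carrier ?H"
  then have "- x : carrier ?H" unfolding uminus_eq_pm_scale by (simp add: keys_pm_scaleI)
  then show "\<exists>y\<in>carrier ?H. y \<oplus>\<^bsub>?H\<^esub> x = \<zero>\<^bsub>?H\<^esub>" by (rule rev_bexI) simp
 next
  fix x y assume "x : carrier ?H" "y : carrier ?H"
  then show "x \<oplus>\<^bsub>?H\<^esub> y : carrier ?H" by (simp add: keys_addI)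
 qed (simp_all add: ac_simps)
 show "Group.comm_monoid ?H"
 proof (rule comm_monoidI)
  fix x y assume "x : carrier ?H" "y : carrier ?H"
  then show "x \<otimes>\<^bsub>?H\<^esub> y : carrier ?H" by (simp add: keys_multI)
 qed (simp_all add: ac_simps)
qed (simp add: distrib_right)

lemma is_k_algebra_poly_algebra: "is_k_algebra (poly_algebra X :: ('k::field, ('v \<Rightarrow>\<^sub>0 nat) \<Rightarrow>\<^sub>0 'k) module)"
 unfolding is_k_algebra_def
proof (intro conjI allI ballI)
 let ?H = "poly_algebra X :: ('k, ('v \<Rightarrow>\<^sub>0 nat) \<Rightarrow>\<^sub>0 'k) module"
 show r: "ring ?H" using cring_poly_algebra by (rule cring.axioms)
 show "kmod ?H"
 proof (rule kmodI)
  show "abelian_group ?H" using r by (rule ring.axioms)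
 qed (simp_all add: keys_pm_scaleI pm_scale_distrib)
qed (simp_all add: pm_scale_eq_mult ac_simps)

lemma ev_alg_hom: "ev g : alg_hom (poly_algebra X) ground_field"
 unfolding alg_hom_def by (auto intro!: lin_homI ring_hom_memI)

lemma ev_lin_hom: "ev g : lin_hom (poly_algebra X) ground_field"
 using ev_alg_hom by (auto simp: alg_hom_def)

section \<open>Groups with homogeneous polynomial multiplication\<close>

abbreviation wt :: "('v => expo) => ('v \<Rightarrow>\<^sub>0 nat) => expo" where "wt deg \<equiv> msum deg"

definition pgr :: "'v set => ('v => expo) => expo => (('v \<Rightarrow>\<^sub>0 nat) \<Rightarrow>\<^sub>0 'k::field) set" where
 "pgr X deg \<alpha> = {z. keys z <= {m. keys m <= X \<and> wt deg m = \<alpha>}}"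

text \<open>Points are families of scalars supported on \<open>X\<close>, with the origin as unit.
  Only the product is assumed polynomial; that inverses are polynomial is deduced from the nonzero
  degrees. \<open>finite_deg\<close> makes the homogeneous components of the polynomial algebra
  finite-dimensional.\<close>

locale poly_group =
 fixes X :: "'v set" and deg :: "'v => expo" and n :: nat
  and gm :: "('v => 'k::field_char_0) => ('v => 'k) => 'v => 'k" and gi :: "('v => 'k) => 'v => 'k" and Pts
 defines "Pts \<equiv> {g. \<forall>v. v \<notin> X \<longrightarrow> g v = 0}"
 assumes deg: "v : X ==> deg v : exponents n" "v : X ==> deg v ~= 0"
  and finite_deg: "finite {v : X. deg v = \<alpha>}"
  and gm: "g : Pts ==> h : Pts ==> gm g h : Pts"
   "g : Pts ==> h : Pts ==> k : Pts ==> gm (gm g h) k = gm g (gm h k)"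
   "g : Pts ==> gm (%_. 0) g = g" "g : Pts ==> gm g (%_. 0) = g"
  and gi: "g : Pts ==> gi g : Pts" "g : Pts ==> gm (gi g) g = (%_. 0)" "g : Pts ==> gm g (gi g) = (%_. 0)"
  and law: "v : X ==> pf (pgens X deg) (deg v) (%(g, h). gm g h v)"
begin

definition HA :: "('k, ('v \<Rightarrow>\<^sub>0 nat) \<Rightarrow>\<^sub>0 'k) module" where "HA = poly_algebra X"

abbreviation "TH \<equiv> tensor HA HA"
abbreviation gr where "gr \<equiv> (pgr X deg :: expo => (('v \<Rightarrow>\<^sub>0 nat) \<Rightarrow>\<^sub>0 'k) set)"
abbreviation "E g h \<equiv> tev (ev g) (ev h)"
abbreviation "monos \<equiv> {m :: 'v \<Rightarrow>\<^sub>0 nat. keys m <= X}"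

lemma HA: "is_k_algebra HA" "kmod HA" "ring HA" "cring HA"
 using is_k_algebra_poly_algebra[of X, where 'k = 'k] cring_poly_algebra[of X, where 'k = 'k]
  is_k_algebraD[OF is_k_algebra_poly_algebra[of X, where 'k = 'k]]
 by (auto simp: HA_def)

lemma HA_simps [simp]:
 "carrier HA = {z. keys z <= monos}" "x \<otimes>\<^bsub>HA\<^esub> y = x * y" "x \<oplus>\<^bsub>HA\<^esub> y = x + y"
 "c \<odot>\<^bsub>HA\<^esub> x = pm_scale c x" "\<one>\<^bsub>HA\<^esub> = 1" "\<zero>\<^bsub>HA\<^esub> = 0"
 by (simp_all add: HA_def)

lemma ev_lin: "ev g : lin_hom HA ground_field" by (simp add: HA_def ev_lin_hom)

lemma HA_separates: "separates HA (ev ` Pts)"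
 unfolding separates_def
proof (intro conjI ballI impI)
 fix x assume "x : carrier HA" "\<forall>f\<in>ev ` Pts. f x = 0"
 then show "x = \<zero>\<^bsub>HA\<^esub>" using ev_eq_0_imp[of x X] by (auto simp: Pts_def)
qed (use ev_lin in auto)

lemmas T = is_k_algebra_tensor[OF HA(1) HA(1)] and kT = kmod_tensor[OF HA(1) HA(1)]

lemmas E_lin = tev_lin_hom[OF HA(1) HA(1) ev_lin ev_lin]
lemmas E_pure = tev_pure[OF HA(1) HA(1) ev_lin ev_lin]

lemma E_mult: "t : carrier TH ==> u : carrier TH ==>
  E g h (t \<otimes>\<^bsub>TH\<^esub> u) = E g h t * E g h u"
 by (rule tensor_lift_mult[OF HA(1) HA(1) is_k_algebra_ground bil_functionals[OF ev_lin ev_lin], simplified ground_field_simps])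
  (simp_all add: ac_simps)

lemma T_eqI:
 assumes "t : carrier TH" "u : carrier TH"
  "\<And>g h. g : Pts ==> h : Pts ==> E g h t = E g h u"
 shows "t = u"
 by (rule separates_eqI[OF kT tensor_separates[OF HA(1) HA(1) HA_separates HA_separates] assms(1,2)])
  (use assms(3) in auto)

subsubsection \<open>The grading\<close>

lemma gr_subset: "gr \<alpha> <= carrier HA" by (auto simp: pgr_def)

lemma gr_add: "x : gr \<alpha> ==> y : gr \<alpha> ==> x + y : gr \<alpha>" by (simp add: pgr_def keys_addI)
lemma gr_scale: "x : gr \<alpha> ==> pm_scale c x : gr \<alpha>" by (simp add: pgr_def keys_pm_scaleI)
lemma gr_zero [simp]: "0 : gr \<alpha>" by (simp add: pgr_def)
lemma gr_uminus: "x : gr \<alpha> ==> - x : gr \<alpha>" unfolding uminus_eq_pm_scale by (rule gr_scale)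
lemma gr_one [simp]: "1 : gr 0" by (simp add: pgr_def)
lemma gr_single: "keys m <= X ==> wt deg m = \<alpha> ==> single m c : gr \<alpha>" by (simp add: pgr_def)
lemma gr_mult: "x : gr \<alpha> ==> y : gr \<beta> ==> x * y : gr (\<alpha> + \<beta>)"
 unfolding pgr_def mem_Collect_eq by (erule keys_mult_subset, assumption) simp
lemma gr_sum: "(\<And>i. i : S ==> f i : gr \<alpha>) ==> sum f S : gr \<alpha>"
 by (induction S rule: infinite_finite_induct) (auto intro: gr_add)

lemma wt_mono_exponents: "keys m <= X ==> wt deg m : exponents n"
 by (induction rule: mono_induct) (use deg(1) in \<open>auto simp: exponents_def\<close>)

lemma wt_mono_eq_0: "keys m <= X ==> wt deg m = 0 ==> m = 0"
proof (induction rule: mono_induct)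
 case (add v m)
 have "keys (deg v + wt deg m) = {}" using add.prems by simp
 then have "deg v = 0" by simp
 with deg(2)[OF add.hyps(1)] show ?case by simp
qed simp

lemma gr_0_value: "z : gr \<alpha> ==> \<alpha> ~= 0 ==> ev (%_. 0) z = 0"
proof -
 assume z: "z : gr \<alpha>" and a: "\<alpha> ~= 0"
 have "mev (%_. 0::'k) m = 0" if "keys m <= X" "wt deg m = \<alpha>" for m
 proof -
  have "m ~= 0" using that a by auto
  then obtain v where "v : keys m" by (metis keys_eq_empty ex_in_conv)
  then show ?thesis unfolding mev_def by (intro prod_zero) (auto simp: in_keys_iff)
 qed
 then show ?thesis using z unfolding pgr_def mem_Collect_eq ev_def lext_ground by (intro sum.neutral) auto
qed

text \<open>The component of degree \<open>d\<close> of the tensor square, in the form in which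
  \<open>graded_hopf_algebra\<close> expresses the homogeneity of the coproduct.\<close>

definition Tgr :: "expo => _ set" where
 "Tgr d = tensor_class HA HA ` {z. keys z <= (\<Union>(\<beta>, \<gamma>)\<in>splits d. gr \<beta> \<times> gr \<gamma>)}"

lemma splits_gr_subset: "(\<Union>(\<beta>, \<gamma>)\<in>splits d. gr \<beta> \<times> gr \<gamma>) <= carrier HA \<times> carrier HA"
 using gr_subset by fastforce

lemma Tgr_carrier: "Tgr d <= carrier TH"
 unfolding Tgr_def tensor_carrier[OF HA(1) HA(1)]
 by (intro image_mono Collect_mono impI) (erule subset_trans[OF _ splits_gr_subset])

lemma Tgr_add:
 assumes "t : Tgr d" "u : Tgr d" shows "t \<oplus>\<^bsub>TH\<^esub> u : Tgr d"
proof -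
 let ?S = "(\<Union>(\<beta>, \<gamma>)\<in>splits d. gr \<beta> \<times> gr \<gamma>)"
 obtain z w where zw: "keys z <= ?S" "t = tensor_class HA HA z" "keys w <= ?S" "u = tensor_class HA HA w"
  using assms unfolding Tgr_def by blast
 have "t \<oplus>\<^bsub>TH\<^esub> u = tensor_class HA HA (z + w)"
  unfolding zw by (rule tensor_class_hom(1)[OF HA(1) HA(1)]) (use zw splits_gr_subset[of d] in \<open>auto simp del: HA_simps(1)\<close>)
 then show ?thesis unfolding Tgr_def using keys_addI[OF zw(1,3)] by blast
qed

lemma Tgr_pure: "x : gr \<beta> ==> y : gr \<gamma> ==> \<beta> + \<gamma> = d ==> pure_tensor HA HA x y : Tgr d"
 unfolding Tgr_def pure_tensor_def by (rule imageI) (auto simp: splits_def)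

lemma Tgr_zero: "\<zero>\<^bsub>TH\<^esub> : Tgr d"
 unfolding Tgr_def tensor_one_zero(2)[OF HA(1) HA(1)] by (rule imageI) simp

lemma Tgr_induct [consumes 1, case_names zero pure add]:
 assumes t: "t : Tgr d" and "P \<zero>\<^bsub>TH\<^esub>"
  "\<And>\<beta> \<gamma> x y. x : gr \<beta> ==> y : gr \<gamma> ==> \<beta> + \<gamma> = d ==> P (pure_tensor HA HA x y)"
  "\<And>t u. t : Tgr d ==> u : Tgr d ==> P t ==> P u ==> P (t \<oplus>\<^bsub>TH\<^esub> u)"
 shows "P t"
proof -
 let ?S = "(\<Union>(\<beta>, \<gamma>)\<in>splits d. gr \<beta> \<times> gr \<gamma>)"
 obtain z where z: "keys z <= ?S" "t = tensor_class HA HA z" using t unfolding Tgr_def by blast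
 have "P (tensor_class HA HA z)" using z(1)
 proof (induction rule: pm_induct)
  case zero then show ?case using assms(2) by (simp add: tensor_one_zero(2)[OF HA(1) HA(1)])
 next
  case (single g c)
  then obtain \<beta> \<gamma> x y where g: "g = (x, y)" "x : gr \<beta>" "y : gr \<gamma>" "\<beta> + \<gamma> = d" by (auto simp: splits_def)
  have c: "x : carrier HA" "y : carrier HA" using g gr_subset by blast+
  then have k: "keys (single (x, y) (1::'k)) <= carrier HA \<times> carrier HA" by simp
  have "tensor_class HA HA (single g c) = c \<odot>\<^bsub>TH\<^esub> pure_tensor HA HA x y"
   using tensor_class_hom(3)[OF HA(1) HA(1) k k, of c] by (simp add: pure_tensor_def g)
  also have "\<dots> = pure_tensor HA HA (pm_scale c x) y"
   using bilD(4)[OF bil_pure_tensor[OF HA(1) HA(1)] c, of c] by simp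
  finally show ?case using assms(3)[OF gr_scale[OF g(2)] g(3,4)] by simp
 next
  case (add z w)
  have zw: "tensor_class HA HA z : Tgr d" "tensor_class HA HA w : Tgr d" using add(1,2) unfolding Tgr_def by blast+
  have "tensor_class HA HA (z + w) = tensor_class HA HA z \<oplus>\<^bsub>TH\<^esub> tensor_class HA HA w"
   by (rule tensor_class_hom(1)[OF HA(1) HA(1), symmetric]) (use add(1,2) splits_gr_subset[of d] in \<open>auto simp del: HA_simps(1)\<close>)
  then show ?case using assms(4)[OF zw add(3,4)] by simp
 qed
 with z show ?thesis by simp
qed

lemma pure_gr_closed: "x : gr \<beta> ==> y : gr \<gamma> ==> pure_tensor HA HA x y : carrier TH"
 by (rule pure_tensor_closed[OF HA(1) HA(1)]) (use gr_subset in blast)+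

lemma Tgr_mult:
 assumes t: "t : Tgr d" and u: "u : Tgr e" shows "t \<otimes>\<^bsub>TH\<^esub> u : Tgr (d + e)"
proof -
 interpret T: ring "TH" by (rule is_k_algebraD[OF T])
 note tc = subsetD[OF Tgr_carrier]
 show ?thesis using t
 proof (induction rule: Tgr_induct)
  case zero then show ?case using tc[OF u] by (simp add: Tgr_zero)
 next
  case (pure \<beta> \<gamma> x y)
  show ?case using u
  proof (induction rule: Tgr_induct)
   case zero then show ?case using pure_gr_closed[OF pure(1,2)] by (simp add: Tgr_zero)
  next
   case (pure \<beta>' \<gamma>' x' y')
   have "pure_tensor HA HA x y \<otimes>\<^bsub>TH\<^esub> pure_tensor HA HA x' y' = pure_tensor HA HA (x * x') (y * y')"
    using pure_tensor_mult[OF HA(1) HA(1), of x y x' y'] pure \<open>x : gr \<beta>\<close> \<open>y : gr \<gamma>\<close> gr_subset by (simp del: HA_simps(1) add: subset_iff)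
   moreover have "\<beta> + \<beta>' + (\<gamma> + \<gamma>') = d + e" using pure \<open>\<beta> + \<gamma> = d\<close> by (simp add: ac_simps flip: pure(3) \<open>\<beta> + \<gamma> = d\<close>)
   ultimately show ?case using Tgr_pure[OF gr_mult gr_mult] pure \<open>x : gr \<beta>\<close> \<open>y : gr \<gamma>\<close> by simp
  next
   case (add t' u')
   then show ?case using pure_gr_closed[OF \<open>x : gr \<beta>\<close> \<open>y : gr \<gamma>\<close>] tc by (simp add: T.r_distr Tgr_add)
  qed
 next
  case (add t' u')
  then show ?case using tc tc[OF u] by (simp add: T.l_distr Tgr_add)
 qed
qed

lemma E_zero: "E g h \<zero>\<^bsub>TH\<^esub> = 0"
 using lin_hom_zero[OF E_lin kT kmod_ground] by simp

lemma E_add: "t : Tgr d ==> u : Tgr e ==> E g h (t \<oplus>\<^bsub>TH\<^esub> u) = E g h t + E g h u"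
 using lin_homD(2)[OF E_lin] Tgr_carrier by (auto simp: subset_iff)

lemma E_pure_gr: "x : gr \<beta> ==> y : gr \<gamma> ==> E g h (pure_tensor HA HA x y) = ev g x * ev h y"
 using E_pure[of x y] gr_subset by blast

lemma gr_var: "v : X ==> single (single v 1) 1 : gr (deg v)"
 by (rule gr_single) simp_all

text \<open>Evaluation at a pair of points is a ring homomorphism, so realizing tensors can be added
  and multiplied, and their degrees behave like those of the functions.\<close>

lemma pf_Tgr:
 assumes "pf (pgens X deg) d f"
 shows "\<exists>t\<in>Tgr d. \<forall>g h. E g h t = f (g, h)"
 using assms
proof induction
 case (gen d f)
 then consider v where "d = deg v" "f = (%(g, h). g v)" "v : X" | v where "d = deg v" "f = (%(g, h). h v)" "v : X"
  by (auto simp: pgens_def)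
 then show ?case
 proof cases
  case 1
  then show ?thesis by (intro bexI[OF _ Tgr_pure[OF gr_var gr_one, of v d]]) (simp_all add: E_pure_gr[OF gr_var[unfolded One_nat_def] gr_one])
 next
  case 2
  then show ?thesis by (intro bexI[OF _ Tgr_pure[OF gr_one gr_var, of v d]]) (simp_all add: E_pure_gr[OF gr_one gr_var[unfolded One_nat_def]])
 qed
next
 case (const c)
 have c: "single 0 c : gr 0" by (rule gr_single) auto
 show ?case by (intro bexI[OF _ Tgr_pure[OF c gr_one]]) (simp_all add: E_pure_gr[OF c gr_one])
next
 case (zero d) then show ?case by (intro bexI[OF _ Tgr_zero]) (simp add: E_zero)
next
 case (add d f f')
 then obtain t u where tu: "t : Tgr d" "\<forall>g h. E g h t = f (g, h)" "u : Tgr d" "\<forall>g h. E g h u = f' (g, h)" by blast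
 then show ?case by (intro bexI[OF _ Tgr_add[OF tu(1,3)]]) (use tu in \<open>simp_all add: E_add\<close>)
next
 case (mult d f d' f')
 then obtain t u where tu: "t : Tgr d" "\<forall>g h. E g h t = f (g, h)" "u : Tgr d'" "\<forall>g h. E g h u = f' (g, h)" by blast
 then show ?case using Tgr_carrier by (intro bexI[OF _ Tgr_mult[OF tu(1,3)]]) (use tu in \<open>simp_all add: E_mult subset_iff\<close>)
qed

subsubsection \<open>The coproduct\<close>

lemma Pts_zero [simp]: "(%_. 0) : Pts" by (simp add: Pts_def)

text \<open>The law provides a tensor for each coordinate of the product; a monomial is realized by
  the product of these tensors.\<close>

lemma comult_mono_ex: "keys m <= X ==> \<exists>t\<in>Tgr (wt deg m). \<forall>g h. E g h t = mev (gm g h) m"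
proof (induction rule: mono_induct)
 case zero show ?case by (intro bexI[OF _ Tgr_pure[OF gr_one gr_one]]) (simp_all add: E_pure_gr[OF gr_one gr_one])
next
 case (add v m)
 then obtain t where t: "t : Tgr (wt deg m)" "\<forall>g h. E g h t = mev (gm g h) m" by blast
 obtain u where u: "u : Tgr (deg v)" "\<forall>g h. E g h u = gm g h v" using pf_Tgr[OF law[OF add(1)]] by auto
 have "u \<otimes>\<^bsub>TH\<^esub> t : Tgr (wt deg (single v 1 + m))" using Tgr_mult[OF u(1) t(1)] by simp
 then show ?case by (rule rev_bexI) (use t u Tgr_carrier in \<open>simp_all add: E_mult subset_iff\<close>)
qed

lemma comult_gr_ex:
 assumes "h : gr \<alpha>" shows "\<exists>t\<in>Tgr \<alpha>. \<forall>g g'. E g g' t = ev (gm g g') h"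
 using assms unfolding pgr_def mem_Collect_eq
proof (induction rule: pm_induct)
 case zero show ?case by (intro bexI[OF _ Tgr_zero]) (simp add: E_zero)
next
 case (single m c)
 then obtain t where t: "t : Tgr \<alpha>" "\<forall>g h. E g h t = mev (gm g h) m" using comult_mono_ex[of m] by auto
 have c: "single 0 c : gr 0" by (rule gr_single) auto
 have s: "pure_tensor HA HA (single 0 c) 1 : Tgr 0" by (rule Tgr_pure[OF c gr_one]) simp
 show ?case using Tgr_mult[OF s t(1)] t Tgr_carrier s
  by (intro bexI[where x = "pure_tensor HA HA (single 0 c) 1 \<otimes>\<^bsub>TH\<^esub> t"])
   (simp_all add: E_mult subset_iff E_pure_gr[OF c gr_one])
next
 case (add z w)
 then obtain t u where tu: "t : Tgr \<alpha>" "\<forall>g g'. E g g' t = ev (gm g g') z" "u : Tgr \<alpha>" "\<forall>g g'. E g g' u = ev (gm g g') w" by blast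
 then show ?case by (intro bexI[OF _ Tgr_add[OF tu(1,3)]]) (use tu in \<open>simp_all add: E_add\<close>)
qed

lemma comult_ex:
 assumes "h : carrier HA" shows "\<exists>t\<in>carrier TH. \<forall>g g'. E g g' t = ev (gm g g') h"
proof -
 interpret T: ring "TH" by (rule is_k_algebraD[OF T])
 have "keys h <= monos" using assms by simp
 then show ?thesis
 proof (induction rule: pm_induct)
  case zero show ?case by (intro bexI[of _ "\<zero>\<^bsub>TH\<^esub>"]) (simp_all add: E_zero)
 next
  case (single m c)
  then have "single m c : gr (wt deg m)" by (intro gr_single) auto
  then show ?case using comult_gr_ex Tgr_carrier by blast
 next
  case (add z w)
  then obtain t u where tu: "t : carrier TH" "\<forall>g g'. E g g' t = ev (gm g g') z" "u : carrier TH" "\<forall>g g'. E g g' u = ev (gm g g') w" by blast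
  then show ?case by (intro bexI[OF _ T.a_closed[OF tu(1,3)]]) (use tu in \<open>simp_all add: lin_homD(2)[OF E_lin]\<close>)
 qed
qed

text \<open>The coproduct is pinned down by its values: at a pair of points it is the value of
  \<open>h\<close> at their product. Since evaluations at pairs separate the tensor square, the
  choice is unique.\<close>

definition \<Delta> :: "(('v \<Rightarrow>\<^sub>0 nat) \<Rightarrow>\<^sub>0 'k) => _" where
 "\<Delta> h = (SOME t. t : carrier TH \<and> (\<forall>g\<in>Pts. \<forall>g'\<in>Pts. E g g' t = ev (gm g g') h))"

lemma \<Delta>:
 assumes "h : carrier HA"
 shows "\<Delta> h : carrier TH" "g : Pts ==> g' : Pts ==> E g g' (\<Delta> h) = ev (gm g g') h"
proof -
 have "\<Delta> h : carrier TH \<and> (\<forall>g\<in>Pts. \<forall>g'\<in>Pts. E g g' (\<Delta> h) = ev (gm g g') h)"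
  unfolding \<Delta>_def by (rule someI_ex) (use comult_ex[OF assms] in blast)
 then show "\<Delta> h : carrier TH" "g : Pts ==> g' : Pts ==> E g g' (\<Delta> h) = ev (gm g g') h" by auto
qed

lemma \<Delta>_eqI:
 assumes "h : carrier HA" "t : carrier TH" "\<And>g g'. g : Pts ==> g' : Pts ==> E g g' t = ev (gm g g') h"
 shows "\<Delta> h = t"
 by (rule T_eqI) (use \<Delta>[OF assms(1)] assms(2,3) in auto)

lemma \<Delta>_gr: "h : gr \<alpha> ==> \<Delta> h : Tgr \<alpha>"
proof -
 assume h: "h : gr \<alpha>"
 obtain t where t: "t : Tgr \<alpha>" "\<forall>g g'. E g g' t = ev (gm g g') h" using comult_gr_ex[OF h] by blast
 have "\<Delta> h = t" by (rule \<Delta>_eqI) (use h t gr_subset Tgr_carrier in blast)+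
 with t show ?thesis by simp
qed

lemma \<Delta>_alg_hom: "\<Delta> : alg_hom HA TH"
proof -
 interpret T: ring "TH" by (rule is_k_algebraD[OF T])
 have 1: "x : carrier HA ==> y : carrier HA ==> x + y : carrier HA" "x : carrier HA ==> pm_scale c x : carrier HA"
  "x : carrier HA ==> y : carrier HA ==> x * y : carrier HA" "1 : carrier HA" for x y c
  by (simp_all add: keys_addI keys_pm_scaleI keys_multI)
 have "\<Delta> 1 = \<one>\<^bsub>TH\<^esub>"
  by (rule \<Delta>_eqI[OF 1(4)]) (use E_pure[of 1 1] in \<open>simp_all add: tensor_one_zero(1)[OF HA(1) HA(1)] pure_tensor_closed[OF HA(1) HA(1)]\<close>)
 moreover have "\<Delta> (x \<oplus>\<^bsub>HA\<^esub> y) = \<Delta> x \<oplus>\<^bsub>TH\<^esub> \<Delta> y" "\<Delta> (x \<otimes>\<^bsub>HA\<^esub> y) = \<Delta> x \<otimes>\<^bsub>TH\<^esub> \<Delta> y"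
  "\<Delta> (c \<odot>\<^bsub>HA\<^esub> x) = c \<odot>\<^bsub>TH\<^esub> \<Delta> x" if x: "x : carrier HA" and y: "y : carrier HA" for x y c
  unfolding HA_simps
 proof -
  show "\<Delta> (x + y) = \<Delta> x \<oplus>\<^bsub>TH\<^esub> \<Delta> y"
   by (rule \<Delta>_eqI[OF 1(1)[OF x y] T.a_closed[OF \<Delta>(1)[OF x] \<Delta>(1)[OF y]]])
    (simp add: lin_homD(2)[OF E_lin \<Delta>(1)[OF x] \<Delta>(1)[OF y]] \<Delta>(2)[OF x] \<Delta>(2)[OF y])
  show "\<Delta> (x * y) = \<Delta> x \<otimes>\<^bsub>TH\<^esub> \<Delta> y"
   by (rule \<Delta>_eqI[OF 1(3)[OF x y] T.m_closed[OF \<Delta>(1)[OF x] \<Delta>(1)[OF y]]])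
    (simp add: E_mult[OF \<Delta>(1)[OF x] \<Delta>(1)[OF y]] \<Delta>(2)[OF x] \<Delta>(2)[OF y])
  show "\<Delta> (pm_scale c x) = c \<odot>\<^bsub>TH\<^esub> \<Delta> x"
   by (rule \<Delta>_eqI[OF 1(2)[OF x] kmodD(2)[OF kT \<Delta>(1)[OF x]]])
    (simp add: lin_homD(3)[OF E_lin \<Delta>(1)[OF x]] \<Delta>(2)[OF x])
 qed
 ultimately show ?thesis unfolding alg_hom_def
  by (intro IntI lin_homI ring_hom_memI \<Delta>(1)) simp_all
qed

lemma \<Delta>_lin: "\<Delta> : lin_hom HA TH"
 using \<Delta>_alg_hom by (simp add: alg_hom_def)

subsubsection \<open>The antipode\<close>

text \<open>Coordinates have nonzero degree, so a polynomial of degree 0 is a constant. Pure tensors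
  with a factor of degree 0 thus depend on one point only and are collected in \<open>a\<close> and
  \<open>b\<close>.\<close>

lemma Tgr_decompose:
 assumes "t : Tgr d" "d ~= 0"
 shows "\<exists>a\<in>gr d. \<exists>b\<in>gr d. \<exists>ps. (\<forall>(x, y)\<in>set ps. \<exists>\<beta> \<gamma>. \<beta> + \<gamma> = d \<and> \<beta> ~= 0 \<and> \<gamma> ~= 0 \<and> x : gr \<beta> \<and> y : gr \<gamma>) \<and>
  (\<forall>g h. E g h t = ev g a + ev h b + (\<Sum>(x, y)\<leftarrow>ps. ev g x * ev h y))"
 using assms(1)
proof (induction rule: Tgr_induct)
 case zero show ?case by (intro bexI[of _ 0] exI[of _ "[]"]) (simp_all add: E_zero)
next
 case (pure \<beta> \<gamma> x y)
 have c: "ev g z = ev (%_. 0) z" if "z : gr 0" for g z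
 proof -
  have "keys z <= {0}" using that wt_mono_eq_0 by (auto simp: pgr_def)
  then show ?thesis by (induction rule: pm_induct) simp_all
 qed
 consider "\<beta> = 0" | "\<gamma> = 0" | "\<beta> ~= 0" "\<gamma> ~= 0" by blast
 then show ?case
 proof cases
  case 1
  then have "y : gr d" "x : gr 0" using pure by auto
  then show ?thesis using pure c[of x]
   by (intro bexI[of _ 0] bexI[of _ "pm_scale (ev (%_. 0) x) y"] exI[of _ "[]"]) (simp_all add: E_pure_gr gr_scale)
 next
  case 2
  then have "x : gr d" "y : gr 0" using pure by auto
  then show ?thesis using pure c[of y]
   by (intro bexI[of _ "pm_scale (ev (%_. 0) y) x"] bexI[of _ 0] exI[of _ "[]"]) (simp_all add: E_pure_gr gr_scale)
 next
  case 3
  then show ?thesis using pure by (intro bexI[of _ 0] exI[of _ "[(x, y)]"]) (auto simp: E_pure_gr)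
 qed
next
 case (add t u)
 from add(3) obtain a b ps where 1:
  "a : gr d" "b : gr d" "\<forall>(x, y)\<in>set ps. \<exists>\<beta> \<gamma>. \<beta> + \<gamma> = d \<and> \<beta> ~= 0 \<and> \<gamma> ~= 0 \<and> x : gr \<beta> \<and> y : gr \<gamma>"
  "\<forall>g h. E g h t = ev g a + ev h b + (\<Sum>(x, y)\<leftarrow>ps. ev g x * ev h y)" by (elim bexE exE conjE)
 from add(4) obtain a' b' ps' where 2:
  "a' : gr d" "b' : gr d" "\<forall>(x, y)\<in>set ps'. \<exists>\<beta> \<gamma>. \<beta> + \<gamma> = d \<and> \<beta> ~= 0 \<and> \<gamma> ~= 0 \<and> x : gr \<beta> \<and> y : gr \<gamma>"
  "\<forall>g h. E g h u = ev g a' + ev h b' + (\<Sum>(x, y)\<leftarrow>ps'. ev g x * ev h y)" by (elim bexE exE conjE)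
 show ?case
 proof (rule bexI[of _ "a + a'"], rule bexI[of _ "b + b'"], intro exI[of _ "ps @ ps'"] conjI allI)
  show "\<forall>(x, y)\<in>set (ps @ ps'). \<exists>\<beta> \<gamma>. \<beta> + \<gamma> = d \<and> \<beta> ~= 0 \<and> \<gamma> ~= 0 \<and> x : gr \<beta> \<and> y : gr \<gamma>"
   unfolding set_append ball_Un using 1(3) 2(3) by (rule conjI)
  fix g h show "E g h (t \<oplus>\<^bsub>TH\<^esub> u) = ev g (a + a') + ev h (b + b') + (\<Sum>(x, y)\<leftarrow>ps @ ps'. ev g x * ev h y)"
   using spec[OF spec[OF 1(4)], of g h] spec[OF spec[OF 2(4)], of g h] by (simp add: E_add[OF add(1,2)])
 qed (intro gr_add 1 2)+
qed

text \<open>The coordinate \<open>v\<close> of a product is \<open>g v + h v\<close> plus mixed terms of smaller degrees.\<close>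

lemma law_decompose:
 assumes v: "v : X"
 shows "\<exists>ps. (\<forall>(x, y)\<in>set ps. \<exists>\<beta> \<gamma>. \<beta> + \<gamma> = deg v \<and> \<beta> ~= 0 \<and> \<gamma> ~= 0 \<and> x : gr \<beta> \<and> y : gr \<gamma>) \<and>
  (\<forall>g\<in>Pts. \<forall>h\<in>Pts. gm g h v = g v + h v + (\<Sum>(x, y)\<leftarrow>ps. ev g x * ev h y))"
proof -
 obtain t where t: "t : Tgr (deg v)" "\<forall>g h. E g h t = gm g h v" using pf_Tgr[OF law[OF v]] by auto
 from Tgr_decompose[OF t(1) deg(2)[OF v]] obtain a b ps where
  ab: "a : gr (deg v)" "b : gr (deg v)" and ps: "\<forall>(x, y)\<in>set ps. \<exists>\<beta> \<gamma>. \<beta> + \<gamma> = deg v \<and> \<beta> ~= 0 \<and> \<gamma> ~= 0 \<and> x : gr \<beta> \<and> y : gr \<gamma>"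
  and e: "\<forall>g h. E g h t = ev g a + ev h b + (\<Sum>(x, y)\<leftarrow>ps. ev g x * ev h y)" by blast
 have "ev (%_. 0) x = 0 \<and> ev (%_. 0) y = 0" if xy: "(x, y) : set ps" for x y
 proof -
  obtain \<beta> \<gamma> where "\<beta> ~= 0" "\<gamma> ~= 0" "x : gr \<beta>" "y : gr \<gamma>" using bspec[OF ps xy] by auto
  then show ?thesis by (simp add: gr_0_value)
 qed
 then have "\<forall>p\<in>set ps. ev (%_. 0) (fst p) = 0 \<and> ev (%_. 0) (snd p) = 0" by auto
 then have z: "(\<Sum>(x, y)\<leftarrow>ps. ev g x * ev (%_. 0) y) = 0" "(\<Sum>(x, y)\<leftarrow>ps. ev (%_. 0) x * ev g y) = 0" for g
  by (induction ps) (simp_all add: case_prod_beta)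
 have l: "gm g h v = ev g a + ev h b + (\<Sum>(x, y)\<leftarrow>ps. ev g x * ev h y)" for g h
  using spec[OF spec[OF e], of g h] spec[OF spec[OF t(2)], of g h] by (rule trans[OF sym, rotated])
 \<comment> \<open>Put the unit in one argument of the law: the mixed terms vanish, because
   homogeneous polynomials of nonzero degree vanish at the origin, and one of the two linear parts
   survives.\<close>
 have "ev g a = g v" "ev g b = g v" if "g : Pts" for g
 proof -
  have "g v = ev g a + ev (%_. 0) b + 0" "g v = ev (%_. 0) a + ev g b + 0"
   using l[of g "%_. 0"] l[of "%_. 0" g] unfolding gm(3,4)[OF that] z by blast+
  then show "ev g a = g v" "ev g b = g v" by (simp_all add: gr_0_value[OF ab(1) deg(2)[OF v]] gr_0_value[OF ab(2) deg(2)[OF v]])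
 qed
 with l ps show ?thesis by (intro exI[of _ ps] conjI ballI) simp_all
qed

text \<open>The coordinate \<open>v\<close> of \<open>gi g\<close> times \<open>g\<close> is 0, so
  \<open>gi g v\<close> is \<open>- g v\<close> minus a sum of products \<open>x(gi g) y(g)\<close>
  in which every \<open>x\<close> has smaller total degree than \<open>v\<close>. This is a
  recursion for the inverse; monomials and linear combinations follow by multiplicativity and
  linearity of evaluation.\<close>

lemma antipode_ex: "h : gr \<alpha> ==> \<exists>s\<in>gr \<alpha>. \<forall>g\<in>Pts. ev g s = ev (gi g) h"
proof (induction "mlen \<alpha>" arbitrary: h \<alpha> rule: less_induct)
 case less
 have var: "\<exists>s\<in>gr (deg v). \<forall>g\<in>Pts. ev g s = gi g v" if v: "v : X" and le: "mlen (deg v) \<le> mlen \<alpha>" for v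
 proof -
  obtain ps where ps: "\<forall>(x, y)\<in>set ps. \<exists>\<beta> \<gamma>. \<beta> + \<gamma> = deg v \<and> \<beta> ~= 0 \<and> \<gamma> ~= 0 \<and> x : gr \<beta> \<and> y : gr \<gamma>"
   and l: "\<forall>g\<in>Pts. \<forall>h\<in>Pts. gm g h v = g v + h v + (\<Sum>(x, y)\<leftarrow>ps. ev g x * ev h y)"
   using law_decompose[OF v] by (elim exE conjE)
  have "\<exists>s\<in>gr (deg v). \<forall>g\<in>Pts. ev g s = (\<Sum>(x, y)\<leftarrow>ps. ev (gi g) x * ev g y)" using ps
  proof (induction ps rule: list.induct)
   case Nil show ?case by (intro bexI[of _ 0]) simp_all
  next
   case (Cons p ps)
   obtain x y where p: "p = (x, y)" by fastforce
   obtain s where s: "s : gr (deg v)" "\<forall>g\<in>Pts. ev g s = (\<Sum>(x, y)\<leftarrow>ps. ev (gi g) x * ev g y)" using Cons by auto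
   obtain \<beta> \<gamma> where b: "\<beta> + \<gamma> = deg v" "\<gamma> ~= 0" "x : gr \<beta>" "y : gr \<gamma>" using Cons.prems p by auto
   have "mlen \<beta> < mlen (deg v)" unfolding b(1)[symmetric] using b(2) mlen_eq_0_iff[of \<gamma>] by (simp del: mlen_eq_0_iff)
   then obtain s' where s': "s' : gr \<beta>" "\<forall>g\<in>Pts. ev g s' = ev (gi g) x" using less.hyps[of \<beta> x] le b(3) by auto
   have "s' * y : gr (deg v)" using gr_mult[OF s'(1) b(4)] unfolding b(1) .
   then have "s' * y + s : gr (deg v)" by (rule gr_add[OF _ s(1)])
   moreover have "ev g (s' * y + s) = (\<Sum>(x, y)\<leftarrow>p # ps. ev (gi g) x * ev g y)" if "g : Pts" for g
    using bspec[OF s(2) that] bspec[OF s'(2) that] by (simp add: p)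
   ultimately show ?case by (intro bexI[of _ "s' * y + s"] ballI)
  qed
  then obtain s where s: "s : gr (deg v)" "\<forall>g\<in>Pts. ev g s = (\<Sum>(x, y)\<leftarrow>ps. ev (gi g) x * ev g y)" by (elim bexE)
  let ?x = "single (single v 1) (1::'k)"
  have "ev g (- (?x + s)) = gi g v" if g: "g : Pts" for g
  proof -
   have "0 = gi g v + g v + ev g s"
    using bspec[OF bspec[OF l gi(1)[OF g]] g] unfolding gi(2)[OF g] bspec[OF s(2) g] .
   then have "gi g v + (g v + ev g s) = 0" unfolding add.assoc[symmetric] by (rule sym)
   then have "gi g v = - (g v + ev g s)" unfolding eq_neg_iff_add_eq_0 .
   then show ?thesis by simp
  qed
  moreover have "- (?x + s) : gr (deg v)" by (intro gr_uminus gr_add s gr_var v)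
  ultimately show ?thesis by (intro bexI[of _ "- (?x + s)"] ballI)
 qed
 have mono: "mlen (wt deg m) \<le> mlen \<alpha> ==> \<exists>s\<in>gr (wt deg m). \<forall>g\<in>Pts. ev g s = mev (gi g) m" if "keys m <= X" for m
  using that
 proof (induction rule: mono_induct)
  case zero show ?case by (intro bexI[of _ 1]) simp_all
 next
  case (add v m)
  then obtain s where s: "s : gr (wt deg m)" "\<forall>g\<in>Pts. ev g s = mev (gi g) m" by auto
  obtain s' where s': "s' : gr (deg v)" "\<forall>g\<in>Pts. ev g s' = gi g v" using var[OF add(1)] add.prems by auto
  show ?case using s s' gr_mult[OF s'(1) s(1)] by (intro bexI[of _ "s' * s"]) simp_all
 qed
 have "keys h <= {m. keys m <= X \<and> wt deg m = \<alpha>}" using less.prems by (simp add: pgr_def)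
 then show ?case
 proof (induction rule: pm_induct)
  case zero then show ?case by (intro bexI[of _ 0]) simp_all
 next
  case (single m c)
  then obtain s where "s : gr \<alpha>" "\<forall>g\<in>Pts. ev g s = mev (gi g) m" using mono[of m] by auto
  then show ?case by (intro bexI[of _ "pm_scale c s"]) (simp_all add: gr_scale)
 next
  case (add z w)
  then obtain s t where "s : gr \<alpha>" "\<forall>g\<in>Pts. ev g s = ev (gi g) z" "t : gr \<alpha>" "\<forall>g\<in>Pts. ev g t = ev (gi g) w" by blast
  then show ?case by (intro bexI[of _ "s + t"]) (simp_all add: gr_add)
 qed
qed

end

context poly_group
begin

text \<open>As for the coproduct, the values at the points determine the polynomial, which exists by
  the recursion for inverses.\<close>

definition S :: "(('v \<Rightarrow>\<^sub>0 nat) \<Rightarrow>\<^sub>0 'k) => (('v \<Rightarrow>\<^sub>0 nat) \<Rightarrow>\<^sub>0 'k)" where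
 "S h = (SOME s. s : carrier HA \<and> (\<forall>g\<in>Pts. ev g s = ev (gi g) h))"

lemma HA_eqI: "x : carrier HA ==> y : carrier HA ==> (\<And>g. g : Pts ==> ev g x = ev g y) ==> x = y"
 by (rule separates_eqI[OF HA(2) HA_separates]) auto

lemma HA_closed: "x : carrier HA ==> y : carrier HA ==> x + y : carrier HA" "x : carrier HA ==> pm_scale c x : carrier HA"
  "x : carrier HA ==> y : carrier HA ==> x * y : carrier HA" "1 : carrier HA" "0 : carrier HA"
 by (simp_all add: keys_addI keys_pm_scaleI keys_multI)

lemma antipode_ex': "h : carrier HA ==> \<exists>s\<in>carrier HA. \<forall>g\<in>Pts. ev g s = ev (gi g) h"
proof -
 assume "h : carrier HA"
 then have "keys h <= monos" by simp
 then show ?thesis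
 proof (induction rule: pm_induct)
  case zero show ?case by (rule bexI[OF _ HA_closed(5)]) simp
 next
  case (single m c)
  then have "single m c : gr (wt deg m)" by (intro gr_single) auto
  from antipode_ex[OF this] obtain s where s: "s : gr (wt deg m)" "\<forall>g\<in>Pts. ev g s = ev (gi g) (single m c)"
   by (elim bexE)
  show ?case by (rule rev_bexI[OF subsetD[OF gr_subset s(1)]]) (rule s(2))
 next
  case (add z w)
  from add(3) obtain s where s: "s : carrier HA" "\<forall>g\<in>Pts. ev g s = ev (gi g) z" by (elim bexE)
  from add(4) obtain t where t: "t : carrier HA" "\<forall>g\<in>Pts. ev g t = ev (gi g) w" by (elim bexE)
  show ?case by (rule bexI[OF _ HA_closed(1)[OF s(1) t(1)]]) (simp add: s(2) t(2))
 qed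
qed

lemma S:
 assumes "h : carrier HA"
 shows "S h : carrier HA" "g : Pts ==> ev g (S h) = ev (gi g) h"
proof -
 obtain s where s: "s : carrier HA" "\<forall>g\<in>Pts. ev g s = ev (gi g) h" using antipode_ex'[OF assms] by (elim bexE)
 have "S h : carrier HA \<and> (\<forall>g\<in>Pts. ev g (S h) = ev (gi g) h)"
  unfolding S_def by (rule someI[of _ s]) (rule conjI[OF s])
 then show "S h : carrier HA" "g : Pts ==> ev g (S h) = ev (gi g) h" by auto
qed

lemma S_eqI: "h : carrier HA ==> s : carrier HA ==> (\<And>g. g : Pts ==> ev g s = ev (gi g) h) ==> S h = s"
 by (rule HA_eqI) (simp_all only: S)

lemma S_gr: assumes h: "h : gr \<alpha>" shows "S h : gr \<alpha>"
proof -
 obtain s where s: "s : gr \<alpha>" "\<forall>g\<in>Pts. ev g s = ev (gi g) h" using antipode_ex[OF h] by (elim bexE)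
 have "S h = s" by (rule S_eqI[OF subsetD[OF gr_subset h] subsetD[OF gr_subset s(1)]]) (use s(2) in simp)
 with s show ?thesis by simp
qed

lemma S_lin: "S : lin_hom HA HA"
proof (rule lin_homI)
 fix x y c assume x: "x : carrier HA"
 show "S x : carrier HA" by (rule S[OF x])
 show "S (c \<odot>\<^bsub>HA\<^esub> x) = c \<odot>\<^bsub>HA\<^esub> S x" unfolding HA_simps
  by (rule S_eqI[OF HA_closed(2)[OF x] HA_closed(2)[OF S(1)[OF x]]]) (simp add: S(2)[OF x])
 assume y: "y : carrier HA"
 show "S (x \<oplus>\<^bsub>HA\<^esub> y) = S x \<oplus>\<^bsub>HA\<^esub> S y" unfolding HA_simps
  by (rule S_eqI[OF HA_closed(1)[OF x y] HA_closed(1)[OF S(1)[OF x] S(1)[OF y]]]) (simp add: S(2)[OF x] S(2)[OF y])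
qed

section \<open>The graded Hopf algebra of polynomial functions\<close>

definition H :: "('k, ('v \<Rightarrow>\<^sub>0 nat) \<Rightarrow>\<^sub>0 'k) hopf" where
 "H = module.extend HA (hopf.fields \<Delta> (ev (%_. 0)) S)"

lemma H_simps:
 "carrier H = carrier HA" "comult H = \<Delta>" "counit H = ev (%_. 0)" "antipode H = S"
 "x \<otimes>\<^bsub>H\<^esub> y = x * y" "x \<oplus>\<^bsub>H\<^esub> y = x + y" "c \<odot>\<^bsub>H\<^esub> x = pm_scale c x" "\<one>\<^bsub>H\<^esub> = 1" "\<zero>\<^bsub>H\<^esub> = 0"
 by (auto simp: H_def module.defs hopf.defs HA_def poly_algebra_def)

lemma H_same: "same_alg H HA"
 by (simp add: same_alg_def H_def module.defs hopf.defs)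

lemma H_k: "is_k_algebra H" "kmod H"
 using HA(1,2) is_k_algebra_same[OF H_same] kmod_same[OF H_same] by auto

lemma H_cring: "cring H"
proof (rule cringI)
 show "abelian_group H" by (rule kmodD(1)[OF H_k(2)])
 show "Group.comm_monoid H"
  by (rule comm_monoidI) (simp_all add: H_simps keys_multI ac_simps)
qed (simp add: H_simps distrib_right)

text \<open>Each axiom is a group law read at points: coassociativity comes from associativity of
  \<open>gm\<close>, the counit axioms from the unit at the origin, and the antipode axioms from the
  two inverse laws.\<close>

lemma \<Delta>_hopf:
 assumes h: "h : carrier HA"
 shows "tensor_assoc HA (tensor_map TH HA \<Delta> (%x. x) (\<Delta> h)) = tensor_map HA TH (%x. x) \<Delta> (\<Delta> h)"
  "tensor_lift HA (%x y. pm_scale (ev (%_. 0) x) y) (\<Delta> h) = h"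
  "tensor_lift HA (%x y. pm_scale (ev (%_. 0) y) x) (\<Delta> h) = h"
  "tensor_lift HA (%x y. S x * y) (\<Delta> h) = pm_scale (ev (%_. 0) h) 1"
  "tensor_lift HA (%x y. x * S y) (\<Delta> h) = pm_scale (ev (%_. 0) h) 1"
proof -
 note k = HA(1) and dh = \<Delta>(1)[OF h]
 note m1 = tensor_map_lin_hom[OF k k T k \<Delta>_lin lin_hom_id] and m2 = tensor_map_lin_hom[OF k k k T lin_hom_id \<Delta>_lin]
 show "tensor_assoc HA (tensor_map TH HA \<Delta> (%x. x) (\<Delta> h)) = tensor_map HA TH (%x. x) \<Delta> (\<Delta> h)"
  (is "?l = ?r")
 proof (rule separates_eqI[OF kmod_tensor[OF k T] tensor_separates[OF k T HA_separates tensor_separates[OF k k HA_separates HA_separates]]])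
  show "?l : carrier (tensor HA TH)" "?r : carrier (tensor HA TH)"
   by (rule lin_homD(1)[OF tensor_assoc_lin_hom[OF k] lin_homD(1)[OF m1 dh]], rule lin_homD(1)[OF m2 dh])
  fix f assume "f : {tev f g |f g. f : ev ` Pts \<and> g : {tev f g |f g. f : ev ` Pts \<and> g : ev ` Pts}}"
  then obtain x y z where f: "f = tev (ev x) (tev (ev y) (ev z))" and p: "x : Pts" "y : Pts" "z : Pts" by auto
  have "tev (ev x) (tev (ev y) (ev z)) ?l = tev (tev (ev x) (ev y)) (ev z) (tensor_map TH HA \<Delta> (%x. x) (\<Delta> h))"
   by (rule tev_assoc[OF k ev_lin ev_lin ev_lin lin_homD(1)[OF m1 dh]])
  also have "\<dots> = tensor_lift ground_field (%a b. tev (ev x) (ev y) (\<Delta> a) * ev z b) (\<Delta> h)"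
   by (rule tensor_lift_map[OF k k T k \<Delta>_lin lin_hom_id kmod_ground bil_functionals[OF E_lin ev_lin] dh])
  also have "\<dots> = tev (ev (gm x y)) (ev z) (\<Delta> h)"
   by (rule tensor_lift_cong[OF k k kmod_ground bil_functionals[OF lin_hom_comp[OF \<Delta>_lin E_lin] ev_lin] _ dh])
    (simp add: \<Delta>(2) p del: HA_simps(1))
  also have "\<dots> = tev (ev x) (ev (gm y z)) (\<Delta> h)"
   by (simp add: \<Delta>(2)[OF h] p gm)
  also have "\<dots> = tensor_lift ground_field (%a b. ev x a * tev (ev y) (ev z) (\<Delta> b)) (\<Delta> h)"
   by (rule tensor_lift_cong[OF k k kmod_ground bil_functionals[OF ev_lin ev_lin] _ dh])
    (simp add: \<Delta>(2) p del: HA_simps(1))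
  also have "\<dots> = tev (ev x) (tev (ev y) (ev z)) ?r"
   by (rule tensor_lift_map[OF k k k T lin_hom_id \<Delta>_lin kmod_ground bil_functionals[OF ev_lin E_lin] dh, symmetric])
  finally show "f ?l = f ?r" by (simp add: f)
 qed
 \<comment> \<open>Common form of the counit and antipode axioms: if the value of
   \<open>\<beta> a b\<close> at \<open>g\<close> is the value of \<open>a\<close> at
   \<open>x\<close> times that of \<open>b\<close> at \<open>x'\<close>, then the lift of
   \<open>\<beta>\<close> at the coproduct of \<open>h\<close> has the value of \<open>h\<close> at
   the product of \<open>x\<close> and \<open>x'\<close>.\<close>
 have lift: "tensor_lift HA \<beta> (\<Delta> h) = y"
  if b: "bil HA HA HA \<beta>" and y: "y : carrier HA"
   and e: "\<And>g. g : Pts ==> \<exists>x\<in>Pts. \<exists>x'\<in>Pts. (\<forall>a\<in>carrier HA. \<forall>b\<in>carrier HA. ev g (\<beta> a b) = ev x a * ev x' b) \<and> ev (gm x x') h = ev g y" for \<beta> y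
 proof (rule HA_eqI[OF lin_homD(1)[OF tensor_lift_lin_hom[OF k k HA(2) b] dh] y])
  fix g assume "g : Pts"
  from e[OF this] obtain x x' where x: "x : Pts" "x' : Pts" "\<forall>a\<in>carrier HA. \<forall>b\<in>carrier HA. ev g (\<beta> a b) = ev x a * ev x' b" "ev (gm x x') h = ev g y"
   by (elim bexE conjE)
  have "ev g (tensor_lift HA \<beta> (\<Delta> h)) = tensor_lift ground_field (%a b. ev g (\<beta> a b)) (\<Delta> h)"
   by (rule lin_hom_tensor_lift[OF k k HA(2) b ev_lin kmod_ground dh])
  also have "\<dots> = E x x' (\<Delta> h)"
   by (rule tensor_lift_cong[OF k k kmod_ground bil_lin_hom[OF b ev_lin] _ dh]) (use x(3) in blast)
  finally show "ev g (tensor_lift HA \<beta> (\<Delta> h)) = ev g y" using x \<Delta>(2)[OF h x(1,2)] by simp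
 qed
 have sc: "bil HA HA HA (%x y. pm_scale (ev (%_. 0) x) y)" "bil HA HA HA (%x y. pm_scale (ev (%_. 0) y) x)"
  by (rule bilI; simp add: keys_pm_scaleI pm_scale_distrib ac_simps)+
 have ss: "bil HA HA HA (%x y. S x * y)" "bil HA HA HA (%x y. x * S y)"
  by (rule bilI; simp add: keys_multI lin_homD[OF S_lin, simplified] distrib_left distrib_right pm_scale_mult)+
 show "tensor_lift HA (%x y. pm_scale (ev (%_. 0) x) y) (\<Delta> h) = h"
  by (rule lift[OF sc(1) h], rule bexI[of _ "%_. 0"], rule_tac x = g in bexI) (simp_all add: gm)
 show "tensor_lift HA (%x y. pm_scale (ev (%_. 0) y) x) (\<Delta> h) = h"
  by (rule lift[OF sc(2) h], rule_tac x = g in bexI, rule bexI[of _ "%_. 0"]) (simp_all add: gm)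
 show "tensor_lift HA (%x y. S x * y) (\<Delta> h) = pm_scale (ev (%_. 0) h) 1"
  by (rule lift[OF ss(1) HA_closed(2)[OF HA_closed(4)]], rule_tac x = "gi g" in bexI, rule_tac x = g in bexI) (simp_all add: gi S(2) del: HA_simps(1))
 show "tensor_lift HA (%x y. x * S y) (\<Delta> h) = pm_scale (ev (%_. 0) h) 1"
  by (rule lift[OF ss(2) HA_closed(2)[OF HA_closed(4)]], rule_tac x = g in bexI, rule_tac x = "gi g" in bexI) (simp_all add: gi S(2) del: HA_simps(1))
qed

lemma hopf_H: "hopf_algebra H"
 unfolding hopf_algebra_def tensor_same[OF H_same H_same] tensor_map_same[OF same_alg_refl H_same] tensor_map_same[OF H_same same_alg_refl]
  tensor_assoc_same[OF H_same] tensor_lift_same[OF H_same] H_simps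
  alg_hom_same[OF H_same same_alg_refl] lin_hom_same[OF H_same H_same]
proof (intro conjI ballI)
 show "is_k_algebra H" by (rule H_k)
 show "\<Delta> : alg_hom HA TH" by (rule \<Delta>_alg_hom)
 show "ev (%_. 0) : alg_hom HA ground_field" unfolding HA_def by (rule ev_alg_hom)
 show "S : lin_hom HA HA" by (rule S_lin)
qed (rule \<Delta>_hopf, assumption)+

lemma commutative_hopf_H: "commutative_hopf_algebra H"
 unfolding commutative_hopf_algebra_def by (rule conjI[OF hopf_H H_cring])

lemma finsum_H: "f ` A <= carrier HA ==> finsum H f A = sum f A"
proof -
 interpret abelian_group H by (rule kmodD(1)[OF H_k(2)])
 show "f ` A <= carrier HA ==> finsum H f A = sum f A"
 proof (induction A rule: infinite_finite_induct)
  case (insert x F)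
  then have "f : F \<rightarrow> carrier H" "f x : carrier H" by (auto simp: H_simps(1) simp del: HA_simps(1))
  with insert show ?case by (simp add: H_simps(6))
 qed (simp_all add: H_simps)
qed

definition part :: "expo => (('v \<Rightarrow>\<^sub>0 nat) \<Rightarrow>\<^sub>0 'k) => (('v \<Rightarrow>\<^sub>0 nat) \<Rightarrow>\<^sub>0 'k)" where
 "part \<alpha> h = Poly_Mapping.mapp (%m c. if wt deg m = \<alpha> then c else 0) h"

lemma lookup_part: "lookup (part \<alpha> h) m = (if wt deg m = \<alpha> then lookup h m else 0)"
 by (auto simp: part_def lookup_mapp when_def in_keys_iff)

lemma part_gr: "h : carrier HA ==> part \<alpha> h : gr \<alpha>"
 by (auto simp: pgr_def in_keys_iff lookup_part subset_iff split: if_splits)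

lemma gr_lookup: "z : gr \<alpha> ==> \<not> keys m <= X \<or> wt deg m ~= \<alpha> ==> lookup z m = 0"
 unfolding pgr_def mem_Collect_eq not_in_keys_iff_lookup_eq_zero[symmetric] by blast

lemma graded_H: "graded_hopf_algebra n H gr"
 unfolding graded_hopf_algebra_def
proof (intro conjI ballI)
 show "hopf_algebra H" by (rule hopf_H)
 show "\<one>\<^bsub>H\<^esub> : gr 0" by (simp add: H_simps)
 interpret abelian_group H by (rule kmodD(1)[OF H_k(2)])
 show "submodule (gr \<alpha>) (ground_field :: ('k, 'k) module) H" for \<alpha>
 proof (intro submodule.intro submodule_axioms.intro)
  show "subgroup (gr \<alpha>) (add_monoid H)"
  proof (rule add.subgroupI)
   show "gr \<alpha> <= carrier H" unfolding H_simps by (rule gr_subset)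
   show "gr \<alpha> ~= {}" using gr_zero by blast
   fix a b assume a: "a : gr \<alpha>"
   show "\<ominus>\<^bsub>H\<^esub> a : gr \<alpha>"
    unfolding kmod_uminus[OF H_k(2), of a, unfolded H_simps, OF subsetD[OF gr_subset a]] by (rule gr_scale[OF a])
   assume b: "b : gr \<alpha>" show "a \<oplus>\<^bsub>H\<^esub> b : gr \<alpha>" unfolding H_simps by (rule gr_add[OF a b])
  qed
 qed (simp add: H_simps gr_scale)
 fix h assume h: "h : carrier H"
 then have hc: "h : carrier HA" by (simp only: H_simps)
 let ?c = "\<lambda>\<alpha>\<in>exponents n. part \<alpha> h"
 have wtE: "wt deg m : exponents n" if "m : keys h" for m
  by (rule wt_mono_exponents) (use hc that in auto)
 have sub: "{\<alpha> : exponents n. ?c \<alpha> ~= \<zero>\<^bsub>H\<^esub>} <= wt deg ` keys h"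
 proof
  fix \<alpha> assume "\<alpha> : {\<alpha> : exponents n. ?c \<alpha> ~= \<zero>\<^bsub>H\<^esub>}"
  then have "part \<alpha> h ~= 0" by (auto simp: H_simps(9) simp del: HA_simps split: if_splits)
  then have "keys (part \<alpha> h) ~= {}" by simp
  then obtain m where "m : keys (part \<alpha> h)" by blast
  then show "\<alpha> : wt deg ` keys h" by (auto simp: lookup_part in_keys_iff split: if_splits)
 qed
 have fin: "finite {\<alpha> : exponents n. ?c \<alpha> ~= \<zero>\<^bsub>H\<^esub>}" by (rule finite_subset[OF sub]) simp
 \<comment> \<open>A monomial occurs only in the component of its own weight, so every decomposition
   into components is determined by the coefficients of the sum.\<close>
 have coeff: "lookup (\<Oplus>\<^bsub>H\<^esub>\<alpha>\<in>{\<alpha> : exponents n. c \<alpha> ~= \<zero>\<^bsub>H\<^esub>}. c \<alpha>) m = lookup (c (wt deg m)) m"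
  if c: "c : (\<Pi>\<^sub>E \<alpha>\<in>exponents n. gr \<alpha>)" "finite {\<alpha> : exponents n. c \<alpha> ~= \<zero>\<^bsub>H\<^esub>}" and m: "wt deg m : exponents n" for c m
 proof -
  have cg: "c \<alpha> : gr \<alpha>" if "\<alpha> : exponents n" for \<alpha> using c(1) that by (rule PiE_mem)
  have "(\<Oplus>\<^bsub>H\<^esub>\<alpha>\<in>{\<alpha> : exponents n. c \<alpha> ~= \<zero>\<^bsub>H\<^esub>}. c \<alpha>) = sum c {\<alpha> : exponents n. c \<alpha> ~= \<zero>\<^bsub>H\<^esub>}"
   by (rule finsum_H, rule image_subsetI, rule subsetD[OF gr_subset], rule cg) simp
  then have "lookup (\<Oplus>\<^bsub>H\<^esub>\<alpha>\<in>{\<alpha> : exponents n. c \<alpha> ~= \<zero>\<^bsub>H\<^esub>}. c \<alpha>) m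
   = (\<Sum>\<alpha>\<in>{\<alpha> : exponents n. c \<alpha> ~= \<zero>\<^bsub>H\<^esub>}. if \<alpha> = wt deg m then lookup (c (wt deg m)) m else 0)"
   by (simp only: lookup_sum) (rule sum.cong[OF refl], use gr_lookup[OF cg, of _ m] in \<open>simp split: if_split\<close>)
  also have "\<dots> = lookup (c (wt deg m)) m"
   using c(2) m by (simp add: H_simps)
  finally show ?thesis .
 qed
 show "\<exists>!c. c : (\<Pi>\<^sub>E \<alpha>\<in>exponents n. gr \<alpha>) \<and> finite {\<alpha> : exponents n. c \<alpha> ~= \<zero>\<^bsub>H\<^esub>} \<and>
    h = (\<Oplus>\<^bsub>H\<^esub>\<alpha>\<in>{\<alpha> : exponents n. c \<alpha> ~= \<zero>\<^bsub>H\<^esub>}. c \<alpha>)"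
 proof (rule ex1I[of _ ?c], intro conjI)
  show c: "?c : (\<Pi>\<^sub>E \<alpha>\<in>exponents n. gr \<alpha>)" by (rule restrict_PiE_iff[THEN iffD2]) (simp add: part_gr[OF hc])
  show "finite {\<alpha> : exponents n. ?c \<alpha> ~= \<zero>\<^bsub>H\<^esub>}" by (rule fin)
  have cg: "?c \<alpha> : gr \<alpha>" if "\<alpha> : exponents n" for \<alpha> using c that by (rule PiE_mem)
  have "(\<Oplus>\<^bsub>H\<^esub>\<alpha>\<in>{\<alpha> : exponents n. ?c \<alpha> ~= \<zero>\<^bsub>H\<^esub>}. ?c \<alpha>) = sum ?c {\<alpha> : exponents n. ?c \<alpha> ~= \<zero>\<^bsub>H\<^esub>}" (is "?s = _")
   by (rule finsum_H, rule image_subsetI, rule subsetD[OF gr_subset], rule cg) simp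
  then have ls: "lookup ?s m = (\<Sum>\<alpha>\<in>{\<alpha> : exponents n. ?c \<alpha> ~= \<zero>\<^bsub>H\<^esub>}. lookup (?c \<alpha>) m)" for m
   by (simp only: lookup_sum)
  have z: "lookup ?s m = 0" if "m \<notin> monos" for m
   unfolding ls
  proof (rule sum.neutral, rule ballI)
   fix \<alpha> assume "\<alpha> : {\<alpha> : exponents n. ?c \<alpha> ~= \<zero>\<^bsub>H\<^esub>}"
   then have "?c \<alpha> : gr \<alpha>" using cg[of \<alpha>] by (simp only: mem_Collect_eq)
   then show "lookup (?c \<alpha>) m = 0" by (rule gr_lookup) (use that in simp)
  qed
  show "h = ?s"
  proof (rule poly_mapping_eqI)
   fix m
   show "lookup h m = lookup ?s m"
   proof (cases "m : monos")
    case True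
    then have "wt deg m : exponents n" by (intro wt_mono_exponents) simp
    then show ?thesis unfolding coeff[OF c fin \<open>wt deg m : exponents n\<close>] by (simp add: lookup_part)
   next
    case False
    with hc have "lookup h m = 0" by (auto simp: in_keys_iff)
    with z[OF False] show ?thesis by simp
   qed
  qed
 next
  fix c assume c: "c : (\<Pi>\<^sub>E \<alpha>\<in>exponents n. gr \<alpha>) \<and> finite {\<alpha> : exponents n. c \<alpha> ~= \<zero>\<^bsub>H\<^esub>} \<and>
    h = (\<Oplus>\<^bsub>H\<^esub>\<alpha>\<in>{\<alpha> : exponents n. c \<alpha> ~= \<zero>\<^bsub>H\<^esub>}. c \<alpha>)"
  show "c = ?c"
  proof (rule extensionalityI[of _ "exponents n"])
   fix \<alpha> assume a: "\<alpha> : exponents n"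
   have cg: "c \<alpha> : gr \<alpha>" using conjunct1[OF c] a by (rule PiE_mem)
   have "c \<alpha> = part \<alpha> h"
   proof (rule poly_mapping_eqI)
    fix m show "lookup (c \<alpha>) m = lookup (part \<alpha> h) m"
    proof (cases "wt deg m = \<alpha>")
     case True
     then show ?thesis using coeff[of c m] c a by (simp add: lookup_part)
    next
     case False
     then show ?thesis using gr_lookup[OF cg, of m] by (simp add: lookup_part)
    qed
   qed
   then show "c \<alpha> = ?c \<alpha>" using a by simp
  qed (use c in \<open>auto simp: PiE_def\<close>)
 qed
next
 fix \<alpha> \<beta> x y assume "x : gr \<alpha>" "y : gr \<beta>"
 then show "x \<otimes>\<^bsub>H\<^esub> y : gr (\<alpha> + \<beta>)" by (simp add: H_simps gr_mult)
next
 fix \<alpha> x assume "x : gr \<alpha>"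
 then show "comult H x : tensor_class H H ` {z. keys z <= (\<Union>(\<beta>, \<gamma>)\<in>splits \<alpha>. gr \<beta> \<times> gr \<gamma>)}" "antipode H x : gr \<alpha>"
  using \<Delta>_gr[of x \<alpha>] S_gr[of x \<alpha>] by (simp_all add: H_simps Tgr_def tensor_same[OF H_same H_same])
next
 fix \<alpha> x assume "\<alpha> : exponents n - {0}" "x : gr \<alpha>"
 then show "counit H x = 0" by (simp add: H_simps gr_0_value)
qed

text \<open>A variable that divides a monomial of weight \<open>\<alpha>\<close> has a degree below
  \<open>\<alpha>\<close>, which leaves finitely many variables. Each has total degree at least 1,
  so exponents are bounded by the total degree of \<open>\<alpha>\<close>.\<close>

lemma finite_monos: "finite {m. keys m <= X \<and> wt deg m = \<alpha>}"
proof -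
 let ?V = "{v : X. \<exists>\<gamma>. deg v + \<gamma> = \<alpha>}"
 let ?F = "{f. \<forall>v. (v : ?V \<longrightarrow> f v : {..mlen \<alpha>}) \<and> (v \<notin> ?V \<longrightarrow> f v = 0)}"
 have "?V = (\<Union>\<beta>\<in>{\<beta>. \<exists>\<gamma>. \<beta> + \<gamma> = \<alpha>}. {v : X. deg v = \<beta>})" by auto
 then have "finite ?V" using finite_exponents_below[of \<alpha>] finite_deg by simp
 then have "finite ?F" by (rule finite_set_of_finite_funs) simp
 moreover have "lookup ` {m. keys m <= X \<and> wt deg m = \<alpha>} <= ?F"
 proof (intro image_subsetI)
  fix m assume "m : {m. keys m <= X \<and> wt deg m = \<alpha>}"
  then have m: "keys m <= X" "wt deg m = \<alpha>" by auto
  have "mlen m \<le> mlen (wt deg m)" using m(1)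
  proof (induction rule: mono_induct)
   case (add v m)
   then have "0 < mlen (deg v)" using deg(2)[of v] mlen_eq_0_iff[of "deg v"] by (simp del: mlen_eq_0_iff)
   with add show ?case by simp
  qed simp
  have key: "v : ?V \<and> lookup m v \<le> mlen \<alpha>" if v: "v : keys m" for v
  proof -
   have "lookup m v \<le> mlen m"
    unfolding msum_def using member_le_sum[OF v, of "lookup m"] by simp
   moreover have "deg v + wt deg (m - single v 1) = \<alpha>"
    using m(2) mono_decompose[OF v] msum_add[of deg "single v 1" "m - single v 1"] by simp
   ultimately show ?thesis using m v \<open>mlen m \<le> mlen (wt deg m)\<close> by auto
  qed
  show "lookup m : ?F"
  proof (intro CollectI allI conjI impI)
   fix v
   show "v : ?V ==> lookup m v : {..mlen \<alpha>}"
    using key[of v] by (cases "v : keys m") (simp_all add: in_keys_iff)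
   show "v \<notin> ?V ==> lookup m v = 0"
    using key[of v] by (cases "v : keys m") (simp_all add: in_keys_iff)
  qed
 qed
 ultimately have "finite (lookup ` {m. keys m <= X \<and> wt deg m = \<alpha>})"
  by (rule finite_subset[rotated])
 then show ?thesis by (rule finite_imageD) (auto simp: inj_on_def intro: poly_mapping_eqI)
qed

lemma locally_finite_H: "locally_finite n H gr"
 unfolding locally_finite_def
proof
 fix \<alpha> assume "\<alpha> : exponents n"
 let ?M = "{m. keys m <= X \<and> wt deg m = \<alpha>}"
 let ?e = "%m. single m (1::'k)"
 have inj: "inj_on ?e ?M"
 proof (rule inj_onI)
  fix x y :: "'v \<Rightarrow>\<^sub>0 nat" assume "?e x = ?e y"
  then have "keys (?e x) = keys (?e y)" by simp
  then show "x = y" by simp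
 qed
 have sum: "(\<Oplus>\<^bsub>H\<^esub>e\<in>?e ` ?M. c e \<odot>\<^bsub>H\<^esub> e) = (\<Sum>m\<in>?M. single m (c (?e m)))" for c
 proof -
  have "(\<Oplus>\<^bsub>H\<^esub>e\<in>?e ` ?M. c e \<odot>\<^bsub>H\<^esub> e) = (\<Sum>e\<in>?e ` ?M. c e \<odot>\<^bsub>H\<^esub> e)"
   by (rule finsum_H) (auto simp: H_simps split: if_splits)
  also have "\<dots> = (\<Sum>m\<in>?M. c (?e m) \<odot>\<^bsub>H\<^esub> ?e m)" by (rule sum.reindex[OF inj, unfolded o_def])
  finally show ?thesis by (simp add: H_simps)
 qed
 show "\<exists>E. finite E \<and> E <= gr \<alpha> \<and> gr \<alpha> = {\<Oplus>\<^bsub>H\<^esub>e\<in>E. c e \<odot>\<^bsub>H\<^esub> e | c. True}"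
 proof (intro exI[of _ "?e ` ?M"] conjI)
  show "finite (?e ` ?M)" using finite_monos by simp
  show "?e ` ?M <= gr \<alpha>" by (auto intro!: gr_single)
  show "gr \<alpha> = {\<Oplus>\<^bsub>H\<^esub>e\<in>?e ` ?M. c e \<odot>\<^bsub>H\<^esub> e | c. True}"
  proof (intro equalityI subsetI)
   fix z assume z: "z : gr \<alpha>"
   have "z = (\<Sum>m\<in>?M. single m (lookup z m))"
    by (rule pm_eq_sum_singles[OF finite_monos]) (use z in \<open>simp add: pgr_def\<close>)
   \<comment> \<open>Local finiteness indexes coefficients by elements of the spanning set; the
     inverse of \<open>m |-> single m 1\<close> recovers the monomial from such an element.\<close>
   also have "\<dots> = (\<Sum>m\<in>?M. single m ((%e. lookup z (the_inv_into ?M ?e e)) (?e m)))"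
    using the_inv_into_f_f[OF inj] by (intro sum.cong refl) simp
   also have "\<dots> = (\<Oplus>\<^bsub>H\<^esub>e\<in>?e ` ?M. lookup z (the_inv_into ?M ?e e) \<odot>\<^bsub>H\<^esub> e)" by (rule sum[symmetric])
   finally show "z : {\<Oplus>\<^bsub>H\<^esub>e\<in>?e ` ?M. c e \<odot>\<^bsub>H\<^esub> e | c. True}"
    by (intro CollectI exI[of _ "%e. lookup z (the_inv_into ?M ?e e)"] conjI TrueI)
  next
   fix z assume "z : {\<Oplus>\<^bsub>H\<^esub>e\<in>?e ` ?M. c e \<odot>\<^bsub>H\<^esub> e | c. True}"
   then obtain c where "z = (\<Oplus>\<^bsub>H\<^esub>e\<in>?e ` ?M. c e \<odot>\<^bsub>H\<^esub> e)" by (elim CollectE exE conjE)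
   then show "z : gr \<alpha>" unfolding sum by (simp only:) (rule gr_sum, rule gr_single, simp_all)
  qed
 qed
qed

subsubsection \<open>Characters\<close>

text \<open>An algebra morphism is determined by the images of the variables, and evaluation at the
  point with these coordinates has the same images. Thus every character comes from a point.\<close>

lemma character_hom:
 assumes "\<phi> : alg_hom HA ground_field" "h : carrier HA"
 shows "\<phi> h = ev (%v. if v : X then \<phi> (single (single v 1) 1) else 0) h"
  (is "_ = ev ?g h")
proof -
 have l: "\<phi> : lin_hom HA ground_field" and r: "\<phi> : Ring.ring_hom HA ground_field" using assms(1) by (auto simp: alg_hom_def)
 note m = ring_hom_mult[OF r, unfolded HA_simps ground_field_simps] and o = ring_hom_one[OF r, unfolded HA_simps ground_field_simps]
 note li = lin_homD[OF l, unfolded HA_simps ground_field_simps]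
 have mono: "\<phi> (single m 1) = mev ?g m" if "keys m <= X" for m
  using that
 proof (induction rule: mono_induct)
  case zero show ?case using o by simp
 next
  case (add v m)
  have "\<phi> (single (single v 1 + m) 1)
   = \<phi> (single (single v 1) 1 * single m 1)" by (simp add: mult_single)
  also have "\<dots> = \<phi> (single (single v 1) 1) * \<phi> (single m 1)"
   by (rule m) (use add in simp_all)
  finally show ?case using add by simp
 qed
 have "keys h <= monos" using assms(2) by simp
 then show ?thesis
 proof (induction rule: pm_induct)
  case zero show ?case using lin_hom_zero[OF l HA(2) kmod_ground] by simp
 next
  case (single m c)
  then show ?case using li(3)[of "single m 1" c] mono[of m] by simp
 next
  case (add z w) then show ?case using li(2)[of z w] by simp
 qed
qed

text \<open>\<open>c\<close> is a coordinate system on \<open>G\<close>. Composing it with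
  evaluation gives the isomorphism, along which the group axioms are transported to the
  characters.\<close>

lemma character_iso:
 assumes G: "group G" and c: "bij_betw c (carrier G) Pts"
  and cm: "\<And>x y. x : carrier G ==> y : carrier G ==> c (x \<otimes>\<^bsub>G\<^esub> y) = gm (c x) (c y)" and c1: "c \<one>\<^bsub>G\<^esub> = (%_. 0)"
 shows "G \<cong> character_group H" "group (character_group H)"
proof -
 define \<chi> where "\<chi> g = restrict (ev g) (carrier H)" for g :: "'v => 'k"
 have \<chi>: "\<chi> g : carrier (character_group H)" for g
 proof -
  have "\<chi> g : alg_hom HA ground_field"
   unfolding alg_hom_def \<chi>_def H_simps
   by (intro IntI lin_homI ring_hom_memI)
    (simp_all add: HA_closed[unfolded HA_simps(1)[symmetric]] keys_addI keys_pm_scaleI keys_multI)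
  then show ?thesis by (simp add: character_group_def alg_hom_same[OF H_same same_alg_refl] \<chi>_def)
 qed
 have inj: "g = g'" if "g : Pts" "g' : Pts" "\<chi> g = \<chi> g'" for g g'
 proof
  fix v show "g v = g' v"
  proof (cases "v : X")
   case True
   then have "single (single v 1) (1::'k) : carrier H" by (simp add: H_simps)
   with fun_cong[OF that(3), of "single (single v 1) 1"] show ?thesis by (simp add: \<chi>_def)
  qed (use that in \<open>auto simp: Pts_def\<close>)
 qed
 have surj: "\<exists>g\<in>Pts. \<phi> = \<chi> g" if "\<phi> : carrier (character_group H)" for \<phi>
 proof -
  have p: "\<phi> : alg_hom HA ground_field" "\<phi> : extensional (carrier H)"
   using that by (auto simp: character_group_def alg_hom_same[OF H_same same_alg_refl])
  show ?thesis
   by (rule bexI[of _ "%v. if v : X then \<phi> (single (single v 1) 1) else 0"])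
    (use p(2) character_hom[OF p(1)] in \<open>auto simp: \<chi>_def H_simps Pts_def extensional_def simp del: HA_simps(1) intro!: ext\<close>)
 qed
 have mult: "\<chi> (gm g g') = \<chi> g \<otimes>\<^bsub>character_group H\<^esub> \<chi> g'" if "g : Pts" "g' : Pts" for g g'
 proof
  fix h
  show "\<chi> (gm g g') h = (\<chi> g \<otimes>\<^bsub>character_group H\<^esub> \<chi> g') h"
  proof (cases "h : carrier HA")
   case True
   have "tensor_lift ground_field (%x y. \<chi> g x * \<chi> g' y) (\<Delta> h) = E g g' (\<Delta> h)"
    by (rule tensor_lift_cong[OF HA(1) HA(1) kmod_ground bil_functionals[OF ev_lin ev_lin] _ \<Delta>(1)[OF True], symmetric])
     (simp add: \<chi>_def H_simps del: HA_simps(1))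
   then show ?thesis using True \<Delta>(2)[OF True that]
    by (simp add: \<chi>_def[of "gm g g'"] character_group_def H_simps del: HA_simps(1))
  next
   case False
   then show ?thesis by (simp add: \<chi>_def[of "gm g g'"] character_group_def H_simps del: HA_simps(1))
  qed
 qed
 have cP: "c x : Pts" if "x : carrier G" for x using bij_betwE[OF c] that by blast
 have iso: "(%x. \<chi> (c x)) : iso G (character_group H)"
  unfolding iso_def hom_def mem_Collect_eq
 proof (intro conjI ballI bij_betwI' Pi_I)
  fix x y assume xy: "x : carrier G" "y : carrier G"
  show "\<chi> (c (x \<otimes>\<^bsub>G\<^esub> y)) = \<chi> (c x) \<otimes>\<^bsub>character_group H\<^esub> \<chi> (c y)" using xy by (simp add: cm mult cP)
  show "(\<chi> (c x) = \<chi> (c y)) = (x = y)"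
   using inj[OF cP[OF xy(1)] cP[OF xy(2)]] bij_betw_imp_inj_on[OF c] xy by (auto dest: inj_onD)
 next
  fix \<phi> assume "\<phi> : carrier (character_group H)"
  then obtain g where "g : Pts" "\<phi> = \<chi> g" using surj by blast
  then show "\<exists>x\<in>carrier G. \<phi> = \<chi> (c x)" using c by (auto simp: bij_betw_def)
 qed (rule \<chi>)+
 then show "G \<cong> character_group H" by (auto simp: is_iso_def)
 \<comment> \<open>The transported group has the image of the unit of \<open>G\<close> as its unit.
   As \<open>c\<close> maps that unit to the origin, this is the restricted counit, which already is
   the unit of the record.\<close>
 have "character_group H \<lparr>one := \<chi> (c \<one>\<^bsub>G\<^esub>)\<rparr> = character_group H"
  by (simp add: c1 character_group_def \<chi>_def H_simps restrict_def)
 then show "group (character_group H)" using group.iso_imp_img_group[OF G iso] by simp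
qed

end

lemma bil_add:
 assumes "kmod W" "bil A B W \<beta>" "bil A B W \<gamma>"
 shows "bil A B W (%x y. \<beta> x y \<oplus>\<^bsub>W\<^esub> \<gamma> x y)"
proof -
 interpret W: abelian_group W by (rule kmodD(1)[OF assms(1)])
 show ?thesis
  by (rule bilI) (simp_all add: bilD[OF assms(2)] bilD[OF assms(3)] W.a_ac kmodD(4)[OF assms(1)])
qed

lemma bil_comp:
 assumes "bil C D W \<beta>" "\<phi> : lin_hom A C" "\<psi> : lin_hom B D"
 shows "bil A B W (%x y. \<beta> (\<phi> x) (\<psi> y))"
 by (rule bilI) (simp_all add: bilD[OF assms(1)] lin_homD[OF assms(2)] lin_homD[OF assms(3)])

lemma bil_mult: "is_k_algebra A ==> bil A A A (%x y. x \<otimes>\<^bsub>A\<^esub> y)"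
proof -
 assume A: "is_k_algebra A"
 interpret ring A by (rule is_k_algebraD[OF A])
 show ?thesis by (rule bilI) (simp_all add: l_distr r_distr is_k_algebraD(4,5)[OF A])
qed

lemma bil_tensor_eqI:
 assumes k: "is_k_algebra A" "is_k_algebra B" "is_k_algebra C" "is_k_algebra D" and W: "kmod W"
  and F: "bil (tensor A B) (tensor C D) W F" and G: "bil (tensor A B) (tensor C D) W G"
  and eq: "\<And>a b c d. a : carrier A ==> b : carrier B ==> c : carrier C ==> d : carrier D ==>
   F (pure_tensor A B a b) (pure_tensor C D c d) = G (pure_tensor A B a b) (pure_tensor C D c d)"
  and t: "t : carrier (tensor A B)" and u: "u : carrier (tensor C D)"
 shows "F t u = G t u"
proof (rule lin_hom_tensor_eqI[OF k(1,2) _ _ W _ t])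
 show "(%t. F t u) : lin_hom (tensor A B) W" "(%t. G t u) : lin_hom (tensor A B) W" using F G u by (auto simp: bil_def)
 fix x y assume xy: "x : carrier A" "y : carrier B"
 show "F (pure_tensor A B x y) u = G (pure_tensor A B x y) u"
  by (rule lin_hom_tensor_eqI[OF k(3,4) _ _ W _ u])
   (use F G pure_tensor_closed[OF k(1,2) xy] eq[OF xy] in \<open>auto simp: bil_def\<close>)
qed

section \<open>Convolution of functionals\<close>

context poly_group
begin

abbreviation \<epsilon> where "\<epsilon> \<equiv> ev (%_. 0) :: _ => 'k"
abbreviation K where "K \<equiv> ground_field :: ('k, 'k) module"

text \<open>The product of the graded dual, available for all functionals regardless of their
  support; the restriction makes it extensional.\<close>

definition conv where "conv f g = (\<lambda>h\<in>carrier HA. tev f g (\<Delta> h))"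

lemma conv_lin:
 assumes f: "f : lin_hom HA K" and g: "g : lin_hom HA K" shows "conv f g : lin_hom HA K"
proof -
 note l = lin_hom_comp[OF \<Delta>_lin tev_lin_hom[OF HA(1) HA(1) f g]]
 interpret ring HA by (rule HA)
 show ?thesis
  by (rule lin_homI) (use lin_homD[OF l] a_closed kmodD(2)[OF HA(2)] in \<open>simp_all add: conv_def del: HA_simps\<close>)
qed

text \<open>Both sides are the triple product of the functionals evaluated at the twofold coproduct,
  grouped in the two ways that coassociativity identifies.\<close>

lemma conv_assoc:
 assumes f: "f : lin_hom HA K" and g: "g : lin_hom HA K" and k: "k : lin_hom HA K"
 shows "conv (conv f g) k = conv f (conv g k)"
proof
 fix h
 note A = HA(1)
 show "conv (conv f g) k h = conv f (conv g k) h"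
 proof (cases "h : carrier HA")
  case True
  note dh = \<Delta>(1)[OF True]
  note m1 = tensor_map_lin_hom[OF A A T A \<Delta>_lin lin_hom_id]
  note fg = tev_lin_hom[OF A A f g] and gk = tev_lin_hom[OF A A g k]
  have "conv (conv f g) k h = tensor_lift K (%a b. tev f g (\<Delta> a) * k b) (\<Delta> h)"
   unfolding conv_def[of "conv f g"] restrict_apply'[OF True]
   by (rule tensor_lift_cong[OF A A kmod_ground bil_functionals[OF conv_lin[OF f g] k] _ dh]) (simp add: conv_def del: HA_simps)
  also have "\<dots> = tev (tev f g) k (tensor_map TH HA \<Delta> (%x. x) (\<Delta> h))"
   by (rule tensor_lift_map[OF A A T A \<Delta>_lin lin_hom_id kmod_ground bil_functionals[OF fg k] dh, symmetric])
  also have "\<dots> = tev f (tev g k) (tensor_assoc HA (tensor_map TH HA \<Delta> (%x. x) (\<Delta> h)))"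
   by (rule tev_assoc[OF A f g k lin_homD(1)[OF m1 dh], symmetric])
  also have "\<dots> = tev f (tev g k) (tensor_map HA TH (%x. x) \<Delta> (\<Delta> h))"
   unfolding \<Delta>_hopf(1)[OF True] ..
  also have "\<dots> = tensor_lift K (%a b. f a * tev g k (\<Delta> b)) (\<Delta> h)"
   by (rule tensor_lift_map[OF A A A T lin_hom_id \<Delta>_lin kmod_ground bil_functionals[OF f gk] dh])
  also have "\<dots> = conv f (conv g k) h"
   unfolding conv_def[of f] restrict_apply'[OF True]
   by (rule tensor_lift_cong[OF A A kmod_ground bil_functionals[OF f conv_lin[OF g k]] _ dh, symmetric]) (simp add: conv_def del: HA_simps)
  finally show ?thesis .
 qed (simp add: conv_def)
qed

lemma tev_counit:
 assumes f: "f : lin_hom HA K" and h: "h : carrier HA"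
 shows "tev \<epsilon> f (\<Delta> h) = f h" "tev f \<epsilon> (\<Delta> h) = f h"
proof -
 have sc: "bil HA HA HA (%x y. pm_scale (\<epsilon> x) y)" "bil HA HA HA (%x y. pm_scale (\<epsilon> y) x)"
  by (rule bilI; simp add: keys_pm_scaleI pm_scale_distrib ac_simps)+
 have "f (tensor_lift HA (%x y. pm_scale (\<epsilon> x) y) (\<Delta> h)) = tensor_lift K (%x y. f (pm_scale (\<epsilon> x) y)) (\<Delta> h)"
  by (rule lin_hom_tensor_lift[OF HA(1) HA(1) HA(2) sc(1) f kmod_ground \<Delta>(1)[OF h]])
 also have "\<dots> = tev \<epsilon> f (\<Delta> h)"
  by (rule tensor_lift_cong[OF HA(1) HA(1) kmod_ground bil_lin_hom[OF sc(1) f] _ \<Delta>(1)[OF h]])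
   (use lin_homD(3)[OF f] in \<open>simp add: HA_simps(4)[symmetric] del: HA_simps\<close>)
 finally show "tev \<epsilon> f (\<Delta> h) = f h" by (simp add: \<Delta>_hopf(2)[OF h])
 have "f (tensor_lift HA (%x y. pm_scale (\<epsilon> y) x) (\<Delta> h)) = tensor_lift K (%x y. f (pm_scale (\<epsilon> y) x)) (\<Delta> h)"
  by (rule lin_hom_tensor_lift[OF HA(1) HA(1) HA(2) sc(2) f kmod_ground \<Delta>(1)[OF h]])
 also have "\<dots> = tev f \<epsilon> (\<Delta> h)"
  by (rule tensor_lift_cong[OF HA(1) HA(1) kmod_ground bil_lin_hom[OF sc(2) f] _ \<Delta>(1)[OF h]])
   (use lin_homD(3)[OF f] in \<open>simp add: HA_simps(4)[symmetric] mult.commute del: HA_simps\<close>)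
 finally show "tev f \<epsilon> (\<Delta> h) = f h" by (simp add: \<Delta>_hopf(3)[OF h])
qed

subsubsection \<open>The graded dual algebra\<close>

definition DA where "DA = graded_dual_algebra n H gr"

definition supp where "supp f = {\<alpha> : exponents n. \<exists>x\<in>gr \<alpha>. f x ~= (0::'k)}"

lemma DA_simps:
 "carrier DA = {f : lin_hom HA K \<inter> extensional (carrier HA). finite (supp f)}"
 "f \<otimes>\<^bsub>DA\<^esub> g = conv f g" "\<one>\<^bsub>DA\<^esub> = restrict \<epsilon> (carrier HA)" "\<zero>\<^bsub>DA\<^esub> = (\<lambda>h\<in>carrier HA. 0)"
 "f \<oplus>\<^bsub>DA\<^esub> g = (\<lambda>h\<in>carrier HA. f h + g h)" "c \<odot>\<^bsub>DA\<^esub> f = (\<lambda>h\<in>carrier HA. c * f h)"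
 by (simp_all add: DA_def graded_dual_algebra_def H_simps(1-4) conv_def supp_def restrict_def
   lin_hom_same[OF H_same same_alg_refl] del: HA_simps)

lemma DA_carrierD: "f : carrier DA ==> f : lin_hom HA K" "f : carrier DA ==> f : extensional (carrier HA)"
 "f : carrier DA ==> finite (supp f)"
 by (simp_all add: DA_simps)

lemma DA_carrierI: "f : lin_hom HA K ==> f : extensional (carrier HA) ==> finite (supp f) ==> f : carrier DA"
 by (simp add: DA_simps)

lemma DA_ext: "f : carrier DA ==> g : carrier DA ==> (\<And>h. h : carrier HA ==> f h = g h) ==> f = g"
 using DA_carrierD(2) by (intro extensionalityI[of f "carrier HA" g])

lemma HA_op: "x : carrier HA ==> y : carrier HA ==> x \<oplus>\<^bsub>HA\<^esub> y : carrier HA" "x : carrier HA ==> c \<odot>\<^bsub>HA\<^esub> x : carrier HA"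
 unfolding HA_simps(3,4) by (rule HA_closed; assumption)+

lemma restrict_lin_hom: "f : lin_hom HA K ==> restrict f (carrier HA) : lin_hom HA K"
 by (rule lin_homI) (simp_all add: lin_homD HA_op del: HA_simps)

lemma exp_splits: "\<beta> + \<gamma> : exponents n \<longleftrightarrow> \<beta> : exponents n \<and> \<gamma> : exponents n"
 by (simp add: exponents_def)

text \<open>A functional on \<open>A \<otimes> A\<close> sees only the degrees in which its factors do.\<close>

lemma tev_gr_0:
 assumes f: "f : lin_hom HA K" and g: "g : lin_hom HA K" and t: "t : Tgr d"
  and z: "\<And>\<beta> \<gamma> x y. \<beta> + \<gamma> = d ==> x : gr \<beta> ==> y : gr \<gamma> ==> f x * g y = 0"
 shows "tev f g t = 0"
 using t
proof (induction rule: Tgr_induct)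
 case zero show ?case using lin_hom_zero[OF tev_lin_hom[OF HA(1) HA(1) f g] kT kmod_ground] by simp
next
 case (pure \<beta> \<gamma> x y)
 have "tev f g (pure_tensor HA HA x y) = f x * g y"
  by (rule tev_pure[OF HA(1) HA(1) f g subsetD[OF gr_subset pure(1)] subsetD[OF gr_subset pure(2)]])
 then show ?case using z[OF pure(3,1,2)] by simp
next
 case (add t u)
 then show ?case using lin_homD(2)[OF tev_lin_hom[OF HA(1) HA(1) f g] subsetD[OF Tgr_carrier add(1)] subsetD[OF Tgr_carrier add(2)]] by simp
qed

lemma conv_gr_0:
 assumes f: "f : lin_hom HA K" and g: "g : lin_hom HA K" and h: "h : gr d"
  and z: "\<And>\<beta> \<gamma> x y. \<beta> + \<gamma> = d ==> x : gr \<beta> ==> y : gr \<gamma> ==> f x * g y = 0"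
 shows "conv f g h = 0"
 unfolding conv_def restrict_apply'[OF subsetD[OF gr_subset h]]
 by (rule tev_gr_0[OF f g \<Delta>_gr[OF h] z])

text \<open>The coproduct is homogeneous, so a convolution can be nonzero only in a degree that is a
  sum of degrees in which the factors are nonzero. This keeps supports finite.\<close>

lemma supp_conv:
 assumes f: "f : lin_hom HA K" and g: "g : lin_hom HA K"
 shows "supp (conv f g) <= (%(\<beta>, \<gamma>). \<beta> + \<gamma>) ` (supp f \<times> supp g)"
proof
 fix \<alpha> assume a: "\<alpha> : supp (conv f g)"
 show "\<alpha> : (%(\<beta>, \<gamma>). \<beta> + \<gamma>) ` (supp f \<times> supp g)"
 proof (rule ccontr)
  assume n: "\<alpha> \<notin> (%(\<beta>, \<gamma>). \<beta> + \<gamma>) ` (supp f \<times> supp g)"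
  have "conv f g h = 0" if h: "h : gr \<alpha>" for h
  proof (rule conv_gr_0[OF f g h], rule ccontr)
   fix \<beta> \<gamma> x y assume b: "\<beta> + \<gamma> = \<alpha>" "x : gr \<beta>" "y : gr \<gamma>" "f x * g y ~= 0"
   then have "\<beta> : supp f" "\<gamma> : supp g" using a exp_splits[of \<beta> \<gamma>] by (auto simp: supp_def)
   with n b(1) show False by force
  qed
  with a show False by (auto simp: supp_def)
 qed
qed

lemma supp_restrict: "supp (restrict f (carrier HA)) = supp f"
proof -
 have "restrict f (carrier HA) x = f x" if "x : gr \<alpha>" for x \<alpha> using subsetD[OF gr_subset that] by (rule restrict_apply')
 then show ?thesis by (simp add: supp_def)
qed

lemma DA_closed:
 assumes f: "f : carrier DA" and g: "g : carrier DA"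
 shows "f \<oplus>\<^bsub>DA\<^esub> g : carrier DA" "conv f g : carrier DA"
proof -
 note d = DA_carrierD[OF f] DA_carrierD[OF g]
 show "f \<oplus>\<^bsub>DA\<^esub> g : carrier DA"
  unfolding DA_simps(5)
 proof (rule DA_carrierI[OF restrict_lin_hom])
  show "(%h. f h + g h) : lin_hom HA K"
   by (rule lin_homI) (simp_all add: lin_homD[OF d(1)] lin_homD[OF d(4)] algebra_simps del: HA_simps)
  show "finite (supp (\<lambda>h\<in>carrier HA. f h + g h))"
   unfolding supp_restrict by (rule finite_subset[of _ "supp f \<union> supp g"]) (use d(3,6) in \<open>auto simp: supp_def\<close>)
 qed simp
 show "conv f g : carrier DA"
 proof (rule DA_carrierI[OF conv_lin[OF d(1,4)]])
  show "finite (supp (conv f g))" by (rule finite_subset[OF supp_conv[OF d(1,4)]]) (use d(3,6) in simp)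
 qed (simp add: conv_def)
qed

lemma DA_scale_closed: "f : carrier DA ==> c \<odot>\<^bsub>DA\<^esub> f : carrier DA"
 unfolding DA_simps(6)
proof (rule DA_carrierI[OF restrict_lin_hom])
 assume f: "f : carrier DA"
 show "(%h. c * f h) : lin_hom HA K"
  by (rule lin_homI) (simp_all add: lin_homD[OF DA_carrierD(1)[OF f]] algebra_simps del: HA_simps)
 show "finite (supp (\<lambda>h\<in>carrier HA. c * f h))"
  unfolding supp_restrict by (rule finite_subset[of _ "supp f"]) (use DA_carrierD(3)[OF f] in \<open>auto simp: supp_def\<close>)
qed simp

lemma DA_zero_closed: "\<zero>\<^bsub>DA\<^esub> : carrier DA"
 unfolding DA_simps(4) by (rule DA_carrierI[OF restrict_lin_hom]) (auto intro!: lin_homI simp: supp_restrict simp del: HA_simps, simp add: supp_def)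

lemma DA_one_closed: "\<one>\<^bsub>DA\<^esub> : carrier DA"
 unfolding DA_simps(3)
proof (rule DA_carrierI[OF restrict_lin_hom[OF ev_lin]])
 have "supp \<epsilon> <= {0}" using gr_0_value by (auto simp: supp_def)
 then show "finite (supp (restrict \<epsilon> (carrier HA)))" unfolding supp_restrict by (rule finite_subset) simp
qed simp

lemma DA_apply: "h : carrier HA ==> (f \<oplus>\<^bsub>DA\<^esub> g) h = f h + g h" "h : carrier HA ==> (c \<odot>\<^bsub>DA\<^esub> f) h = c * f h"
 "h : carrier HA ==> \<zero>\<^bsub>DA\<^esub> h = 0" "h : carrier HA ==> \<one>\<^bsub>DA\<^esub> h = \<epsilon> h" "h : carrier HA ==> conv f g h = tev f g (\<Delta> h)"
 unfolding DA_simps conv_def by (rule restrict_apply'; assumption)+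

lemma tev_restrict:
 assumes f: "f : lin_hom HA K" and g: "g : lin_hom HA K" and t: "t : carrier TH"
 shows "tev (restrict f (carrier HA)) g t = tev f g t" "tev f (restrict g (carrier HA)) t = tev f g t"
 by (rule tensor_lift_cong[OF HA(1) HA(1) kmod_ground bil_functionals[OF restrict_lin_hom[OF f] g] _ t], simp,
   rule tensor_lift_cong[OF HA(1) HA(1) kmod_ground bil_functionals[OF f restrict_lin_hom[OF g]] _ t], simp)

lemma DA_k: "is_k_algebra DA"
proof -
 note cl = DA_closed(1) DA_closed(2) DA_scale_closed DA_zero_closed DA_one_closed
 have ag: "abelian_group DA"
 proof (rule abelian_groupI)
  fix f g k assume f: "f : carrier DA" and g: "g : carrier DA" and k: "k : carrier DA"
  show "f \<oplus>\<^bsub>DA\<^esub> g \<oplus>\<^bsub>DA\<^esub> k = f \<oplus>\<^bsub>DA\<^esub> (g \<oplus>\<^bsub>DA\<^esub> k)" by (rule DA_ext) (simp_all add: cl f g k DA_apply del: HA_simps)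
 next
  fix f g assume f: "f : carrier DA" and g: "g : carrier DA"
  show "f \<oplus>\<^bsub>DA\<^esub> g = g \<oplus>\<^bsub>DA\<^esub> f" by (rule DA_ext) (simp_all add: cl f g DA_apply del: HA_simps)
 next
  fix f assume f: "f : carrier DA"
  show "\<zero>\<^bsub>DA\<^esub> \<oplus>\<^bsub>DA\<^esub> f = f" by (rule DA_ext) (simp_all add: cl f DA_apply del: HA_simps)
  show "\<exists>g\<in>carrier DA. g \<oplus>\<^bsub>DA\<^esub> f = \<zero>\<^bsub>DA\<^esub>"
  proof (rule bexI[OF _ cl(3)[OF f, of "-1"]])
   show "((-1) \<odot>\<^bsub>DA\<^esub> f) \<oplus>\<^bsub>DA\<^esub> f = \<zero>\<^bsub>DA\<^esub>" by (rule DA_ext) (simp_all add: cl f DA_apply del: HA_simps)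
  qed
 qed (simp_all add: cl)
 have bl: "conv (f \<oplus>\<^bsub>DA\<^esub> g) k = conv f k \<oplus>\<^bsub>DA\<^esub> conv g k" "conv k (f \<oplus>\<^bsub>DA\<^esub> g) = conv k f \<oplus>\<^bsub>DA\<^esub> conv k g"
  "conv (c \<odot>\<^bsub>DA\<^esub> f) k = c \<odot>\<^bsub>DA\<^esub> conv f k" "conv k (c \<odot>\<^bsub>DA\<^esub> f) = c \<odot>\<^bsub>DA\<^esub> conv k f"
  if f: "f : carrier DA" and g: "g : carrier DA" and k: "k : carrier DA" for f g k c
 proof -
  note lf = DA_carrierD(1)[OF f] and lg = DA_carrierD(1)[OF g] and lk = DA_carrierD(1)[OF k]
   and lfg = DA_carrierD(1)[OF cl(1)[OF f g]] and lc = DA_carrierD(1)[OF cl(3)[OF f, of c]]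
  note tl = tev_lin_hom[OF HA(1) HA(1)] and tp = tev_pure[OF HA(1) HA(1)]
  have s: "(%t. tev a b t + tev a' b' t) : lin_hom TH K" "(%t. c * tev a b t) : lin_hom TH K"
   if "a : lin_hom HA K" "b : lin_hom HA K" "a' : lin_hom HA K" "b' : lin_hom HA K" for a b a' b'
   by (rule lin_homI; simp add: lin_homD[OF tl[OF that(1,2)]] lin_homD[OF tl[OF that(3,4)]] algebra_simps)+
  have e: "tev (f \<oplus>\<^bsub>DA\<^esub> g) k t = tev f k t + tev g k t" "tev k (f \<oplus>\<^bsub>DA\<^esub> g) t = tev k f t + tev k g t"
   "tev (c \<odot>\<^bsub>DA\<^esub> f) k t = c * tev f k t" "tev k (c \<odot>\<^bsub>DA\<^esub> f) t = c * tev k f t" if t: "t : carrier TH" for t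
   by (rule lin_hom_tensor_eqI[OF HA(1) HA(1) tl[OF lfg lk] s(1)[OF lf lk lg lk] kmod_ground _ t],
     simp add: tp[OF lfg lk] tp[OF lf lk] tp[OF lg lk] DA_apply distrib_right del: HA_simps,
     rule lin_hom_tensor_eqI[OF HA(1) HA(1) tl[OF lk lfg] s(1)[OF lk lf lk lg] kmod_ground _ t],
     simp add: tp[OF lk lfg] tp[OF lk lf] tp[OF lk lg] DA_apply distrib_left del: HA_simps,
     rule lin_hom_tensor_eqI[OF HA(1) HA(1) tl[OF lc lk] s(2)[OF lf lk lf lk] kmod_ground _ t],
     simp add: tp[OF lc lk] tp[OF lf lk] DA_apply del: HA_simps,
     rule lin_hom_tensor_eqI[OF HA(1) HA(1) tl[OF lk lc] s(2)[OF lk lf lk lf] kmod_ground _ t],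
     simp add: tp[OF lk lc] tp[OF lk lf] DA_apply del: HA_simps)
  show "conv (f \<oplus>\<^bsub>DA\<^esub> g) k = conv f k \<oplus>\<^bsub>DA\<^esub> conv g k" by (rule DA_ext) (simp_all add: cl f g k DA_apply(1,2,5) e \<Delta>(1) del: HA_simps)
  show "conv k (f \<oplus>\<^bsub>DA\<^esub> g) = conv k f \<oplus>\<^bsub>DA\<^esub> conv k g" by (rule DA_ext) (simp_all add: cl f g k DA_apply(1,2,5) e \<Delta>(1) del: HA_simps)
  show "conv (c \<odot>\<^bsub>DA\<^esub> f) k = c \<odot>\<^bsub>DA\<^esub> conv f k" by (rule DA_ext) (simp_all add: cl f g k DA_apply(1,2,5) e \<Delta>(1) del: HA_simps)
  show "conv k (c \<odot>\<^bsub>DA\<^esub> f) = c \<odot>\<^bsub>DA\<^esub> conv k f" by (rule DA_ext) (simp_all add: cl f g k DA_apply(1,2,5) e \<Delta>(1) del: HA_simps)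
 qed
 have un: "conv \<one>\<^bsub>DA\<^esub> f = f" "conv f \<one>\<^bsub>DA\<^esub> = f" if f: "f : carrier DA" for f
 proof -
  have "tev \<one>\<^bsub>DA\<^esub> f (\<Delta> h) = f h" "tev f \<one>\<^bsub>DA\<^esub> (\<Delta> h) = f h" if h: "h : carrier HA" for h
   unfolding DA_simps(3) tev_restrict(1)[OF ev_lin DA_carrierD(1)[OF f] \<Delta>(1)[OF h]] tev_restrict(2)[OF DA_carrierD(1)[OF f] ev_lin \<Delta>(1)[OF h]]
   by (rule tev_counit[OF DA_carrierD(1)[OF f] h])+
  then show "conv \<one>\<^bsub>DA\<^esub> f = f" "conv f \<one>\<^bsub>DA\<^esub> = f" by (auto intro!: DA_ext simp: cl f DA_apply(5) simp del: HA_simps)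
 qed
 have r: "ring DA"
 proof (rule ringI[OF ag])
  show "monoid DA"
   by (rule monoidI) (simp_all add: DA_simps(2) cl un conv_assoc DA_carrierD(1))
 qed (simp_all add: DA_simps(2) bl)
 have k: "kmod DA"
  by (rule kmodI[OF ag]; (rule cl(3), assumption)?; rule DA_ext) (simp_all add: cl DA_apply algebra_simps del: HA_simps)
 show ?thesis unfolding is_k_algebra_def by (intro conjI k r ballI allI) (simp_all add: DA_simps(2) bl)
qed

text \<open>Evaluations at polynomials; their products make the coproduct of the graded dual, which
  is given by a definite description, unique.\<close>

lemma DA_separates: "separates DA ((%h f. f h) ` carrier HA)"
 unfolding separates_def
proof (intro conjI ballI impI image_subsetI)
 fix h assume "h : carrier HA"
 then show "(%f. f h) : lin_hom DA ground_field" by (intro lin_homI) (simp_all add: DA_apply del: HA_simps)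
next
 fix f assume f: "f : carrier DA" and z: "\<forall>u\<in>(%h f. f h) ` carrier HA. u f = 0"
 show "f = \<zero>\<^bsub>DA\<^esub>" by (rule DA_ext[OF f DA_zero_closed]) (use z in \<open>simp add: DA_apply del: HA_simps\<close>)
qed

subsubsection \<open>Primitive elements\<close>

text \<open>\<open>\<iota> x\<close> is the functional reading off the linear part of a polynomial.\<close>

definition lin :: "('v \<Rightarrow>\<^sub>0 'k) => (('v \<Rightarrow>\<^sub>0 nat) \<Rightarrow>\<^sub>0 'k) => 'k" where
 "lin x h = (\<Sum>v\<in>keys x. lookup x v * lookup h (single v 1))"

lemma lin_superset: "finite V ==> keys x <= V ==>
  lin x h = (\<Sum>v\<in>V. lookup x v * lookup h (single v 1))"
 unfolding lin_def by (rule sum.mono_neutral_left) (auto simp: in_keys_iff)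

lemma lin_simps [simp]:
 "lin (x + y) h = lin x h + lin y h" "lin (pm_scale c x) h = c * lin x h" "lin x (h + k) = lin x h + lin x k"
 "lin x (pm_scale c h) = c * lin x h" "lin 0 h = 0" "lin x 0 = 0"
 "lin (single v c) h = c * lookup h (single v 1)"
proof -
 let ?V = "keys x \<union> keys y"
 have k: "keys (x + y) <= ?V" by (rule keys_add)
 show "lin (x + y) h = lin x h + lin y h"
  using lin_superset[OF _ k] lin_superset[of ?V x] lin_superset[of ?V y] by (simp add: lookup_add distrib_right sum.distrib)
 show "lin (pm_scale c x) h = c * lin x h"
  using lin_superset[OF _ keys_pm_scale, of x c h] by (simp add: lin_def sum_distrib_left mult.assoc)
 show "lin x (h + k) = lin x h + lin x k" "lin x (pm_scale c h) = c * lin x h" "lin 0 h = 0" "lin x 0 = 0"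
  by (simp_all add: lin_def lookup_add distrib_left sum.distrib sum_distrib_left ac_simps)
 show "lin (single v c) h = c * lookup h (single v 1)"
  by (simp add: lin_def)
qed

lemma lin_lin: "lin x : lin_hom HA K" by (rule lin_homI) simp_all

lemma lin_mono: "lin x (single m c) = c * (if \<exists>v. m = single v 1 then lookup x (THE v. m = single v 1) else 0)"
proof (cases "\<exists>v. m = single v 1")
 case True
 then obtain v where m: "m = single v 1" by blast
 have i: "single v (1::nat) = single w 1 \<longleftrightarrow> v = w" for v w :: 'v
  by (metis keys_single singleton_inject zero_neq_one)
 have "lin x (single m c) = (\<Sum>w\<in>keys x. if w = v then lookup x v * c else 0)"
  unfolding lin_def m by (intro sum.cong refl) (simp add: lookup_single when_def i[unfolded One_nat_def])
 also have "\<dots> = lookup x v * c" by (simp add: in_keys_iff)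
 finally show ?thesis unfolding m i by simp
next
 case False
 then have "lin x (single m c) = 0"
  unfolding lin_def by (intro sum.neutral) (auto simp: lookup_single when_def)
 with False show ?thesis by simp
qed

lemma \<epsilon>_mono: "\<epsilon> (single m c) = (if m = 0 then c else 0)"
proof (cases "m = 0")
 case False
 then have "keys m ~= {}" by simp
 then obtain v where "v : keys m" by blast
 then have "mev (%_. 0::'k) m = 0" unfolding mev_def by (intro prod_zero) (auto simp: in_keys_iff)
 then show ?thesis using False by simp
qed simp

text \<open>A product of two monomials is a single variable only if one of them is 1 and the other
  is that variable. In dual terms, \<open>lin x\<close> is a primitive functional.\<close>

lemma lin_deriv: "lin x (a * b) = lin x a * \<epsilon> b + \<epsilon> a * lin x b"
proof -
 have nz: "single v (1::nat) ~= 0" for v :: 'v by (metis keys_single keys_zero insert_not_empty zero_neq_one)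
 have sp: "(\<exists>v. m + m' = single v 1) \<longleftrightarrow> (m = 0 \<and> (\<exists>v. m' = single v 1)) \<or> (m' = 0 \<and> (\<exists>v. m = single v 1))"
  for m m' :: "'v \<Rightarrow>\<^sub>0 nat"
 proof
  assume "\<exists>v. m + m' = single v 1"
  then obtain v where v: "m + m' = single v 1" by blast
  have "mlen m + mlen m' = 1" using arg_cong[OF v, of mlen] by simp
  then have "mlen m = 0 \<or> mlen m' = 0" by linarith
  then have "m = 0 \<or> m' = 0" unfolding mlen_eq_0_iff .
  then show "(m = 0 \<and> (\<exists>v. m' = single v 1)) \<or> (m' = 0 \<and> (\<exists>v. m = single v 1))"
   using v by auto
 qed auto
 have s: "lin x (single m c * single m' d) = lin x (single m c) * \<epsilon> (single m' d) + \<epsilon> (single m c) * lin x (single m' d)"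
  for m m' c d
  unfolding mult_single lin_mono \<epsilon>_mono sp using nz by auto
 have s2: "lin x (single m c * b) = lin x (single m c) * \<epsilon> b + \<epsilon> (single m c) * lin x b" for m c
 proof -
  have "keys b <= UNIV" by simp
  then show ?thesis
  proof (induction rule: pm_induct)
   case (single g d) show ?case by (rule s)
  qed (simp_all add: distrib_left del: ev_simps(2) lin_simps(7))
 qed
 have "keys a <= UNIV" by simp
 then show ?thesis
 proof (induction rule: pm_induct)
  case (single g d) show ?case by (rule s2)
 qed (simp_all add: distrib_right del: ev_simps(2) lin_simps(7))
qed

lemma lin_one [simp]: "lin x 1 = 0"
 using lin_deriv[of x 1 1] by simp

text \<open>Derivations along \<open>\<epsilon>\<close> are determined by their values on the
  variables. Two primitive functionals, in particular a commutator and its expected value, need to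
  be compared only there.\<close>

lemma derivation_eqI:
 assumes d: "\<phi> : lin_hom HA K" "\<psi> : lin_hom HA K"
  "\<And>a b. a : carrier HA ==> b : carrier HA ==> \<phi> (a * b) = \<phi> a * \<epsilon> b + \<epsilon> a * \<phi> b"
  "\<And>a b. a : carrier HA ==> b : carrier HA ==> \<psi> (a * b) = \<psi> a * \<epsilon> b + \<epsilon> a * \<psi> b"
  and v: "\<And>v. v : X ==> \<phi> (single (single v 1) 1) = \<psi> (single (single v 1) 1)"
  and h: "h : carrier HA"
 shows "\<phi> h = \<psi> h"
proof -
 have o: "\<phi> 1 = 0" "\<psi> 1 = 0" using d(3,4)[OF HA_closed(4) HA_closed(4)] by simp_all
 have mono: "\<phi> (single m 1) = \<psi> (single m 1)" if "keys m <= X" for m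
  using that
 proof (induction rule: mono_induct)
  case zero show ?case using o by simp
 next
  case (add v m)
  have e: "single (single v 1 + m) (1::'k) = single (single v 1) 1 * single m 1"
   by (simp add: mult_single)
  have c: "single (single v 1) (1::'k) : carrier HA" "single m (1::'k) : carrier HA" using add by simp_all
  show ?case unfolding e d(3)[OF c] d(4)[OF c] v[OF add(1)] add(3) ..
 qed
 have "keys h <= monos" using h by simp
 then show ?thesis
 proof (induction rule: pm_induct)
  case zero show ?case using lin_hom_zero[OF d(1) HA(2) kmod_ground] lin_hom_zero[OF d(2) HA(2) kmod_ground] by simp
 next
  case (single m c)
  then show ?case using lin_homD(3)[OF d(1), of "single m 1" c] lin_homD(3)[OF d(2), of "single m 1" c] mono[of m] by simp
 next
  case (add z w)
  then show ?case using lin_homD(2)[OF d(1), of z w] lin_homD(2)[OF d(2), of z w] by simp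
 qed
qed

text \<open>\<open>op f h = (f \<otimes> id) (\<Delta> h)\<close>\<close>

definition op where "op x h = tensor_lift HA (%a b. pm_scale (lin x a) b) (\<Delta> h)"

lemma op_bil: "bil HA HA HA (%a b. pm_scale (lin x a) b)"
 by (rule bilI; simp add: keys_pm_scaleI pm_scale_distrib ac_simps)

lemma op_lin: "op x : lin_hom HA HA"
proof -
 have "(%h. tensor_lift HA (%a b. pm_scale (lin x a) b) (\<Delta> h)) : lin_hom HA HA"
  by (rule lin_hom_comp[OF \<Delta>_lin tensor_lift_lin_hom[OF HA(1) HA(1) HA(2) op_bil]])
 then show ?thesis by (simp add: op_def[abs_def])
qed

lemma op_apply:
 assumes g: "g : lin_hom HA K" and h: "h : carrier HA" shows "g (op x h) = tev (lin x) g (\<Delta> h)"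
proof -
 have "g (op x h) = tensor_lift K (%a b. g (pm_scale (lin x a) b)) (\<Delta> h)"
  unfolding op_def by (rule lin_hom_tensor_lift[OF HA(1) HA(1) HA(2) op_bil g kmod_ground \<Delta>(1)[OF h]])
 also have "\<dots> = tev (lin x) g (\<Delta> h)"
  by (rule tensor_lift_cong[OF HA(1) HA(1) kmod_ground bil_lin_hom[OF op_bil g] _ \<Delta>(1)[OF h]])
   (use lin_homD(3)[OF g] in \<open>simp add: HA_simps(4)[symmetric] del: HA_simps\<close>)
 finally show ?thesis .
qed

lemma conv_lin_op: "g : lin_hom HA K ==> h : carrier HA ==> conv (lin x) g h = g (op x h)"
 unfolding conv_def restrict_apply' by (rule op_apply[symmetric])

text \<open>The coproduct is multiplicative and \<open>lin x\<close> is a derivation along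
  \<open>\<epsilon>\<close>; the factors paired with \<open>\<epsilon>\<close> collapse by the
  counit axiom. \<open>op x\<close> is the invariant vector field with value \<open>x\<close> at the
  unit.\<close>

lemma op_deriv:
 assumes a: "a : carrier HA" and b: "b : carrier HA"
 shows "op x (a * b) = op x a * b + a * op x b"
proof -
 let ?L = "tensor_lift HA (%a b. pm_scale (lin x a) b)" and ?E = "tensor_lift HA (%a b. pm_scale (\<epsilon> a) b)"
 have eb: "bil HA HA HA (%a b. pm_scale (\<epsilon> a) b)" by (rule bilI; simp add: keys_pm_scaleI pm_scale_distrib ac_simps)
 note L = tensor_lift_lin_hom[OF HA(1) HA(1) HA(2) op_bil[of x]] and E = tensor_lift_lin_hom[OF HA(1) HA(1) HA(2) eb]
 note Lp = tensor_lift_pure[OF HA(1) HA(1) HA(2) op_bil[of x]] and Ep = tensor_lift_pure[OF HA(1) HA(1) HA(2) eb]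
 note bm = bil_mult[OF HA(1)]
 have "?L (t \<otimes>\<^bsub>TH\<^esub> u) = (?L t \<otimes>\<^bsub>HA\<^esub> ?E u) \<oplus>\<^bsub>HA\<^esub> (?E t \<otimes>\<^bsub>HA\<^esub> ?L u)"
  if t: "t : carrier TH" and u: "u : carrier TH" for t u
 proof (rule bil_tensor_eqI[OF HA(1) HA(1) HA(1) HA(1) HA(2) bil_lin_hom[OF bil_mult[OF T] L]
    bil_add[OF HA(2) bil_comp[OF bm L E] bil_comp[OF bm E L]] _ t u])
  fix p q r s assume c: "p : carrier HA" "q : carrier HA" "r : carrier HA" "s : carrier HA"
  have c2: "p \<otimes>\<^bsub>HA\<^esub> r : carrier HA" "q \<otimes>\<^bsub>HA\<^esub> s : carrier HA" unfolding HA_simps(2) by (rule HA_closed(3); fact)+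
  show "?L (pure_tensor HA HA p q \<otimes>\<^bsub>TH\<^esub> pure_tensor HA HA r s)
   = (?L (pure_tensor HA HA p q) \<otimes>\<^bsub>HA\<^esub> ?E (pure_tensor HA HA r s)) \<oplus>\<^bsub>HA\<^esub> (?E (pure_tensor HA HA p q) \<otimes>\<^bsub>HA\<^esub> ?L (pure_tensor HA HA r s))"
   unfolding pure_tensor_mult[OF HA(1) HA(1) c] Lp[OF c2] Lp[OF c(1,2)] Lp[OF c(3,4)] Ep[OF c(1,2)] Ep[OF c(3,4)]
   by (simp add: lin_deriv pm_scale_distrib pm_scale_mult ac_simps del: HA_simps(1))
 qed
 from this[OF \<Delta>(1)[OF a] \<Delta>(1)[OF b]] show ?thesis
  using ring_hom_mult[of \<Delta> HA "TH" a b] \<Delta>_alg_hom a b \<Delta>_hopf(2)[OF a] \<Delta>_hopf(2)[OF b]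
  by (simp add: op_def alg_hom_def del: HA_simps(1))
qed

lemma \<epsilon>_op: "h : carrier HA ==> \<epsilon> (op x h) = lin x h"
 unfolding op_apply[OF ev_lin] by (rule tev_counit(2)[OF lin_lin])

end

lemma keys_ma_mult_subset:
 assumes "keys z <= S" "keys w <= S'" "\<And>g h. g : S ==> h : S' ==> g \<otimes>\<^bsub>M\<^esub> h : S''"
 shows "keys (z \<otimes>\<^bsub>monoid_algebra M :: ('k::field, _) module\<^esub> w) <= S''"
 unfolding ma_mult_superset[OF finite_keys finite_keys order_refl order_refl]
 by (intro keys_sum_subset) (use assms in \<open>auto split: if_splits\<close>)

text \<open>The maps \<open>h |-> a f(h) b\<close> form a translation-stable family, and each of
  them vanishes on the relations because \<open>f\<close> does. Antimultiplicative maps are included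
  for the sake of the antipode.\<close>

lemma lext_mult_vanishes:
 fixes W :: "('k::field, 'w, 'n) module_scheme"
 assumes M: "monoid M" and W: "is_k_algebra W" and S: "S <= carrier (monoid_algebra M)"
  and f: "\<And>h. h : carrier M ==> f h : carrier W"
  and fm: "(\<forall>g\<in>carrier M. \<forall>h\<in>carrier M. f (g \<otimes>\<^bsub>M\<^esub> h) = f g \<otimes>\<^bsub>W\<^esub> f h) \<or>
   (\<forall>g\<in>carrier M. \<forall>h\<in>carrier M. f (g \<otimes>\<^bsub>M\<^esub> h) = f h \<otimes>\<^bsub>W\<^esub> f g)"
  and van: "\<And>s. s : S ==> lext W f s = \<zero>\<^bsub>W\<^esub>" and z: "z : Idl\<^bsub>monoid_algebra M\<^esub> S"
 shows "lext W f z = \<zero>\<^bsub>W\<^esub>"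
proof -
 interpret W: ring W by (rule is_k_algebraD[OF W])
 interpret M: monoid M by (rule M)
 note kW = is_k_algebraD(1)[OF W]
 let ?F = "{k. \<exists>a\<in>carrier W. \<exists>b\<in>carrier W. \<forall>h\<in>carrier M. k h = a \<otimes>\<^bsub>W\<^esub> f h \<otimes>\<^bsub>W\<^esub> b}"
 have FI: "k : ?F" if "a : carrier W" "b : carrier W" "\<And>h. h : carrier M ==> k h = a \<otimes>\<^bsub>W\<^esub> f h \<otimes>\<^bsub>W\<^esub> b" for a b k
  using that by (intro CollectI bexI[of _ a] bexI[of _ b] ballI)
 show ?thesis
 proof (rule lext_vanishes_on_genideal[OF M kW S, where \<F> = ?F])
  fix k assume "k : ?F"
  then obtain a b where ab: "a : carrier W" "b : carrier W" and k: "\<forall>h\<in>carrier M. k h = a \<otimes>\<^bsub>W\<^esub> f h \<otimes>\<^bsub>W\<^esub> b" by (elim CollectE bexE)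
  show "k h : carrier W" if "h : carrier M" for h using k that f[OF that] ab by simp
  fix g assume g: "g : carrier M"
  from fm show "(%h. k (g \<otimes>\<^bsub>M\<^esub> h)) : ?F"
  proof
   assume m: "\<forall>g\<in>carrier M. \<forall>h\<in>carrier M. f (g \<otimes>\<^bsub>M\<^esub> h) = f g \<otimes>\<^bsub>W\<^esub> f h"
   show ?thesis by (rule FI[of "a \<otimes>\<^bsub>W\<^esub> f g" b]) (use ab f g k m in \<open>simp_all add: W.m_assoc\<close>)
  next
   assume m: "\<forall>g\<in>carrier M. \<forall>h\<in>carrier M. f (g \<otimes>\<^bsub>M\<^esub> h) = f h \<otimes>\<^bsub>W\<^esub> f g"
   show ?thesis by (rule FI[of a "f g \<otimes>\<^bsub>W\<^esub> b"]) (use ab f g k m in \<open>simp_all add: W.m_assoc\<close>)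
  qed
  from fm show "(%h. k (h \<otimes>\<^bsub>M\<^esub> g)) : ?F"
  proof
   assume m: "\<forall>g\<in>carrier M. \<forall>h\<in>carrier M. f (g \<otimes>\<^bsub>M\<^esub> h) = f g \<otimes>\<^bsub>W\<^esub> f h"
   show ?thesis by (rule FI[of a "f g \<otimes>\<^bsub>W\<^esub> b"]) (use ab f g k m in \<open>simp_all add: W.m_assoc\<close>)
  next
   assume m: "\<forall>g\<in>carrier M. \<forall>h\<in>carrier M. f (g \<otimes>\<^bsub>M\<^esub> h) = f h \<otimes>\<^bsub>W\<^esub> f g"
   show ?thesis by (rule FI[of "a \<otimes>\<^bsub>W\<^esub> f g" b]) (use ab f g k m in \<open>simp_all add: W.m_assoc\<close>)
  qed
 next
  fix k s assume "k : ?F" and s: "s : S"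
  then obtain a b where ab: "a : carrier W" "b : carrier W" and k: "\<forall>h\<in>carrier M. k h = a \<otimes>\<^bsub>W\<^esub> f h \<otimes>\<^bsub>W\<^esub> b" by (elim CollectE bexE)
  have ks: "keys s <= carrier M" using S s by auto
  have l: "(%x. a \<otimes>\<^bsub>W\<^esub> x \<otimes>\<^bsub>W\<^esub> b) : lin_hom W W"
   by (rule lin_homI) (use ab in \<open>simp_all add: W.l_distr W.r_distr is_k_algebraD(4,5)[OF W]\<close>)
  have "lext W k s = lext W (%h. a \<otimes>\<^bsub>W\<^esub> f h \<otimes>\<^bsub>W\<^esub> b) s"
   by (rule lext_cong[OF _ kW]) (use ks k ab f in auto)
  also have "\<dots> = a \<otimes>\<^bsub>W\<^esub> lext W f s \<otimes>\<^bsub>W\<^esub> b" by (rule lin_hom_lext[OF kW _ l kW ks, symmetric]) (rule f)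
  finally show "lext W k s = \<zero>\<^bsub>W\<^esub>" using van[OF s] ab by simp
 next
  show "f : ?F" by (rule FI[of "\<one>\<^bsub>W\<^esub>" "\<one>\<^bsub>W\<^esub>"]) (simp_all add: f)
 qed (rule z)
qed

lemma single_one_inj: "single v (1::nat) = single w 1 \<longleftrightarrow> v = w"
proof
 assume "single v (1::nat) = single w 1"
 then have "keys (single v (1::nat)) = keys (single w (1::nat))" by simp
 then show "v = w" by simp
qed simp

lemma mlen_of_nat_mult: "mlen (of_nat k * d) = k * mlen (d :: expo)"
 by (induction k) (simp_all add: distrib_right)

section \<open>Commutators of primitive functionals\<close>

context poly_group
begin

definition pt :: "'v => 'v => 'k" where "pt u = (%v. if v = u then 1 else 0)"

lemma pt_Pts: "u : X ==> pt u : Pts" by (simp add: pt_def Pts_def)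

abbreviation BB :: "'v => 'v \<Rightarrow>\<^sub>0 'k" where "BB v \<equiv> single v 1"

lemma linB_mono: "lin (BB u) (single m c) = (if m = single u 1 then c else 0)"
 by (simp add: lookup_single when_def)

lemma linB_gr: "lin (BB u) a ~= 0 ==> a : gr \<beta> ==> \<beta> = deg u"
 using gr_lookup[of a \<beta> "single u 1"] by auto

lemma mev_pt: "mev (pt u) m = (if \<exists>k. m = single u k then 1 else 0)"
proof (cases "\<exists>k. m = single u k")
 case False
 have "\<not> keys m <= {u}"
 proof
  assume "keys m <= {u}"
  then have "m = single u (lookup m u)"
   by (intro poly_mapping_eqI) (auto simp: lookup_single when_def in_keys_iff subset_iff)
  with False show False by blast
 qed
 then obtain v where "v : keys m" "v ~= u" by blast
 then have "mev (pt u) m = 0" unfolding mev_def by (intro prod_zero) (auto simp: in_keys_iff pt_def)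
 with False show ?thesis by simp
qed (auto simp: pt_def)

declare lin_simps(7) [simp del]

lemma if_mult_0: "\<not> (A \<and> B) ==> (if A then c else 0) * (if B then d else 0) = (0::'k)"
 by auto

text \<open>A monomial is 1 at \<open>pt u\<close> if it is a power of \<open>u\<close> and 0
  otherwise; subtracting the value at the origin discards the power 0. As the degrees of
  \<open>u\<close> and \<open>w\<close> are nonzero, the degree condition forces both remaining
  exponents to be 1, so reading values and reading linear parts agree.\<close>

lemma linB_linB_mono:
 assumes "u : X" "w : X" "wt deg m + wt deg m' = deg u + deg w"
 shows "lin (BB u) (single m c) * lin (BB w) (single m' c') =
  (ev (pt u) (single m c) - \<epsilon> (single m c)) * (ev (pt w) (single m' c') - \<epsilon> (single m' c'))"
proof -
 have P: "ev (pt u) (single m c) - \<epsilon> (single m c) = (if \<exists>k>0. m = single u k then c else 0)" for u m c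
 proof (cases "m = 0")
  case True
  then have n: "\<nexists>k. k > 0 \<and> m = single u k" by (metis keys_single keys_zero insert_not_empty less_numeral_extra(3))
  show ?thesis by (subst if_not_P[OF n]) (simp add: True)
 next
  case False
  have "(\<exists>k>0. m = single u k) \<longleftrightarrow> (\<exists>k. m = single u k)"
  proof
   assume "\<exists>k. m = single u k"
   then obtain k where k: "m = single u k" by (elim exE)
   with False have "0 < k" by (cases k) simp_all
   with k show "\<exists>k>0. m = single u k" by (intro exI[of _ k] conjI)
  qed (elim exE conjE, rule exI)
  with False show ?thesis unfolding \<epsilon>_mono ev_simps mev_pt by simp
 qed
 have one: "m = single u 1 \<and> m' = single w 1"
  if m: "k > 0" "m = single u k" "l > 0" "m' = single w l" for k l
 proof -
  have "k * mlen (deg u) + l * mlen (deg w) = mlen (deg u) + mlen (deg w)"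
   using arg_cong[OF assms(3), of mlen] by (simp only: m(2,4) msum_simps msum_add mlen_of_nat_mult)
  moreover have "0 < mlen (deg u)" "0 < mlen (deg w)" unfolding neq0_conv[symmetric] mlen_eq_0_iff by (rule deg(2)[OF assms(1)], rule deg(2)[OF assms(2)])
  moreover have "k * mlen (deg u) \<ge> mlen (deg u)" "l * mlen (deg w) \<ge> mlen (deg w)" using m by simp_all
  ultimately have "k * mlen (deg u) = mlen (deg u)" "l * mlen (deg w) = mlen (deg w)" by linarith+
  then have "k = 1" "l = 1" using \<open>0 < mlen (deg u)\<close> \<open>0 < mlen (deg w)\<close> by simp_all
  with m show ?thesis by simp
 qed
 show ?thesis
 proof (cases "(\<exists>k>0. m = single u k) \<and> (\<exists>l>0. m' = single w l)")
  case True
  then obtain k l where "k > 0" "m = single u k" "l > 0" "m' = single w l" by blast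
  from one[OF this] True show ?thesis unfolding P linB_mono by simp
 next
  case False
  have nn: "\<not> (m = single u 1 \<and> m' = single w 1)"
  proof
   assume mm: "m = single u 1 \<and> m' = single w 1"
   have 1: "\<exists>k>0. m = single u k" using mm by (intro exI[of _ 1]) simp
   have 2: "\<exists>l>0. m' = single w l" using mm by (intro exI[of _ 1]) simp
   show False using False 1 2 by simp
  qed
  show ?thesis unfolding P linB_mono if_mult_0[OF nn] if_mult_0[OF False] ..
 qed
qed

lemma linB_linB:
 assumes u: "u : X" "w : X" and a: "a : gr \<beta>" and b: "b : gr \<gamma>" and d: "\<beta> + \<gamma> = deg u + deg w"
 shows "lin (BB u) a * lin (BB w) b = (ev (pt u) a - \<epsilon> a) * (ev (pt w) b - \<epsilon> b)"
proof -
 have ka: "keys a <= {m. keys m <= X \<and> wt deg m = \<beta>}" and kb: "keys b <= {m. keys m <= X \<and> wt deg m = \<gamma>}"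
  using a b by (simp_all add: pgr_def)
 have 1: "lin (BB u) (single m c) * lin (BB w) b = (ev (pt u) (single m c) - \<epsilon> (single m c)) * (ev (pt w) b - \<epsilon> b)"
  if m: "wt deg m = \<beta>" for m c
  using kb
 proof (induction rule: pm_induct)
  case (single m' c')
  show ?case by (rule linB_linB_mono[OF u]) (use single m d in simp)
 qed (simp_all add: distrib_left right_diff_distrib del: ev_simps(2) lin_simps(7))
 show ?thesis using ka
 proof (induction rule: pm_induct)
  case (single m c) then show ?case by (intro 1) simp
 next
  case (add z z')
  then show ?case by (simp only: lin_simps(3) ev_simps add_diff_add distrib_right)
 qed simp
qed

text \<open>The coefficient of \<open>g u * h w\<close> in coordinate \<open>v\<close> of the
  product of \<open>g\<close> and \<open>h\<close>. In the degree of \<open>v\<close> no other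
  product of a power of \<open>u\<close> in \<open>g\<close> with a power of \<open>w\<close> in
  \<open>h\<close> can occur, so the value at two points with one nonzero coordinate yields
  it.\<close>

definition lam where "lam v u w = (if deg v = deg u + deg w then gm (pt u) (pt w) v else 0)"

text \<open>In the right degree, linear parts are differences of values at \<open>pt\<close> and at
  the origin, which gives four evaluations of the coproduct. Those involving the origin are
  coordinates \<open>v\<close> of \<open>pt u\<close>, of \<open>pt w\<close> and of the origin;
  they vanish since \<open>v\<close> differs from \<open>u\<close> and \<open>w\<close> by
  degree.\<close>

lemma tev_linB_linB:
 assumes u: "u : X" and w: "w : X" and v: "v : X"
 shows "tev (lin (BB u)) (lin (BB w)) (\<Delta> (single (single v 1) 1)) = lam v u w"
proof (cases "deg v = deg u + deg w")
 case False
 have "tev (lin (BB u)) (lin (BB w)) (\<Delta> (single (single v 1) 1)) = 0"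
 proof (rule tev_gr_0[OF lin_lin lin_lin \<Delta>_gr[OF gr_var[OF v]]], rule ccontr)
  fix \<beta> \<gamma> x y assume "\<beta> + \<gamma> = deg v" "x : gr \<beta>" "y : gr \<gamma>" "lin (BB u) x * lin (BB w) y ~= 0"
  then have "\<beta> = deg u" "\<gamma> = deg w" "\<beta> + \<gamma> = deg v" using linB_gr[of u x \<beta>] linB_gr[of w y \<gamma>] by auto
  with False show False by simp
 qed
 with False show ?thesis by (simp add: lam_def)
next
 case True
 let ?x = "single (single v 1) (1::'k)"
 note tl = tev_lin_hom[OF HA(1) HA(1)] and tp = tev_pure[OF HA(1) HA(1)]
 have "tev (lin (BB u)) (lin (BB w)) t = E (pt u) (pt w) t - E (%_. 0) (pt w) t - E (pt u) (%_. 0) t + E (%_. 0) (%_. 0) t"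
  if "t : Tgr (deg u + deg w)" for t
  using that
 proof (induction rule: Tgr_induct)
  case zero show ?case unfolding lin_hom_zero[OF tl[OF lin_lin lin_lin] kT kmod_ground] E_zero by simp
 next
  case (pure \<beta> \<gamma> a b)
  have c: "a : carrier HA" "b : carrier HA" using subsetD[OF gr_subset pure(1)] subsetD[OF gr_subset pure(2)] by simp_all
  have 1: "tev (lin (BB u)) (lin (BB w)) (pure_tensor HA HA a b) = lin (BB u) a * lin (BB w) b" by (rule tp[OF lin_lin lin_lin c])
  have 2: "E g h (pure_tensor HA HA a b) = ev g a * ev h b" for g h by (rule E_pure[OF c])
  show ?case by (rule trans[OF 1]) (simp only: 2 linB_linB[OF u w pure], simp add: algebra_simps)
 next
  case (add t t')
  show ?case unfolding lin_homD(2)[OF tl[OF lin_lin lin_lin] subsetD[OF Tgr_carrier add(1)] subsetD[OF Tgr_carrier add(2)]]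
    E_add[OF add(1,2)] add(3,4) ground_field_simps by simp
 qed
 from this[of "\<Delta> ?x"] have "tev (lin (BB u)) (lin (BB w)) (\<Delta> ?x) =
   E (pt u) (pt w) (\<Delta> ?x) - E (%_. 0) (pt w) (\<Delta> ?x) - E (pt u) (%_. 0) (\<Delta> ?x) + E (%_. 0) (%_. 0) (\<Delta> ?x)"
  using \<Delta>_gr[OF gr_var[OF v]] True by simp
 also have "\<dots> = gm (pt u) (pt w) v - pt w v - pt u v + 0"
  using v pt_Pts[OF u] pt_Pts[OF w] by (simp add: \<Delta>(2) gm)
 moreover have "pt w v = 0" "pt u v = 0" using True deg(2)[OF u] deg(2)[OF w] by (auto simp: pt_def)
 ultimately show ?thesis using True by (simp add: lam_def)
qed

lemma tev_lin_lin:
 assumes x: "keys x <= X" and y: "keys y <= X" and v: "v : X"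
 shows "tev (lin x) (lin y) (\<Delta> (single (single v 1) 1)) =
  (\<Sum>u\<in>keys x. \<Sum>w\<in>keys y. lookup x u * lookup y w * lam v u w)"
proof -
 let ?x = "single (single v 1) (1::'k)"
 have xc: "?x : carrier HA" using v by simp
 \<comment> \<open>A finite sum of pure tensors for the coproduct of the variable exhibits the
   pairing as a bilinear expression in the two functionals.\<close>
 obtain ps where ps: "set ps <= carrier HA \<times> carrier HA" "\<Delta> ?x = tsum HA HA ps"
  using tensor_tsum[OF HA(1) HA(1) \<Delta>(1)[OF xc]] by blast
 have t: "tev f g (\<Delta> ?x) = (\<Sum>p\<leftarrow>ps. f (fst p) * g (snd p))" if "f : lin_hom HA K" "g : lin_hom HA K" for f g
  unfolding ps(2) by (rule tev_tsum[OF HA(1) HA(1) that ps(1)])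
 note tl = t[OF lin_lin lin_lin]
 note ll = lext_single[OF kmod_ground, of UNIV, simplified] lext_add[OF kmod_ground, of UNIV, simplified] lext_zero[OF kmod_ground, of UNIV, simplified]
 have sm: "(\<Sum>p\<leftarrow>ps. (c * f p) * g p) = c * (\<Sum>p\<leftarrow>ps. f p * g p)" "(\<Sum>p\<leftarrow>ps. f p * (c * g p)) = c * (\<Sum>p\<leftarrow>ps. f p * g p)" for c :: 'k and f g
  unfolding sum_list_const_mult[symmetric] by (simp_all add: ac_simps)
 have B: "tev (lin (BB u)) (lin y) (\<Delta> ?x) = lext K (%w. lam v u w) y" if u: "u : X" for u
  using y
 proof (induction rule: pm_induct)
  case zero show ?case unfolding tl by (simp add: ll)
 next
  case (single w c)
  have e: "tev (lin (BB u)) (lin (single w c)) (\<Delta> ?x) = c * tev (lin (BB u)) (lin (BB w)) (\<Delta> ?x)"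
   unfolding tl sm(2)[symmetric] by (simp add: lin_simps(7))
  have "c * tev (lin (BB u)) (lin (BB w)) (\<Delta> ?x) = lext K (%w. lam v u w) (single w c)"
   unfolding tev_linB_linB[OF u single v] by (simp add: ll)
  with e show ?case by (rule trans)
 next
  case (add y y')
  then show ?case unfolding tl by (simp add: ll distrib_left sum_list_addf)
 qed
 have "tev (lin x) (lin y) (\<Delta> ?x) = lext K (%u. lext K (%w. lam v u w) y) x"
  using x
 proof (induction rule: pm_induct)
  case zero show ?case unfolding tl by (simp add: ll)
 next
  case (single u c)
  have e: "tev (lin (single u c)) (lin y) (\<Delta> ?x) = c * tev (lin (BB u)) (lin y) (\<Delta> ?x)"
   unfolding tl sm(1)[symmetric] by (simp add: lin_simps(7))
  have "c * tev (lin (BB u)) (lin y) (\<Delta> ?x) = lext K (%u. lext K (%w. lam v u w) y) (single u c)"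
   unfolding B[OF single] by (simp add: ll)
  with e show ?case by (rule trans)
 next
  case (add x x')
  then show ?case unfolding tl by (simp add: ll distrib_right sum_list_addf)
 qed
 also have "\<dots> = (\<Sum>u\<in>keys x. \<Sum>w\<in>keys y. lookup x u * lookup y w * lam v u w)"
  by (simp add: lext_ground sum_distrib_left mult.assoc)
 finally show ?thesis .
qed

text \<open>A single convolution also produces the mixed terms
  \<open>lin x a * lin y b + lin y a * lin x b\<close>; these are symmetric in \<open>x\<close> and
  \<open>y\<close> and cancel in the commutator.\<close>

lemma commutator_deriv:
 assumes a: "a : carrier HA" and b: "b : carrier HA"
 shows "conv (lin x) (lin y) (a * b) - conv (lin y) (lin x) (a * b) =
  (conv (lin x) (lin y) a - conv (lin y) (lin x) a) * \<epsilon> b + \<epsilon> a * (conv (lin x) (lin y) b - conv (lin y) (lin x) b)"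
proof -
 have c: "op x a : carrier HA" "op x b : carrier HA" for x by (rule lin_homD(1)[OF op_lin], fact)+
 have ab: "a * b : carrier HA" by (rule HA_closed(3)[OF a b])
 have s: "lin x (h + k) = lin x h + lin x k" for x h k by (rule lin_simps)
 show ?thesis
  unfolding conv_lin_op[OF lin_lin ab] conv_lin_op[OF lin_lin a] conv_lin_op[OF lin_lin b] op_deriv[OF a b] s lin_deriv
   \<epsilon>_op[OF a] \<epsilon>_op[OF b] by (simp add: algebra_simps)
qed

text \<open>Both sides are derivations along \<open>\<epsilon>\<close>, and the condition on
  \<open>z\<close> says that they agree on the variables.\<close>

lemma lin_commutator:
 assumes x: "keys x <= X" and y: "keys y <= X"
  and z: "\<And>v. v : X ==> lookup z v = (\<Sum>u\<in>keys x. \<Sum>w\<in>keys y.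
    lookup x u * lookup y w * (lam v u w - lam v w u))"
  and h: "h : carrier HA"
 shows "lin z h = conv (lin x) (lin y) h - conv (lin y) (lin x) h"
proof (rule derivation_eqI[OF lin_lin _ _ _ _ h])
 note l1 = conv_lin[OF lin_lin lin_lin, of x y] and l2 = conv_lin[OF lin_lin lin_lin, of y x]
 show "(%h. conv (lin x) (lin y) h - conv (lin y) (lin x) h) : lin_hom HA K"
  by (rule lin_homI) (simp_all add: lin_homD[OF l1] lin_homD[OF l2] algebra_simps del: HA_simps)
 fix v assume v: "v : X"
 let ?x = "single (single v 1) (1::'k)"
 have xc: "?x : carrier HA" using v by simp
 have lz: "lin z ?x = lookup z v"
  unfolding lin_mono single_one_inj by simp
 show "lin z ?x = conv (lin x) (lin y) ?x - conv (lin y) (lin x) ?x"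
  unfolding lz z[OF v] conv_def restrict_apply'[OF xc] tev_lin_lin[OF x y v] tev_lin_lin[OF y x v]
  by (subst (2) sum.swap) (simp add: right_diff_distrib sum_subtractf mult.commute)
next
 fix a b assume "a : carrier HA" "b : carrier HA"
 then show "conv (lin x) (lin y) (a * b) - conv (lin y) (lin x) (a * b) =
  (conv (lin x) (lin y) a - conv (lin y) (lin x) a) * \<epsilon> b + \<epsilon> a * (conv (lin x) (lin y) b - conv (lin y) (lin x) b)"
  by (rule commutator_deriv)
qed (rule lin_deriv)

subsubsection \<open>Triangularity\<close>

text \<open>The power \<open>l\<close> of the augmentation ideal, that is, of the ideal of
  polynomials without constant term.\<close>

definition Il :: "nat => (('v \<Rightarrow>\<^sub>0 nat) \<Rightarrow>\<^sub>0 'k) set" where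
 "Il l = {z. keys z <= {m. keys m <= X \<and> l \<le> mlen m}}"

lemma Il_add: "a : Il l ==> b : Il l ==> a + b : Il l"
 by (simp add: Il_def keys_addI)

lemma Il_mult: "a : Il l ==> b : Il k ==> a * b : Il (l + k)"
 unfolding Il_def mem_Collect_eq by (erule keys_mult_subset, assumption) auto

lemma Il_single: "keys m <= X ==> l \<le> mlen m ==> single m c : Il l"
 by (simp add: Il_def)

lemma \<epsilon>_lookup: "\<epsilon> h = lookup h 0"
proof -
 have "keys h <= UNIV" by simp
 then show ?thesis
 proof (induction rule: pm_induct)
  case (single m c) show ?case unfolding \<epsilon>_mono by (simp add: lookup_single when_def)
 qed (simp_all add: lookup_add)
qed

lemma op_one: "op x 1 = 0"
 using op_deriv[OF HA_closed(4) HA_closed(4), of x] by simp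

text \<open>Modulo longer terms the derivation is the partial derivative with respect to
  \<open>v\<close>: on variables it is so up to polynomials without constant term, and the product
  rule propagates this. If \<open>v\<close> does not divide \<open>m\<close>, the truncated
  difference is \<open>m\<close>, but its coefficient is 0.\<close>

lemma op_mono:
 assumes "keys m <= X"
 shows "op (BB v) (single m 1) - single (m - single v 1) (of_nat (lookup m v)) : Il (mlen m)"
 using assms
proof (induction rule: mono_induct)
 case zero show ?case using op_one[of "BB v"] by (simp add: Il_def)
next
 case (add u m)
 let ?xu = "single (single u 1) (1::'k)" and ?xm = "single m (1::'k)"
 define \<delta> where "\<delta> = (if u = v then 1 else 0 :: nat)"
 define t where "t = single (m - single v 1) (of_nat (lookup m v) :: 'k)"
 define r1 where "r1 = op (BB v) ?xu - single 0 (of_nat \<delta>)"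
 define r2 where "r2 = op (BB v) ?xm - t"
 have c: "?xu : carrier HA" "?xm : carrier HA" using add by simp_all
 have r1: "r1 : Il 1"
 proof -
  have oc: "op (BB v) ?xu : carrier HA" by (rule lin_homD(1)[OF op_lin c(1)])
  have "lookup (op (BB v) ?xu) 0 = of_nat \<delta>"
   unfolding \<epsilon>_lookup[symmetric] \<epsilon>_op[OF c(1)] linB_mono \<delta>_def single_one_inj by simp
  then have "0 \<notin> keys r1" by (simp add: r1_def in_keys_iff lookup_minus lookup_of_nat)
  moreover have "keys r1 <= monos"
   unfolding r1_def diff_conv_add_uminus uminus_eq_pm_scale
   by (intro keys_addI keys_pm_scaleI) (use oc in \<open>simp_all del: single_of_nat\<close>)
  ultimately have "keys m <= X \<and> 1 \<le> mlen m" if "m : keys r1" for m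
   using that mlen_eq_0_iff[of m] by (cases "m = 0") (auto simp: Suc_le_eq simp del: mlen_eq_0_iff)
  then show ?thesis unfolding Il_def by blast
 qed
 have eq: "single 0 (of_nat \<delta>) * ?xm + ?xu * t = single (single u 1 + m - single v 1)
   (of_nat (lookup (single u 1 + m) v))"
 proof (cases "lookup m v = 0")
  case True
  then show ?thesis by (cases "u = v") (simp_all add: t_def \<delta>_def mult_single lookup_add lookup_single when_def)
 next
  case False
  then have v: "single v 1 + (m - single v 1) = m" by (intro mono_decompose) (simp add: in_keys_iff)
  have uv: "single u 1 + (m - single v 1) = single u 1 + m - single v 1"
   by (rule poly_mapping_eqI) (use False in \<open>auto simp: lookup_add lookup_minus lookup_single when_def\<close>)
  show ?thesis
  proof (cases "u = v")
   case True
   then show ?thesis using v by (simp add: t_def \<delta>_def mult_single lookup_add lookup_single when_def single_add[symmetric])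
  next
   case False
   then show ?thesis using uv by (simp add: t_def \<delta>_def mult_single lookup_add lookup_single when_def)
  qed
 qed
 have "op (BB v) (?xu * ?xm) = op (BB v) ?xu * ?xm + ?xu * op (BB v) ?xm" by (rule op_deriv[OF c])
 also have "\<dots> = (single 0 (of_nat \<delta>) * ?xm + ?xu * t) + (r1 * ?xm + ?xu * r2)"
  by (simp add: r1_def r2_def algebra_simps)
 finally have "op (BB v) (single (single u 1 + m) 1) - single (single u 1 + m - single v 1)
   (of_nat (lookup (single u 1 + m) v)) = r1 * ?xm + ?xu * r2"
  unfolding eq by (simp add: mult_single)
 moreover have "r1 * ?xm : Il (1 + mlen m)" by (rule Il_mult[OF r1 Il_single]) (use add in simp_all)
 moreover have "?xu * r2 : Il (1 + mlen m)" by (rule Il_mult[OF Il_single]) (use add in \<open>simp_all add: r2_def t_def\<close>)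
 ultimately show ?case using Il_add by simp
qed

end

text \<open>The last condition says that \<open>br\<close> is, in coordinates, the commutator of the
  primitive functionals of the group.\<close>

locale env_group = poly_group X deg n gm gi
 for X :: "'v set" and deg and n and gm :: "('v => 'k::field_char_0) => ('v => 'k) => 'v => 'k" and gi +
 fixes L :: "('k, 'v \<Rightarrow>\<^sub>0 'k) module" and br :: "('v \<Rightarrow>\<^sub>0 'k) => ('v \<Rightarrow>\<^sub>0 'k) => ('v \<Rightarrow>\<^sub>0 'k)"
 assumes L: "carrier L = {x. keys x <= X}" "x \<oplus>\<^bsub>L\<^esub> y = x + y" "c \<odot>\<^bsub>L\<^esub> x = pm_scale c x"
  and br_closed: "keys x <= X ==> keys y <= X ==> keys (br x y) <= X"
  and br_coeff: "keys x <= X ==> keys y <= X ==> v : X ==>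
   lookup (br x y) v = (\<Sum>u\<in>keys x. \<Sum>w\<in>keys y.
    lookup x u * lookup y w * (lam v u w - lam v w u))"
begin

section \<open>Presentation and universal property of the enveloping algebra\<close>

abbreviation "LC \<equiv> {x :: 'v \<Rightarrow>\<^sub>0 'k. keys x <= X}"
abbreviation "UM \<equiv> list_monoid (carrier L)"
abbreviation "UR \<equiv> monoid_algebra UM :: ('k, ('v \<Rightarrow>\<^sub>0 'k) list \<Rightarrow>\<^sub>0 'k) module"
abbreviation "UI \<equiv> Idl\<^bsub>UR\<^esub> (env_relations L br)"
abbreviation "UA \<equiv> env_algebra L br"
abbreviation "cl \<equiv> env_class L br"

lemma UM_simps [simp]: "carrier UM = lists LC" "w \<otimes>\<^bsub>UM\<^esub> w' = w @ w'" "\<one>\<^bsub>UM\<^esub> = []"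
 by (simp_all add: list_monoid_def L)

lemma monoid_UM: "monoid UM"
 by (rule monoidI) simp_all

lemma env_relations_cases [consumes 1]:
 assumes "s : env_relations L br"
 obtains x y where "s = single [x + y] 1 - single [x] 1 - single [y] 1" "x : LC" "y : LC"
  | c x where "s = single [pm_scale c x] 1 - single [x] c" "x : LC"
  | x y where "s = single [x, y] 1 - single [y, x] 1 - single [br x y] 1" "x : LC" "y : LC"
 using assms unfolding env_relations_def Let_def pm_scale_single mult_1_right L by blast

lemma keys_diffI:
 "keys z <= C ==> keys w <= C ==> keys (z - w :: 'a \<Rightarrow>\<^sub>0 'k) <= C"
 unfolding diff_conv_add_uminus uminus_eq_pm_scale by (intro keys_addI keys_pm_scaleI)

lemma keys_word: "w : lists LC ==> keys (single w (c::'k)) <= lists LC" by simp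

lemma LC_closed: "x : LC ==> y : LC ==> x + y : LC" "x : LC ==> pm_scale c x : LC" "x : LC ==> y : LC ==> br x y : LC"
 "0 : LC"
 by (simp_all add: keys_addI keys_pm_scaleI br_closed)

lemma wordsI: "x : LC ==> [x] : lists LC" "x : LC ==> y : LC ==> [x, y] : lists LC"
 by simp_all

lemma env_relations_carrier: "env_relations L br <= carrier UR"
proof
 fix s assume "s : env_relations L br"
 then have "keys s <= lists LC"
 proof (cases rule: env_relations_cases)
  case (1 x y) show ?thesis unfolding 1(1) by (intro keys_diffI keys_word wordsI LC_closed 1)
 next
  case (2 c x) show ?thesis unfolding 2(1) by (intro keys_diffI keys_word wordsI LC_closed 2)
 next
  case (3 x y) show ?thesis unfolding 3(1) by (intro keys_diffI keys_word wordsI LC_closed 3)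
 qed
 then show "s : carrier UR" by simp
qed

lemma ideal_UI: "ideal UI UR"
 by (rule ring.genideal_ideal[OF ring_monoid_algebra[OF monoid_UM] env_relations_carrier])

lemmas URI = is_k_algebra_monoid_algebra[OF monoid_UM] ideal_UI

lemma UA_k: "is_k_algebra UA"
 unfolding env_algebra_def by (rule is_k_algebra_quotient[OF URI])

lemma UA_carrier: "carrier UA = cl ` {z. keys z <= lists LC}"
 by (simp add: env_algebra_def quotient_algebra_simps(1) env_class_def[abs_def])

lemma cl_hom:
 assumes "keys z <= lists LC" "keys w <= lists LC"
 shows "cl z \<oplus>\<^bsub>UA\<^esub> cl w = cl (z + w)" "cl z \<otimes>\<^bsub>UA\<^esub> cl w = cl (z \<otimes>\<^bsub>UR\<^esub> w)" "c \<odot>\<^bsub>UA\<^esub> cl z = cl (pm_scale c z)"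
 using quotient_hom[OF URI, of z w] assms by (auto simp: env_algebra_def env_class_def)

lemma cl_one_zero: "\<one>\<^bsub>UA\<^esub> = cl (single [] 1)" "\<zero>\<^bsub>UA\<^esub> = cl 0"
 using quotient_one_zero[OF URI] by (simp_all add: env_algebra_def env_class_def)

lemma cl_rel:
 assumes "z - w : env_relations L br" "keys z <= lists LC" "keys w <= lists LC"
 shows "cl z = cl w"
proof -
 have "z \<ominus>\<^bsub>UR\<^esub> w = z - w"
  using kmod_uminus[OF is_k_algebraD(1)[OF URI(1)], of w] assms(3) by (simp add: a_minus_def uminus_eq_pm_scale[symmetric])
 then have "z \<ominus>\<^bsub>UR\<^esub> w : UI" using ring.genideal_self[OF ring_monoid_algebra[OF monoid_UM] env_relations_carrier] assms(1) by auto
 then show ?thesis unfolding env_class_def using coset_eq_iff[OF URI, of z w] assms(2,3) by simp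
qed

definition wd where "wd w = cl (single w 1)"

lemma wd_closed: "w : lists LC ==> wd w : carrier UA"
 unfolding wd_def UA_carrier by (intro imageI CollectI keys_word)

lemma wd_append: "w : lists LC ==> w' : lists LC ==> wd (w @ w') = wd w \<otimes>\<^bsub>UA\<^esub> wd w'"
 unfolding wd_def by (subst cl_hom(2)) (simp_all add: ma_mult_single)

lemma wd_Cons: "x : LC ==> w : lists LC ==> wd (x # w) = wd [x] \<otimes>\<^bsub>UA\<^esub> wd w"
 using wd_append[of "[x]" w] by simp

lemma wd_add: assumes "x : LC" "y : LC" shows "wd [x + y] = wd [x] \<oplus>\<^bsub>UA\<^esub> wd [y]"
proof -
 have r: "single [x + y] 1 - (single [x] 1 + single [y] 1) : env_relations L br"
  unfolding env_relations_def Let_def L diff_diff_add[symmetric] using assms by blast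
 show ?thesis unfolding wd_def cl_hom(1)[OF keys_word[OF wordsI(1)[OF assms(1)]] keys_word[OF wordsI(1)[OF assms(2)]]]
  by (rule cl_rel[OF r]) (intro keys_addI keys_word wordsI LC_closed assms)+
qed

lemma wd_scale: assumes "x : LC" shows "wd [pm_scale c x] = c \<odot>\<^bsub>UA\<^esub> wd [x]"
proof -
 have r: "single [pm_scale c x] 1 - pm_scale c (single [x] 1) : env_relations L br"
  unfolding env_relations_def Let_def L using assms by blast
 show ?thesis unfolding wd_def cl_hom(3)[OF keys_word[OF wordsI(1)[OF assms]] keys_word[OF wordsI(1)[OF assms]]]
  by (rule cl_rel[OF r]) (intro keys_pm_scaleI keys_word wordsI LC_closed assms)+
qed

lemma wd_br: assumes "x : LC" "y : LC" shows "wd [x, y] = wd [y, x] \<oplus>\<^bsub>UA\<^esub> wd [br x y]"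
proof -
 have r: "single [x, y] 1 - (single [y, x] 1 + single [br x y] 1) : env_relations L br"
  unfolding env_relations_def Let_def L diff_diff_add[symmetric] using assms by blast
 show ?thesis unfolding wd_def cl_hom(1)[OF keys_word[OF wordsI(2)[OF assms(2,1)]] keys_word[OF wordsI(1)[OF LC_closed(3)[OF assms]]]]
  by (rule cl_rel[OF r]) (intro keys_addI keys_word wordsI LC_closed assms)+
qed

text \<open>The universal property of the enveloping algebra, for multiplicative and for antimultiplicative maps.\<close>

context
 fixes W :: "('k, 'w, 'm) module_scheme" and f :: "('v \<Rightarrow>\<^sub>0 'k) list => 'w"
 assumes W: "is_k_algebra W" and f: "\<And>w. w : lists LC ==> f w : carrier W"
  and fm: "(\<forall>w\<in>lists LC. \<forall>w'\<in>lists LC. f (w @ w') = f w \<otimes>\<^bsub>W\<^esub> f w') \<or> (\<forall>w\<in>lists LC. \<forall>w'\<in>lists LC. f (w @ w') = f w' \<otimes>\<^bsub>W\<^esub> f w)"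
  and fr: "\<And>x y. x : LC ==> y : LC ==> f [x + y] = f [x] \<oplus>\<^bsub>W\<^esub> f [y]" "\<And>c x. x : LC ==> f [pm_scale c x] = c \<odot>\<^bsub>W\<^esub> f [x]"
   "\<And>x y. x : LC ==> y : LC ==> f [x, y] = f [y, x] \<oplus>\<^bsub>W\<^esub> f [br x y]"
begin

lemma lext_UI: "z : UI ==> lext W f z = \<zero>\<^bsub>W\<^esub>"
proof (rule lext_mult_vanishes[OF monoid_UM W env_relations_carrier])
 note kW = is_k_algebraD(1)[OF W]
 interpret W: abelian_group W by (rule kmodD(1)[OF kW])
 fix s assume s: "s : env_relations L br"
 have ls: "lext W f (single w c) = c \<odot>\<^bsub>W\<^esub> f w" if "w : lists LC" for w c
  by (rule lext_single[OF kW _ that]) (rule f)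
 have ld: "lext W f (z - w) = lext W f z \<ominus>\<^bsub>W\<^esub> lext W f w" if "keys z <= lists LC" "keys w <= lists LC" for z w
  by (rule lext_diff[OF kW _ that]) (rule f)
 have m: "(a \<oplus>\<^bsub>W\<^esub> b) \<ominus>\<^bsub>W\<^esub> a \<ominus>\<^bsub>W\<^esub> b = \<zero>\<^bsub>W\<^esub>" if "a : carrier W" "b : carrier W" for a b
 proof -
  have "(a \<oplus>\<^bsub>W\<^esub> b) \<ominus>\<^bsub>W\<^esub> a \<ominus>\<^bsub>W\<^esub> b = (a \<oplus>\<^bsub>W\<^esub> b) \<oplus>\<^bsub>W\<^esub> (\<ominus>\<^bsub>W\<^esub> a \<oplus>\<^bsub>W\<^esub> \<ominus>\<^bsub>W\<^esub> b)"
   using that by (simp add: a_minus_def W.a_assoc)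
  also have "\<dots> = (a \<oplus>\<^bsub>W\<^esub> b) \<oplus>\<^bsub>W\<^esub> \<ominus>\<^bsub>W\<^esub> (a \<oplus>\<^bsub>W\<^esub> b)" using that by (simp add: W.minus_add)
  also have "\<dots> = \<zero>\<^bsub>W\<^esub>" using that by (intro W.r_neg) simp
  finally show ?thesis .
 qed
 have m2: "a \<ominus>\<^bsub>W\<^esub> a = \<zero>\<^bsub>W\<^esub>" if "a : carrier W" for a using that by (simp add: a_minus_def W.r_neg)
 from s show "lext W f s = \<zero>\<^bsub>W\<^esub>"
 proof (cases rule: env_relations_cases)
  case (1 x y)
  note w = wordsI(1)[OF LC_closed(1)[OF 1(2,3)]] wordsI(1)[OF 1(2)] wordsI(1)[OF 1(3)]
  show ?thesis unfolding 1(1) ld[OF keys_diffI[OF keys_word[OF w(1)] keys_word[OF w(2)]] keys_word[OF w(3)]] ld[OF keys_word[OF w(1)] keys_word[OF w(2)]]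
    ls[OF w(1)] ls[OF w(2)] ls[OF w(3)] kmodD(6)[OF kW f[OF w(1)]] kmodD(6)[OF kW f[OF w(2)]] kmodD(6)[OF kW f[OF w(3)]] fr(1)[OF 1(2,3)] kmodD(6)[OF kW W.a_closed[OF f[OF w(2)] f[OF w(3)]]]
   by (rule m[OF f[OF w(2)] f[OF w(3)]])
 next
  case (2 c x)
  note w = wordsI(1)[OF LC_closed(2)[OF 2(2), of c]] wordsI(1)[OF 2(2)]
  show ?thesis unfolding 2(1) ld[OF keys_word[OF w(1)] keys_word[OF w(2)]] ls[OF w(1)] ls[OF w(2)] kmodD(6)[OF kW kmodD(2)[OF kW f[OF w(2)]]] fr(2)[OF 2(2)]
   by (rule m2[OF kmodD(2)[OF kW f[OF w(2)]]])
 next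
  case (3 x y)
  note w = wordsI(2)[OF 3(2,3)] wordsI(2)[OF 3(3,2)] wordsI(1)[OF LC_closed(3)[OF 3(2,3)]]
  show ?thesis unfolding 3(1) ld[OF keys_diffI[OF keys_word[OF w(1)] keys_word[OF w(2)]] keys_word[OF w(3)]] ld[OF keys_word[OF w(1)] keys_word[OF w(2)]]
    ls[OF w(1)] ls[OF w(2)] ls[OF w(3)] kmodD(6)[OF kW f[OF w(1)]] kmodD(6)[OF kW f[OF w(2)]] kmodD(6)[OF kW f[OF w(3)]] fr(3)[OF 3(2,3)] kmodD(6)[OF kW W.a_closed[OF f[OF w(2)] f[OF w(3)]]]
   by (rule m[OF f[OF w(2)] f[OF w(3)]])
 qed
qed (use f fm in simp_all)

lemma induced_cl: "keys z <= lists LC ==> induced W f (cl z) = lext W f z"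
 unfolding env_class_def
 by (rule induced_coset[OF monoid_UM ideal_UI is_k_algebraD(1)[OF W]]) (simp_all add: f lext_UI)

lemma induced_wd: "w : lists LC ==> induced W f (wd w) = f w"
 unfolding wd_def induced_cl[OF keys_word]
 by (subst lext_single[OF is_k_algebraD(1)[OF W], where C = "lists LC"]) (simp_all add: f kmodD(6)[OF is_k_algebraD(1)[OF W]])

lemma induced_lin: "induced W f : lin_hom UA W"
proof (rule lin_homI)
 note kW = is_k_algebraD(1)[OF W]
 fix x c assume "x : carrier UA"
 then obtain z where z: "x = cl z" "keys z <= lists LC" unfolding UA_carrier by (elim imageE CollectE)
 show "induced W f x : carrier W" unfolding z(1) induced_cl[OF z(2)] by (rule lext_closed[OF kW _ z(2)]) (rule f)
 show "induced W f (c \<odot>\<^bsub>UA\<^esub> x) = c \<odot>\<^bsub>W\<^esub> induced W f x"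
  unfolding z(1) cl_hom(3)[OF z(2) z(2)] induced_cl[OF z(2)] induced_cl[OF keys_pm_scaleI[OF z(2)]] by (rule lext_scale[OF kW _ z(2)]) (rule f)
 fix y assume "y : carrier UA"
 then obtain w where w: "y = cl w" "keys w <= lists LC" unfolding UA_carrier by (elim imageE CollectE)
 show "induced W f (x \<oplus>\<^bsub>UA\<^esub> y) = induced W f x \<oplus>\<^bsub>W\<^esub> induced W f y"
  unfolding z(1) w(1) cl_hom(1)[OF z(2) w(2)] induced_cl[OF z(2)] induced_cl[OF w(2)] induced_cl[OF keys_addI[OF z(2) w(2)]]
  by (rule lext_add[OF kW _ z(2) w(2)]) (rule f)
qed

end

lemma UA_induct [consumes 1, case_names zero word add]:
 assumes u: "u : carrier UA" and "P \<zero>\<^bsub>UA\<^esub>" "\<And>c w. w : lists LC ==> P (c \<odot>\<^bsub>UA\<^esub> wd w)"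
  "\<And>u u'. u : carrier UA ==> u' : carrier UA ==> P u ==> P u' ==> P (u \<oplus>\<^bsub>UA\<^esub> u')"
 shows "P u"
proof -
 obtain z where z: "u = cl z" "keys z <= lists LC" using u unfolding UA_carrier by (elim imageE CollectE)
 show ?thesis unfolding z(1) using z(2)
 proof (induction rule: pm_induct)
  case zero show ?case using assms(2) by (simp add: cl_one_zero)
 next
  case (single w c)
  have "cl (single w c) = c \<odot>\<^bsub>UA\<^esub> wd w" unfolding wd_def cl_hom(3)[OF keys_word[OF single] keys_word[OF single]] by simp
  with assms(3)[OF single] show ?case by simp
 next
  case (add z w)
  show ?case unfolding cl_hom(1)[OF add(1,2), symmetric]
   by (rule assms(4)) (use add in \<open>auto simp: UA_carrier\<close>)
 qed
qed

lemma lin_hom_UA_eqI: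
 assumes "\<phi> : lin_hom UA W" "\<psi> : lin_hom UA W" "kmod W" "\<And>w. w : lists LC ==> \<phi> (wd w) = \<psi> (wd w)" "u : carrier UA"
 shows "\<phi> u = \<psi> u"
 using assms(5)
proof (induction rule: UA_induct)
 case zero show ?case using lin_hom_zero[OF assms(1) is_k_algebraD(1)[OF UA_k] assms(3)] lin_hom_zero[OF assms(2) is_k_algebraD(1)[OF UA_k] assms(3)] by simp
next
 case (word c w) then show ?case by (simp add: lin_homD(3)[OF assms(1) wd_closed] lin_homD(3)[OF assms(2) wd_closed] assms(4))
next
 case (add u u') then show ?case by (simp add: lin_homD(2)[OF assms(1)] lin_homD(2)[OF assms(2)])
qed

subsubsection \<open>Spanning by canonical words\<close>

definition spn where "spn Z = cl ` {z :: ('v \<Rightarrow>\<^sub>0 'k) list \<Rightarrow>\<^sub>0 'k. keys z <= Z}"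

lemma spn_I: "keys z <= Z ==> cl z : spn Z" unfolding spn_def by (intro imageI CollectI)
lemma spn_E: "u : spn Z ==> (\<And>z. u = cl z ==> keys z <= Z ==> P) ==> P" unfolding spn_def by (elim imageE CollectE)

lemma spn_wd: "w : Z ==> wd w : spn Z" unfolding wd_def by (rule spn_I) simp

lemma spn_zero: "\<zero>\<^bsub>UA\<^esub> : spn Z" unfolding cl_one_zero by (rule spn_I) simp

lemma spn_add: "Z <= lists LC ==> u : spn Z ==> u' : spn Z ==> u \<oplus>\<^bsub>UA\<^esub> u' : spn Z"
proof -
 assume Z: "Z <= lists LC" and "u : spn Z" "u' : spn Z"
 then obtain z z' where z: "u = cl z" "keys z <= Z" "u' = cl z'" "keys z' <= Z" by (elim spn_E)
 show ?thesis unfolding z(1,3) cl_hom(1)[OF order_trans[OF z(2) Z] order_trans[OF z(4) Z]] by (rule spn_I, rule keys_addI[OF z(2,4)])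
qed

lemma spn_scale: "Z <= lists LC ==> u : spn Z ==> c \<odot>\<^bsub>UA\<^esub> u : spn Z"
proof -
 assume Z: "Z <= lists LC" and "u : spn Z"
 then obtain z where z: "u = cl z" "keys z <= Z" by (elim spn_E)
 show ?thesis unfolding z(1) cl_hom(3)[OF order_trans[OF z(2) Z] order_trans[OF z(2) Z]] by (rule spn_I, rule keys_pm_scaleI[OF z(2)])
qed

lemma spn_mult:
 assumes "Z <= lists LC" "Z' <= lists LC" "u : spn Z" "u' : spn Z'" "\<And>w w'. w : Z ==> w' : Z' ==> w @ w' : Z''"
 shows "u \<otimes>\<^bsub>UA\<^esub> u' : spn Z''"
proof -
 obtain z z' where z: "u = cl z" "keys z <= Z" "u' = cl z'" "keys z' <= Z'" using assms(3,4) by (elim spn_E)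
 show ?thesis unfolding z(1,3) cl_hom(2)[OF order_trans[OF z(2) assms(1)] order_trans[OF z(4) assms(2)]]
  by (rule spn_I, rule keys_ma_mult_subset[OF z(2,4)]) (simp add: assms(5))
qed

lemma spn_carrier: "Z <= lists LC ==> u : spn Z ==> u : carrier UA"
 unfolding UA_carrier by (elim spn_E) (simp only:, intro imageI CollectI, erule order_trans)

lemma spn_sub:
 assumes Z: "Z <= lists LC" "Z' <= lists LC" and w: "\<And>w. w : Z ==> wd w : spn Z'" and u: "u : spn Z"
 shows "u : spn Z'"
proof -
 obtain z where z: "u = cl z" "keys z <= Z" using u by (elim spn_E)
 show ?thesis unfolding z(1) using z(2)
 proof (induction rule: pm_induct)
  case zero show ?case using spn_zero by (simp add: cl_one_zero)
 next
  case (single v c)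
  have k: "keys (single v (1::'k)) <= lists LC" using single Z by auto
  have "cl (single v c) = c \<odot>\<^bsub>UA\<^esub> wd v" unfolding wd_def cl_hom(3)[OF k k] by simp
  with spn_scale[OF Z(2) w[OF single]] show ?case by simp
 next
  case (add z z')
  show ?case unfolding cl_hom(1)[OF order_trans[OF add(1) Z(1)] order_trans[OF add(2) Z(1)], symmetric]
   by (rule spn_add[OF Z(2) add(3,4)])
 qed
qed

abbreviation bw where "bw \<equiv> map BB"

lemma bw_LC: "vs : lists X ==> bw vs : lists LC"
 by (induction vs) simp_all

text \<open>These words span step \<open>k\<close> of the length filtration of the enveloping
  algebra.\<close>

definition Wk where "Wk k = bw ` {vs : lists X. length vs \<le> k}"

lemma Wk_LC: "Wk k <= lists LC" unfolding Wk_def by (auto dest: bw_LC)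

lemma letter_spn: "x : LC ==> wd [x] : spn (Wk 1)"
proof -
 assume "x : LC"
 then have "keys x <= X" by simp
 then show ?thesis
 proof (induction rule: pm_induct)
  case zero
  have "wd [0] = 0 \<odot>\<^bsub>UA\<^esub> wd [0]" using wd_scale[OF LC_closed(4), of 0] by simp
  also have "\<dots> = \<zero>\<^bsub>UA\<^esub>" by (rule kmodD(7)[OF is_k_algebraD(1)[OF UA_k] wd_closed[OF wordsI(1)[OF LC_closed(4)]]])
  finally show ?case using spn_zero by simp
 next
  case (single v c)
  have "BB v : LC" using single by simp
  then have "wd [single v c] = c \<odot>\<^bsub>UA\<^esub> wd [BB v]" using wd_scale[of "BB v" c] by simp
  moreover have "[BB v] : Wk 1" unfolding Wk_def by (rule image_eqI[of _ _ "[v]"]) (use single in simp_all)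
  ultimately show ?case using spn_scale[OF Wk_LC spn_wd] by simp
 next
  case (add x y)
  then show ?case using wd_add[of x y] spn_add[OF Wk_LC] by simp
 qed
qed

lemma Wk_append: "w : Wk k ==> w' : Wk l ==> w @ w' : Wk (k + l)"
 unfolding Wk_def by (elim imageE CollectE conjE) (rule image_eqI[of _ _ "_ @ _"], auto)

lemma Wk_mult: "u : spn (Wk k) ==> u' : spn (Wk l) ==> u \<otimes>\<^bsub>UA\<^esub> u' : spn (Wk (k + l))"
 by (rule spn_mult[OF Wk_LC Wk_LC _ _ Wk_append])

lemma word_spn: "w : lists LC ==> wd w : spn (Wk (length w))"
proof (induction w)
 case Nil show ?case by (rule spn_wd) (simp add: Wk_def image_iff)
next
 case (Cons x w)
 then have c: "x : LC" "w : lists LC" by simp_all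
 show ?case unfolding wd_Cons[OF c] using Wk_mult[OF letter_spn[OF c(1)] Cons.IH[OF c(2)]] by simp
qed

text \<open>Transposing neighbours changes a word only by shorter ones.\<close>

lemma move_front:
 assumes "vs : lists X" "a : X" "vs' : lists X"
 shows "\<exists>r\<in>spn (Wk (length vs + length vs')). wd (bw (vs @ a # vs')) = wd (bw (a # vs @ vs')) \<oplus>\<^bsub>UA\<^esub> r"
 using assms(1)
proof (induction vs rule: list.induct)
 case Nil
 have "wd (bw (a # vs')) : carrier UA" by (rule wd_closed, rule bw_LC) (use assms in simp)
 then show ?case using spn_zero kmod_simps(4)[OF is_k_algebraD(1)[OF UA_k]] by (intro bexI[of _ "\<zero>\<^bsub>UA\<^esub>"]) simp_all
next
 case (Cons b vs)
 interpret U: ring UA by (rule is_k_algebraD[OF UA_k])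
 have b: "BB b : LC" "BB a : LC" and w: "bw (vs @ a # vs') : lists LC" "bw (vs @ vs') : lists LC" "bw (a # vs @ vs') : lists LC"
  using Cons.prems assms bw_LC[of vs] bw_LC[of vs'] by simp_all
 obtain r where r: "r : spn (Wk (length vs + length vs'))" "wd (bw (vs @ a # vs')) = wd (bw (a # vs @ vs')) \<oplus>\<^bsub>UA\<^esub> r"
  using Cons by auto
 note c = wd_closed[OF wordsI(1)[OF b(1)]] wd_closed[OF wordsI(1)[OF b(2)]] wd_closed[OF w(2)] wd_closed[OF w(3)] spn_carrier[OF Wk_LC r(1)]
  wd_closed[OF wordsI(1)[OF LC_closed(3)[OF b]]]
 have "wd (bw ((b # vs) @ a # vs')) = wd [BB b] \<otimes>\<^bsub>UA\<^esub> (wd (bw (a # vs @ vs')) \<oplus>\<^bsub>UA\<^esub> r)"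
  using wd_Cons[OF b(1) w(1)] r(2) by simp
 also have "\<dots> = (wd [BB b] \<otimes>\<^bsub>UA\<^esub> wd [BB a]) \<otimes>\<^bsub>UA\<^esub> wd (bw (vs @ vs')) \<oplus>\<^bsub>UA\<^esub> wd [BB b] \<otimes>\<^bsub>UA\<^esub> r"
  using wd_Cons[OF b(2) w(2)] c by (simp add: U.r_distr U.m_assoc)
 also have "wd [BB b] \<otimes>\<^bsub>UA\<^esub> wd [BB a] = wd [BB a] \<otimes>\<^bsub>UA\<^esub> wd [BB b] \<oplus>\<^bsub>UA\<^esub> wd [br (BB b) (BB a)]"
  using wd_br[OF b] wd_Cons[OF b(1) wordsI(1)[OF b(2)]] wd_Cons[OF b(2) wordsI(1)[OF b(1)]] by simp
 also have "(wd [BB a] \<otimes>\<^bsub>UA\<^esub> wd [BB b] \<oplus>\<^bsub>UA\<^esub> wd [br (BB b) (BB a)]) \<otimes>\<^bsub>UA\<^esub> wd (bw (vs @ vs')) \<oplus>\<^bsub>UA\<^esub> wd [BB b] \<otimes>\<^bsub>UA\<^esub> r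
  = wd [BB a] \<otimes>\<^bsub>UA\<^esub> (wd [BB b] \<otimes>\<^bsub>UA\<^esub> wd (bw (vs @ vs'))) \<oplus>\<^bsub>UA\<^esub> (wd [br (BB b) (BB a)] \<otimes>\<^bsub>UA\<^esub> wd (bw (vs @ vs')) \<oplus>\<^bsub>UA\<^esub> wd [BB b] \<otimes>\<^bsub>UA\<^esub> r)"
  using c by (simp add: U.l_distr U.m_assoc U.a_assoc)
 also have "wd [BB a] \<otimes>\<^bsub>UA\<^esub> (wd [BB b] \<otimes>\<^bsub>UA\<^esub> wd (bw (vs @ vs'))) = wd (bw (a # (b # vs) @ vs'))"
  using wd_Cons[OF b(1) w(2)] wd_Cons[OF b(2), of "BB b # bw (vs @ vs')"] b w(2) by simp
 finally have e: "wd (bw ((b # vs) @ a # vs')) = wd (bw (a # (b # vs) @ vs')) \<oplus>\<^bsub>UA\<^esub>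
  (wd [br (BB b) (BB a)] \<otimes>\<^bsub>UA\<^esub> wd (bw (vs @ vs')) \<oplus>\<^bsub>UA\<^esub> wd [BB b] \<otimes>\<^bsub>UA\<^esub> r)" .
 have "wd (bw (vs @ vs')) : spn (Wk (length vs + length vs'))" using word_spn[OF w(2)] by simp
 then have "wd [br (BB b) (BB a)] \<otimes>\<^bsub>UA\<^esub> wd (bw (vs @ vs')) : spn (Wk (1 + (length vs + length vs')))"
  by (rule Wk_mult[OF letter_spn[OF LC_closed(3)[OF b]]])
 moreover have "wd [BB b] \<otimes>\<^bsub>UA\<^esub> r : spn (Wk (1 + (length vs + length vs')))" by (rule Wk_mult[OF letter_spn[OF b(1)] r(1)])
 ultimately show ?case using e spn_add[OF Wk_LC] by (intro bexI[of _ "wd [br (BB b) (BB a)] \<otimes>\<^bsub>UA\<^esub> wd (bw (vs @ vs')) \<oplus>\<^bsub>UA\<^esub> wd [BB b] \<otimes>\<^bsub>UA\<^esub> r"]) simp_all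
qed

text \<open>Move the first letter of \<open>vs\<close> to the front of \<open>vs'\<close> and
  rearrange the rest by induction; each move costs only words that are shorter by one.\<close>

lemma perm_words:
 assumes "vs : lists X" "mset vs' = mset vs"
 shows "\<exists>r\<in>spn (Wk (length vs - 1)). wd (bw vs') = wd (bw vs) \<oplus>\<^bsub>UA\<^esub> r"
 using assms
proof (induction vs arbitrary: vs' rule: list.induct)
 case Nil
 have "wd [] : carrier UA" by (rule wd_closed) simp
 then show ?case using Nil spn_zero kmod_simps(4)[OF is_k_algebraD(1)[OF UA_k]] by (intro bexI[of _ "\<zero>\<^bsub>UA\<^esub>"]) simp_all
next
 case (Cons a vs)
 interpret U: ring UA by (rule is_k_algebraD[OF UA_k])
 have sv: "set vs' = set (a # vs)" using arg_cong[OF Cons.prems(2), of set_mset] by simp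
 then have "a : set vs'" by simp
 from split_list[OF this] obtain us ws where vs': "vs' = us @ a # ws" by (elim exE)
 have m: "mset (us @ ws) = mset vs" using Cons.prems(2) vs' by simp
 have X: "us : lists X" "a : X" "ws : lists X" "vs : lists X" "us @ ws : lists X"
  using Cons.prems(1) sv vs' unfolding in_lists_conv_set by auto
 have len: "length us + length ws = length vs" using arg_cong[OF m, of size] by simp
 obtain r where r: "r : spn (Wk (length vs))" "wd (bw vs') = wd (bw (a # us @ ws)) \<oplus>\<^bsub>UA\<^esub> r"
  using move_front[OF X(1-3)] vs' len by auto
 obtain s where s: "s : spn (Wk (length vs - 1))" "wd (bw (us @ ws)) = wd (bw vs) \<oplus>\<^bsub>UA\<^esub> s"
  using Cons.IH[OF X(4) m] by auto
 have b: "BB a : LC" using X(2) by simp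
 note c = wd_closed[OF wordsI(1)[OF b]] wd_closed[OF bw_LC[OF X(4)]] spn_carrier[OF Wk_LC r(1)] spn_carrier[OF Wk_LC s(1)]
 have "wd (bw vs') = wd [BB a] \<otimes>\<^bsub>UA\<^esub> (wd (bw vs) \<oplus>\<^bsub>UA\<^esub> s) \<oplus>\<^bsub>UA\<^esub> r"
  using r(2) wd_Cons[OF b bw_LC[OF X(5)]] s(2) by simp
 also have "\<dots> = wd (bw (a # vs)) \<oplus>\<^bsub>UA\<^esub> (wd [BB a] \<otimes>\<^bsub>UA\<^esub> s \<oplus>\<^bsub>UA\<^esub> r)"
  using c wd_Cons[OF b bw_LC[OF X(4)]] by (simp add: U.r_distr U.a_assoc)
 finally have e: "wd (bw vs') = wd (bw (a # vs)) \<oplus>\<^bsub>UA\<^esub> (wd [BB a] \<otimes>\<^bsub>UA\<^esub> s \<oplus>\<^bsub>UA\<^esub> r)" .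
 \<comment> \<open>For empty \<open>vs\<close> the truncated bound \<open>length vs - 1\<close> is
   0, and multiplication by a letter would exceed the bound wanted here. In that case the correction
   \<open>s\<close> is zero, because both words are empty and \<open>s\<close> is their
   difference.\<close>
 have "wd [BB a] \<otimes>\<^bsub>UA\<^esub> s : spn (Wk (length vs))"
 proof (cases vs)
  case Nil
  have "s = \<zero>\<^bsub>UA\<^esub>"
   using s(2) m Nil c(2,4) U.add.r_cancel_one[of "wd []" s] by simp
  then show ?thesis using spn_zero c(1) by simp
 next
  case (Cons b bs)
  then show ?thesis using Wk_mult[OF letter_spn[OF b] s(1)] by simp
 qed
 with e r(1) show ?case using spn_add[OF Wk_LC] by (intro bexI[of _ "wd [BB a] \<otimes>\<^bsub>UA\<^esub> s \<oplus>\<^bsub>UA\<^esub> r"]) simp_all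
qed

definition mm :: "'v list => 'v \<Rightarrow>\<^sub>0 nat" where "mm vs = sum_list (map (%v. single v 1) vs)"

lemma mm_simps [simp]: "mm [] = 0" "mm (v # vs) = single v 1 + mm vs"
 by (simp_all add: mm_def)

lemma mlen_mm: "mlen (mm vs) = length vs"
 by (induction vs) simp_all

lemma lookup_mm: "lookup (mm vs) v = count (mset vs) v"
 by (induction vs) (simp_all add: lookup_add lookup_single when_def)

lemma mm_eq_iff: "mm vs = mm vs' \<longleftrightarrow> mset vs = mset vs'"
proof
 assume e: "mm vs = mm vs'"
 show "mset vs = mset vs'" by (rule multiset_eqI) (simp add: lookup_mm[symmetric] e)
next
 assume e: "mset vs = mset vs'"
 show "mm vs = mm vs'" by (rule poly_mapping_eqI) (simp add: lookup_mm e)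
qed

text \<open>An arbitrary arrangement of the letters of a monomial serves as its normal form, so the
  variables need no order.\<close>

definition cw :: "('v \<Rightarrow>\<^sub>0 nat) => 'v list" where "cw m = (SOME vs. vs : lists X \<and> mm vs = m)"

lemma cw: "keys m <= X ==> cw m : lists X \<and> mm (cw m) = m"
 unfolding cw_def
proof (rule someI_ex, induction rule: mono_induct)
 case zero show ?case by (intro exI[of _ "[]"]) simp
next
 case (add v m)
 then obtain vs where "vs : lists X" "mm vs = m" by blast
 with add(1) show ?case by (intro exI[of _ "v # vs"]) simp
qed

lemma keys_mm: "vs : lists X ==> keys (mm vs) <= X"
 by (induction vs) simp_all

definition Can where "Can = bw ` cw ` {m. keys m <= X}"

lemma Can_LC: "Can <= lists LC"
proof
 fix w assume "w : Can"
 then obtain m where "w = bw (cw m)" "keys m <= X" unfolding Can_def by (elim imageE CollectE) simp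
 then show "w : lists LC" using cw[of m] by (simp only: bw_LC)
qed

text \<open>A word and the canonical arrangement of its letters differ by shorter words, to which
  the induction applies.\<close>

lemma word_Can: "vs : lists X ==> wd (bw vs) : spn Can"
proof (induction "length vs" arbitrary: vs rule: less_induct)
 case less
 have c: "cw (mm vs) : lists X" "mset vs = mset (cw (mm vs))" using cw[OF keys_mm[OF less.prems]] mm_eq_iff by auto
 have l: "length (cw (mm vs)) = length vs" using arg_cong[OF c(2), of size] by simp
 from perm_words[OF c] obtain r where r: "r : spn (Wk (length vs - 1))" "wd (bw vs) = wd (bw (cw (mm vs))) \<oplus>\<^bsub>UA\<^esub> r"
  unfolding l by (elim bexE)
 have cc: "wd (bw (cw (mm vs))) : spn Can"
  by (rule spn_wd) (use keys_mm[OF less.prems] in \<open>auto simp: Can_def\<close>)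
 show ?case
 proof (cases vs)
  case Nil
  with l have "cw (mm vs) = []" by simp
  with cc Nil show ?thesis by simp
 next
  case (Cons b bs)
  have "r : spn Can"
  proof (rule spn_sub[OF Wk_LC Can_LC _ r(1)])
   fix w assume "w : Wk (length vs - 1)"
   then obtain us where "w = bw us" "us : lists X" "length us \<le> length vs - 1" unfolding Wk_def by (elim imageE CollectE conjE)
   then show "wd w : spn Can" using less.hyps[of us] Cons by simp
  qed
  then show ?thesis unfolding r(2) by (rule spn_add[OF Can_LC cc])
 qed
qed

text \<open>The spanning half of the Poincare-Birkhoff-Witt theorem. Independence will follow from
  the pairing with polynomials.\<close>

lemma UA_Can: "u : carrier UA ==> u : spn Can"
proof (induction rule: UA_induct)
 case (word c w)
 have "wd w : spn Can"
  by (rule spn_sub[OF Wk_LC Can_LC _ word_spn[OF word]]) (auto simp: Wk_def intro!: word_Can)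
 then show ?case by (rule spn_scale[OF Can_LC])
qed (simp_all add: spn_zero spn_add[OF Can_LC])

end

lemma lin_hom_add_ground:
 fixes A :: "('k::field, 'a, 'm) module_scheme"
 assumes f: "f : lin_hom A (ground_field :: ('k, 'k) module)" and g: "g : lin_hom A (ground_field :: ('k, 'k) module)"
 shows "(%x. f x + g x) : lin_hom A (ground_field :: ('k, 'k) module)"
 by (rule lin_homI) (simp_all add: lin_homD[OF f] lin_homD[OF g] algebra_simps)

section \<open>Primitive elements of the graded dual\<close>

context poly_group
begin

lemma lin_gr:
 assumes h: "h : gr \<alpha>" and n0: "lin x h ~= 0"
 shows "\<exists>v\<in>keys x. deg v = \<alpha>"
proof -
 obtain v where v: "v : keys x" "lookup x v * lookup h (single v 1) ~= 0"
  using n0 unfolding lin_def by (rule sum.not_neutral_contains_not_neutral)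
 then have "\<not> (\<not> keys (single v (1::nat)) <= X \<or> wt deg (single v 1) ~= \<alpha>)"
  using gr_lookup[OF h, of "single v 1"] by auto
 then have "deg v = \<alpha>" by simp
 with v(1) show ?thesis by (rule bexI[rotated])
qed

text \<open>Elements of the graded dual are undefined outside the carrier, hence the
  restriction.\<close>

definition lr where "lr x = restrict (lin x) (carrier HA)"

lemma lr_DA: "lr x : carrier DA"
 unfolding lr_def
proof (rule DA_carrierI[OF restrict_lin_hom[OF lin_lin]])
 have "supp (lin x) <= deg ` keys x"
 proof
  fix \<alpha> assume "\<alpha> : supp (lin x)"
  then obtain h where "h : gr \<alpha>" "lin x h ~= 0" unfolding supp_def by (elim CollectE conjE bexE)
  from lin_gr[OF this] show "\<alpha> : deg ` keys x" by auto
 qed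
 then show "finite (supp (restrict (lin x) (carrier HA)))" unfolding supp_restrict by (rule finite_subset) simp
qed simp

lemma lr_apply: "h : carrier HA ==> lr x h = lin x h"
 by (simp add: lr_def del: HA_simps)

lemma conv_lr:
 assumes d: "d : lin_hom HA K"
 shows "conv (lr x) d = conv (lin x) d" "conv d (lr x) = conv d (lin x)"
 unfolding conv_def lr_def by (rule restrict_ext, rule tev_restrict[OF _ _ \<Delta>(1)]; (assumption | rule lin_lin d))+

lemma DA_eval: "h : carrier HA ==> (%f. f h) : lin_hom DA K"
 by (intro lin_homI) (simp_all add: DA_apply del: HA_simps)

lemma DA_eqI_mono:
 assumes f: "f : carrier DA" and g: "g : carrier DA"
  and eq: "\<And>m. keys m <= X ==> f (single m 1) = g (single m 1)"
 shows "f = g"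
proof (rule DA_ext[OF f g])
 fix h assume "h : carrier HA"
 then have "keys h <= monos" by simp
 note lf = DA_carrierD(1)[OF f] and lg = DA_carrierD(1)[OF g]
 from \<open>keys h <= monos\<close> show "f h = g h"
 proof (induction rule: pm_induct)
  case zero
  show ?case using lin_hom_zero[OF lf HA(2) kmod_ground] lin_hom_zero[OF lg HA(2) kmod_ground] by simp
 next
  case (single m c)
  have "single m (1::'k) : carrier HA" using single by simp
  from lin_homD(3)[OF lf this, of c] lin_homD(3)[OF lg this, of c] eq[of m] single show ?case by simp
 next
  case (add z w)
  then have "z : carrier HA" "w : carrier HA" by simp_all
  from lin_homD(2)[OF lf this] lin_homD(2)[OF lg this] add show ?case by simp
 qed
qed

subsubsection \<open>The antipode and convolution\<close>

lemma gi_mult: assumes g: "g : Pts" and h: "h : Pts" shows "gi (gm g h) = gm (gi h) (gi g)"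
proof -
 have p: "gm g h : Pts" "gi g : Pts" "gi h : Pts" "gi (gm g h) : Pts" "gm (gi h) (gi g) : Pts" using g h gm(1) gi(1) by simp_all
 have i: "gm (gm (gi h) (gi g)) (gm g h) = (%_. 0)"
  unfolding gm(2)[OF p(3,2,1)] gm(2)[OF p(2) g h, symmetric] gi(2)[OF g] gm(3)[OF h] by (rule gi(2)[OF h])
 have "gm (gi h) (gi g) = gm (gm (gi h) (gi g)) (gm (gm g h) (gi (gm g h)))" unfolding gi(3)[OF p(1)] by (rule gm(4)[OF p(5), symmetric])
 also have "\<dots> = gi (gm g h)" unfolding gm(2)[OF p(5,1,4), symmetric] i by (rule gm(3)[OF p(4)])
 finally show ?thesis ..
qed

lemma bil_S: "bil HA HA TH (%a b. pure_tensor HA HA (S b) (S a))"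
proof -
 note b = bilD[OF bil_pure_tensor[OF HA(1) HA(1)]] and s = lin_homD[OF S_lin]
 show ?thesis by (rule bilI; (subst s(2) s(3))?; (assumption | rule b s)+)
qed

text \<open>At a pair of points this is the rule that inversion reverses products,
  \<open>gi_mult\<close>.\<close>

lemma \<Delta>_S:
 assumes h: "h : carrier HA"
 shows "\<Delta> (S h) = tensor_lift TH (%a b. pure_tensor HA HA (S b) (S a)) (\<Delta> h)"
proof (rule \<Delta>_eqI[OF S(1)[OF h] lin_homD(1)[OF tensor_lift_lin_hom[OF HA(1) HA(1) kT bil_S] \<Delta>(1)[OF h]]])
 fix g k assume gk: "g : Pts" "k : Pts"
 note Sl = lin_hom_comp[OF S_lin ev_lin]
 have b1: "bil HA HA K (%a b. E g k (pure_tensor HA HA (S b) (S a)))" by (rule bil_lin_hom[OF bil_S E_lin])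
 have "E g k (tensor_lift TH (%a b. pure_tensor HA HA (S b) (S a)) (\<Delta> h)) =
  tensor_lift K (%a b. E g k (pure_tensor HA HA (S b) (S a))) (\<Delta> h)"
  by (rule lin_hom_tensor_lift[OF HA(1) HA(1) kT bil_S E_lin kmod_ground \<Delta>(1)[OF h]])
 also have "\<dots> = E (gi k) (gi g) (\<Delta> h)"
 proof (rule tensor_lift_cong[OF HA(1) HA(1) kmod_ground b1 _ \<Delta>(1)[OF h]])
  fix a b assume ab: "a : carrier HA" "b : carrier HA"
  show "E g k (pure_tensor HA HA (S b) (S a)) = ev (gi k) a * ev (gi g) b"
   unfolding E_pure[OF S(1)[OF ab(2)] S(1)[OF ab(1)]] S(2)[OF ab(1) gk(2)] S(2)[OF ab(2) gk(1)] by (rule mult.commute)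
 qed
 also have "\<dots> = ev (gm (gi k) (gi g)) h" by (rule \<Delta>(2)[OF h gi(1)[OF gk(2)] gi(1)[OF gk(1)]])
 also have "\<dots> = ev (gm g k) (S h)" unfolding gi_mult[OF gk, symmetric] by (rule S(2)[OF h gm(1)[OF gk], symmetric])
 finally show "E g k (tensor_lift TH (%a b. pure_tensor HA HA (S b) (S a)) (\<Delta> h)) = ev (gm g k) (S h)" .
qed

lemma conv_S:
 assumes f: "f : lin_hom HA K" and g: "g : lin_hom HA K" and h: "h : carrier HA"
 shows "conv f g (S h) = conv (%x. g (S x)) (%x. f (S x)) h"
proof -
 note l = tev_lin_hom[OF HA(1) HA(1) f g]
 have "tev f g (\<Delta> (S h)) = tensor_lift K (%a b. tev f g (pure_tensor HA HA (S b) (S a))) (\<Delta> h)"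
  unfolding \<Delta>_S[OF h] by (rule lin_hom_tensor_lift[OF HA(1) HA(1) kT bil_S l kmod_ground \<Delta>(1)[OF h]])
 also have "\<dots> = tev (%x. g (S x)) (%x. f (S x)) (\<Delta> h)"
 proof (rule tensor_lift_cong[OF HA(1) HA(1) kmod_ground bil_lin_hom[OF bil_S l] _ \<Delta>(1)[OF h]])
  fix a b assume ab: "a : carrier HA" "b : carrier HA"
  show "tev f g (pure_tensor HA HA (S b) (S a)) = g (S a) * f (S b)"
   unfolding tev_pure[OF HA(1) HA(1) f g S(1)[OF ab(2)] S(1)[OF ab(1)]] by (rule mult.commute)
 qed
 finally show ?thesis using h S(1)[OF h] by (simp add: conv_def del: HA_simps)
qed

lemma \<epsilon>_S: "h : carrier HA ==> \<epsilon> (S h) = \<epsilon> h"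
 using S(2)[of h "%_. 0"] gm(4)[of "gi (%_. 0)"] gi(1,2)[of "%_. 0"] by simp

text \<open>Apply \<open>lin x\<close> to the antipode axiom: a derivation along
  \<open>\<epsilon>\<close> kills the constant on the right, and on the left it gives
  \<open>lin x (S h) + lin x h\<close> by the counit axiom.\<close>

lemma lin_S:
 assumes h: "h : carrier HA" shows "lin x (S h) = - lin x h"
proof -
 note Sl = lin_hom_comp[OF S_lin lin_lin, of x]
 have b: "bil HA HA HA (%a b. S a * b)"
  using bil_comp[OF bil_mult[OF HA(1)] S_lin lin_hom_id] by simp
 have "0 = lin x (tensor_lift HA (%a b. S a * b) (\<Delta> h))" unfolding \<Delta>_hopf(4)[OF h] by simp
 also have "\<dots> = tensor_lift K (%a b. lin x (S a * b)) (\<Delta> h)"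
  by (rule lin_hom_tensor_lift[OF HA(1) HA(1) HA(2) b lin_lin kmod_ground \<Delta>(1)[OF h]])
 also have "\<dots> = tensor_lift K (%a b. lin x (S a) * \<epsilon> b + \<epsilon> a * lin x b) (\<Delta> h)"
  by (rule tensor_lift_cong[OF HA(1) HA(1) kmod_ground bil_lin_hom[OF b lin_lin] _ \<Delta>(1)[OF h]])
   (simp only: lin_deriv \<epsilon>_S)
 also have "\<dots> = tev (%a. lin x (S a)) \<epsilon> (\<Delta> h) + tev \<epsilon> (lin x) (\<Delta> h)"
 proof (rule lin_hom_tensor_eqI[OF HA(1) HA(1) _ _ kmod_ground _ \<Delta>(1)[OF h]])
  note b1 = bil_functionals[OF Sl ev_lin] and b2 = bil_functionals[OF ev_lin lin_lin]
  note b12 = bil_add[OF kmod_ground b1 b2, unfolded ground_field_simps]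
  note t1 = tev_lin_hom[OF HA(1) HA(1) Sl ev_lin] and t2 = tev_lin_hom[OF HA(1) HA(1) ev_lin lin_lin]
  show "tensor_lift K (%a b. lin x (S a) * \<epsilon> b + \<epsilon> a * lin x b) : lin_hom TH K"
   by (rule tensor_lift_lin_hom[OF HA(1) HA(1) kmod_ground b12])
  show "(%t. tev (%a. lin x (S a)) \<epsilon> t + tev \<epsilon> (lin x) t) : lin_hom TH K"
   by (rule lin_hom_add_ground[OF t1 t2])
  fix a b assume ab: "a : carrier HA" "b : carrier HA"
  show "tensor_lift K (%a b. lin x (S a) * \<epsilon> b + \<epsilon> a * lin x b) (pure_tensor HA HA a b) =
   tev (%a. lin x (S a)) \<epsilon> (pure_tensor HA HA a b) + tev \<epsilon> (lin x) (pure_tensor HA HA a b)"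
   unfolding tev_pure[OF HA(1) HA(1) Sl ev_lin ab] tev_pure[OF HA(1) HA(1) ev_lin lin_lin ab]
   by (rule tensor_lift_pure[OF HA(1) HA(1) kmod_ground b12 ab])
 qed
 also have "\<dots> = lin x (S h) + lin x h" unfolding tev_counit(2)[OF Sl h] tev_counit(1)[OF lin_lin h] ..
 finally show ?thesis by (simp add: add_eq_0_iff2)
qed

end

context env_group
begin

subsubsection \<open>The map to the graded dual\<close>

definition \<Phi>w :: "('v \<Rightarrow>\<^sub>0 'k) list => (('v \<Rightarrow>\<^sub>0 nat) \<Rightarrow>\<^sub>0 'k) => 'k" where
 "\<Phi>w w = foldr (%x d. lr x \<otimes>\<^bsub>DA\<^esub> d) w \<one>\<^bsub>DA\<^esub>"

lemma \<Phi>w_simps: "\<Phi>w [] = \<one>\<^bsub>DA\<^esub>" "\<Phi>w (x # w) = lr x \<otimes>\<^bsub>DA\<^esub> \<Phi>w w"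
 by (simp_all add: \<Phi>w_def)

lemma DA_monoid: "monoid DA" by (rule is_k_algebraD[OF DA_k])

lemma \<Phi>w_DA: "\<Phi>w w : carrier DA"
 by (induction w) (simp_all only: \<Phi>w_simps DA_one_closed monoid.m_closed[OF DA_monoid lr_DA])

lemmas \<Phi>w_lin = DA_carrierD(1)[OF \<Phi>w_DA]

lemma \<Phi>w_append: "\<Phi>w (w @ w') = \<Phi>w w \<otimes>\<^bsub>DA\<^esub> \<Phi>w w'"
proof (induction w)
 case Nil show ?case by (simp only: append_Nil \<Phi>w_simps monoid.l_one[OF DA_monoid \<Phi>w_DA])
next
 case (Cons x w) then show ?case by (simp only: append_Cons \<Phi>w_simps monoid.m_assoc[OF DA_monoid lr_DA \<Phi>w_DA \<Phi>w_DA])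
qed

lemma \<Phi>w_letter: "\<Phi>w [x] = lr x"
 unfolding \<Phi>w_simps by (rule monoid.r_one[OF DA_monoid lr_DA])

text \<open>A word is paired with a polynomial letter by letter: the first letter acts as a
  derivation and the rest of the word is applied to the result.\<close>

lemma \<Phi>w_op: "h : carrier HA ==> \<Phi>w (x # w) h = \<Phi>w w (op x h)"
 unfolding \<Phi>w_simps DA_simps(2) conv_lr[OF \<Phi>w_lin] by (rule conv_lin_op[OF \<Phi>w_lin])

lemma \<Phi>w_rel:
 "\<Phi>w [x + y] = \<Phi>w [x] \<oplus>\<^bsub>DA\<^esub> \<Phi>w [y]"
 "\<Phi>w [pm_scale c x] = c \<odot>\<^bsub>DA\<^esub> \<Phi>w [x]"
 "x : LC ==> y : LC ==> \<Phi>w [x, y] = \<Phi>w [y, x] \<oplus>\<^bsub>DA\<^esub> \<Phi>w [br x y]"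
proof -
 show "\<Phi>w [x + y] = \<Phi>w [x] \<oplus>\<^bsub>DA\<^esub> \<Phi>w [y]"
  unfolding \<Phi>w_letter by (rule DA_ext[OF lr_DA DA_closed(1)[OF lr_DA lr_DA]]) (simp add: DA_apply lr_apply del: HA_simps)
 show "\<Phi>w [pm_scale c x] = c \<odot>\<^bsub>DA\<^esub> \<Phi>w [x]"
  unfolding \<Phi>w_letter by (rule DA_ext[OF lr_DA DA_scale_closed[OF lr_DA]]) (simp add: DA_apply lr_apply del: HA_simps)
 assume xy: "x : LC" "y : LC"
 have two: "\<Phi>w [a, b] = conv (lin a) (lin b)" for a b
  unfolding \<Phi>w_simps(2)[of a "[b]"] \<Phi>w_letter DA_simps(2) conv_lr(1)[OF DA_carrierD(1)[OF lr_DA]] by (rule conv_lr(2)[OF lin_lin])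
 show "\<Phi>w [x, y] = \<Phi>w [y, x] \<oplus>\<^bsub>DA\<^esub> \<Phi>w [br x y]"
 proof (rule DA_ext[OF \<Phi>w_DA DA_closed(1)[OF \<Phi>w_DA \<Phi>w_DA]])
  fix h assume h: "h : carrier HA"
  have k: "keys x <= X" "keys y <= X" using xy by simp_all
  \<comment> \<open>Here the bracket of \<open>L\<close> meets the convolution commutator:
    \<open>br_coeff\<close> is the condition of \<open>lin_commutator\<close> on the linear
    part.\<close>
  have "lin (br x y) h = conv (lin x) (lin y) h - conv (lin y) (lin x) h"
   by (rule lin_commutator[OF k _ h]) (rule br_coeff[OF k])
  then show "\<Phi>w [x, y] h = (\<Phi>w [y, x] \<oplus>\<^bsub>DA\<^esub> \<Phi>w [br x y]) h"
   unfolding DA_apply(1)[OF h] two \<Phi>w_letter lr_apply[OF h] by simp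
 qed
qed

lemma \<Phi>w_fm: "(\<forall>w\<in>lists LC. \<forall>w'\<in>lists LC. \<Phi>w (w @ w') = \<Phi>w w \<otimes>\<^bsub>DA\<^esub> \<Phi>w w') \<or>
  (\<forall>w\<in>lists LC. \<forall>w'\<in>lists LC. \<Phi>w (w @ w') = \<Phi>w w' \<otimes>\<^bsub>DA\<^esub> \<Phi>w w)"
 by (simp add: \<Phi>w_append)

definition \<Phi> where "\<Phi> = induced DA \<Phi>w"

lemma \<Phi>_cl: "keys z <= lists LC ==> \<Phi> (cl z) = lext DA \<Phi>w z"
 unfolding \<Phi>_def by (rule induced_cl[OF DA_k]) (rule \<Phi>w_DA \<Phi>w_fm \<Phi>w_rel | assumption)+

lemma \<Phi>_wd: "w : lists LC ==> \<Phi> (wd w) = \<Phi>w w"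
 unfolding \<Phi>_def by (rule induced_wd[OF DA_k]) (rule \<Phi>w_DA \<Phi>w_fm \<Phi>w_rel | assumption)+

lemma \<Phi>_lin: "\<Phi> : lin_hom UA DA"
 unfolding \<Phi>_def by (rule induced_lin[OF DA_k]) (rule \<Phi>w_DA \<Phi>w_fm \<Phi>w_rel | assumption)+

lemma wd_Nil: "wd [] = \<one>\<^bsub>UA\<^esub>" unfolding wd_def cl_one_zero ..

lemma bil_UA_eqI:
 assumes W: "kmod W" and b: "bil UA UA W \<beta>" and c: "bil UA UA W \<gamma>"
  and eq: "\<And>w w'. w : lists LC ==> w' : lists LC ==> \<beta> (wd w) (wd w') = \<gamma> (wd w) (wd w')"
  and u: "u : carrier UA" and u': "u' : carrier UA"
 shows "\<beta> u u' = \<gamma> u u'"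
proof (rule lin_hom_UA_eqI[OF _ _ W _ u])
 show "(%u. \<beta> u u') : lin_hom UA W" "(%u. \<gamma> u u') : lin_hom UA W" using b c u' unfolding bil_def by simp_all
 fix w assume w: "w : lists LC"
 show "\<beta> (wd w) u' = \<gamma> (wd w) u'"
 proof (rule lin_hom_UA_eqI[OF _ _ W _ u'])
  show "\<beta> (wd w) : lin_hom UA W" "\<gamma> (wd w) : lin_hom UA W" using b c wd_closed[OF w] unfolding bil_def by simp_all
 qed (rule eq[OF w])
qed

lemma \<Phi>_mult: "u : carrier UA ==> u' : carrier UA ==> \<Phi> (u \<otimes>\<^bsub>UA\<^esub> u') = \<Phi> u \<otimes>\<^bsub>DA\<^esub> \<Phi> u'"
proof (rule bil_UA_eqI[OF is_k_algebraD(1)[OF DA_k] bil_lin_hom[OF bil_mult[OF UA_k] \<Phi>_lin] bil_comp[OF bil_mult[OF DA_k] \<Phi>_lin \<Phi>_lin]])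
 fix w w' assume w: "w : lists LC" "w' : lists LC"
 then have ww: "w @ w' : lists LC" by simp
 show "\<Phi> (wd w \<otimes>\<^bsub>UA\<^esub> wd w') = \<Phi> (wd w) \<otimes>\<^bsub>DA\<^esub> \<Phi> (wd w')"
  unfolding wd_append[OF w, symmetric] \<Phi>_wd[OF w(1)] \<Phi>_wd[OF w(2)] \<Phi>_wd[OF ww] by (rule \<Phi>w_append)
qed

lemma \<Phi>_one: "\<Phi> \<one>\<^bsub>UA\<^esub> = \<one>\<^bsub>DA\<^esub>"
 unfolding wd_Nil[symmetric] \<Phi>_wd[OF lists.Nil] by (rule \<Phi>w_simps)

lemma \<Phi>_alg_hom: "\<Phi> : alg_hom UA DA"
 unfolding alg_hom_def
proof (rule IntI[OF \<Phi>_lin], rule ring_hom_memI)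
qed (simp_all add: lin_homD[OF \<Phi>_lin] \<Phi>_mult \<Phi>_one)

lemma lext_\<Phi>w_apply: "h : carrier HA ==> lext DA \<Phi>w z h = lext K (%w. \<Phi>w w h) z"
 by (rule lin_hom_lext[OF is_k_algebraD(1)[OF DA_k] _ DA_eval kmod_ground, where C = UNIV]) (simp_all add: \<Phi>w_DA)

lemma lext_\<Phi>w_DA: "lext DA \<Phi>w z : carrier DA"
 by (rule lext_closed[OF is_k_algebraD(1)[OF DA_k], where C = UNIV]) (simp_all add: \<Phi>w_DA)

subsubsection \<open>Triangularity\<close>

lemma single_HA: "keys m <= X ==> single m c : carrier HA" by simp

lemma Il_HA: "z : Il l ==> z : carrier HA" by (auto simp: Il_def)

lemma mlen_minus: "v : keys m ==> mlen m = Suc (mlen (m - single v 1))"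
 by (subst mono_decompose[of v m, symmetric]) simp_all

lemma keys_minus: "keys (m - single v (1::nat)) <= keys m"
 by (auto simp: in_keys_iff lookup_minus)

lemma Il_antimono: "k \<le> l ==> Il l <= Il k"
 by (auto simp: Il_def)

text \<open>Both the partial derivative and the error term of \<open>op_mono\<close> lose at most
  one from the length of a monomial.\<close>

lemma op_Il:
 assumes z: "z : Il (Suc l)" shows "op (BB v) z : Il l"
proof -
 have "keys z <= {m. keys m <= X \<and> Suc l \<le> mlen m}" using z by (simp add: Il_def)
 then show ?thesis
 proof (induction rule: pm_induct)
  case zero
  show ?case using lin_hom_zero[OF op_lin HA(2) HA(2), of "BB v"] by (simp add: Il_def)
 next
  case (single m c)
  then have m: "keys m <= X" "Suc l \<le> mlen m" by simp_all
  let ?t = "single (m - single v 1) (of_nat (lookup m v) :: 'k)"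
  have r: "op (BB v) (single m 1) - ?t : Il l"
   by (rule subsetD[OF Il_antimono op_mono[OF m(1)]]) (use m(2) in simp)
  have t: "?t : Il l"
  proof (cases "v : keys m")
   case True
   show ?thesis by (rule Il_single) (use keys_minus[of m v] m mlen_minus[OF True] in \<open>auto simp del: One_nat_def\<close>)
  next
   case False
   then have "lookup m v = 0" by (simp add: in_keys_iff)
   then show ?thesis by (simp add: Il_def)
  qed
  have "op (BB v) (single m c) = pm_scale c (op (BB v) (single m 1))"
   using lin_homD(3)[OF op_lin single_HA[OF m(1)], of "BB v" c 1] by simp
  moreover have "op (BB v) (single m 1) : Il l" using Il_add[OF r t] by simp
  ultimately show ?case by (simp add: Il_def keys_pm_scaleI)
 next
  case (add z w)
  have "z : carrier HA" "w : carrier HA" using add(1,2) by auto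
  from lin_homD(2)[OF op_lin this, of "BB v"] add show ?case by (simp add: Il_add)
 qed
qed

text \<open>Every letter lowers the power of the augmentation ideal by at most one. After all
  letters the polynomial still has no constant term, and the counit gives 0.\<close>

lemma \<Phi>w_Il: "z : Il (Suc (length vs)) ==> \<Phi>w (bw vs) z = 0"
proof (induction vs arbitrary: z)
 case Nil
 then have "0 \<notin> keys z" by (auto simp: Il_def)
 then show ?case unfolding list.map \<Phi>w_simps DA_apply(4)[OF Il_HA[OF Nil]] \<epsilon>_lookup by (simp add: in_keys_iff)
next
 case (Cons v vs)
 show ?case unfolding list.map \<Phi>w_op[OF Il_HA[OF Cons.prems]]
  by (rule Cons.IH) (use op_Il[of z "length (v # vs)" v] Cons.prems in simp)
qed

text \<open>On monomials at least as long as the word, letters act as partial derivatives, since the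
  error terms are too long to be seen by the remaining letters. If the letters of the word are those
  of \<open>m\<close>, the value is the product of the factorials of the exponents, which is nonzero
  in characteristic zero.\<close>

lemma triangular:
 assumes "keys m <= X" "length vs \<le> mlen m"
 shows "\<Phi>w (bw vs) (single m 1) ~= 0 \<longleftrightarrow> m = mm vs"
 using assms
proof (induction vs arbitrary: m)
 case Nil
 show ?case unfolding list.map \<Phi>w_simps DA_apply(4)[OF single_HA[OF Nil(1)]] \<epsilon>_mono by simp
next
 case (Cons v vs)
 let ?t = "single (m - single v 1) (of_nat (lookup m v) :: 'k)"
 let ?s = "single (m - single v 1) (1 :: 'k)"
 define r where "r = op (BB v) (single m 1) - ?t"
 have r: "r : Il (Suc (length vs))" unfolding r_def
  by (rule subsetD[OF Il_antimono op_mono[OF Cons.prems(1)]]) (use Cons.prems(2) in simp)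
 have k: "keys (m - single v 1) <= X" using keys_minus[of m v] Cons.prems(1) by (rule order_trans)
 have e: "op (BB v) (single m 1) = ?t \<oplus>\<^bsub>HA\<^esub> r" by (simp add: r_def)
 have "\<Phi>w (bw (v # vs)) (single m 1) = \<Phi>w (bw vs) ?t + \<Phi>w (bw vs) r"
  unfolding list.map \<Phi>w_op[OF single_HA[OF Cons.prems(1)]] e lin_homD(2)[OF \<Phi>w_lin single_HA[OF k] Il_HA[OF r]] by simp
 also have "\<dots> = of_nat (lookup m v) * \<Phi>w (bw vs) ?s"
  using lin_homD(3)[OF \<Phi>w_lin single_HA[OF k], of "bw vs" "of_nat (lookup m v)" 1] \<Phi>w_Il[OF r] by simp
 finally have v: "\<Phi>w (bw (v # vs)) (single m 1) = of_nat (lookup m v) * \<Phi>w (bw vs) ?s" .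
 show ?case
 proof (cases "v : keys m")
  case True
  have "\<Phi>w (bw vs) ?s ~= 0 \<longleftrightarrow> m - single v 1 = mm vs"
   by (rule Cons.IH[OF k]) (use Cons.prems(2) mlen_minus[OF True] in \<open>simp del: One_nat_def\<close>)
  also have "\<dots> \<longleftrightarrow> m = mm (v # vs)"
   using mono_decompose[OF True] by (auto simp del: One_nat_def)
  finally show ?thesis unfolding v using True by (simp add: in_keys_iff del: One_nat_def)
 next
  case False
  then have "m ~= mm (v # vs)" by auto
  moreover have "lookup m v = 0" using False by (simp add: in_keys_iff)
  ultimately show ?thesis unfolding v by simp
 qed
qed

lemma \<Phi>w_gr:
 assumes "list_all2 (%x d. \<forall>v\<in>keys x. deg v = d) w ds" "h : gr \<beta>" "\<beta> ~= sum_list ds"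
 shows "\<Phi>w w h = 0"
 using assms
proof (induction w ds arbitrary: h \<beta> rule: list_all2_induct)
 case Nil
 have "\<epsilon> h = 0" by (rule gr_0_value[OF Nil(1)]) (use Nil in simp)
 then show ?case unfolding \<Phi>w_simps DA_apply(4)[OF subsetD[OF gr_subset Nil(1)]] .
next
 case (Cons x w d ds)
 show ?case unfolding \<Phi>w_simps DA_simps(2) conv_lr[OF \<Phi>w_lin]
 proof (rule conv_gr_0[OF lin_lin \<Phi>w_lin Cons.prems(1)], rule ccontr)
  fix \<beta>' \<gamma> a b assume a: "\<beta>' + \<gamma> = \<beta>" "a : gr \<beta>'" "b : gr \<gamma>" "lin x a * \<Phi>w w b ~= 0"
  then obtain v where "v : keys x" "deg v = \<beta>'" using lin_gr[OF a(2), of x] by auto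
  then have "\<beta>' = d" using Cons.hyps(1) by auto
  moreover have "\<gamma> = sum_list ds" using Cons.IH[OF a(3)] a(4) by auto
  ultimately show False using a(1) Cons.prems(2) by simp
 qed
qed

lemma wt_mm: "wt deg (mm vs) = sum_list (map deg vs)"
 by (induction vs) simp_all

lemma \<Phi>w_bw_gr: "h : gr \<beta> ==> \<beta> ~= wt deg (mm vs) ==> \<Phi>w (bw vs) h = 0"
 by (rule \<Phi>w_gr[of _ "map deg vs"]) (simp_all add: list.rel_map list.rel_refl wt_mm)

lemma cw_simps: "keys m <= X ==> cw m : lists X" "keys m <= X ==> mm (cw m) = m"
 "keys m <= X ==> length (cw m) = mlen m"
 using cw[of m] mlen_mm[of "cw m"] by auto

definition Dw where "Dw A = bw ` cw ` {m. keys m <= X \<and> wt deg m : A}"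

text \<open>Induction on a bound for the lengths of monomials on which \<open>f\<close> is nonzero.
  The values at length \<open>k\<close> are matched by canonical words of length \<open>k\<close>,
  with coefficients divided by the diagonal entries of the pairing. By triangularity the correction
  does not touch longer monomials, so subtracting it lowers the bound; restricting to weights in
  \<open>A\<close> keeps track of degrees.\<close>

lemma surj_aux:
 assumes A: "finite A"
 shows "f : carrier DA ==> supp f <= A ==>
  (\<And>m. keys m <= X ==> k \<le> mlen m ==> f (single m 1) = 0) ==>
  \<exists>z. keys z <= Dw A \<and> lext DA \<Phi>w z = f"
proof (induction k arbitrary: f)
 case 0
 note kD = is_k_algebraD(1)[OF DA_k]
 have "f = \<zero>\<^bsub>DA\<^esub>" by (rule DA_eqI_mono[OF 0(1) DA_zero_closed]) (simp add: 0(3) DA_apply(3)[OF single_HA])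
 then show ?case using lext_zero[OF kD, of UNIV \<Phi>w] by (intro exI[of _ 0]) (simp add: \<Phi>w_DA)
next
 case (Suc k)
 define M where "M = {m. keys m <= X \<and> wt deg m : A \<and> mlen m = k}"
 have M: "finite M"
 proof (rule finite_subset)
  show "M <= (\<Union>\<alpha>\<in>A. {m. keys m <= X \<and> wt deg m = \<alpha>})" by (auto simp: M_def)
  show "finite (\<Union>\<alpha>\<in>A. {m. keys m <= X \<and> wt deg m = \<alpha>})" using A finite_monos by auto
 qed
 define c where "c m = f (single m 1) / \<Phi>w (bw (cw m)) (single m 1)" for m
 define z where "z = (\<Sum>m\<in>M. single (bw (cw m)) (c m))"
 have zk: "keys z <= Dw A" unfolding z_def Dw_def by (rule keys_sum_subset) (auto simp: M_def)
 note kD = is_k_algebraD(1)[OF DA_k]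
 define f' where "f' = f \<oplus>\<^bsub>DA\<^esub> (-1) \<odot>\<^bsub>DA\<^esub> lext DA \<Phi>w z"
 have f'D: "f' : carrier DA" unfolding f'_def by (intro DA_closed(1) Suc.prems(1) DA_scale_closed lext_\<Phi>w_DA)
 have zh: "lext DA \<Phi>w z h = (\<Sum>m\<in>M. c m * \<Phi>w (bw (cw m)) h)" if h: "h : carrier HA" for h
 proof -
  have "lext K (%w. \<Phi>w w h) (\<Sum>m\<in>M. single (bw (cw m)) (c m)) = (\<Sum>m\<in>M. c m * \<Phi>w (bw (cw m)) h)"
   using M by (induction rule: finite_induct)
    (simp_all add: lext_zero[OF kmod_ground, of UNIV] lext_add[OF kmod_ground, of UNIV] lext_single[OF kmod_ground, of UNIV])
  then show ?thesis unfolding lext_\<Phi>w_apply[OF h] z_def .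
 qed
 have f'h: "f' h = f h - (\<Sum>m\<in>M. c m * \<Phi>w (bw (cw m)) h)" if h: "h : carrier HA" for h
  unfolding f'_def DA_apply(1)[OF h] DA_apply(2)[OF h] zh[OF h] by simp
 have f's: "supp f' <= A"
 proof (rule ccontr)
  assume "\<not> supp f' <= A"
  then obtain \<alpha> h where a: "\<alpha> \<notin> A" "h : gr \<alpha>" "f' h ~= 0" "\<alpha> : exponents n" by (auto simp: supp_def)
  have "f h = 0" using Suc.prems(2) a(1,2,4) by (auto simp: supp_def)
  moreover have "(\<Sum>m\<in>M. c m * \<Phi>w (bw (cw m)) h) = 0"
   by (rule sum.neutral) (use a(1) in \<open>auto simp: M_def cw_simps intro!: \<Phi>w_bw_gr[OF a(2)]\<close>)
  ultimately show False using a(3) f'h[OF subsetD[OF gr_subset a(2)]] by simp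
 qed
 have f'0: "f' (single m 1) = 0" if m: "keys m <= X" "k \<le> mlen m" for m
 proof -
  have t: "\<Phi>w (bw (cw m')) (single m 1) ~= 0 \<longleftrightarrow> m = m'" if "m' : M" for m'
   using triangular[OF m(1), of "cw m'"] that m(2) by (simp add: M_def cw_simps)
  have "(\<Sum>m'\<in>M. c m' * \<Phi>w (bw (cw m')) (single m 1)) = (\<Sum>m'\<in>M. if m' = m then f (single m 1) else 0)"
  proof (rule sum.cong[OF refl])
   fix m' assume m': "m' : M"
   show "c m' * \<Phi>w (bw (cw m')) (single m 1) = (if m' = m then f (single m 1) else 0)"
    using t[OF m'] by (cases "m = m'") (simp_all add: c_def)
  qed
  also have "\<dots> = f (single m 1)"
  proof (cases "m : M")
   case True then show ?thesis using M by simp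
  next
   case False
   then consider "Suc k \<le> mlen m" | "wt deg m \<notin> A" using m by (auto simp: M_def)
   then have "f (single m 1) = 0"
   proof cases
    case 1 then show ?thesis by (rule Suc.prems(3)[OF m(1)])
   next
    case 2
    then show ?thesis using Suc.prems(2) gr_single[OF m(1) refl, of 1] wt_mono_exponents[OF m(1)] by (auto simp: supp_def)
   qed
   then show ?thesis using M by simp
  qed
  finally show ?thesis unfolding f'h[OF single_HA[OF m(1)]] by simp
 qed
 have "\<exists>z. keys z <= Dw A \<and> lext DA \<Phi>w z = f'" by (rule Suc.IH[OF f'D f's f'0])
 then obtain z' where z': "keys z' <= Dw A" "lext DA \<Phi>w z' = f'" by (elim exE conjE)
 have "lext DA \<Phi>w (z' + z) = f"
 proof (rule DA_ext[OF lext_\<Phi>w_DA Suc.prems(1)])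
  fix h assume h: "h : carrier HA"
  have "lext DA \<Phi>w (z' + z) = f' \<oplus>\<^bsub>DA\<^esub> lext DA \<Phi>w z"
   unfolding z'(2)[symmetric] by (rule lext_add[OF kD, of UNIV]) (simp_all add: \<Phi>w_DA)
  then show "lext DA \<Phi>w (z' + z) h = f h" by (simp add: DA_apply(1)[OF h] f'h[OF h] zh[OF h] del: HA_simps)
 qed
 with keys_addI[OF z'(1) zk] show ?case by (intro exI[of _ "z' + z"] conjI)
qed

text \<open>Only the finitely many monomials with weight in \<open>A\<close> can have nonzero
  values, so their lengths are bounded.\<close>

lemma surj:
 assumes A: "finite A" and f: "f : carrier DA" "supp f <= A"
 shows "\<exists>z. keys z <= Dw A \<and> lext DA \<Phi>w z = f"
proof -
 let ?M = "\<Union>\<alpha>\<in>A. {m. keys m <= X \<and> wt deg m = \<alpha>}"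
 have M: "finite ?M" using A finite_monos by auto
 show ?thesis
 proof (rule surj_aux[OF A f, of "Suc (Max (mlen ` ?M))"])
  fix m assume m: "keys m <= X" "Suc (Max (mlen ` ?M)) \<le> mlen m"
  have "m \<notin> ?M"
  proof
   assume "m : ?M"
   from Max_ge[OF finite_imageI[OF M] imageI[OF this], of mlen] m(2) show False by linarith
  qed
  then have "wt deg m \<notin> A" using m(1) by auto
  then show "f (single m 1) = 0"
   using f(2) gr_single[OF m(1) refl, of 1] wt_mono_exponents[OF m(1)] by (auto simp: supp_def)
 qed
qed

lemma Dw_LC: "Dw A <= lists LC"
 using Can_LC by (auto simp: Dw_def Can_def)

text \<open>Expand in canonical words and pair with the monomial of a longest one. Triangularity
  annihilates all other words, so the coefficient of the longest word would have to vanish.\<close>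

lemma \<Phi>_inj0:
 assumes u: "u : carrier UA" and z: "\<Phi> u = \<zero>\<^bsub>DA\<^esub>" shows "u = \<zero>\<^bsub>UA\<^esub>"
proof -
 obtain z where zu: "u = cl z" "keys z <= Can" using UA_Can[OF u] by (elim spn_E)
 have "keys z = {}"
 proof (rule ccontr)
  assume ne: "keys z ~= {}"
  let ?l = "Max (length ` keys z)"
  obtain w0 where w0: "w0 : keys z" "length w0 = ?l"
  proof -
   have "?l : length ` keys z" by (rule Max_in) (use ne in auto)
   then show ?thesis by (elim imageE) (rule that, simp_all)
  qed
  have ml: "length w \<le> length w0" if "w : keys z" for w
   unfolding w0(2) by (rule Max_ge) (use that in auto)
  obtain m0 where m0: "keys m0 <= X" "w0 = bw (cw m0)" using w0(1) zu(2) by (auto simp: Can_def)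
  let ?x = "single m0 (1::'k)"
  have "0 = (\<Sum>w\<in>keys z. lookup z w * \<Phi>w w ?x)"
   using z \<Phi>_cl[OF order_trans[OF zu(2) Can_LC]] lext_\<Phi>w_apply[OF single_HA[OF m0(1)], of z 1] DA_apply(3)[OF single_HA[OF m0(1)], of 1]
   unfolding zu(1) lext_ground by simp
  also have "\<dots> = (\<Sum>w\<in>keys z. if w = w0 then lookup z w0 * \<Phi>w w0 ?x else 0)"
  proof (rule sum.cong[OF refl])
   fix w assume w: "w : keys z"
   then obtain m where m: "keys m <= X" "w = bw (cw m)" using zu(2) by (auto simp: Can_def)
   have "\<Phi>w w ?x ~= 0 \<longleftrightarrow> m0 = m"
    unfolding m(2) using triangular[OF m0(1), of "cw m"] ml[OF w] by (simp add: m m0 cw_simps)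
   then show "lookup z w * \<Phi>w w ?x = (if w = w0 then lookup z w0 * \<Phi>w w0 ?x else 0)"
    using m m0 by auto
  qed
  also have "\<dots> = lookup z w0 * \<Phi>w w0 ?x" using w0(1) by simp
  finally have "\<Phi>w w0 ?x = 0" using w0(1) by (simp add: in_keys_iff)
  moreover have "\<Phi>w w0 ?x ~= 0" unfolding m0(2) using triangular[OF m0(1), of "cw m0"] by (simp add: m0 cw_simps)
  ultimately show False by simp
 qed
 then have "z = 0" by simp
 then show ?thesis using zu(1) by (simp add: cl_one_zero)
qed

lemma \<Phi>_bij: "bij_betw \<Phi> (carrier UA) (carrier DA)"
 unfolding bij_betw_def
proof (intro conjI inj_onI)
 fix u u' assume u: "u : carrier UA" "u' : carrier UA" and e: "\<Phi> u = \<Phi> u'"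
 note kU = is_k_algebraD(1)[OF UA_k] and kD = is_k_algebraD(1)[OF DA_k]
 interpret U: abelian_group UA by (rule kmodD(1)[OF kU])
 interpret D: abelian_group DA by (rule kmodD(1)[OF kD])
 have c: "\<Phi> u' : carrier DA" by (rule lin_homD(1)[OF \<Phi>_lin u(2)])
 have "\<Phi> (u \<oplus>\<^bsub>UA\<^esub> (-1) \<odot>\<^bsub>UA\<^esub> u') = \<Phi> u' \<oplus>\<^bsub>DA\<^esub> (-1) \<odot>\<^bsub>DA\<^esub> \<Phi> u'"
  unfolding lin_homD(2)[OF \<Phi>_lin u(1) kmodD(2)[OF kU u(2)]] lin_homD(3)[OF \<Phi>_lin u(2)] e ..
 also have "\<dots> = \<zero>\<^bsub>DA\<^esub>" unfolding kmod_uminus[OF kD c, symmetric] by (rule D.r_neg[OF c])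
 finally have "u \<oplus>\<^bsub>UA\<^esub> \<ominus>\<^bsub>UA\<^esub> u' = \<zero>\<^bsub>UA\<^esub>"
  unfolding kmod_uminus[OF kU u(2)] by (intro \<Phi>_inj0 U.a_closed u kmodD(2)[OF kU])
 from U.minus_equality[OF this U.a_inv_closed[OF u(2)] u(1)] show "u = u'" using u(2) by simp
next
 show "\<Phi> ` carrier UA = carrier DA"
 proof (intro equalityI image_subsetI subsetI)
  fix f assume f: "f : carrier DA"
  from surj[OF DA_carrierD(3)[OF f] f order_refl] obtain z where z: "keys z <= Dw (supp f)" "lext DA \<Phi>w z = f" by (elim exE conjE)
  have k: "keys z <= lists LC" by (rule order_trans[OF z(1) Dw_LC])
  show "f : \<Phi> ` carrier UA" by (rule image_eqI[of _ _ "cl z"]) (use \<Phi>_cl[OF k] z(2) k in \<open>auto simp: UA_carrier\<close>)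
 qed (rule lin_homD(1)[OF \<Phi>_lin])
qed

abbreviation grL where "grL \<alpha> \<equiv> {x :: 'v \<Rightarrow>\<^sub>0 'k. keys x <= X \<and> (\<forall>v\<in>keys x. deg v = \<alpha>)}"

lemma \<Phi>_grading:
 assumes \<alpha>: "\<alpha> : exponents n"
 shows "\<Phi> ` env_grading L br grL \<alpha> = {f : carrier DA. \<forall>\<beta>\<in>exponents n - {\<alpha>}. \<forall>x\<in>gr \<beta>. f x = 0}" (is "?l = ?r")
proof (intro equalityI subsetI)
 fix f assume "f : ?l"
 then obtain z where f: "f = \<Phi> (cl z)" and z: "\<forall>w\<in>keys z. \<exists>ds. list_all2 (%x d. x : grL d) w ds \<and> sum_list ds = \<alpha>"
  unfolding env_grading_def by (elim imageE CollectE) simp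
 have hom: "w : lists LC \<and> (\<forall>\<beta> h. h : gr \<beta> \<longrightarrow> \<beta> ~= \<alpha> \<longrightarrow> \<Phi>w w h = 0)" if w: "w : keys z" for w
 proof -
  from bspec[OF z w] obtain ds where ds: "list_all2 (%x d. x : grL d) w ds" "sum_list ds = \<alpha>" by (elim exE conjE)
  have "w : lists LC" using ds(1) by (induction rule: list_all2_induct) simp_all
  moreover have "list_all2 (%x d. \<forall>v\<in>keys x. deg v = d) w ds" by (rule list_all2_mono[OF ds(1)]) simp
  ultimately show ?thesis using \<Phi>w_gr[of w ds] ds(2) by simp
 qed
 have k: "keys z <= lists LC" using hom by (intro subsetI) simp
 have "f h = 0" if h: "h : gr \<beta>" "\<beta> ~= \<alpha>" for h \<beta>
  unfolding f \<Phi>_cl[OF k] lext_\<Phi>w_apply[OF subsetD[OF gr_subset h(1)]] lext_ground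
  by (rule sum.neutral) (use hom h in auto)
 moreover have "f : carrier DA" unfolding f \<Phi>_cl[OF k] by (rule lext_\<Phi>w_DA)
 ultimately show "f : ?r" by blast
next
 fix f assume f: "f : ?r"
 then have "supp f <= {\<alpha>}" by (auto simp: supp_def)
 \<comment> \<open>A functional that is homogeneous of degree \<open>\<alpha>\<close> is reached by
   canonical words of weight \<open>\<alpha>\<close> alone, because surjectivity controls
   degrees.\<close>
 with f surj[of "{\<alpha>}" f] obtain z where z: "keys z <= Dw {\<alpha>}" "lext DA \<Phi>w z = f" by auto
 show "f : ?l" unfolding env_grading_def
 proof (rule image_eqI[of _ _ "cl z"], unfold \<Phi>_cl[OF order_trans[OF z(1) Dw_LC]] z(2), rule refl, rule imageI, rule CollectI, rule ballI)
  fix w assume "w : keys z"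
  then obtain m where m: "keys m <= X" "wt deg m = \<alpha>" "w = bw (cw m)" using z(1) by (auto simp: Dw_def)
  have "list_all2 (%x d. x : grL d) (bw (cw m)) (map deg (cw m))"
   using cw_simps(1)[OF m(1)] by (auto simp: list.rel_map intro!: list.rel_refl_strong)
  moreover have "sum_list (map deg (cw m)) = \<alpha>" using wt_mm[of "cw m"] cw_simps(2)[OF m(1)] m(2) by simp
  ultimately show "\<exists>ds. list_all2 (%x d. x : grL d) w ds \<and> sum_list ds = \<alpha>" unfolding m(3) by (intro exI[of _ "map deg (cw m)"] conjI)
 qed
qed

end

context env_group
begin

abbreviation "TU \<equiv> tensor UA UA"
lemmas TU = is_k_algebra_tensor[OF UA_k UA_k] and TUp = pure_tensor_closed[OF UA_k UA_k]

subsubsection \<open>The coproduct\<close>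

definition prim where "prim x = pure_tensor UA UA (wd [x]) \<one>\<^bsub>UA\<^esub> \<oplus>\<^bsub>TU\<^esub> pure_tensor UA UA \<one>\<^bsub>UA\<^esub> (wd [x])"
definition Cw where "Cw w = foldr (%x t. prim x \<otimes>\<^bsub>TU\<^esub> t) w \<one>\<^bsub>TU\<^esub>"
definition Cm where "Cm = induced TU Cw"
definition Aw where "Aw w = cl (single (rev w) ((-1) ^ length w))"
definition Ap where "Ap = induced UA Aw"
definition Eps where "Eps = induced K (%w. if w = [] then 1 else 0)"

lemma env_simps:
 "comult (enveloping_algebra L br) = Cm" "counit (enveloping_algebra L br) = Eps" "antipode (enveloping_algebra L br) = Ap"
 "same_alg (enveloping_algebra L br) UA"
 by (simp_all add: enveloping_algebra_def Let_def module.defs hopf.defs Cm_def Cw_def[abs_def] prim_def wd_def Ap_def Aw_def[abs_def] Eps_def same_alg_def)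

lemma graded_dual_simps:
 "comult (graded_dual n H gr) = (%f. THE t. t : carrier (tensor DA DA) \<and>
  (\<forall>x\<in>carrier H. \<forall>y\<in>carrier H. tensor_lift K (%f1 f2. f1 x * f2 y) t = f (x \<otimes>\<^bsub>H\<^esub> y)))"
 "counit (graded_dual n H gr) = (%f. f \<one>\<^bsub>H\<^esub>)" "antipode (graded_dual n H gr) = (%f. \<lambda>h\<in>carrier H. f (antipode H h))"
 "same_alg (graded_dual n H gr) DA"
 by (simp_all add: graded_dual_def Let_def module.defs hopf.defs DA_def same_alg_def)

lemma one_UA: "\<one>\<^bsub>UA\<^esub> : carrier UA" by (rule monoid.one_closed[OF is_k_algebraD(3)[OF UA_k]])

lemma letter_UA: "x : LC ==> wd [x] : carrier UA" by (rule wd_closed[OF wordsI(1)])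

lemma prim_closed: "x : LC ==> prim x : carrier TU"
 unfolding prim_def by (intro kmod_simps(3)[OF is_k_algebraD(1)[OF TU]] TUp letter_UA one_UA)

lemma Cw_simps: "Cw [] = \<one>\<^bsub>TU\<^esub>" "Cw (x # w) = prim x \<otimes>\<^bsub>TU\<^esub> Cw w"
 by (simp_all add: Cw_def)

lemma TU_monoid: "monoid TU" by (rule is_k_algebraD[OF TU])

lemma Cw_closed: "w : lists LC ==> Cw w : carrier TU"
proof (induction w rule: list.induct)
 case Nil show ?case unfolding Cw_simps by (rule monoid.one_closed[OF TU_monoid])
next
 case (Cons x w)
 then have "x : LC" "w : lists LC" by simp_all
 then show ?case unfolding Cw_simps by (intro monoid.m_closed[OF TU_monoid] prim_closed Cons.IH)
qed

lemma Cw_append: "w : lists LC ==> w' : lists LC ==> Cw (w @ w') = Cw w \<otimes>\<^bsub>TU\<^esub> Cw w'"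
proof (induction w rule: list.induct)
 case Nil then show ?case unfolding append_Nil Cw_simps by (simp only: monoid.l_one[OF TU_monoid Cw_closed])
next
 case (Cons x w)
 then have c: "x : LC" "w : lists LC" by simp_all
 show ?case unfolding append_Cons Cw_simps Cons.IH[OF c(2) Cons.prems(2)]
  by (rule monoid.m_assoc[OF TU_monoid prim_closed[OF c(1)] Cw_closed[OF c(2)] Cw_closed[OF Cons.prems(2)], symmetric])
qed

lemma Cw_fm: "(\<forall>w\<in>lists LC. \<forall>w'\<in>lists LC. Cw (w @ w') = Cw w \<otimes>\<^bsub>TU\<^esub> Cw w') \<or>
  (\<forall>w\<in>lists LC. \<forall>w'\<in>lists LC. Cw (w @ w') = Cw w' \<otimes>\<^bsub>TU\<^esub> Cw w)"
 by (intro disjI1 ballI Cw_append)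

lemma Cw_letter: "x : LC ==> Cw [x] = prim x"
 unfolding Cw_simps by (rule monoid.r_one[OF TU_monoid prim_closed])

lemma Cw_rel:
 "x : LC ==> y : LC ==> Cw [x + y] = Cw [x] \<oplus>\<^bsub>TU\<^esub> Cw [y]"
 "x : LC ==> Cw [pm_scale c x] = c \<odot>\<^bsub>TU\<^esub> Cw [x]"
 "x : LC ==> y : LC ==> Cw [x, y] = Cw [y, x] \<oplus>\<^bsub>TU\<^esub> Cw [br x y]"
proof -
 interpret U: ring UA by (rule is_k_algebraD[OF UA_k])
 interpret TU: ring TU by (rule is_k_algebraD[OF TU])
 note bp = bilD[OF bil_pure_tensor[OF UA_k UA_k]] and kT = kmodD[OF is_k_algebraD(1)[OF TU]]
 let ?p = "pure_tensor UA UA"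
 have ac: "(a \<oplus>\<^bsub>TU\<^esub> b) \<oplus>\<^bsub>TU\<^esub> (c \<oplus>\<^bsub>TU\<^esub> d) = (a \<oplus>\<^bsub>TU\<^esub> c) \<oplus>\<^bsub>TU\<^esub> (b \<oplus>\<^bsub>TU\<^esub> d)"
  if "a : carrier TU" "b : carrier TU" "c : carrier TU" "d : carrier TU" for a b c d
  using that by (simp add: TU.a_ac)
 have dist: "(a \<oplus>\<^bsub>TU\<^esub> b) \<otimes>\<^bsub>TU\<^esub> (c \<oplus>\<^bsub>TU\<^esub> d) = (a \<otimes>\<^bsub>TU\<^esub> c \<oplus>\<^bsub>TU\<^esub> a \<otimes>\<^bsub>TU\<^esub> d) \<oplus>\<^bsub>TU\<^esub> (b \<otimes>\<^bsub>TU\<^esub> c \<oplus>\<^bsub>TU\<^esub> b \<otimes>\<^bsub>TU\<^esub> d)"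
  if "a : carrier TU" "b : carrier TU" "c : carrier TU" "d : carrier TU" for a b c d
  using that by (subst TU.l_distr) (simp_all add: TU.r_distr)
 {
  assume x: "x : LC" and y: "y : LC"
  note l = letter_UA[OF x] letter_UA[OF y]
  show "Cw [x + y] = Cw [x] \<oplus>\<^bsub>TU\<^esub> Cw [y]"
   unfolding Cw_letter[OF LC_closed(1)[OF x y]] Cw_letter[OF x] Cw_letter[OF y] prim_def wd_add[OF x y] bp(2)[OF l one_UA] bp(3)[OF one_UA l]
   by (rule ac; intro TUp l one_UA)
 }
 {
  assume x: "x : LC"
  note l = letter_UA[OF x]
  show "Cw [pm_scale c x] = c \<odot>\<^bsub>TU\<^esub> Cw [x]"
   unfolding Cw_letter[OF LC_closed(2)[OF x]] Cw_letter[OF x] prim_def wd_scale[OF x] bp(4)[OF l one_UA] bp(5)[OF one_UA l]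
    kT(4)[OF TUp[OF l one_UA] TUp[OF one_UA l]] ..
 }
 {
  assume x: "x : LC" and y: "y : LC"
  note l = letter_UA[OF x] letter_UA[OF y] and b = letter_UA[OF LC_closed(3)[OF x y]]
  \<comment> \<open>The mixed terms of the product of two primitive elements are symmetric in the
    letters, so they agree for \<open>[x, y]\<close> and \<open>[y, x]\<close> and the bracket
    relation concerns only the primitive part.\<close>
  have two: "Cw [a, c] = (?p (wd [a, c]) \<one>\<^bsub>UA\<^esub> \<oplus>\<^bsub>TU\<^esub> ?p \<one>\<^bsub>UA\<^esub> (wd [a, c])) \<oplus>\<^bsub>TU\<^esub> (?p (wd [a]) (wd [c]) \<oplus>\<^bsub>TU\<^esub> ?p (wd [c]) (wd [a]))"
   if a: "a : LC" and c: "c : LC" for a c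
  proof -
   note la = letter_UA[OF a] letter_UA[OF c]
   have w: "wd [a, c] = wd [a] \<otimes>\<^bsub>UA\<^esub> wd [c]" by (rule wd_Cons[OF a wordsI(1)[OF c]])
   note m = pure_tensor_mult[OF UA_k UA_k]
   have wc: "wd [a] \<otimes>\<^bsub>UA\<^esub> wd [c] : carrier UA" using la by simp
   note pc = TUp[OF wc one_UA] TUp[OF one_UA wc] TUp[OF la] TUp[OF la(2,1)] TUp[OF la(1) one_UA] TUp[OF one_UA la(1)] TUp[OF la(2) one_UA] TUp[OF one_UA la(2)]
   have "Cw [a, c] = prim a \<otimes>\<^bsub>TU\<^esub> prim c" unfolding Cw_simps(2)[of a] Cw_letter[OF c] ..
   also have "\<dots> = (?p (wd [a]) \<one>\<^bsub>UA\<^esub> \<otimes>\<^bsub>TU\<^esub> ?p (wd [c]) \<one>\<^bsub>UA\<^esub> \<oplus>\<^bsub>TU\<^esub> ?p (wd [a]) \<one>\<^bsub>UA\<^esub> \<otimes>\<^bsub>TU\<^esub> ?p \<one>\<^bsub>UA\<^esub> (wd [c]))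
    \<oplus>\<^bsub>TU\<^esub> (?p \<one>\<^bsub>UA\<^esub> (wd [a]) \<otimes>\<^bsub>TU\<^esub> ?p (wd [c]) \<one>\<^bsub>UA\<^esub> \<oplus>\<^bsub>TU\<^esub> ?p \<one>\<^bsub>UA\<^esub> (wd [a]) \<otimes>\<^bsub>TU\<^esub> ?p \<one>\<^bsub>UA\<^esub> (wd [c]))"
    unfolding prim_def by (rule dist; rule pc)
   also have "\<dots> = (?p (wd [a, c]) \<one>\<^bsub>UA\<^esub> \<oplus>\<^bsub>TU\<^esub> ?p (wd [a]) (wd [c])) \<oplus>\<^bsub>TU\<^esub> (?p (wd [c]) (wd [a]) \<oplus>\<^bsub>TU\<^esub> ?p \<one>\<^bsub>UA\<^esub> (wd [a, c]))"
    unfolding m[OF la(1) one_UA la(2) one_UA] m[OF la(1) one_UA one_UA la(2)] m[OF one_UA la(1) la(2) one_UA] m[OF one_UA la(1) one_UA la(2)] w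
    using la by simp
   also have "\<dots> = (?p (wd [a, c]) \<one>\<^bsub>UA\<^esub> \<oplus>\<^bsub>TU\<^esub> ?p \<one>\<^bsub>UA\<^esub> (wd [a, c])) \<oplus>\<^bsub>TU\<^esub> (?p (wd [a]) (wd [c]) \<oplus>\<^bsub>TU\<^esub> ?p (wd [c]) (wd [a]))"
    unfolding w using pc by (simp add: TU.a_ac)
   finally show ?thesis .
  qed
  note c2 = wd_closed[OF wordsI(2)[OF x y]] wd_closed[OF wordsI(2)[OF y x]]
  note pc = TUp[OF c2(2) one_UA] TUp[OF one_UA c2(2)] TUp[OF b one_UA] TUp[OF one_UA b] TUp[OF l] TUp[OF l(2,1)]
  show "Cw [x, y] = Cw [y, x] \<oplus>\<^bsub>TU\<^esub> Cw [br x y]"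
   unfolding two[OF x y] two[OF y x] Cw_letter[OF LC_closed(3)[OF x y]] prim_def wd_br[OF x y] bp(2)[OF c2(2) b one_UA] bp(3)[OF one_UA c2(2) b]
   using pc by (simp add: TU.a_ac)
 }
qed

lemma Cm_wd: "w : lists LC ==> Cm (wd w) = Cw w"
 unfolding Cm_def by (rule induced_wd[OF TU]) (rule Cw_closed Cw_fm Cw_rel | assumption)+

lemma Cm_lin: "Cm : lin_hom UA TU"
 unfolding Cm_def by (rule induced_lin[OF TU]) (rule Cw_closed Cw_fm Cw_rel | assumption)+

lemma \<Phi>_eval: "h : carrier HA ==> (%u. \<Phi> u h) : lin_hom UA K"
 by (rule lin_hom_comp[OF \<Phi>_lin DA_eval])

abbreviation EU where "EU x y \<equiv> tev (%u. \<Phi> u x) (%u. \<Phi> u y)"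

lemma EU_lin: "x : carrier HA ==> y : carrier HA ==> EU x y : lin_hom TU K"
 by (rule tev_lin_hom[OF UA_k UA_k \<Phi>_eval \<Phi>_eval])

lemma EU_pure: "x : carrier HA ==> y : carrier HA ==> u : carrier UA ==> u' : carrier UA ==>
  EU x y (pure_tensor UA UA u u') = \<Phi> u x * \<Phi> u' y"
 by (rule tev_pure[OF UA_k UA_k \<Phi>_eval \<Phi>_eval])

lemma \<Phi>_letter_mult:
 assumes a: "a : LC" and u: "u : carrier UA" and x: "x : carrier HA"
 shows "\<Phi> (wd [a] \<otimes>\<^bsub>UA\<^esub> u) x = \<Phi> u (op a x)"
 unfolding \<Phi>_mult[OF letter_UA[OF a] u] \<Phi>_wd[OF wordsI(1)[OF a]] \<Phi>w_letter DA_simps(2) conv_lr(1)[OF DA_carrierD(1)[OF lin_homD(1)[OF \<Phi>_lin u]]]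
 by (rule conv_lin_op[OF DA_carrierD(1)[OF lin_homD(1)[OF \<Phi>_lin u]] x])

text \<open>The Leibniz rule in dual form: multiplying by a primitive element lets the derivation of
  the letter act on one of the two polynomials at a time.\<close>

lemma EU_prim:
 assumes x: "x : carrier HA" and y: "y : carrier HA" and a: "a : LC" and t: "t : carrier TU"
 shows "EU x y (prim a \<otimes>\<^bsub>TU\<^esub> t) = EU (op a x) y t + EU x (op a y) t"
proof (rule lin_hom_tensor_eqI[OF UA_k UA_k _ _ kmod_ground _ t])
 interpret U: ring UA by (rule is_k_algebraD[OF UA_k])
 interpret TU: ring TU by (rule is_k_algebraD[OF TU])
 note ox = lin_homD(1)[OF op_lin x, of a] and oy = lin_homD(1)[OF op_lin y, of a]
 have "(\<otimes>\<^bsub>TU\<^esub>) (prim a) : lin_hom TU TU" using bil_mult[OF TU] prim_closed[OF a] unfolding bil_def by simp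
 from lin_hom_comp[OF this EU_lin[OF x y]] show "(%t. EU x y (prim a \<otimes>\<^bsub>TU\<^esub> t)) : lin_hom TU K" .
 show "(%t. EU (op a x) y t + EU x (op a y) t) : lin_hom TU K"
  by (rule lin_hom_add_ground[OF EU_lin[OF ox y] EU_lin[OF x oy]])
 fix u u' assume u: "u : carrier UA" "u' : carrier UA"
 note l = letter_UA[OF a] and m = pure_tensor_mult[OF UA_k UA_k]
 have c: "wd [a] \<otimes>\<^bsub>UA\<^esub> u : carrier UA" "wd [a] \<otimes>\<^bsub>UA\<^esub> u' : carrier UA" using l u by simp_all
 have "prim a \<otimes>\<^bsub>TU\<^esub> pure_tensor UA UA u u' =
   pure_tensor UA UA (wd [a]) \<one>\<^bsub>UA\<^esub> \<otimes>\<^bsub>TU\<^esub> pure_tensor UA UA u u' \<oplus>\<^bsub>TU\<^esub> pure_tensor UA UA \<one>\<^bsub>UA\<^esub> (wd [a]) \<otimes>\<^bsub>TU\<^esub> pure_tensor UA UA u u'"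
  unfolding prim_def by (rule TU.l_distr) (intro TUp l one_UA u)+
 also have "\<dots> = pure_tensor UA UA (wd [a] \<otimes>\<^bsub>UA\<^esub> u) u' \<oplus>\<^bsub>TU\<^esub> pure_tensor UA UA u (wd [a] \<otimes>\<^bsub>UA\<^esub> u')"
  unfolding m[OF l one_UA u] m[OF one_UA l u] using u by simp
 finally have e: "prim a \<otimes>\<^bsub>TU\<^esub> pure_tensor UA UA u u' = pure_tensor UA UA (wd [a] \<otimes>\<^bsub>UA\<^esub> u) u' \<oplus>\<^bsub>TU\<^esub> pure_tensor UA UA u (wd [a] \<otimes>\<^bsub>UA\<^esub> u')" .
 show "EU x y (prim a \<otimes>\<^bsub>TU\<^esub> pure_tensor UA UA u u') = EU (op a x) y (pure_tensor UA UA u u') + EU x (op a y) (pure_tensor UA UA u u')"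
  unfolding e lin_homD(2)[OF EU_lin[OF x y] TUp[OF c(1) u(2)] TUp[OF u(1) c(2)]] EU_pure[OF x y c(1) u(2)] EU_pure[OF x y u(1) c(2)]
   EU_pure[OF ox y u] EU_pure[OF x oy u] \<Phi>_letter_mult[OF a u(1) x] \<Phi>_letter_mult[OF a u(2) y] ground_field_simps ..
qed

text \<open>Removing the first letter, both sides follow the same recursion, since
  \<open>op a\<close> is a derivation of the product of the polynomials.\<close>

lemma EU_Cw:
 assumes "w : lists LC" "x : carrier HA" "y : carrier HA"
 shows "EU x y (Cw w) = \<Phi>w w (x * y)"
 using assms
proof (induction w arbitrary: x y rule: list.induct)
 case Nil
 have "EU x y (Cw []) = \<Phi> \<one>\<^bsub>UA\<^esub> x * \<Phi> \<one>\<^bsub>UA\<^esub> y"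
  unfolding Cw_simps tensor_one_zero(1)[OF UA_k UA_k] by (rule EU_pure[OF Nil(2,3) one_UA one_UA])
 then show ?case unfolding \<Phi>_one \<Phi>w_simps DA_apply(4)[OF Nil(2)] DA_apply(4)[OF Nil(3)] DA_apply(4)[OF HA_closed(3)[OF Nil(2,3)]] ev_mult .
next
 case (Cons a w)
 then have c: "a : LC" "w : lists LC" by simp_all
 note x = Cons.prems(2) and y = Cons.prems(3)
 note ox = lin_homD(1)[OF op_lin x, of a] and oy = lin_homD(1)[OF op_lin y, of a]
 have "EU x y (Cw (a # w)) = \<Phi>w w (op a x * y) + \<Phi>w w (x * op a y)"
  unfolding Cw_simps EU_prim[OF x y c(1) Cw_closed[OF c(2)]] Cons.IH[OF c(2) ox y] Cons.IH[OF c(2) x oy] ..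
 also have "\<dots> = \<Phi>w w (op a (x * y))" unfolding op_deriv[OF x y]
  using lin_homD(2)[OF \<Phi>w_lin HA_closed(3)[OF ox y] HA_closed(3)[OF x oy], of w] by simp
 finally show ?case unfolding \<Phi>w_op[OF HA_closed(3)[OF x y]] .
qed

lemma EU_Cm:
 assumes x: "x : carrier HA" and y: "y : carrier HA" and u: "u : carrier UA"
 shows "EU x y (Cm u) = \<Phi> u (x * y)"
proof (rule lin_hom_UA_eqI[OF lin_hom_comp[OF Cm_lin EU_lin[OF x y]] \<Phi>_eval[OF HA_closed(3)[OF x y]] kmod_ground _ u])
 fix w assume w: "w : lists LC"
 show "EU x y (Cm (wd w)) = \<Phi> (wd w) (x * y)" unfolding Cm_wd[OF w] \<Phi>_wd[OF w] by (rule EU_Cw[OF w x y])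
qed

text \<open>The image tensor has the required values by \<open>EU_Cm\<close>. It is the only one, as
  pairs of evaluations separate the tensor square of the dual, so the definite description denotes
  it.\<close>

lemma comult_\<Phi>:
 assumes u: "u : carrier UA"
 shows "comult (graded_dual n H gr) (\<Phi> u) = tensor_map DA DA \<Phi> \<Phi> (Cm u)"
 unfolding graded_dual_simps(1)
proof (rule the_equality)
 note bf = bil_functionals[OF DA_eval DA_eval]
 have cm: "Cm u : carrier TU" by (rule lin_homD(1)[OF Cm_lin u])
 have c: "tensor_map DA DA \<Phi> \<Phi> (Cm u) : carrier (tensor DA DA)"
  by (rule lin_homD(1)[OF tensor_map_lin_hom[OF UA_k UA_k DA_k DA_k \<Phi>_lin \<Phi>_lin] cm])
 have ev: "tensor_lift K (%f1 f2. f1 x * f2 y) (tensor_map DA DA \<Phi> \<Phi> (Cm u)) = \<Phi> u (x * y)" if x: "x : carrier HA" and y: "y : carrier HA" for x y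
  unfolding tensor_lift_map[OF UA_k UA_k DA_k DA_k \<Phi>_lin \<Phi>_lin kmod_ground bf[OF x y] cm] by (rule EU_Cm[OF x y u])
 show "tensor_map DA DA \<Phi> \<Phi> (Cm u) : carrier (tensor DA DA) \<and>
  (\<forall>x\<in>carrier H. \<forall>y\<in>carrier H. tensor_lift K (%f1 f2. f1 x * f2 y) (tensor_map DA DA \<Phi> \<Phi> (Cm u)) = \<Phi> u (x \<otimes>\<^bsub>H\<^esub> y))"
  unfolding H_simps by (intro conjI ballI c ev)
 fix t assume "t : carrier (tensor DA DA) \<and> (\<forall>x\<in>carrier H. \<forall>y\<in>carrier H. tensor_lift K (%f1 f2. f1 x * f2 y) t = \<Phi> u (x \<otimes>\<^bsub>H\<^esub> y))"
 then have t: "t : carrier (tensor DA DA)" "\<And>x y. x : carrier HA ==> y : carrier HA ==> tensor_lift K (%f1 f2. f1 x * f2 y) t = \<Phi> u (x * y)"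
  unfolding H_simps by simp_all
 show "t = tensor_map DA DA \<Phi> \<Phi> (Cm u)"
 proof (rule separates_eqI[OF kmod_tensor[OF DA_k DA_k] tensor_separates[OF DA_k DA_k DA_separates DA_separates] t(1) c])
  fix F :: "_ => 'k" assume "F : {tev f g |f g. f : (%h f. f h) ` carrier HA \<and> g : (%h f. f h) ` carrier HA}"
  then obtain x y where F: "F = tev (%f. f x) (%f. f y)" and xy: "x : carrier HA" "y : carrier HA" by (elim CollectE exE conjE imageE) simp
  show "F t = F (tensor_map DA DA \<Phi> \<Phi> (Cm u))" unfolding F t(2)[OF xy] ev[OF xy] ..
 qed
qed

subsubsection \<open>Counit and antipode\<close>

text \<open>Derivations kill the polynomial 1, so a nonempty word vanishes there; on the empty word
  both sides are 1.\<close>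

lemma Eps_\<Phi>:
 assumes u: "u : carrier UA" shows "\<Phi> u 1 = Eps u"
proof (rule lin_hom_UA_eqI[OF \<Phi>_eval[OF HA_closed(4)] _ kmod_ground _ u])
 let ?e = "%w :: ('v \<Rightarrow>\<^sub>0 'k) list. if w = [] then 1 else 0 :: 'k"
 have fm: "(\<forall>w\<in>lists LC. \<forall>w'\<in>lists LC. ?e (w @ w') = ?e w \<otimes>\<^bsub>K\<^esub> ?e w') \<or> (\<forall>w\<in>lists LC. \<forall>w'\<in>lists LC. ?e (w @ w') = ?e w' \<otimes>\<^bsub>K\<^esub> ?e w)"
  by simp
 show "Eps : lin_hom UA K" unfolding Eps_def by (rule induced_lin[OF is_k_algebra_ground _ fm]) simp_all
 fix w assume w: "w : lists LC"
 have "Eps (wd w) = ?e w" unfolding Eps_def by (rule induced_wd[OF is_k_algebra_ground _ fm _ _ _ w]) simp_all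
 moreover have "\<Phi>w w 1 = ?e w"
 proof (cases w)
  case Nil then show ?thesis using DA_apply(4)[OF HA_closed(4)] by (simp add: \<Phi>w_simps)
 next
  case (Cons a v)
  have "\<Phi>w w 1 = \<Phi>w v \<zero>\<^bsub>HA\<^esub>" unfolding Cons \<Phi>w_op[OF HA_closed(4)] op_one by simp
  also have "\<dots> = 0" using lin_hom_zero[OF \<Phi>w_lin HA(2) kmod_ground, of v] by simp
  finally show ?thesis using Cons by simp
 qed
 ultimately show "\<Phi> (wd w) 1 = Eps (wd w)" unfolding \<Phi>_wd[OF w] by simp
qed

lemma rev_lists: "w : lists A ==> rev w : lists A"
 by (simp add: in_lists_conv_set)

lemma Aw_wd: "w : lists LC ==> Aw w = (-1) ^ length w \<odot>\<^bsub>UA\<^esub> wd (rev w)"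
 unfolding Aw_def wd_def cl_hom(3)[OF keys_word[OF rev_lists] keys_word[OF rev_lists]] by simp

lemma Aw_closed: "w : lists LC ==> Aw w : carrier UA"
 unfolding Aw_wd by (intro kmodD(2)[OF is_k_algebraD(1)[OF UA_k]] wd_closed rev_lists)

lemma Aw_fm: "(\<forall>w\<in>lists LC. \<forall>w'\<in>lists LC. Aw (w @ w') = Aw w \<otimes>\<^bsub>UA\<^esub> Aw w') \<or>
  (\<forall>w\<in>lists LC. \<forall>w'\<in>lists LC. Aw (w @ w') = Aw w' \<otimes>\<^bsub>UA\<^esub> Aw w)"
proof (intro disjI2 ballI)
 fix w w' assume w: "w : lists LC" "w' : lists LC"
 note k = keys_word[OF rev_lists[OF w(1)], of "(-1) ^ length w"] keys_word[OF rev_lists[OF w(2)], of "(-1) ^ length w'"]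
 show "Aw (w @ w') = Aw w' \<otimes>\<^bsub>UA\<^esub> Aw w"
  unfolding Aw_def cl_hom(2)[OF k(2,1)] ma_mult_single by (simp add: power_add mult.commute)
qed

lemma Aw_rel:
 "x : LC ==> y : LC ==> Aw [x + y] = Aw [x] \<oplus>\<^bsub>UA\<^esub> Aw [y]"
 "x : LC ==> Aw [pm_scale c x] = c \<odot>\<^bsub>UA\<^esub> Aw [x]"
 "x : LC ==> y : LC ==> Aw [x, y] = Aw [y, x] \<oplus>\<^bsub>UA\<^esub> Aw [br x y]"
proof -
 interpret U: ring UA by (rule is_k_algebraD[OF UA_k])
 note kU = kmodD[OF is_k_algebraD(1)[OF UA_k]]
 have one: "Aw [a] = (-1) \<odot>\<^bsub>UA\<^esub> wd [a]" if "a : LC" for a using Aw_wd[OF wordsI(1)[OF that]] by simp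
 have two: "Aw [a, b] = wd [b, a]" if "a : LC" "b : LC" for a b
  using Aw_wd[OF wordsI(2)[OF that]] kU(6)[OF wd_closed[OF wordsI(2)[OF that(2,1)]]] by simp
 show "x : LC ==> y : LC ==> Aw [x + y] = Aw [x] \<oplus>\<^bsub>UA\<^esub> Aw [y]"
  using one[of "x + y"] one[of x] one[of y] LC_closed(1)[of x y] wd_add[of x y] kU(4)[OF letter_UA letter_UA, of x y] by metis
 show "Aw [pm_scale c x] = c \<odot>\<^bsub>UA\<^esub> Aw [x]" if x: "x : LC"
  unfolding one[OF x] one[OF LC_closed(2)[OF x]] wd_scale[OF x] by (rule kU(9)[OF letter_UA[OF x]])
 show "Aw [x, y] = Aw [y, x] \<oplus>\<^bsub>UA\<^esub> Aw [br x y]" if x: "x : LC" and y: "y : LC"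
 proof -
  note b = letter_UA[OF LC_closed(3)[OF x y]]
  show ?thesis unfolding two[OF x y] two[OF y x] one[OF LC_closed(3)[OF x y]] wd_br[OF x y] kmod_uminus[OF is_k_algebraD(1)[OF UA_k] b, symmetric]
   using b wd_closed[OF wordsI(2)[OF y x]] by (simp add: U.a_assoc U.r_neg)
 qed
qed

lemma Ap_wd: "w : lists LC ==> Ap (wd w) = Aw w"
 unfolding Ap_def by (rule induced_wd[OF UA_k]) (rule Aw_closed Aw_fm Aw_rel | assumption)+

lemma Ap_lin: "Ap : lin_hom UA UA"
 unfolding Ap_def by (rule induced_lin[OF UA_k]) (rule Aw_closed Aw_fm Aw_rel | assumption)+

text \<open>Composition with \<open>S\<close> reverses convolution products and changes the sign of
  each primitive factor.\<close>

lemma \<Phi>w_S: "h : carrier HA ==> \<Phi>w w (S h) = (-1) ^ length w * \<Phi>w (rev w) h"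
proof (induction w arbitrary: h)
 case Nil
 then show ?case using DA_apply(4)[OF Nil] DA_apply(4)[OF S(1)[OF Nil]] \<epsilon>_S[OF Nil] by (simp add: \<Phi>w_simps del: HA_simps)
next
 case (Cons a w)
 note h = Cons.prems
 let ?s = "(-1) ^ length (a # w) :: 'k"
 note l = DA_carrierD(1)[OF lr_DA[of a]] and lS = lin_hom_comp[OF S_lin \<Phi>w_lin, of w] lin_hom_comp[OF S_lin DA_carrierD(1)[OF lr_DA[of a]]]
 have sc: "(%c. ?s * c) : lin_hom K K" by (rule lin_homI) (simp_all add: algebra_simps)
 have "\<Phi>w (a # w) (S h) = tev (%x. \<Phi>w w (S x)) (%x. lr a (S x)) (\<Delta> h)"
  unfolding \<Phi>w_simps DA_simps(2) conv_S[OF l \<Phi>w_lin h] using h by (simp add: conv_def del: HA_simps)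
 also have "\<dots> = tensor_lift K (%x y. ?s * (\<Phi>w (rev w) x * lr a y)) (\<Delta> h)"
 proof (rule tensor_lift_cong[OF HA(1) HA(1) kmod_ground bil_functionals[OF lS] _ \<Delta>(1)[OF h]])
  fix x y assume xy: "x : carrier HA" "y : carrier HA"
  show "\<Phi>w w (S x) * lr a (S y) = ?s * (\<Phi>w (rev w) x * lr a y)"
   unfolding Cons.IH[OF xy(1)] lr_apply[OF S(1)[OF xy(2)]] lr_apply[OF xy(2)] lin_S[OF xy(2)] by simp
 qed
 also have "\<dots> = ?s * tev (\<Phi>w (rev w)) (lr a) (\<Delta> h)"
  by (rule lin_hom_tensor_lift[OF HA(1) HA(1) kmod_ground bil_functionals[OF \<Phi>w_lin l] sc kmod_ground \<Delta>(1)[OF h], symmetric])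
 also have "tev (\<Phi>w (rev w)) (lr a) (\<Delta> h) = \<Phi>w (rev (a # w)) h"
  unfolding rev.simps \<Phi>w_append \<Phi>w_letter DA_simps(2) using h by (simp add: conv_def del: HA_simps)
 finally show ?case .
qed

lemma antipode_\<Phi>:
 assumes u: "u : carrier UA" shows "(\<lambda>h\<in>carrier HA. \<Phi> u (S h)) = \<Phi> (Ap u)"
proof (rule extensionalityI[of _ "carrier HA"])
 note au = lin_homD(1)[OF Ap_lin u]
 show "\<Phi> (Ap u) : extensional (carrier HA)" by (rule DA_carrierD(2)[OF lin_homD(1)[OF \<Phi>_lin au]])
 fix h assume h: "h : carrier HA"
 have "\<Phi> (Ap u) h = \<Phi> u (S h)"
 proof (rule lin_hom_UA_eqI[OF lin_hom_comp[OF Ap_lin \<Phi>_eval[OF h]] \<Phi>_eval[OF S(1)[OF h]] kmod_ground _ u])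
  fix w assume w: "w : lists LC"
  then have rw: "rev w : lists LC" by (rule rev_lists)
  show "\<Phi> (Ap (wd w)) h = \<Phi> (wd w) (S h)"
   unfolding Ap_wd[OF w] Aw_wd[OF w] lin_homD(3)[OF \<Phi>_lin wd_closed[OF rw]] \<Phi>_wd[OF w] \<Phi>_wd[OF rw] DA_apply(2)[OF h] \<Phi>w_S[OF h] ..
 qed
 then show "(\<lambda>h\<in>carrier HA. \<Phi> u (S h)) h = \<Phi> (Ap u) h" using h by (simp del: HA_simps)
qed simp

theorem graded_dual_iso:
 "graded_hopf_isomorphic n (enveloping_algebra L br) (env_grading L br grL) (graded_dual n H gr) (dual_grading n H gr)"
 unfolding graded_hopf_isomorphic_def
proof (rule bexI[of _ \<Phi>], intro conjI ballI)
 have ce: "carrier (enveloping_algebra L br) = carrier UA" "carrier (graded_dual n H gr) = carrier DA"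
  using env_simps(4) graded_dual_simps(4) by (simp_all add: same_alg_def)
 show "\<Phi> : alg_hom (enveloping_algebra L br) (graded_dual n H gr)"
  unfolding alg_hom_same[OF env_simps(4) graded_dual_simps(4)] by (rule \<Phi>_alg_hom)
 show "bij_betw \<Phi> (carrier (enveloping_algebra L br)) (carrier (graded_dual n H gr))" unfolding ce by (rule \<Phi>_bij)
 fix u assume "u : carrier (enveloping_algebra L br)"
 then have u: "u : carrier UA" unfolding ce .
 show "comult (graded_dual n H gr) (\<Phi> u) = tensor_map (graded_dual n H gr) (graded_dual n H gr) \<Phi> \<Phi> (comult (enveloping_algebra L br) u)"
  unfolding tensor_map_same[OF graded_dual_simps(4) graded_dual_simps(4)] env_simps(1) by (rule comult_\<Phi>[OF u])
 show "counit (graded_dual n H gr) (\<Phi> u) = counit (enveloping_algebra L br) u"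
  unfolding graded_dual_simps(2) env_simps(2) H_simps by (rule Eps_\<Phi>[OF u])
 show "antipode (graded_dual n H gr) (\<Phi> u) = \<Phi> (antipode (enveloping_algebra L br) u)"
  unfolding graded_dual_simps(3) env_simps(3) H_simps by (rule antipode_\<Phi>[OF u])
next
 have ce: "carrier (graded_dual n H gr) = carrier DA" using graded_dual_simps(4) by (simp add: same_alg_def)
 fix \<alpha> assume "\<alpha> : exponents n"
 then show "\<Phi> ` env_grading L br grL \<alpha> = dual_grading n H gr \<alpha>" unfolding dual_grading_def ce by (rule \<Phi>_grading)
qed

end

subsection \<open>Series\<close>

lemma mcoeff_simps [simp]:
 "mcoeff (F + G) \<alpha> = mcoeff F \<alpha> + mcoeff G \<alpha>" "mcoeff (F - G) \<alpha> = mcoeff F \<alpha> - mcoeff G \<alpha>" "mcoeff (- F) \<alpha> = - mcoeff F \<alpha>"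
 "mcoeff 0 \<alpha> = 0" "mcoeff 1 \<alpha> = (if \<alpha> = 0 then 1 else 0)" "mcoeff (mconst c) \<alpha> = (if \<alpha> = 0 then c else 0)"
 "mcoeff (mvar i) \<alpha> = (if \<alpha> = single i 1 then 1 else 0)"
 by (transfer; simp)+

lemma mcoeff_mult: "mcoeff (F * G) \<gamma> = (\<Sum>(\<alpha>, \<beta>)\<in>splits \<gamma>. mcoeff F \<alpha> * mcoeff G \<beta>)"
 by transfer simp

lemma mcoeff_Abs [simp]: "mcoeff (Abs_mfps f) = f"
 by (rule Abs_mfps_inverse) simp

lemma mcoeff_sum: "mcoeff (sum f S) \<alpha> = (\<Sum>i\<in>S. mcoeff (f i) \<alpha>)"
 by (induction S rule: infinite_finite_induct) simp_all

lemma splits_iff: "(\<alpha>, \<beta>) : splits \<gamma> \<longleftrightarrow> \<alpha> + \<beta> = \<gamma>"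
 by (simp add: splits_def)

lemma mcoeff_mconst_mult [simp]: "mcoeff (mconst c * F) \<gamma> = c * mcoeff F \<gamma>"
proof -
 have "mcoeff (mconst c * F) \<gamma> = (\<Sum>x\<in>splits \<gamma>. if x = (0, \<gamma>) then c * mcoeff F \<gamma> else 0)"
  unfolding mcoeff_mult by (rule sum.cong) (auto simp: splits_iff split: if_splits)
 then show ?thesis by (simp add: splits_iff)
qed

lemma add_eq_0_iff_nat: "(\<alpha> :: expo) + \<beta> = 0 \<longleftrightarrow> \<alpha> = 0 \<and> \<beta> = 0"
 using mlen_eq_0_iff[of "\<alpha> + \<beta>"] mlen_eq_0_iff[of \<alpha>] mlen_eq_0_iff[of \<beta>] by (auto simp del: mlen_eq_0_iff)

lemma mcoeff_mult_0 [simp]: "mcoeff (F * G) 0 = mcoeff F 0 * mcoeff G 0"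
proof -
 have "splits 0 = {(0, 0)}" by (auto simp: splits_def add_eq_0_iff_nat)
 then show ?thesis by (simp add: mcoeff_mult)
qed

lemma mcoeff_power_0 [simp]: "mcoeff (F ^ k) 0 = mcoeff F 0 ^ k"
 by (induction k) simp_all

lemma mcoeff_prod_0: "mcoeff (prod f S) 0 = (\<Prod>i\<in>S. mcoeff (f i) 0)"
 by (induction S rule: infinite_finite_induct) simp_all

text \<open>Each factor without constant term contributes at least 1 to the total degree.\<close>

lemma mcoeff_power_high:
 assumes "mcoeff h 0 = 0" "mlen \<alpha> < k" shows "mcoeff (h ^ k) \<alpha> = 0"
 using assms(2)
proof (induction k arbitrary: \<alpha>)
 case (Suc k)
 have "mcoeff h a * mcoeff (h ^ k) b = 0" if "a + b = \<alpha>" for a b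
 proof (cases "a = 0")
  case False
  then have "mlen a ~= 0" unfolding mlen_eq_0_iff .
  moreover have "mlen \<alpha> = mlen a + mlen b" unfolding that[symmetric] by (rule msum_add)
  ultimately have "mlen b < k" using Suc.prems by linarith
  then show ?thesis using Suc.IH by simp
 qed (simp add: assms)
 then show ?case unfolding power_Suc mcoeff_mult by (intro sum.neutral) (auto simp: splits_iff)
qed simp

text \<open>At each exponent the infinite sum is finite. The bound \<open>N\<close> is left open
  above the total degree so that several coefficients or series can be truncated alike.\<close>

lemma mcoeff_fps_apply:
 assumes h: "mcoeff h 0 = 0" and N: "mlen \<alpha> \<le> N"
 shows "mcoeff (fps_apply f h) \<alpha> = mcoeff (\<Sum>k\<le>N. mconst (fps_nth f k) * h ^ k) \<alpha>"
proof -
 have "mcoeff (fps_apply f h) \<alpha> = (\<Sum>k\<le>N. fps_nth f k * mcoeff (h ^ k) \<alpha>)"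
  unfolding fps_apply_def mcoeff_Abs
  by (rule Sum_any.expand_superset) (use mcoeff_power_high[OF h] N in \<open>auto simp: not_le[symmetric] intro: ccontr order_trans\<close>)
 then show ?thesis by (simp add: mcoeff_sum)
qed

lemma fps_apply_0: "mcoeff h 0 = 0 ==> mcoeff (fps_apply f h) 0 = fps_nth f 0"
 by (subst mcoeff_fps_apply[of _ _ 0]) (simp_all add: mcoeff_sum)

subsubsection \<open>Sums over decompositions\<close>

lemma splits_assoc:
 "(\<Sum>(\<alpha>, \<delta>)\<in>splits \<gamma>. \<Sum>(a, b)\<in>splits \<alpha>. f a b \<delta>) = (\<Sum>(a, \<epsilon>)\<in>splits \<gamma>. \<Sum>(b, d)\<in>splits \<epsilon>. f a b d)" (is "?l = ?r")
proof -
 have "?l = (\<Sum>x\<in>splits \<gamma>. \<Sum>y\<in>splits (fst x). f (fst y) (snd y) (snd x))" by (simp add: case_prod_beta)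
 also have "\<dots> = (\<Sum>(x, y)\<in>Sigma (splits \<gamma>) (%x. splits (fst x)). f (fst y) (snd y) (snd x))"
  by (rule sum.Sigma) auto
 also have "\<dots> = (\<Sum>(x, y)\<in>Sigma (splits \<gamma>) (%x. splits (snd x)). f (fst x) (fst y) (snd y))"
  by (rule sum.reindex_bij_witness[where i = "%(x, y). ((fst x + fst y, snd y), (fst x, fst y))"
     and j = "%(x, y). ((fst y, snd y + snd x), (snd y, snd x))"]) (auto simp: splits_def ac_simps)
 also have "\<dots> = (\<Sum>x\<in>splits \<gamma>. \<Sum>y\<in>splits (snd x). f (fst x) (fst y) (snd y))" by (rule sum.Sigma[symmetric]) auto
 also have "\<dots> = ?r" by (simp add: case_prod_beta)
 finally show ?thesis .
qed

lemma splits_swap: "(\<Sum>(a, b)\<in>splits \<gamma>. f a b) = (\<Sum>(b, a)\<in>splits \<gamma>. f a b)"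
 by (rule sum.reindex_bij_witness[where i = prod.swap and j = prod.swap]) (auto simp: splits_def ac_simps)

lemma splits_inner: "(\<Sum>(b, \<zeta>)\<in>splits \<epsilon>. \<Sum>(c, d)\<in>splits \<zeta>. g b c d) = (\<Sum>(c, \<zeta>)\<in>splits \<epsilon>. \<Sum>(b, d)\<in>splits \<zeta>. g b c d)"
proof -
 have "(\<Sum>(b, \<zeta>)\<in>splits \<epsilon>. \<Sum>(c, d)\<in>splits \<zeta>. g b c d) = (\<Sum>(\<alpha>, d)\<in>splits \<epsilon>. \<Sum>(b, c)\<in>splits \<alpha>. g b c d)" by (rule splits_assoc[symmetric])
 also have "\<dots> = (\<Sum>(\<alpha>, d)\<in>splits \<epsilon>. \<Sum>(c, b)\<in>splits \<alpha>. g b c d)"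
  by (rule sum.cong[OF refl], clarify, rule splits_swap)
 also have "\<dots> = (\<Sum>(c, \<zeta>)\<in>splits \<epsilon>. \<Sum>(b, d)\<in>splits \<zeta>. g b c d)" by (rule splits_assoc)
 finally show ?thesis .
qed

text \<open>Decompositions of \<open>\<gamma>\<close> into four parts, regrouped by exchanging the
  two middle ones; with it, products and compositions of substitutions reduce to products of
  coefficients.\<close>

lemma splits_quad:
 "(\<Sum>(\<alpha>, \<delta>)\<in>splits \<gamma>. \<Sum>(a, b)\<in>splits \<alpha>. \<Sum>(c, d)\<in>splits \<delta>. f a b c d) =
  (\<Sum>(\<alpha>, \<delta>)\<in>splits \<gamma>. \<Sum>(a, c)\<in>splits \<alpha>. \<Sum>(b, d)\<in>splits \<delta>. f a b c d)"
proof -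
 have "(\<Sum>(\<alpha>, \<delta>)\<in>splits \<gamma>. \<Sum>(a, b)\<in>splits \<alpha>. \<Sum>(c, d)\<in>splits \<delta>. f a b c d) =
   (\<Sum>(a, \<epsilon>)\<in>splits \<gamma>. \<Sum>(b, \<zeta>)\<in>splits \<epsilon>. \<Sum>(c, d)\<in>splits \<zeta>. f a b c d)" by (rule splits_assoc)
 also have "\<dots> = (\<Sum>(a, \<epsilon>)\<in>splits \<gamma>. \<Sum>(c, \<zeta>)\<in>splits \<epsilon>. \<Sum>(b, d)\<in>splits \<zeta>. f a b c d)"
  by (rule sum.cong[OF refl], clarify, rule splits_inner)
 also have "\<dots> = (\<Sum>(\<alpha>, \<delta>)\<in>splits \<gamma>. \<Sum>(a, c)\<in>splits \<alpha>. \<Sum>(b, d)\<in>splits \<delta>. f a b c d)" by (rule splits_assoc[symmetric])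
 finally show ?thesis .
qed

lemma splits_prod:
 "(\<Sum>(a, b)\<in>splits \<alpha>. f a b) * (\<Sum>(c, d)\<in>splits \<delta>. g c d) = (\<Sum>(a, b)\<in>splits \<alpha>. \<Sum>(c, d)\<in>splits \<delta>. f a b * (g c d :: 'b::comm_ring_1))"
 by (simp add: sum_product case_prod_beta)

subsubsection \<open>Substitutions of the form \<open>x\<^sub>v \<mapsto> x\<^sub>v \<tau>\<^sub>v\<close>\<close>

definition tpow :: "nat => (nat => 'a::comm_ring_1 mfps) => expo => 'a mfps" where
 "tpow n \<tau> \<alpha> = (\<Prod>i<n. \<tau> i ^ lookup \<alpha> i)"

text \<open>Multiplying the variables by the series \<open>\<tau> v\<close> sends the monomial of
  exponent \<open>\<alpha>\<close> to itself times \<open>tpow n \<tau> \<alpha>\<close>. The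
  coefficient at \<open>\<gamma>\<close> is therefore a finite sum for every series, and no
  summability conditions accompany the ring laws.\<close>

definition twist :: "nat => (nat => 'a::comm_ring_1 mfps) => 'a mfps => 'a mfps" where
 "twist n \<tau> P = Abs_mfps (%\<gamma>. \<Sum>(\<alpha>, \<delta>)\<in>splits \<gamma>. mcoeff P \<alpha> * mcoeff (tpow n \<tau> \<alpha>) \<delta>)"

lemma mcoeff_twist: "mcoeff (twist n \<tau> P) \<gamma> = (\<Sum>(\<alpha>, \<delta>)\<in>splits \<gamma>. mcoeff P \<alpha> * mcoeff (tpow n \<tau> \<alpha>) \<delta>)"
 by (simp add: twist_def)

lemma tpow_add: "tpow n \<tau> (\<alpha> + \<beta>) = tpow n \<tau> \<alpha> * tpow n \<tau> \<beta>"
 by (simp add: tpow_def lookup_add power_add prod.distrib)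

lemma tpow_0 [simp]: "tpow n \<tau> 0 = 1"
 by (simp add: tpow_def)

lemma tpow_cong: "(\<And>i. i < n ==> \<tau> i = \<tau>' i) ==> tpow n \<tau> \<alpha> = tpow n \<tau>' \<alpha>"
 by (simp add: tpow_def)

lemma twist_cong: "(\<And>i. i < n ==> \<tau> i = \<tau>' i) ==> twist n \<tau> P = twist n \<tau>' P"
 using tpow_cong[of n \<tau> \<tau>'] by (simp add: twist_def)

lemma twist_add [simp]: "twist n \<tau> (P + Q) = twist n \<tau> P + twist n \<tau> Q"
 by (rule mfps_eqI) (simp add: mcoeff_twist distrib_right sum.distrib case_prod_beta)

lemma twist_const [simp]: "twist n \<tau> (mconst c) = mconst c"
proof (rule mfps_eqI)
 fix \<gamma>
 have "mcoeff (twist n \<tau> (mconst c)) \<gamma> = (\<Sum>x\<in>splits \<gamma>. if x = (0, \<gamma>) then mcoeff (mconst c) \<gamma> else 0)"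
  unfolding mcoeff_twist by (rule sum.cong) (auto simp: splits_iff split: if_splits)
 then show "mcoeff (twist n \<tau> (mconst c)) \<gamma> = mcoeff (mconst c) \<gamma>" by (simp add: splits_iff)
qed

lemma mconst_01: "mconst 1 = 1" "mconst 0 = 0"
 by (rule mfps_eqI, simp)+

lemma twist_01 [simp]: "twist n \<tau> 1 = 1" "twist n \<tau> 0 = 0"
 using twist_const[of n \<tau> 1] twist_const[of n \<tau> 0] by (simp_all add: mconst_01)

lemma twist_mult [simp]: "twist n \<tau> (P * Q) = twist n \<tau> P * twist n \<tau> Q"
proof (rule mfps_eqI)
 fix \<gamma>
 let ?t = "%a. mcoeff (tpow n \<tau> a)"
 have "mcoeff (twist n \<tau> (P * Q)) \<gamma> = (\<Sum>(\<alpha>, \<delta>)\<in>splits \<gamma>. \<Sum>(a, b)\<in>splits \<alpha>. \<Sum>(c, d)\<in>splits \<delta>. mcoeff P a * mcoeff Q b * (?t a c * ?t b d))"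
  unfolding mcoeff_twist
 proof (rule sum.cong[OF refl], clarify)
  fix \<alpha> \<delta>
  have "mcoeff (P * Q) \<alpha> * ?t \<alpha> \<delta> = (\<Sum>(a, b)\<in>splits \<alpha>. mcoeff P a * mcoeff Q b * ?t (a + b) \<delta>)"
   by (auto simp: mcoeff_mult sum_distrib_right splits_iff intro!: sum.cong)
  then show "mcoeff (P * Q) \<alpha> * ?t \<alpha> \<delta> = (\<Sum>(a, b)\<in>splits \<alpha>. \<Sum>(c, d)\<in>splits \<delta>. mcoeff P a * mcoeff Q b * (?t a c * ?t b d))"
   by (simp add: tpow_add mcoeff_mult sum_distrib_left case_prod_beta)
 qed
 also have "\<dots> = (\<Sum>(\<alpha>, \<delta>)\<in>splits \<gamma>. \<Sum>(a, c)\<in>splits \<alpha>. \<Sum>(b, d)\<in>splits \<delta>. mcoeff P a * mcoeff Q b * (?t a c * ?t b d))" by (rule splits_quad)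
 also have "\<dots> = mcoeff (twist n \<tau> P * twist n \<tau> Q) \<gamma>"
  unfolding mcoeff_mult mcoeff_twist splits_prod by (simp add: ac_simps case_prod_beta)
 finally show "mcoeff (twist n \<tau> (P * Q)) \<gamma> = mcoeff (twist n \<tau> P * twist n \<tau> Q) \<gamma>" .
qed

lemma twist_power [simp]: "twist n \<tau> (P ^ k) = twist n \<tau> P ^ k"
 by (induction k) simp_all

lemma twist_sum: "twist n \<tau> (sum f S) = (\<Sum>i\<in>S. twist n \<tau> (f i))"
 by (induction S rule: infinite_finite_induct) simp_all

lemma twist_prod: "twist n \<tau> (prod f S) = (\<Prod>i\<in>S. twist n \<tau> (f i))"
 by (induction S rule: infinite_finite_induct) simp_all

lemma twist_diff [simp]: "twist n \<tau> (P - Q) = twist n \<tau> P - twist n \<tau> Q"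
 using twist_add[of n \<tau> "P - Q" Q] by simp

lemma twist_0 [simp]: "mcoeff (twist n \<tau> P) 0 = mcoeff P 0"
proof -
 have "splits 0 = {(0, 0)}" by (auto simp: splits_def add_eq_0_iff_nat)
 then show ?thesis by (simp add: mcoeff_twist)
qed

text \<open>The outer substitution turns the variable times \<open>\<tau>' v\<close> into the
  variable times \<open>\<tau> v\<close> times the substituted \<open>\<tau>' v\<close>.
  Compatibility of the group product with substitution rests on this.\<close>

lemma twist_comp: "twist n \<tau> (twist n \<tau>' P) = twist n (%v. \<tau> v * twist n \<tau> (\<tau>' v)) P"
proof (rule mfps_eqI)
 fix \<gamma>
 let ?t = "%a. mcoeff (tpow n \<tau> a)" and ?t' = "%a. mcoeff (tpow n \<tau>' a)"
 have tp: "tpow n (%v. \<tau> v * twist n \<tau> (\<tau>' v)) a = tpow n \<tau> a * twist n \<tau> (tpow n \<tau>' a)" for a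
  by (simp add: tpow_def power_mult_distrib prod.distrib twist_prod)
 have "mcoeff (twist n \<tau> (twist n \<tau>' P)) \<gamma> = (\<Sum>(\<alpha>, \<delta>)\<in>splits \<gamma>. \<Sum>(a, b)\<in>splits \<alpha>. \<Sum>(c, d)\<in>splits \<delta>. mcoeff P a * ?t' a b * (?t a c * ?t b d))"
  unfolding mcoeff_twist[of n \<tau> "twist n \<tau>' P"]
 proof (rule sum.cong[OF refl], clarify)
  fix \<alpha> \<delta>
  have "mcoeff (twist n \<tau>' P) \<alpha> * ?t \<alpha> \<delta> = (\<Sum>(a, b)\<in>splits \<alpha>. mcoeff P a * ?t' a b * ?t (a + b) \<delta>)"
   by (auto simp: mcoeff_twist sum_distrib_right splits_iff intro!: sum.cong)
  then show "mcoeff (twist n \<tau>' P) \<alpha> * ?t \<alpha> \<delta> = (\<Sum>(a, b)\<in>splits \<alpha>. \<Sum>(c, d)\<in>splits \<delta>. mcoeff P a * ?t' a b * (?t a c * ?t b d))"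
   by (simp add: tpow_add mcoeff_mult sum_distrib_left case_prod_beta)
 qed
 also have "\<dots> = (\<Sum>(\<alpha>, \<delta>)\<in>splits \<gamma>. \<Sum>(a, c)\<in>splits \<alpha>. \<Sum>(b, d)\<in>splits \<delta>. mcoeff P a * ?t' a b * (?t a c * ?t b d))" by (rule splits_quad)
 also have "\<dots> = (\<Sum>(a, \<epsilon>)\<in>splits \<gamma>. \<Sum>(c, e)\<in>splits \<epsilon>. \<Sum>(b, d)\<in>splits e. mcoeff P a * ?t' a b * (?t a c * ?t b d))" by (rule splits_assoc)
 also have "\<dots> = mcoeff (twist n (%v. \<tau> v * twist n \<tau> (\<tau>' v)) P) \<gamma>"
  unfolding mcoeff_twist[of n "%v. \<tau> v * twist n \<tau> (\<tau>' v)"] tp mcoeff_mult mcoeff_twist[of n \<tau>]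
  by (simp add: sum_distrib_left case_prod_beta ac_simps)
 finally show "mcoeff (twist n \<tau> (twist n \<tau>' P)) \<gamma> = mcoeff (twist n (%v. \<tau> v * twist n \<tau> (\<tau>' v)) P) \<gamma>" .
qed

lemma twist_id: "(\<And>i. i < n ==> \<tau> i = 1) ==> twist n \<tau> P = P"
proof (rule mfps_eqI)
 fix \<gamma> assume "\<And>i. i < n ==> \<tau> i = 1"
 then have t: "tpow n \<tau> \<alpha> = 1" for \<alpha> by (simp add: tpow_def)
 have "mcoeff (twist n \<tau> P) \<gamma> = (\<Sum>x\<in>splits \<gamma>. if x = (\<gamma>, 0) then mcoeff P \<gamma> else 0)"
  unfolding mcoeff_twist t by (rule sum.cong) (auto simp: splits_iff split: if_splits)
 then show "mcoeff (twist n \<tau> P) \<gamma> = mcoeff P \<gamma>" by (simp add: splits_iff)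
qed

text \<open>Coefficients of a substituted series only depend on coefficients at smaller exponents.\<close>

lemma twist_local:
 assumes "\<And>\<alpha>. mlen \<alpha> \<le> mlen \<gamma> ==> mcoeff P \<alpha> = mcoeff Q \<alpha>"
 shows "mcoeff (twist n \<tau> P) \<gamma> = mcoeff (twist n \<tau> Q) \<gamma>"
proof -
 have "mlen \<alpha> \<le> mlen \<gamma>" if "\<alpha> + \<delta> = \<gamma>" for \<alpha> \<delta> unfolding that[symmetric] by simp
 then show ?thesis unfolding mcoeff_twist by (intro sum.cong) (auto simp: splits_iff assms)
qed

text \<open>At a given exponent only a polynomial truncation in \<open>h\<close> matters, and a ring
  homomorphism that fixes constants commutes with polynomials.\<close>

lemma twist_fps_apply:
 assumes h: "mcoeff h 0 = 0" shows "twist n \<tau> (fps_apply f h) = fps_apply f (twist n \<tau> h)"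
proof (rule mfps_eqI)
 fix \<gamma>
 have h': "mcoeff (twist n \<tau> h) 0 = 0" using h by simp
 have "mcoeff (twist n \<tau> (fps_apply f h)) \<gamma> = mcoeff (twist n \<tau> (\<Sum>k\<le>mlen \<gamma>. mconst (fps_nth f k) * h ^ k)) \<gamma>"
  by (rule twist_local) (rule mcoeff_fps_apply[OF h])
 also have "\<dots> = mcoeff (fps_apply f (twist n \<tau> h)) \<gamma>"
  unfolding mcoeff_fps_apply[OF h' order_refl] by (simp add: twist_sum)
 finally show "mcoeff (twist n \<tau> (fps_apply f h)) \<gamma> = mcoeff (fps_apply f (twist n \<tau> h)) \<gamma>" .
qed

definition mmono :: "expo => 'a::comm_ring_1 mfps" where "mmono \<alpha> = Abs_mfps (%\<gamma>. if \<gamma> = \<alpha> then 1 else 0)"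

lemma mcoeff_mmono [simp]: "mcoeff (mmono \<alpha>) \<gamma> = (if \<gamma> = \<alpha> then 1 else 0)"
 by (simp add: mmono_def)

lemma mcoeff_mmono_mult: "mcoeff (mmono \<alpha> * F) \<gamma> = (\<Sum>(a, \<delta>)\<in>splits \<gamma>. if a = \<alpha> then mcoeff F \<delta> else 0)"
 unfolding mcoeff_mult by (rule sum.cong) auto

lemma mcoeff_mmono_mult_add [simp]:
 "mcoeff (mmono \<alpha> * F) (\<alpha> + \<delta>) = mcoeff F \<delta>" "mcoeff (mmono \<alpha> * F) (\<delta> + \<alpha>) = mcoeff F \<delta>"
proof -
 have "mcoeff (mmono \<alpha> * F) (\<alpha> + \<delta>) = (\<Sum>x\<in>splits (\<alpha> + \<delta>). if x = (\<alpha>, \<delta>) then mcoeff F \<delta> else 0)"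
  unfolding mcoeff_mmono_mult by (rule sum.cong) (auto simp: splits_iff split: if_splits)
 then show "mcoeff (mmono \<alpha> * F) (\<alpha> + \<delta>) = mcoeff F \<delta>" by (simp add: splits_iff)
 then show "mcoeff (mmono \<alpha> * F) (\<delta> + \<alpha>) = mcoeff F \<delta>" by (simp add: add.commute)
qed

lemma mmono_add: "mmono (\<alpha> + \<beta>) = (mmono \<alpha> * mmono \<beta> :: 'a::comm_ring_1 mfps)"
proof (rule mfps_eqI)
 fix \<gamma>
 have "mcoeff (mmono \<alpha> * mmono \<beta> :: 'a mfps) \<gamma> = (\<Sum>x\<in>splits \<gamma>. if x = (\<alpha>, \<beta>) then 1 else 0)"
  unfolding mcoeff_mmono_mult by (rule sum.cong) (auto split: if_splits)
 then show "mcoeff (mmono (\<alpha> + \<beta>)) \<gamma> = mcoeff (mmono \<alpha> * mmono \<beta> :: 'a mfps) \<gamma>" by (auto simp: splits_iff)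
qed

lemma mmono_var: "mvar i = mmono (single i 1)" "mmono 0 = 1"
 by (rule mfps_eqI, simp)+

lemma mmono_prod: "\<alpha> : exponents n ==> (\<Prod>i<n. mvar i ^ lookup \<alpha> i) = (mmono \<alpha> :: 'a::comm_ring_1 mfps)"
 unfolding exponents_def mem_Collect_eq
proof (induction rule: mono_induct)
 case zero show ?case by (simp add: mmono_var)
next
 case (add v \<alpha>)
 have "(\<Prod>i<n. mvar i ^ lookup (single v 1 + \<alpha>) i) =
   (\<Prod>i<n. (if i = v then mvar v else 1 :: 'a mfps) * mvar i ^ lookup \<alpha> i)"
  by (rule prod.cong) (auto simp: lookup_add lookup_single when_def)
 also have "\<dots> = mvar v * mmono \<alpha>" using add by (simp add: prod.distrib)
 finally show ?case by (simp add: mmono_add mmono_var)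
qed

lemma twist_mmono: "twist n \<tau> (mmono \<alpha>) = mmono \<alpha> * tpow n \<tau> \<alpha>"
 by (rule mfps_eqI) (auto simp: mcoeff_twist mcoeff_mmono_mult intro!: sum.cong)

text \<open>In the defining sum of \<open>subst\<close>, a monomial of exponent
  \<open>\<alpha>\<close> contributes to the coefficient at \<open>\<gamma>\<close> only if
  \<open>\<alpha>\<close> is a part of \<open>\<gamma>\<close>; this is the finite sum of
  \<open>twist\<close>.\<close>

lemma subst_twist:
 assumes P: "P : series n" and s: "\<And>v. v < n ==> \<sigma> v = mvar v * \<tau> v"
 shows "subst n \<sigma> P = twist n \<tau> P"
proof (rule mfps_eqI)
 fix \<gamma>
 have c: "mcoeff P \<alpha> * mcoeff (\<Prod>i<n. \<sigma> i ^ lookup \<alpha> i) \<gamma> =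
   (\<Sum>(a, \<delta>)\<in>splits \<gamma>. if a = \<alpha> then mcoeff P \<alpha> * mcoeff (tpow n \<tau> \<alpha>) \<delta> else 0)" for \<alpha>
 proof (cases "mcoeff P \<alpha> = 0")
  case False
  then have "\<alpha> : exponents n" using P by (simp add: series_def)
  then have "(\<Prod>i<n. \<sigma> i ^ lookup \<alpha> i) = mmono \<alpha> * tpow n \<tau> \<alpha>"
   by (simp add: s power_mult_distrib prod.distrib mmono_prod tpow_def)
  then show ?thesis by (simp only: mcoeff_mmono_mult sum_distrib_left) (rule sum.cong, auto)
 next
  case True
  then show ?thesis by (auto intro!: sum.neutral)
 qed
 have "mcoeff (subst n \<sigma> P) \<gamma> = (\<Sum>\<alpha>\<in>fst ` splits \<gamma>. mcoeff P \<alpha> * mcoeff (\<Prod>i<n. \<sigma> i ^ lookup \<alpha> i) \<gamma>)"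
  unfolding subst_def mcoeff_Abs
 proof (rule Sum_any.expand_superset)
  show "{a. mcoeff P a * mcoeff (\<Prod>i<n. \<sigma> i ^ lookup a i) \<gamma> ~= 0} <= fst ` splits \<gamma>"
  proof
   fix \<alpha> assume "\<alpha> : {a. mcoeff P a * mcoeff (\<Prod>i<n. \<sigma> i ^ lookup a i) \<gamma> ~= 0}"
   then have "(\<Sum>(a, \<delta>)\<in>splits \<gamma>. if a = \<alpha> then mcoeff P \<alpha> * mcoeff (tpow n \<tau> \<alpha>) \<delta> else 0) ~= 0" unfolding mem_Collect_eq c .
   then obtain x where "x : splits \<gamma>" "(case x of (a, \<delta>) => if a = \<alpha> then mcoeff P \<alpha> * mcoeff (tpow n \<tau> \<alpha>) \<delta> else 0) ~= 0"
    by (rule sum.not_neutral_contains_not_neutral)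
   then show "\<alpha> : fst ` splits \<gamma>" by (intro image_eqI[of _ _ x]) (auto split: prod.splits if_splits)
  qed
 qed simp
 also have "\<dots> = (\<Sum>x\<in>splits \<gamma>. \<Sum>\<alpha>\<in>fst ` splits \<gamma>. if fst x = \<alpha> then mcoeff P \<alpha> * mcoeff (tpow n \<tau> \<alpha>) (snd x) else 0)"
  unfolding c by (subst sum.swap) (simp add: case_prod_beta)
 also have "\<dots> = mcoeff (twist n \<tau> P) \<gamma>"
  unfolding mcoeff_twist by (rule sum.cong) auto
 finally show "mcoeff (subst n \<sigma> P) \<gamma> = mcoeff (twist n \<tau> P) \<gamma>" .
qed

lemma div_var_mvar [simp]: "div_var i (mvar i * F) = F"
 by (rule mfps_eqI) (simp add: div_var_def mmono_var del: One_nat_def)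

subsubsection \<open>Closure properties of the ring of series in finitely many variables\<close>

lemma exponents_add: "\<alpha> + \<beta> : exponents n \<longleftrightarrow> \<alpha> : exponents n \<and> \<beta> : exponents n"
 by (simp add: exponents_def)

lemma seriesD: "F : series n ==> \<alpha> \<notin> exponents n ==> mcoeff F \<alpha> = 0"
 by (auto simp: series_def)

lemma seriesI: "(\<And>\<alpha>. \<alpha> \<notin> exponents n ==> mcoeff F \<alpha> = 0) ==> F : series n"
 by (auto simp: series_def)

lemma zero_exponents: "0 : exponents n" by (simp add: exponents_def)

lemma series_closed:
 "mconst c : series n" "1 : series n" "0 : series n"
 "F : series n ==> G : series n ==> F + G : series n" "F : series n ==> G : series n ==> F - G : series n" "F : series n ==> - F : series n"
 by (rule seriesI; use zero_exponents[of n] in \<open>auto simp: seriesD\<close>)+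

lemma series_mult: "F : series n ==> G : series n ==> F * G : series n"
proof (rule seriesI, unfold mcoeff_mult, rule sum.neutral, clarify)
 fix \<gamma> \<alpha> \<delta> assume F: "F : series n" and G: "G : series n" and "\<gamma> \<notin> exponents n" "(\<alpha>, \<delta>) : splits \<gamma>"
 then have "\<alpha> \<notin> exponents n \<or> \<delta> \<notin> exponents n" by (auto simp: splits_iff exponents_add)
 then show "mcoeff F \<alpha> * mcoeff G \<delta> = 0" using seriesD[OF F] seriesD[OF G] by auto
qed

lemma series_power: "F : series n ==> F ^ k : series n"
 by (induction k) (simp_all add: series_closed series_mult)

lemma series_sum: "(\<And>i. i : S ==> f i : series n) ==> sum f S : series n"
 by (induction S rule: infinite_finite_induct) (simp_all add: series_closed)

lemma series_prod: "(\<And>i. i : S ==> f i : series n) ==> prod f S : series n"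
 by (induction S rule: infinite_finite_induct) (simp_all add: series_closed series_mult)

lemma series_tpow: "(\<And>i. i < n ==> \<tau> i : series n) ==> tpow n \<tau> \<alpha> : series n"
 unfolding tpow_def by (intro series_prod series_power) simp

lemma series_twist: "P : series n ==> (\<And>i. i < n ==> \<tau> i : series n) ==> twist n \<tau> P : series n"
proof (rule seriesI, unfold mcoeff_twist, rule sum.neutral, clarify)
 fix \<gamma> \<alpha> \<delta> assume P: "P : series n" and t: "\<And>i. i < n ==> \<tau> i : series n" and "\<gamma> \<notin> exponents n" "(\<alpha>, \<delta>) : splits \<gamma>"
 then have "\<alpha> \<notin> exponents n \<or> \<delta> \<notin> exponents n" by (auto simp: splits_iff exponents_add)
 then show "mcoeff P \<alpha> * mcoeff (tpow n \<tau> \<alpha>) \<delta> = 0"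
  using seriesD[OF P] seriesD[OF series_tpow[OF t]] by auto
qed

lemma series_fps_apply: "h : series n ==> mcoeff h 0 = 0 ==> fps_apply f h : series n"
proof (rule seriesI)
 fix \<alpha> assume h: "h : series n" "mcoeff h 0 = 0" and a: "\<alpha> \<notin> exponents n"
 show "mcoeff (fps_apply f h) \<alpha> = 0" unfolding mcoeff_fps_apply[OF h(2) order_refl]
  by (rule seriesD[OF _ a]) (intro series_sum series_mult series_closed series_power h)
qed

subsubsection \<open>Powers and exponentials\<close>

lemma mpow_0 [simp]: "mcoeff G 0 = 1 ==> mcoeff (mpow G c) 0 = 1"
 by (simp add: mpow_def fps_apply_0)

lemma mexp_0 [simp]: "mcoeff h 0 = 0 ==> mcoeff (mexp h) 0 = 1"
 by (simp add: mexp_def fps_apply_0)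

lemma twist_mpow: "mcoeff G 0 = 1 ==> twist n \<tau> (mpow G c) = mpow (twist n \<tau> G) c"
 by (simp add: mpow_def twist_fps_apply)

lemma twist_mexp: "mcoeff h 0 = 0 ==> twist n \<tau> (mexp h) = mexp (twist n \<tau> h)"
 by (simp add: mexp_def twist_fps_apply)

lemma series_mpow: "G : series n ==> mcoeff G 0 = 1 ==> mpow G c : series n"
 unfolding mpow_def by (rule series_fps_apply) (simp_all add: series_closed)

lemma series_mexp: "h : series n ==> mcoeff h 0 = 0 ==> mexp h : series n"
 unfolding mexp_def by (rule series_fps_apply)

lemma mcoeff_mpow:
 "mcoeff G 0 = 1 ==> mlen \<alpha> \<le> N ==> mcoeff (mpow G c) \<alpha> = (\<Sum>k\<le>N. (c gchoose k) * mcoeff ((G - 1) ^ k) \<alpha>)"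
 unfolding mpow_def by (subst mcoeff_fps_apply[of _ _ N]) (simp_all add: mcoeff_sum)

lemma mconst_of_nat: "mconst (of_nat k) = (of_nat k :: 'a::comm_ring_1 mfps)"
proof (induction k)
 case (Suc k)
 have "mconst (1 + of_nat k) = (mconst 1 + mconst (of_nat k) :: 'a mfps)" by (rule mfps_eqI) simp
 then show ?case by (simp add: Suc mconst_01)
qed (simp add: mconst_01)

lemma mpow_of_nat: "mcoeff G 0 = 1 ==> mpow G (of_nat m) = G ^ m"
proof (rule mfps_eqI)
 fix \<alpha> :: "expo" assume G: "mcoeff G 0 = 1"
 let ?N = "mlen \<alpha> + m"
 have "mcoeff (mpow G (of_nat m)) \<alpha> = (\<Sum>k\<le>?N. of_nat (m choose k) * mcoeff ((G - 1) ^ k) \<alpha>)"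
  by (subst mcoeff_mpow[OF G, of _ ?N]) (simp_all add: binomial_gbinomial)
 also have "\<dots> = (\<Sum>k\<le>m. of_nat (m choose k) * mcoeff ((G - 1) ^ k) \<alpha>)"
  by (rule sum.mono_neutral_right) (auto simp: binomial_eq_0)
 also have "\<dots> = mcoeff (\<Sum>k\<le>m. of_nat (m choose k) * (G - 1) ^ k * 1 ^ (m - k)) \<alpha>"
  by (simp add: mcoeff_sum mconst_of_nat[symmetric])
 also have "\<dots> = mcoeff (G ^ m) \<alpha>" unfolding binomial_ring[symmetric] by simp
 finally show "mcoeff (mpow G (of_nat m)) \<alpha> = mcoeff (G ^ m) \<alpha>" .
qed

text \<open>Coefficients of a binomial power are polynomial in its exponent \<open>c\<close>.
  Identities between such powers thus follow from natural exponents, where they are ordinary power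
  laws.\<close>

definition polyfun :: "('k::field_char_0 => 'k) => bool" where "polyfun f \<longleftrightarrow> (\<exists>p. \<forall>c. f c = poly p c)"

lemma polyfun_const: "polyfun (%_. c)" unfolding polyfun_def by (intro exI[of _ "[:c:]"]) simp

lemma polyfun_id: "polyfun (%c. c)" unfolding polyfun_def by (intro exI[of _ "[:0, 1:]"]) simp

lemma polyfun_add: "polyfun f ==> polyfun g ==> polyfun (%c. f c + g c)"
 unfolding polyfun_def by (elim exE, rule exI[of _ "_ + _"], auto)

lemma polyfun_mult: "polyfun f ==> polyfun g ==> polyfun (%c. f c * g c)"
 unfolding polyfun_def by (elim exE, rule exI[of _ "_ * _"], auto)

lemma polyfun_diff: "polyfun f ==> polyfun g ==> polyfun (%c. f c - g c)"
 unfolding polyfun_def by (elim exE, rule exI[of _ "_ - _"], auto)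

lemma polyfun_sum: "(\<And>i. i : S ==> polyfun (f i)) ==> polyfun (%c. \<Sum>i\<in>S. f i c)"
 by (induction S rule: infinite_finite_induct) (simp_all add: polyfun_const polyfun_add)

lemma polyfun_prod: "(\<And>i. i : S ==> polyfun (f i)) ==> polyfun (%c. \<Prod>i\<in>S. f i c)"
 by (induction S rule: infinite_finite_induct) (simp_all add: polyfun_const polyfun_mult)

lemma polyfun_gchoose: "polyfun (%c. c gchoose k)"
proof -
 have "(c gchoose k) = (\<Prod>i = 0..<k. c - of_nat i) * inverse (fact k)" for c :: 'a
  by (simp add: gbinomial_prod_rev divide_inverse)
 then show ?thesis by (simp only:) (intro polyfun_mult polyfun_prod polyfun_diff polyfun_id polyfun_const)
qed

lemma polyfun_eqI:
 fixes f g :: "'k::field_char_0 => 'k"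
 assumes "polyfun f" "polyfun g" "\<And>m. f (of_nat m) = g (of_nat m)" shows "f c = g c"
proof -
 obtain p where p: "\<And>c. f c - g c = poly p c" using polyfun_diff[OF assms(1,2)] unfolding polyfun_def by blast
 have "p = 0"
 proof (rule ccontr)
  assume "p ~= 0"
  then have "finite {x. poly p x = 0}" by (rule poly_roots_finite)
  moreover have "range of_nat <= {x. poly p x = 0}" using assms(3) by (auto simp: p[symmetric])
  ultimately have "finite (range (of_nat :: nat => 'k))" by (rule finite_subset[rotated])
  moreover have "inj (of_nat :: nat => 'k)" by (simp add: inj_on_def)
  ultimately have "finite (UNIV :: nat set)" by (rule finite_imageD)
  then show False by simp
 qed
 then show ?thesis using p[of c] by simp
qed

lemma polyfun_mpow: "mcoeff G 0 = 1 ==> polyfun (%c. mcoeff (mpow G c) \<alpha>)"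
 by (simp only: mcoeff_mpow[OF _ order_refl]) (intro polyfun_sum polyfun_mult polyfun_gchoose polyfun_const)

text \<open>For each exponent, both sides are polynomials in \<open>c\<close> that agree at the natural numbers.\<close>

lemma mpow_mult:
 assumes G: "mcoeff G 0 = 1" and H: "mcoeff H 0 = 1" shows "mpow (G * H) c = mpow G c * mpow H c"
proof (rule mfps_eqI)
 fix \<alpha> :: "expo"
 have GH: "mcoeff (G * H) 0 = 1" using G H by simp
 show "mcoeff (mpow (G * H) c) \<alpha> = mcoeff (mpow G c * mpow H c) \<alpha>"
 proof (rule polyfun_eqI[of "%c. mcoeff (mpow (G * H) c) \<alpha>" "%c. mcoeff (mpow G c * mpow H c) \<alpha>"])
  show "polyfun (%c. mcoeff (mpow (G * H) c) \<alpha>)" by (rule polyfun_mpow[OF GH])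
  show "polyfun (%c. mcoeff (mpow G c * mpow H c) \<alpha>)"
   unfolding mcoeff_mult case_prod_beta by (intro polyfun_sum polyfun_mult polyfun_mpow G H)
 qed (simp add: mpow_of_nat G H GH power_mult_distrib)
qed

lemma mpow_1 [simp]: "mpow 1 c = 1"
proof (rule mfps_eqI)
 fix \<alpha> :: "expo"
 have "mcoeff (mpow 1 c) \<alpha> = (\<Sum>k\<le>mlen \<alpha>. if k = 0 then mcoeff 1 \<alpha> else 0)"
  unfolding mcoeff_mpow[of "1::'a mfps", OF _ order_refl, simplified] by (rule sum.cong) (auto simp: power_0_left)
 then show "mcoeff (mpow 1 c) \<alpha> = mcoeff 1 \<alpha>" by simp
qed

lemma mexp_zero [simp]: "mexp 0 = 1"
proof (rule mfps_eqI)
 fix \<alpha> :: "expo"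
 have "mcoeff (mexp 0) \<alpha> = (\<Sum>k\<le>mlen \<alpha>. if k = 0 then mcoeff 1 \<alpha> else 0)"
  unfolding mexp_def by (subst mcoeff_fps_apply[OF _ order_refl], simp, unfold mcoeff_sum, rule sum.cong) (auto simp: power_0_left)
 then show "mcoeff (mexp 0) \<alpha> = mcoeff 1 \<alpha>" by simp
qed

lemma mcoeff_power_mult_high:
 assumes "mcoeff a 0 = 0" "mcoeff b 0 = 0" "mlen \<gamma> < i + j" shows "mcoeff (a ^ i * b ^ j) \<gamma> = 0"
 unfolding mcoeff_mult
proof (rule sum.neutral, clarify)
 fix \<alpha> \<beta> assume "(\<alpha>, \<beta>) : splits \<gamma>"
 then have "mlen \<gamma> = mlen \<alpha> + mlen \<beta>" using msum_add[of "%_. 1" \<alpha> \<beta>] by (simp only: splits_iff)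
 then have "mlen \<alpha> < i \<or> mlen \<beta> < j" using assms(3) by linarith
 then show "mcoeff (a ^ i) \<alpha> * mcoeff (b ^ j) \<beta> = 0" using mcoeff_power_high assms(1,2) by fastforce
qed

text \<open>All series are truncated at the total degree \<open>N\<close> of
  \<open>\<gamma>\<close>. In the product of truncations the terms with \<open>i + j > N\<close>
  vanish at \<open>\<gamma>\<close>, and the remaining triangle of indices is summed by the binomial
  theorem.\<close>

lemma mexp_add:
 assumes a: "mcoeff a 0 = 0" and b: "mcoeff b 0 = 0" shows "mexp (a + b) = mexp a * mexp b"
proof (rule mfps_eqI)
 fix \<gamma> :: "expo"
 define N where "N = mlen \<gamma>"
 let ?i = "%k. mconst (inverse (fact k) :: 'a)"
 have e: "mcoeff (mexp h) \<alpha> = mcoeff (\<Sum>k\<le>N. ?i k * h ^ k) \<alpha>" if "mcoeff h 0 = 0" "mlen \<alpha> \<le> N" for h \<alpha>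
  unfolding mexp_def by (subst mcoeff_fps_apply[OF that]) (simp add: divide_inverse)
 have mc: "mcoeff (F * G) \<gamma> = mcoeff (F' * G') \<gamma>"
  if "\<And>\<alpha>. mlen \<alpha> \<le> N ==> mcoeff F \<alpha> = mcoeff F' \<alpha>" "\<And>\<alpha>. mlen \<alpha> \<le> N ==> mcoeff G \<alpha> = mcoeff G' \<alpha>" for F G F' G' :: "'a mfps"
  unfolding mcoeff_mult
 proof (rule sum.cong[OF refl], clarify)
  fix \<alpha> \<beta> assume "(\<alpha>, \<beta>) : splits \<gamma>"
  then have "mlen \<gamma> = mlen \<alpha> + mlen \<beta>" using msum_add[of "%_. 1" \<alpha> \<beta>] by (simp only: splits_iff)
  then show "mcoeff F \<alpha> * mcoeff G \<beta> = mcoeff F' \<alpha> * mcoeff G' \<beta>" using that by (simp add: N_def)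
 qed
 have "mcoeff (mexp a * mexp b) \<gamma> = mcoeff ((\<Sum>k\<le>N. ?i k * a ^ k) * (\<Sum>k\<le>N. ?i k * b ^ k)) \<gamma>"
  by (rule mc) (rule e[OF a], assumption, rule e[OF b], assumption)
 also have "\<dots> = (\<Sum>i\<le>N. \<Sum>j\<le>N. inverse (fact i) * inverse (fact j) * mcoeff (a ^ i * b ^ j) \<gamma>)"
 proof -
  have "(?i i * a ^ i) * (?i j * b ^ j) = ?i i * (?i j * (a ^ i * b ^ j))" for i j by (simp add: ac_simps)
  then show ?thesis by (simp only: sum_product mcoeff_sum mcoeff_mconst_mult mult.assoc)
 qed
 also have "\<dots> = (\<Sum>(i, j)\<in>{..N} \<times> {..N}. inverse (fact i) * inverse (fact j) * mcoeff (a ^ i * b ^ j) \<gamma>)" by (rule sum.cartesian_product)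
 also have "\<dots> = (\<Sum>(i, j)\<in>{(i, j). i + j \<le> N}. inverse (fact i) * inverse (fact j) * mcoeff (a ^ i * b ^ j) \<gamma>)"
 proof (rule sum.mono_neutral_right)
  show "\<forall>x\<in>{..N} \<times> {..N} - {(i, j). i + j \<le> N}. (case x of (i, j) => inverse (fact i) * inverse (fact j) * mcoeff (a ^ i * b ^ j) \<gamma>) = 0"
  proof
   fix x assume x: "x : {..N} \<times> {..N} - {(i, j). i + j \<le> N}"
   obtain i j where ij: "x = (i, j)" by (cases x)
   have "N < i + j" using x ij by auto
   then have "mcoeff (a ^ i * b ^ j) \<gamma> = 0" unfolding N_def by (rule mcoeff_power_mult_high[OF a b])
   then show "(case x of (i, j) => inverse (fact i) * inverse (fact j) * mcoeff (a ^ i * b ^ j) \<gamma>) = 0" by (simp add: ij)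
  qed
 qed auto
 also have "\<dots> = (\<Sum>k\<le>N. \<Sum>i\<le>k. inverse (fact i) * inverse (fact (k - i)) * mcoeff (a ^ i * b ^ (k - i)) \<gamma>)" by (rule sum.triangle_reindex_eq)
 also have "\<dots> = (\<Sum>k\<le>N. inverse (fact k) * mcoeff ((a + b) ^ k) \<gamma>)"
 proof (rule sum.cong[OF refl])
  fix k
  have "inverse (fact k) * mcoeff ((a + b) ^ k) \<gamma> = (\<Sum>i\<le>k. inverse (fact k) * of_nat (k choose i) * mcoeff (a ^ i * b ^ (k - i)) \<gamma>)"
   unfolding binomial_ring by (simp add: mcoeff_sum mconst_of_nat[symmetric] mult.assoc sum_distrib_left)
  also have "\<dots> = (\<Sum>i\<le>k. inverse (fact i) * inverse (fact (k - i)) * mcoeff (a ^ i * b ^ (k - i)) \<gamma>)"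
   by (rule sum.cong) (auto simp: binomial_fact field_simps)
  finally show "(\<Sum>i\<le>k. inverse (fact i) * inverse (fact (k - i)) * mcoeff (a ^ i * b ^ (k - i)) \<gamma>) = inverse (fact k) * mcoeff ((a + b) ^ k) \<gamma>" ..
 qed
 also have "\<dots> = mcoeff (mexp (a + b)) \<gamma>" by (subst e) (use a b in \<open>simp_all add: mcoeff_sum N_def\<close>)
 finally show "mcoeff (mexp (a + b)) \<gamma> = mcoeff (mexp a * mexp b) \<gamma>" ..
qed

subsubsection \<open>Triangular systems\<close>

lemma mlen_splits: "(\<alpha>, \<delta>) : splits \<gamma> ==> \<delta> ~= 0 ==> mlen \<alpha> < mlen \<gamma>"
 using mlen_eq_0_iff[of \<delta>] by (auto simp: splits_iff simp del: mlen_eq_0_iff)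

text \<open>Solves the triangular linear system in which row \<open>\<gamma>\<close> sums
  \<open>w \<alpha>\<close> times the coefficient of \<open>T \<alpha>\<close> at
  \<open>\<delta>\<close> over all decompositions of \<open>\<gamma>\<close>. When the constant
  terms of \<open>T\<close> are 1, the part with \<open>\<delta> = 0\<close> is the unknown
  \<open>w \<gamma>\<close>, and all other unknowns of the row have smaller total degree.\<close>

function tri_solve :: "(expo => 'a::comm_ring_1 mfps) => 'a mfps => expo => 'a" where
 "tri_solve T R \<gamma> = mcoeff R \<gamma> - (\<Sum>x\<in>{x : splits \<gamma>. snd x ~= 0}. tri_solve T R (fst x) * mcoeff (T (fst x)) (snd x))"
 by pat_completeness auto
termination
 by (relation "measure (%(T, R, \<gamma>). mlen \<gamma>)") (auto dest: mlen_splits)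

declare tri_solve.simps [simp del]

lemma tri_solve:
 assumes T: "\<And>\<alpha>. mcoeff (T \<alpha>) 0 = 1"
 shows "(\<Sum>(\<alpha>, \<delta>)\<in>splits \<gamma>. tri_solve T R \<alpha> * mcoeff (T \<alpha>) \<delta>) = mcoeff R \<gamma>"
proof -
 have s: "splits \<gamma> = insert (\<gamma>, 0) {x : splits \<gamma>. snd x ~= 0}" by (auto simp: splits_iff)
 have "(\<Sum>x\<in>splits \<gamma>. tri_solve T R (fst x) * mcoeff (T (fst x)) (snd x)) =
   tri_solve T R \<gamma> + (\<Sum>x\<in>{x : splits \<gamma>. snd x ~= 0}. tri_solve T R (fst x) * mcoeff (T (fst x)) (snd x))"
  by (subst s, subst sum.insert) (simp_all add: T)
 also have "\<dots> = mcoeff R \<gamma>" by (subst (1) tri_solve.simps) simp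
 finally show ?thesis by (simp add: case_prod_beta)
qed

lemma tri_solve_series:
 assumes T: "\<And>\<alpha>. T \<alpha> : series n" and R: "R : series n"
 shows "\<gamma> \<notin> exponents n ==> tri_solve T R \<gamma> = 0"
proof (induction "mlen \<gamma>" arbitrary: \<gamma> rule: less_induct)
 case less
 have "tri_solve T R (fst x) * mcoeff (T (fst x)) (snd x) = 0" if x: "x : splits \<gamma>" "snd x ~= 0" for x
 proof (cases "fst x : exponents n")
  case True
  then have "snd x \<notin> exponents n" using x less.prems exponents_add[of "fst x" "snd x"] by (auto simp: splits_def)
  then show ?thesis using seriesD[OF T] by simp
 next
  case False
  then show ?thesis using less.hyps[of "fst x"] mlen_splits[of "fst x" "snd x" \<gamma>] x by simp
 qed
 then show ?case by (subst tri_solve.simps) (simp add: seriesD[OF R less.prems])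
qed

text \<open>The equation is linear in the coefficients of \<open>w\<close>: each one enters with the
  series \<open>u * tpow n \<tau> \<alpha>\<close>, whose constant term is 1. It is thus a unipotent
  triangular system.\<close>

lemma right_inverse_ex:
 fixes \<tau> :: "nat => 'a::comm_ring_1 mfps"
 assumes \<tau>: "\<And>i. i < n ==> \<tau> i : series n" "\<And>i. i < n ==> mcoeff (\<tau> i) 0 = 1" and u: "u : series n" "mcoeff u 0 = 1"
 shows "\<exists>w\<in>series n. mcoeff w 0 = 1 \<and> u * twist n \<tau> w = 1"
proof -
 define T where "T \<alpha> = u * tpow n \<tau> \<alpha>" for \<alpha>
 have T: "mcoeff (T \<alpha>) 0 = 1" "T \<alpha> : series n" for \<alpha>
  unfolding T_def by (simp add: u tpow_def mcoeff_prod_0 \<tau>) (intro series_mult u series_tpow \<tau>)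
 define w where "w = Abs_mfps (tri_solve T 1)"
 have "w : series n" using tri_solve_series[OF T(2) series_closed(2)] by (intro seriesI) (simp add: w_def)
 moreover have e: "u * twist n \<tau> w = 1"
 proof (rule mfps_eqI)
  fix \<gamma>
  have "mcoeff (u * twist n \<tau> w) \<gamma> = (\<Sum>(\<epsilon>, c)\<in>splits \<gamma>. \<Sum>(a, d)\<in>splits \<epsilon>. tri_solve T 1 a * (mcoeff u c * mcoeff (tpow n \<tau> a) d))"
   unfolding mult.commute[of u] mcoeff_mult mcoeff_twist w_def by (simp add: sum_distrib_left sum_distrib_right case_prod_beta ac_simps)
  also have "\<dots> = (\<Sum>(a, \<zeta>)\<in>splits \<gamma>. \<Sum>(d, c)\<in>splits \<zeta>. tri_solve T 1 a * (mcoeff u c * mcoeff (tpow n \<tau> a) d))" by (rule splits_assoc)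
  also have "\<dots> = (\<Sum>(a, \<zeta>)\<in>splits \<gamma>. tri_solve T 1 a * mcoeff (T a) \<zeta>)"
   unfolding T_def mult.commute[of u] mcoeff_mult by (simp add: sum_distrib_left case_prod_beta ac_simps)
  also have "\<dots> = mcoeff 1 \<gamma>" by (rule tri_solve[OF T(1)])
  finally show "mcoeff (u * twist n \<tau> w) \<gamma> = mcoeff 1 \<gamma>" .
 qed
 moreover have "mcoeff w 0 = 1" using arg_cong[OF e, of "%F. mcoeff F 0"] u(2) by simp
 ultimately show ?thesis by (intro bexI[of _ w] conjI)
qed

subsection \<open>The groups\<close>

text \<open>The constructions produce only right inverses. If \<open>y\<close> is a right inverse of
  \<open>x\<close> and \<open>z\<close> one of \<open>y\<close>, then \<open>x = z\<close>, so
  \<open>y\<close> is also a left inverse.\<close>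

lemma group_by_right_inverses:
 assumes m: "monoid G" and i: "\<And>x. x : carrier G ==> \<exists>y\<in>carrier G. x \<otimes>\<^bsub>G\<^esub> y = \<one>\<^bsub>G\<^esub>"
 shows "group G"
proof -
 interpret monoid G by (rule m)
 show ?thesis
 proof (rule group_l_invI)
  fix x assume x: "x : carrier G"
  from i[OF x] obtain y where y: "y : carrier G" "x \<otimes>\<^bsub>G\<^esub> y = \<one>\<^bsub>G\<^esub>" by (elim bexE)
  from i[OF y(1)] obtain z where z: "z : carrier G" "y \<otimes>\<^bsub>G\<^esub> z = \<one>\<^bsub>G\<^esub>" by (elim bexE)
  have "x = x \<otimes>\<^bsub>G\<^esub> (y \<otimes>\<^bsub>G\<^esub> z)" using x z(2) by simp
  also have "\<dots> = z" using m_assoc[OF x y(1) z(1)] y(2) z(1) by simp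
  finally show "\<exists>y\<in>carrier G. y \<otimes>\<^bsub>G\<^esub> x = \<one>\<^bsub>G\<^esub>" using y z by auto
 qed
qed

lemma semidirect_simps:
 "carrier (semidirect N G act) = carrier N \<times> carrier G"
 "(x, g) \<otimes>\<^bsub>semidirect N G act\<^esub> (x', g') = (x \<otimes>\<^bsub>N\<^esub> act g x', g \<otimes>\<^bsub>G\<^esub> g')"
 "\<one>\<^bsub>semidirect N G act\<^esub> = (\<one>\<^bsub>N\<^esub>, \<one>\<^bsub>G\<^esub>)"
 by (simp_all add: semidirect_def)

lemma group_semidirect:
 assumes N: "group N" and G: "group G"
  and c: "\<And>g x. g : carrier G ==> x : carrier N ==> act g x : carrier N"
  and h: "\<And>g x y. g : carrier G ==> x : carrier N ==> y : carrier N ==> act g (x \<otimes>\<^bsub>N\<^esub> y) = act g x \<otimes>\<^bsub>N\<^esub> act g y"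
  and m: "\<And>g g' x. g : carrier G ==> g' : carrier G ==> x : carrier N ==> act (g \<otimes>\<^bsub>G\<^esub> g') x = act g (act g' x)"
  and o: "\<And>x. x : carrier N ==> act \<one>\<^bsub>G\<^esub> x = x"
 shows "group (semidirect N G act)"
proof (rule group_by_right_inverses)
 interpret N: group N by (rule N)
 interpret G: group G by (rule G)
 have a1: "act g \<one>\<^bsub>N\<^esub> = \<one>\<^bsub>N\<^esub>" if "g : carrier G" for g
  using h[OF that N.one_closed N.one_closed] N.r_cancel_one[OF c[OF that N.one_closed] c[OF that N.one_closed]] by simp
 show "monoid (semidirect N G act)"
 proof (rule monoidI)
  fix x y assume "x : carrier (semidirect N G act)" "y : carrier (semidirect N G act)"
  then show "x \<otimes>\<^bsub>semidirect N G act\<^esub> y : carrier (semidirect N G act)" by (cases x; cases y) (simp add: semidirect_simps c)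
 next
  fix x y z assume "x : carrier (semidirect N G act)" "y : carrier (semidirect N G act)" "z : carrier (semidirect N G act)"
  then show "x \<otimes>\<^bsub>semidirect N G act\<^esub> y \<otimes>\<^bsub>semidirect N G act\<^esub> z = x \<otimes>\<^bsub>semidirect N G act\<^esub> (y \<otimes>\<^bsub>semidirect N G act\<^esub> z)"
   by (cases x; cases y; cases z) (simp add: semidirect_simps c h m N.m_assoc G.m_assoc)
 next
  fix x assume "x : carrier (semidirect N G act)"
  then show "\<one>\<^bsub>semidirect N G act\<^esub> \<otimes>\<^bsub>semidirect N G act\<^esub> x = x" "x \<otimes>\<^bsub>semidirect N G act\<^esub> \<one>\<^bsub>semidirect N G act\<^esub> = x"
   by (cases x, simp add: semidirect_simps o a1)+
 qed (simp add: semidirect_simps)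
 fix x assume "x : carrier (semidirect N G act)"
 then obtain n g where x: "x = (n, g)" "n : carrier N" "g : carrier G" by (cases x) (simp add: semidirect_simps)
 let ?y = "(act (inv\<^bsub>G\<^esub> g) (inv\<^bsub>N\<^esub> n), inv\<^bsub>G\<^esub> g)"
 have "act g (act (inv\<^bsub>G\<^esub> g) (inv\<^bsub>N\<^esub> n)) = inv\<^bsub>N\<^esub> n"
  using m[of g "inv\<^bsub>G\<^esub> g" "inv\<^bsub>N\<^esub> n"] o[of "inv\<^bsub>N\<^esub> n"] x by simp
 then show "\<exists>y\<in>carrier (semidirect N G act). x \<otimes>\<^bsub>semidirect N G act\<^esub> y = \<one>\<^bsub>semidirect N G act\<^esub>"
  using x by (intro bexI[of _ ?y]) (simp_all add: semidirect_simps c)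
qed

text \<open>The inverse of \<open>g\<close> acts by the inverse map, which gives bijectivity.
  Elements of \<open>AutoGroup\<close> are extensional, hence the restriction to the
  carrier.\<close>

lemma group_hom_AutoGroup:
 assumes V: "group V" and G: "group G"
  and c: "\<And>g x. g : carrier G ==> x : carrier V ==> act g x : carrier V"
  and h: "\<And>g x y. g : carrier G ==> x : carrier V ==> y : carrier V ==> act g (x \<otimes>\<^bsub>V\<^esub> y) = act g x \<otimes>\<^bsub>V\<^esub> act g y"
  and m: "\<And>g g' x. g : carrier G ==> g' : carrier G ==> x : carrier V ==> act (g \<otimes>\<^bsub>G\<^esub> g') x = act g (act g' x)"
  and o: "\<And>x. x : carrier V ==> act \<one>\<^bsub>G\<^esub> x = x"
 shows "group_hom G (AutoGroup V) (%g. \<lambda>x\<in>carrier V. act g x)"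
proof -
 interpret V: group V by (rule V)
 interpret G: group G by (rule G)
 have A: "group (AutoGroup V)" by (rule V.AutoGroup)
 have b: "(\<lambda>x\<in>carrier V. act g x) : Bij (carrier V)" if g: "g : carrier G" for g
  unfolding Bij_def
 proof (intro IntI CollectI)
  have i: "act (inv\<^bsub>G\<^esub> g) (act g x) = x" "act g (act (inv\<^bsub>G\<^esub> g) x) = x" if "x : carrier V" for x
   using m[of "inv\<^bsub>G\<^esub> g" g x] m[of g "inv\<^bsub>G\<^esub> g" x] o[OF that] that g by simp_all
  have "bij_betw (act g) (carrier V) (carrier V)"
   by (rule bij_betw_byWitness[of _ "act (inv\<^bsub>G\<^esub> g)"]) (use i c g in auto)
  then show "bij_betw (\<lambda>x\<in>carrier V. act g x) (carrier V) (carrier V)" by (simp cong: bij_betw_cong)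
 qed simp
 have au: "(\<lambda>x\<in>carrier V. act g x) : auto V" if g: "g : carrier G" for g
  unfolding auto_def using b[OF g] g by (auto simp: hom_def c h)
 have "(%g. \<lambda>x\<in>carrier V. act g x) : hom G (AutoGroup V)"
 proof (rule homI)
  fix g g' assume g: "g : carrier G" "g' : carrier G"
  show "(\<lambda>x\<in>carrier V. act (g \<otimes>\<^bsub>G\<^esub> g') x) = (\<lambda>x\<in>carrier V. act g x) \<otimes>\<^bsub>AutoGroup V\<^esub> (\<lambda>x\<in>carrier V. act g' x)"
   using b[OF g(1)] b[OF g(2)] g by (auto simp: AutoGroup_def BijGroup_def compose_def restrict_def m c)
 qed (simp add: AutoGroup_def au)
 then show ?thesis by (intro group_hom.intro group_hom_axioms.intro G A)
qed

lemma V_group_simps: "carrier (V_group p q) = series_plus (p + q)" "x \<otimes>\<^bsub>V_group p q\<^esub> y = x + y" "\<one>\<^bsub>V_group p q\<^esub> = 0"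
 by (simp_all add: V_group_def)

lemma series_plus_iff: "F : series_plus n \<longleftrightarrow> F : series n \<and> mcoeff F 0 = 0"
 by (simp add: series_plus_def)

lemma series_plus_closed:
 "0 : series_plus n" "F : series_plus n ==> G : series_plus n ==> F + G : series_plus n" "F : series_plus n ==> - F : series_plus n"
 by (simp_all add: series_plus_iff series_closed)

lemma group_V_group: "group (V_group p q)"
proof (rule groupI)
 fix x assume "x : carrier (V_group p q)"
 then show "\<exists>y\<in>carrier (V_group p q). y \<otimes>\<^bsub>V_group p q\<^esub> x = \<one>\<^bsub>V_group p q\<^esub>"
  by (intro bexI[of _ "- x"]) (simp_all add: V_group_simps series_plus_closed)
qed (simp_all add: V_group_simps series_plus_closed)

definition units1 :: "nat => 'k::field_char_0 mfps set" where "units1 n = {u : series n. mcoeff u 0 = 1}"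

lemma units1_iff: "u : units1 n \<longleftrightarrow> u : series n \<and> mcoeff u 0 = 1" by (simp add: units1_def)

lemma units1_closed:
 "1 : units1 n" "u : units1 n ==> v : units1 n ==> u * v : units1 n" "u : units1 n ==> mpow u c : units1 n"
 "P : series_plus n ==> mexp P : units1 n"
 by (simp_all add: units1_iff series_plus_iff series_closed series_mult series_mpow series_mexp)

lemma units1_prod: "(\<And>i. i : S ==> f i : units1 n) ==> prod f S : units1 n"
 by (induction S rule: infinite_finite_induct) (simp_all add: units1_closed)

text \<open>The series \<open>F\<^sub>i / x\<^sub>i\<close> and the factors by which the substitution attached to \<open>F\<close> multiplies the variables.\<close>

abbreviation quo :: "(nat => 'k::field_char_0 mfps) => nat => 'k mfps" where "quo F i \<equiv> div_var i (F i)"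

definition tau :: "nat => 'k::field_char_0 mat => (nat => 'k mfps) => nat => 'k mfps" where
 "tau p B u v = (if v < p then u v else \<Prod>i<p. mpow (u i) (B $$ (v - p, i)))"

lemma tau_cong: "(\<And>i. i < p ==> u i = u' i) ==> tau p B u v = tau p B u' v"
 by (simp add: tau_def)

lemma tau_units1: "(\<And>i. i < p ==> u i : units1 n) ==> tau p B u v : units1 n"
 by (auto simp: tau_def intro: units1_closed units1_prod)

lemma G_factor_iff: "F : G_factor p q i \<longleftrightarrow> (\<exists>u\<in>units1 (p + q). F = mvar i * u)"
proof
 assume "F : G_factor p q i"
 then obtain h where "F = mvar i * (1 + h)" "h : series_plus (p + q)" by (auto simp: G_factor_def)
 then show "\<exists>u\<in>units1 (p + q). F = mvar i * u" by (intro bexI[of _ "1 + h"]) (simp_all add: units1_iff series_plus_iff series_closed)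
next
 assume "\<exists>u\<in>units1 (p + q). F = mvar i * u"
 then obtain u where u: "u : units1 (p + q)" "F = mvar i * u" by blast
 then have "F = mvar i * (1 + (u - 1))" "u - 1 : series_plus (p + q)" by (simp_all add: units1_iff series_plus_iff series_closed)
 then show "F : G_factor p q i" unfolding G_factor_def by blast
qed

context
 fixes p q :: nat and B :: "'k::field_char_0 mat"
begin

abbreviation "GG \<equiv> G_group p q B"
abbreviation "tw F \<equiv> twist (p + q) (tau p B (quo F))"

lemma GG_simps: "carrier GG = (\<Pi>\<^sub>E i\<in>{..<p}. G_factor p q i)" "F \<otimes>\<^bsub>GG\<^esub> G = (\<lambda>i\<in>{..<p}. B_subst p q B F (G i))"
 "\<one>\<^bsub>GG\<^esub> = (\<lambda>i\<in>{..<p}. mvar i)"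
 by (simp_all add: G_group_def)

lemma GG_quo: assumes "F : carrier GG" "i < p" shows "quo F i : units1 (p + q)" "F i = mvar i * quo F i"
proof -
 have "F i : G_factor p q i" using assms by (auto simp: GG_simps)
 then obtain u where "u : units1 (p + q)" "F i = mvar i * u" unfolding G_factor_iff by (elim bexE)
 then show "quo F i : units1 (p + q)" "F i = mvar i * quo F i" by simp_all
qed

lemma GG_mk: "(\<And>i. i < p ==> u i : units1 (p + q)) ==> (\<lambda>i\<in>{..<p}. mvar i * u i) : carrier GG"
 unfolding GG_simps by (rule restrict_PiE_iff[THEN iffD2]) (auto simp: G_factor_iff)

lemma tau_GG: "F : carrier GG ==> tau p B (quo F) v : units1 (p + q)"
 by (rule tau_units1) (rule GG_quo)

lemma tw_closed: "F : carrier GG ==> P : series (p + q) ==> tw F P : series (p + q)"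
 using tau_GG[of F] by (intro series_twist) (simp_all add: units1_iff)

lemma tw_units1: "F : carrier GG ==> u : units1 (p + q) ==> tw F u : units1 (p + q)"
 using tw_closed[of F u] by (simp add: units1_iff)

lemma tw_plus: "F : carrier GG ==> u : series_plus (p + q) ==> tw F u : series_plus (p + q)"
 using tw_closed[of F u] by (simp add: series_plus_iff)

lemma B_subst_eq:
 assumes F: "F : carrier GG" and P: "P : series (p + q)" shows "B_subst p q B F P = tw F P"
 unfolding B_subst_def by (rule subst_twist[OF P]) (use GG_quo(2)[OF F] in \<open>auto simp: tau_def\<close>)

lemma mvar_series: "i < n ==> mvar i : series n"
 by (rule seriesI) (auto simp: exponents_def)

lemma GG_series: "F : carrier GG ==> i < p ==> F i : series (p + q)"
proof -
 assume F: "F : carrier GG" and i: "i < p"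
 have "mvar i * quo F i : series (p + q)"
  by (rule series_mult) (use GG_quo(1)[OF F i] i in \<open>simp_all add: units1_iff mvar_series\<close>)
 then show "F i : series (p + q)" by (rule ssubst[OF GG_quo(2)[OF F i]])
qed

lemma tw_mvar: "i < p ==> tw F (mvar i) = mvar i * quo F i"
proof -
 assume i: "i < p"
 have "tpow (p + q) (tau p B (quo F)) (single i 1) = (\<Prod>j<p + q. if j = i then quo F i else 1)"
  unfolding tpow_def by (rule prod.cong) (use i in \<open>auto simp: lookup_single when_def tau_def\<close>)
 then show ?thesis using i by (simp add: mmono_var twist_mmono del: One_nat_def)
qed

lemma GG_mult_apply:
 assumes F: "F : carrier GG" and G: "G : carrier GG" and i: "i < p"
 shows "(F \<otimes>\<^bsub>GG\<^esub> G) i = tw F (mvar i * quo G i)"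
proof -
 have "(F \<otimes>\<^bsub>GG\<^esub> G) i = B_subst p q B F (G i)" using i by (simp add: GG_simps)
 also have "\<dots> = tw F (G i)" by (rule B_subst_eq[OF F GG_series[OF G i]])
 also have "\<dots> = tw F (mvar i * quo G i)" by (rule arg_cong[OF GG_quo(2)[OF G i]])
 finally show ?thesis .
qed

text \<open>On the quotients by the variables the product has no shift: the quotient of
  \<open>F\<close> is multiplied by the substituted quotient of \<open>G\<close>. Associativity and
  inverses are proved in this form.\<close>

lemma quo_mult:
 assumes F: "F : carrier GG" and G: "G : carrier GG" and i: "i < p"
 shows "quo (F \<otimes>\<^bsub>GG\<^esub> G) i = quo F i * tw F (quo G i)"
proof -
 have "(F \<otimes>\<^bsub>GG\<^esub> G) i = tw F (mvar i * quo G i)"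
  by (rule GG_mult_apply[OF F G i])
 also have "\<dots> = mvar i * (quo F i * tw F (quo G i))" unfolding twist_mult tw_mvar[OF i] by (simp add: mult.assoc)
 finally show ?thesis by simp
qed

lemma GG_mult_closed: assumes F: "F : carrier GG" and G: "G : carrier GG" shows "F \<otimes>\<^bsub>GG\<^esub> G : carrier GG"
proof -
 have "F \<otimes>\<^bsub>GG\<^esub> G = (\<lambda>i\<in>{..<p}. mvar i * (quo F i * tw F (quo G i)))"
 proof (rule extensionalityI[of _ "{..<p}"])
  fix i assume "i : {..<p}"
  then have i: "i < p" by simp
  have "(F \<otimes>\<^bsub>GG\<^esub> G) i = tw F (mvar i * quo G i)"
    by (rule GG_mult_apply[OF F G i])
  also have "\<dots> = mvar i * (quo F i * tw F (quo G i))" unfolding twist_mult tw_mvar[OF i] by (simp add: mult.assoc)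
  finally show "(F \<otimes>\<^bsub>GG\<^esub> G) i = (\<lambda>i\<in>{..<p}. mvar i * (quo F i * tw F (quo G i))) i" using i by simp
 qed (simp_all add: GG_simps)
 also have "\<dots> : carrier GG" by (rule GG_mk) (intro units1_closed GG_quo[OF F] tw_units1[OF F] GG_quo[OF G])
 finally show ?thesis .
qed

lemma tau_neg: "\<not> v < p ==> tau p B u v = (\<Prod>i<p. mpow (u i) (B $$ (v - p, i)))"
 by (simp add: tau_def)

text \<open>Powers are multiplicative and commute with substitution, so the factors of the
  y-variables obey the same rule as the quotients. This makes the substitution of a product the
  composite of the substitutions, by \<open>twist_comp\<close>.\<close>

lemma tau_mult:
 assumes F: "F : carrier GG" and G: "G : carrier GG"
 shows "tau p B (quo (F \<otimes>\<^bsub>GG\<^esub> G)) v = tau p B (quo F) v * tw F (tau p B (quo G) v)"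
proof (cases "v < p")
 case True then show ?thesis by (simp add: tau_def quo_mult[OF F G])
next
 case False
 have u: "mcoeff (quo F i) 0 = 1" "mcoeff (quo G i) 0 = 1" "mcoeff (tw F (quo G i)) 0 = 1" if "i < p" for i
  using GG_quo[OF F that] GG_quo[OF G that] by (simp_all add: units1_iff)
 have "tau p B (quo (F \<otimes>\<^bsub>GG\<^esub> G)) v = (\<Prod>i<p. mpow (quo F i) (B $$ (v - p, i)) * mpow (tw F (quo G i)) (B $$ (v - p, i)))"
  unfolding tau_neg[OF False] by (rule prod.cong) (simp_all add: quo_mult[OF F G] mpow_mult u)
 also have "\<dots> = tau p B (quo F) v * tw F (\<Prod>i<p. mpow (quo G i) (B $$ (v - p, i)))"
  unfolding tau_neg[OF False] twist_prod prod.distrib[symmetric] by (rule prod.cong) (simp_all add: twist_mpow u)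
 finally show ?thesis unfolding tau_neg[OF False, of "quo G"] .
qed

lemma tw_mult: "F : carrier GG ==> G : carrier GG ==> tw (F \<otimes>\<^bsub>GG\<^esub> G) P = tw F (tw G P)"
 unfolding twist_comp by (rule twist_cong) (rule tau_mult)

lemma GG_one: "\<one>\<^bsub>GG\<^esub> : carrier GG" "i < p ==> quo \<one>\<^bsub>GG\<^esub> i = 1"
 using GG_mk[of "%_. 1"] div_var_mvar[of i 1] by (simp_all add: GG_simps(3) units1_closed)

lemma tw_one: "tw \<one>\<^bsub>GG\<^esub> P = P"
 by (rule twist_id) (simp add: tau_def GG_one)

lemma GG_eqI: "F : carrier GG ==> G : carrier GG ==> (\<And>i. i < p ==> quo F i = quo G i) ==> F = G"
proof (rule extensionalityI[of _ "{..<p}"])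
 assume F: "F : carrier GG" and G: "G : carrier GG" and e: "\<And>i. i < p ==> quo F i = quo G i"
 show "F : extensional {..<p}" "G : extensional {..<p}" using F G by (simp_all add: GG_simps PiE_def)
 fix i assume "i : {..<p}"
 then show "F i = G i" using GG_quo(2)[OF F, of i] GG_quo(2)[OF G, of i] e[of i] by simp
qed

lemma group_GG: "group GG"
proof (rule group_by_right_inverses)
 show "monoid GG"
 proof (rule monoidI)
  fix F G K assume F: "F : carrier GG" and G: "G : carrier GG" and K: "K : carrier GG"
  show "F \<otimes>\<^bsub>GG\<^esub> G \<otimes>\<^bsub>GG\<^esub> K = F \<otimes>\<^bsub>GG\<^esub> (G \<otimes>\<^bsub>GG\<^esub> K)"
  proof (rule GG_eqI)
   fix i assume i: "i < p"
   show "quo (F \<otimes>\<^bsub>GG\<^esub> G \<otimes>\<^bsub>GG\<^esub> K) i = quo (F \<otimes>\<^bsub>GG\<^esub> (G \<otimes>\<^bsub>GG\<^esub> K)) i"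
    unfolding quo_mult[OF GG_mult_closed[OF F G] K i] quo_mult[OF F GG_mult_closed[OF G K] i] quo_mult[OF F G i] quo_mult[OF G K i]
     tw_mult[OF F G] twist_mult by (rule mult.assoc)
  qed (intro GG_mult_closed F G K)+
 next
  fix F assume F: "F : carrier GG"
  show "\<one>\<^bsub>GG\<^esub> \<otimes>\<^bsub>GG\<^esub> F = F" "F \<otimes>\<^bsub>GG\<^esub> \<one>\<^bsub>GG\<^esub> = F"
   by (rule GG_eqI[OF GG_mult_closed[OF GG_one(1) F] F], simp only: quo_mult[OF GG_one(1) F] tw_one GG_one(2) mult_1_left)
    (rule GG_eqI[OF GG_mult_closed[OF F GG_one(1)] F], simp only: quo_mult[OF F GG_one(1)] GG_one(2) twist_01 mult_1_right)
 qed (simp_all only: GG_mult_closed GG_one)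
 fix F assume F: "F : carrier GG"
 have "\<exists>w. \<forall>i<p. w i : units1 (p + q) \<and> quo F i * tw F (w i) = 1"
 proof (rule choice, rule allI)
  fix i
  show "\<exists>w. i < p \<longrightarrow> w : units1 (p + q) \<and> quo F i * tw F w = 1"
  proof (cases "i < p")
   case True
   have t: "tau p B (quo F) v : series (p + q)" "mcoeff (tau p B (quo F) v) 0 = 1" for v using tau_GG[OF F, of v] by (simp_all add: units1_iff)
   have u: "quo F i : series (p + q)" "mcoeff (quo F i) 0 = 1" using GG_quo(1)[OF F True] by (simp_all add: units1_iff)
   have "\<exists>w\<in>series (p + q). mcoeff w 0 = 1 \<and> quo F i * tw F w = 1" by (rule right_inverse_ex[OF _ _ u]) (rule t)+
   then obtain w where "w : series (p + q)" "mcoeff w 0 = 1" "quo F i * tw F w = 1" by (elim bexE conjE)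
   then show ?thesis by (intro exI[of _ w]) (simp add: units1_iff)
  qed simp
 qed
 then obtain w where w': "\<forall>i<p. w i : units1 (p + q) \<and> quo F i * tw F (w i) = 1" by (elim exE)
 note w = conjunct1[OF w'[rule_format]] conjunct2[OF w'[rule_format]]
 let ?G = "\<lambda>i\<in>{..<p}. mvar i * w i"
 have G: "?G : carrier GG" by (rule GG_mk[OF w(1)])
 have q: "quo ?G i = w i" if "i < p" for i using that by simp
 have "F \<otimes>\<^bsub>GG\<^esub> ?G = \<one>\<^bsub>GG\<^esub>"
  by (rule GG_eqI[OF GG_mult_closed[OF F G] GG_one(1)]) (simp only: quo_mult[OF F G] q w GG_one(2))
 then show "\<exists>y\<in>carrier GG. F \<otimes>\<^bsub>GG\<^esub> y = \<one>\<^bsub>GG\<^esub>" by (rule bexI[of _ ?G, OF _ G])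
qed

abbreviation "PV I \<equiv> product_group I (%_. V_group p q) :: (nat => 'k mfps) monoid"

lemma group_PV: "group (PV I)" by (simp add: group_V_group)

lemma PV_simps: "carrier (PV I) = (\<Pi>\<^sub>E i\<in>I. series_plus (p + q))" "x \<otimes>\<^bsub>PV I\<^esub> y = (\<lambda>i\<in>I. x i + y i)" "\<one>\<^bsub>PV I\<^esub> = (\<lambda>i\<in>I. 0)"
 by (simp_all add: V_group_simps)

lemma PV_D: "P : carrier (PV I) ==> i : I ==> P i : series_plus (p + q)"
 unfolding PV_simps by (rule PiE_mem)

lemma plus_series: "P : series_plus n ==> P : series n" "P : series_plus n ==> mcoeff P 0 = 0" by (simp_all add: series_plus_iff)

lemma PV_eqI: "x : extensional I ==> P : carrier (PV I) ==> (\<And>i. i : I ==> x i = P i) ==> x = P"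
 by (rule extensionalityI[of _ I]) (simp_all add: PV_simps PiE_def)

text \<open>Coordinatewise actions on tuples of series.\<close>

lemma PV_action:
 assumes G: "group G"
  and c: "\<And>i g x. i : I ==> g : carrier G ==> x : series_plus (p + q) ==> act i g x : series_plus (p + q)"
  and h: "\<And>i g x y. i : I ==> g : carrier G ==> x : series_plus (p + q) ==> y : series_plus (p + q) ==> act i g (x + y) = act i g x + act i g y"
  and m: "\<And>i g g' x. i : I ==> g : carrier G ==> g' : carrier G ==> x : series_plus (p + q) ==> act i (g \<otimes>\<^bsub>G\<^esub> g') x = act i g (act i g' x)"
  and o: "\<And>i x. i : I ==> x : series_plus (p + q) ==> act i \<one>\<^bsub>G\<^esub> x = x"
 shows "group (semidirect (PV I) G (%g P. \<lambda>i\<in>I. act i g (P i)))"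
proof (rule group_semidirect[OF group_PV G])
 fix g x assume g: "g : carrier G" and x: "x : carrier (PV I)"
 show "(\<lambda>i\<in>I. act i g (x i)) : carrier (PV I)" unfolding PV_simps by (rule restrict_PiE_iff[THEN iffD2]) (auto intro: c g PV_D[OF x])
next
 fix g x y assume g: "g : carrier G" and x: "x : carrier (PV I)" and y: "y : carrier (PV I)"
 show "(\<lambda>i\<in>I. act i g ((x \<otimes>\<^bsub>PV I\<^esub> y) i)) = (\<lambda>i\<in>I. act i g (x i)) \<otimes>\<^bsub>PV I\<^esub> (\<lambda>i\<in>I. act i g (y i))"
  unfolding PV_simps by (rule restrict_ext) (simp add: h[OF _ g PV_D[OF x] PV_D[OF y]])
next
 fix g g' x assume g: "g : carrier G" "g' : carrier G" and x: "x : carrier (PV I)"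
 show "(\<lambda>i\<in>I. act i (g \<otimes>\<^bsub>G\<^esub> g') (x i)) = (\<lambda>i\<in>I. act i g ((\<lambda>i\<in>I. act i g' (x i)) i))"
  by (rule restrict_ext) (simp add: m[OF _ g PV_D[OF x]])
next
 fix x assume x: "x : carrier (PV I)"
 show "(\<lambda>i\<in>I. act i \<one>\<^bsub>G\<^esub> (x i)) = x" by (rule PV_eqI[OF _ x]) (simp_all add: o PV_D[OF x])
qed

lemma tw_B_subst: "F : carrier GG ==> P : series_plus (p + q) ==> B_subst p q B F P = tw F P"
 by (rule B_subst_eq[OF _ plus_series(1)])

lemma group_VG: "group (VG_group p q r B)"
 unfolding VG_group_def
 by (rule PV_action[OF group_GG, where act = "%_. B_subst p q B"])
  (simp_all only: tw_B_subst tw_plus series_plus_closed twist_add GG_mult_closed tw_mult GG_one(1) tw_one)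

lemma VG_simps:
 "carrier (VG_group p q r B) = carrier (PV {..<r}) \<times> carrier GG"
 "(P, F) \<otimes>\<^bsub>VG_group p q r B\<^esub> (P', F') = (P \<otimes>\<^bsub>PV {..<r}\<^esub> (\<lambda>j\<in>{..<r}. B_subst p q B F (P' j)), F \<otimes>\<^bsub>GG\<^esub> F')"
 "\<one>\<^bsub>VG_group p q r B\<^esub> = (\<one>\<^bsub>PV {..<r}\<^esub>, \<one>\<^bsub>GG\<^esub>)"
 unfolding VG_group_def semidirect_simps by (rule refl)+

definition factor :: "nat => 'k vec => 'k vec => (nat => 'k mfps) => (nat => 'k mfps) => 'k mfps" where
 "factor r a b P u = mexp (\<Sum>j<r. mconst (a $ j) * P j) * (\<Prod>i<p. mpow (u i) (b $ i))"

lemma expo_plus: "P : carrier (PV {..<r}) ==> (\<Sum>j<r. mconst (a $ j) * P j) : series_plus (p + q)"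
 unfolding series_plus_iff mcoeff_sum using plus_series[OF PV_D[of P "{..<r}"]]
 by (auto intro!: series_sum series_mult series_closed)

lemma factor_units1: "P : carrier (PV {..<r}) ==> F : carrier GG ==> factor r a b P (quo F) : units1 (p + q)"
 unfolding factor_def by (intro units1_closed units1_prod expo_plus GG_quo) auto

lemma V_action_eq:
 "F : carrier GG ==> Q : series_plus (p + q) ==> V_action p q r B a b (P, F) Q = tw F Q * factor r a b P (quo F)"
 by (simp add: V_action_def factor_def tw_B_subst mult.assoc)

text \<open>The cocycle identity for the multiplier of the action: the exponent is additive under
  the product of the first components and the powers are multiplicative. With it, the action of a
  product is the composite of the actions.\<close>

lemma factor_mult:
 assumes P: "P : carrier (PV {..<r})" "P' : carrier (PV {..<r})" and F: "F : carrier GG" "F' : carrier GG"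
 shows "factor r a b (P \<otimes>\<^bsub>PV {..<r}\<^esub> (\<lambda>j\<in>{..<r}. B_subst p q B F (P' j))) (quo (F \<otimes>\<^bsub>GG\<^esub> F')) =
  factor r a b P (quo F) * tw F (factor r a b P' (quo F'))"
proof -
 have 1: "(\<Sum>j<r. mconst (a $ j) * (P \<otimes>\<^bsub>PV {..<r}\<^esub> (\<lambda>j\<in>{..<r}. B_subst p q B F (P' j))) j) =
  (\<Sum>j<r. mconst (a $ j) * P j) + tw F (\<Sum>j<r. mconst (a $ j) * P' j)"
  unfolding twist_sum sum.distrib[symmetric] PV_simps
  by (rule sum.cong) (simp_all add: tw_B_subst[OF F(1) PV_D[OF P(2)]] distrib_left)
 have z: "mcoeff (\<Sum>j<r. mconst (a $ j) * P j) 0 = 0" "mcoeff (\<Sum>j<r. mconst (a $ j) * P' j) 0 = 0"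
  using plus_series(2)[OF expo_plus[OF P(1)]] plus_series(2)[OF expo_plus[OF P(2)]] by simp_all
 have 2: "(\<Prod>i<p. mpow (quo (F \<otimes>\<^bsub>GG\<^esub> F') i) (b $ i)) = (\<Prod>i<p. mpow (quo F i) (b $ i)) * tw F (\<Prod>i<p. mpow (quo F' i) (b $ i))"
  unfolding twist_prod prod.distrib[symmetric]
 proof (rule prod.cong)
  fix i assume "i : {..<p}"
  then have i: "i < p" by simp
  have u: "mcoeff (quo F i) 0 = 1" "mcoeff (quo F' i) 0 = 1" "mcoeff (tw F (quo F' i)) 0 = 1"
   using GG_quo[OF F(1) i] GG_quo[OF F(2) i] by (simp_all add: units1_iff)
  show "mpow (quo (F \<otimes>\<^bsub>GG\<^esub> F') i) (b $ i) = mpow (quo F i) (b $ i) * tw F (mpow (quo F' i) (b $ i))"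
   unfolding quo_mult[OF F i] twist_mpow[OF u(2)] by (rule mpow_mult[OF u(1,3)])
 qed simp
 show ?thesis unfolding factor_def 1 2 twist_mult twist_mexp[OF z(2)] mexp_add[OF z(1) twist_0[THEN trans, OF z(2)]]
  by (simp only: ac_simps)
qed

lemma V_action_props:
 assumes g: "g : carrier (VG_group p q r B)" and Q: "Q : series_plus (p + q)"
 shows "V_action p q r B a b g Q : series_plus (p + q)"
  and "Q' : series_plus (p + q) ==> V_action p q r B a b g (Q + Q') = V_action p q r B a b g Q + V_action p q r B a b g Q'"
  and "g' : carrier (VG_group p q r B) ==>
   V_action p q r B a b (g \<otimes>\<^bsub>VG_group p q r B\<^esub> g') Q = V_action p q r B a b g (V_action p q r B a b g' Q)"
proof -
 obtain P F where gd: "g = (P, F)" and P: "P : carrier (PV {..<r})" and F: "F : carrier GG" using g unfolding VG_simps by (elim SigmaE)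
 show "V_action p q r B a b g Q : series_plus (p + q)"
  unfolding gd V_action_eq[OF F Q] using tw_plus[OF F Q] factor_units1[OF P F, of a b] by (simp add: series_plus_iff units1_iff series_mult)
 show "V_action p q r B a b g (Q + Q') = V_action p q r B a b g Q + V_action p q r B a b g Q'" if Q': "Q' : series_plus (p + q)"
  unfolding gd V_action_eq[OF F Q] V_action_eq[OF F Q'] V_action_eq[OF F series_plus_closed(2)[OF Q Q']] by (simp add: distrib_right)
 assume g': "g' : carrier (VG_group p q r B)"
 obtain P' F' where gd': "g' = (P', F')" and P': "P' : carrier (PV {..<r})" and F': "F' : carrier GG" using g' unfolding VG_simps by (elim SigmaE)
 have "tw F' Q * factor r a b P' (quo F') : series_plus (p + q)"
  using tw_plus[OF F' Q] factor_units1[OF P' F', of a b] by (simp add: series_plus_iff units1_iff series_mult)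
 then show "V_action p q r B a b (g \<otimes>\<^bsub>VG_group p q r B\<^esub> g') Q = V_action p q r B a b g (V_action p q r B a b g' Q)"
  unfolding gd gd' VG_simps(2) V_action_eq[OF F' Q] V_action_eq[OF GG_mult_closed[OF F F'] Q]
  by (simp only: V_action_eq[OF F] factor_mult[OF P P' F F'] tw_mult[OF F F'] twist_mult ac_simps)
qed

lemma V_action_one: "Q : series_plus (p + q) ==> V_action p q r B a b \<one>\<^bsub>VG_group p q r B\<^esub> Q = Q"
 unfolding VG_simps V_action_eq[OF GG_one(1)] tw_one by (simp add: factor_def GG_one(2) PV_simps del: one_product_group)

lemma V_action_hom:
 "group_hom (VG_group p q r B) (AutoGroup (V_group p q)) (%g. \<lambda>Q\<in>carrier (V_group p q). V_action p q r B a b g Q)"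
 by (rule group_hom_AutoGroup[OF group_V_group group_VG]) (simp_all only: V_group_simps V_action_props V_action_one)

lemma group_full: "group (full_group p q r B s a b)"
 unfolding full_group_def
 by (rule PV_action[OF group_VG, where act = "%k. V_action p q r B (a k) (b k)"]) (simp_all only: V_action_props V_action_one)

lemma full_simps:
 "carrier (full_group p q r B s a b) = carrier (PV {..<s}) \<times> carrier (PV {..<r}) \<times> carrier GG"
 "(Q, g) \<otimes>\<^bsub>full_group p q r B s a b\<^esub> (Q', g') = (Q \<otimes>\<^bsub>PV {..<s}\<^esub> (\<lambda>k\<in>{..<s}. V_action p q r B (a k) (b k) g (Q' k)), g \<otimes>\<^bsub>VG_group p q r B\<^esub> g')"
 "\<one>\<^bsub>full_group p q r B s a b\<^esub> = (\<one>\<^bsub>PV {..<s}\<^esub>, \<one>\<^bsub>PV {..<r}\<^esub>, \<one>\<^bsub>GG\<^esub>)"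
 unfolding full_group_def semidirect_simps VG_simps by (rule refl)+

end

subsection \<open>Graded families of series\<close>

lemma pf_sum: "(\<And>i. i : S ==> pf G d (f i)) ==> pf G d (%\<omega>. \<Sum>i\<in>S. f i \<omega>)"
 by (induction S rule: infinite_finite_induct) (simp_all add: pf.zero pf.add)

text \<open>A series depending on parameters whose coefficient at each exponent is homogeneous of
  that very degree. The property survives all operations in the group law, so homogeneity is proved
  for whole series instead of coefficient by coefficient.\<close>

definition gs :: "(expo \<times> ('o => 'k::comm_ring_1)) set => ('o => 'k mfps) => bool" where
 "gs G F \<longleftrightarrow> (\<forall>\<gamma>. pf G \<gamma> (%\<omega>. mcoeff (F \<omega>) \<gamma>))"

lemma gsD: "gs G F ==> pf G \<gamma> (%\<omega>. mcoeff (F \<omega>) \<gamma>)" by (simp add: gs_def)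

lemma gs_const: "gs G (%_. mconst c)"
 by (auto simp: gs_def intro: pf.const pf.zero)

lemma gs_one: "gs G (%_. 1)" using gs_const[of G 1] by (simp add: mconst_01)

lemma gs_zero: "gs G (%_. 0)" using gs_const[of G 0] by (simp add: mconst_01)

lemma gs_add: "gs G F ==> gs G F' ==> gs G (%\<omega>. F \<omega> + F' \<omega>)"
 by (simp add: gs_def pf.add)

lemma gs_mult:
 assumes "gs G F" "gs G F'" shows "gs G (%\<omega>. F \<omega> * F' \<omega>)"
 unfolding gs_def mcoeff_mult case_prod_beta
proof (intro allI pf_sum)
 fix \<gamma> x assume "x : splits \<gamma>"
 then have "fst x + snd x = \<gamma>" by (auto simp: splits_def)
 with pf.mult[OF gsD[OF assms(1)] gsD[OF assms(2)], of "fst x" "snd x"]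
 show "pf G \<gamma> (%\<omega>. mcoeff (F \<omega>) (fst x) * mcoeff (F' \<omega>) (snd x))" by simp
qed

lemma gs_power: "gs G F ==> gs G (%\<omega>. F \<omega> ^ k)"
 by (induction k) (simp_all add: gs_one gs_mult)

lemma gs_sum: "(\<And>i. i : S ==> gs G (F i)) ==> gs G (%\<omega>. \<Sum>i\<in>S. F i \<omega>)"
 by (induction S rule: infinite_finite_induct) (simp_all add: gs_zero gs_add)

lemma gs_prod: "(\<And>i. i : S ==> gs G (F i)) ==> gs G (%\<omega>. \<Prod>i\<in>S. F i \<omega>)"
 by (induction S rule: infinite_finite_induct) (simp_all add: gs_one gs_mult)

lemma gs_fps_apply:
 assumes h: "gs G h" "\<And>\<omega>. mcoeff (h \<omega>) 0 = 0" shows "gs G (%\<omega>. fps_apply f (h \<omega>))"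
 unfolding gs_def
proof
 fix \<gamma> :: "expo"
 have "gs G (%\<omega>. \<Sum>k\<le>mlen \<gamma>. mconst (fps_nth f k) * h \<omega> ^ k)"
  by (intro gs_sum gs_mult gs_const gs_power h)
 then show "pf G \<gamma> (%\<omega>. mcoeff (fps_apply f (h \<omega>)) \<gamma>)"
  unfolding mcoeff_fps_apply[OF h(2) order_refl] by (rule gsD)
qed

lemma gs_mpow: "gs G F ==> (\<And>\<omega>. mcoeff (F \<omega>) 0 = 1) ==> gs G (%\<omega>. mpow (F \<omega>) c)"
proof -
 assume F: "gs G F" and 1: "\<And>\<omega>. mcoeff (F \<omega>) 0 = 1"
 have e: "(%\<omega>. F \<omega> - 1) = (%\<omega>. F \<omega> + mconst (-1))" by (rule ext, rule mfps_eqI) simp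
 have "gs G (%\<omega>. F \<omega> - 1)" unfolding e by (intro gs_add F gs_const)
 then show ?thesis unfolding mpow_def by (rule gs_fps_apply) (simp add: 1)
qed

lemma gs_mexp: "gs G F ==> (\<And>\<omega>. mcoeff (F \<omega>) 0 = 0) ==> gs G (%\<omega>. mexp (F \<omega>))"
 unfolding mexp_def by (rule gs_fps_apply)

lemma gs_twist:
 assumes P: "gs G P" and t: "\<And>i. i < n ==> gs G (%\<omega>. \<tau> \<omega> i)" shows "gs G (%\<omega>. twist n (\<tau> \<omega>) (P \<omega>))"
 unfolding gs_def mcoeff_twist case_prod_beta
proof (intro allI pf_sum)
 fix \<gamma> x assume "x : splits \<gamma>"
 then have "fst x + snd x = \<gamma>" by (auto simp: splits_def)
 moreover have "gs G (%\<omega>. tpow n (\<tau> \<omega>) (fst x))" unfolding tpow_def by (intro gs_prod gs_power t) simp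
 ultimately show "pf G \<gamma> (%\<omega>. mcoeff (P \<omega>) (fst x) * mcoeff (tpow n (\<tau> \<omega>) (fst x)) (snd x))"
  using pf.mult[OF gsD[OF P, of "fst x"] gsD, of "%\<omega>. tpow n (\<tau> \<omega>) (fst x)" "snd x"] by simp
qed

subsection \<open>Coordinates\<close>

context
 fixes p q r s :: nat and B :: "'k::field_char_0 mat" and a b :: "nat => 'k vec"
begin

abbreviation "XX \<equiv> {..<p + r + s} \<times> (exponents (p + q) - {0})"
abbreviation "FG \<equiv> full_group p q r B s a b"
abbreviation "FPts \<equiv> {g :: nat \<times> expo => 'k. \<forall>v. v \<notin> XX \<longrightarrow> g v = 0}"

text \<open>The constant term \<open>c\<close> is not a coordinate: it is 1 for the quotients by the
  variables and 0 for the additive components. Coordinates therefore belong to nonzero exponents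
  only.\<close>

definition Ser :: "'k => (nat \<times> expo => 'k) => nat => 'k mfps" where
 "Ser c g i = Abs_mfps (%\<alpha>. if \<alpha> = 0 then c else if (i, \<alpha>) : XX then g (i, \<alpha>) else 0)"

lemma mcoeff_Ser: "mcoeff (Ser c g i) \<alpha> = (if \<alpha> = 0 then c else if (i, \<alpha>) : XX then g (i, \<alpha>) else 0)"
 by (simp add: Ser_def)

lemma Ser_0 [simp]: "mcoeff (Ser c g i) 0 = c" by (simp add: mcoeff_Ser)

lemma Ser_series: "Ser c g i : series (p + q)"
 by (rule seriesI) (auto simp: mcoeff_Ser zero_exponents)

lemma Ser_mem: "Ser 1 g i : units1 (p + q)" "Ser 0 g i : series_plus (p + q)"
 by (simp_all add: units1_iff series_plus_iff Ser_series)

definition dec :: "(nat \<times> expo => 'k) => (nat => 'k mfps) \<times> (nat => 'k mfps) \<times> (nat => 'k mfps)" where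
 "dec g = (\<lambda>k\<in>{..<s}. Ser 0 g (p + r + k), \<lambda>j\<in>{..<r}. Ser 0 g (p + j), \<lambda>i\<in>{..<p}. mvar i * Ser 1 g i)"

text \<open>The indices follow the basis of the deg1 algebra: quotients, then the \<open>P\<close>
  block, then the \<open>Q\<close> block. The triple has the reverse order because the normal factor
  of each semidirect product stands in front.\<close>

definition cser :: "(nat => 'k mfps) \<times> (nat => 'k mfps) \<times> (nat => 'k mfps) => nat => 'k mfps" where
 "cser = (%(Q, P, F) i. if i < p then quo F i else if i < p + r then P (i - p) else Q (i - p - r))"

definition cod :: "(nat => 'k mfps) \<times> (nat => 'k mfps) \<times> (nat => 'k mfps) => nat \<times> expo => 'k" where
 "cod x = (%(i, \<alpha>). if (i, \<alpha>) : XX then mcoeff (cser x i) \<alpha> else 0)"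

lemma cod_apply: "(i, \<alpha>) : XX ==> cod x (i, \<alpha>) = mcoeff (cser x i) \<alpha>" by (simp add: cod_def)

lemma cod_Pts: "cod x : FPts" by (auto simp: cod_def)

lemma restrict_PiE_I: "(\<And>i. i : I ==> f i : A i) ==> (\<lambda>i\<in>I. f i) : Pi\<^sub>E I A" by auto

lemma dec_closed: "dec g : carrier FG"
 unfolding full_simps dec_def PV_simps
 by (intro SigmaI restrict_PiE_I Ser_mem GG_mk)

lemma cser_dec: "i < p + r + s ==> cser (dec g) i = Ser (if i < p then 1 else 0) g i"
 by (auto simp: cser_def dec_def)

lemma cod_dec: "g : FPts ==> cod (dec g) = g"
proof (rule ext)
 fix v :: "nat \<times> expo" assume g: "g : FPts"
 obtain i \<alpha> where v: "v = (i, \<alpha>)" by (cases v)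
 show "cod (dec g) v = g v"
 proof (cases "v : XX")
  case True
  then show ?thesis unfolding v by (auto simp: cod_def cser_dec mcoeff_Ser)
 next
  case False
  then show ?thesis using g by (auto simp: cod_def v)
 qed
qed

lemma Ser_cod:
 assumes i: "i < p + r + s" and s: "cser x i : series (p + q)" and c: "mcoeff (cser x i) 0 = c"
 shows "Ser c (cod x) i = cser x i"
 by (rule mfps_eqI) (use i c seriesD[OF s] in \<open>auto simp: mcoeff_Ser cod_def\<close>)

lemma dec_cod:
 assumes x: "x : carrier FG" shows "dec (cod x) = x"
proof -
 obtain Q P F where xd: "x = (Q, P, F)" and m: "Q : carrier (PV p q {..<s})" "P : carrier (PV p q {..<r})" "F : carrier (GG p q B)"
  using x unfolding full_simps by (elim SigmaE) simp
 have 1: "Ser 0 (cod x) (p + r + k) = Q k" if "k < s" for k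
  using Ser_cod[of "p + r + k" x 0] plus_series[OF PV_D[OF m(1)], of k] that by (simp add: xd cser_def)
 have 2: "Ser 0 (cod x) (p + j) = P j" if "j < r" for j
  using Ser_cod[of "p + j" x 0] plus_series[OF PV_D[OF m(2)], of j] that by (simp add: xd cser_def)
 have 3: "mvar i * Ser 1 (cod x) i = F i" if i: "i < p" for i
  using Ser_cod[of i x 1] GG_quo[OF m(3) i] i by (simp add: xd cser_def units1_iff)
 have "(\<lambda>k\<in>{..<s}. Ser 0 (cod x) (p + r + k)) = Q" by (rule PV_eqI[OF _ m(1)]) (simp_all add: 1)
 moreover have "(\<lambda>j\<in>{..<r}. Ser 0 (cod x) (p + j)) = P" by (rule PV_eqI[OF _ m(2)]) (simp_all add: 2)
 moreover have "(\<lambda>i\<in>{..<p}. mvar i * Ser 1 (cod x) i) = F"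
  by (rule extensionalityI[of _ "{..<p}"]) (use m(3) in \<open>auto simp: 3 GG_simps PiE_def\<close>)
 ultimately show ?thesis by (simp add: dec_def xd)
qed

text \<open>\<open>dec\<close> reads only coordinates in the index set, so the polynomial formulas
  for this product hold at arbitrary functions and not only at points.\<close>

definition fm :: "(nat \<times> expo => 'k) => (nat \<times> expo => 'k) => nat \<times> expo => 'k" where
 "fm g h = cod (dec g \<otimes>\<^bsub>FG\<^esub> dec h)"

definition fi :: "(nat \<times> expo => 'k) => nat \<times> expo => 'k" where
 "fi g = cod (inv\<^bsub>FG\<^esub> dec g)"

abbreviation "Tg g \<equiv> tau p B (Ser 1 g)"
abbreviation "Fac g k \<equiv> factor p r (a k) (b k) (%j. Ser 0 g (p + j)) (Ser 1 g)"

lemma fm_apply: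
 assumes v: "(i, \<gamma>) : XX"
 shows "fm g h (i, \<gamma>) = mcoeff (
  if i < p then Ser 1 g i * twist (p + q) (Tg g) (Ser 1 h i)
  else if i < p + r then Ser 0 g i + twist (p + q) (Tg g) (Ser 0 h i)
  else Ser 0 g i + twist (p + q) (Tg g) (Ser 0 h i) * Fac g (i - p - r)) \<gamma>"
proof -
 let ?F = "%g. \<lambda>i\<in>{..<p}. mvar i * Ser 1 g i" and ?P = "%g. \<lambda>j\<in>{..<r}. Ser 0 g (p + j)" and ?Q = "%g. \<lambda>k\<in>{..<s}. Ser 0 g (p + r + k)"
 have F: "?F g : carrier (GG p q B)" for g by (intro GG_mk Ser_mem)
 have q: "quo (?F g) i = Ser 1 g i" if "i < p" for g i using that by simp
 have tw: "tw p q B (?F g) = twist (p + q) (Tg g)" for g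
  by (intro ext twist_cong tau_cong q)
 have fac: "factor p r (a k) (b k) (?P g) (quo (?F g)) = Fac g k" for k
  unfolding factor_def by (intro arg_cong2[of _ _ _ _ "(*)"] arg_cong[of _ _ mexp] sum.cong prod.cong refl) simp_all
 have mult: "dec g \<otimes>\<^bsub>FG\<^esub> dec h = (?Q g \<otimes>\<^bsub>PV p q {..<s}\<^esub> (\<lambda>k\<in>{..<s}. V_action p q r B (a k) (b k) (?P g, ?F g) (?Q h k)),
   ?P g \<otimes>\<^bsub>PV p q {..<r}\<^esub> (\<lambda>j\<in>{..<r}. B_subst p q B (?F g) (?P h j)), ?F g \<otimes>\<^bsub>GG p q B\<^esub> ?F h)"
  unfolding dec_def full_simps VG_simps ..
 have i: "i < p + r + s" using v by simp
 have "cser (dec g \<otimes>\<^bsub>FG\<^esub> dec h) i = (if i < p then Ser 1 g i * twist (p + q) (Tg g) (Ser 1 h i)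
  else if i < p + r then Ser 0 g i + twist (p + q) (Tg g) (Ser 0 h i)
  else Ser 0 g i + twist (p + q) (Tg g) (Ser 0 h i) * Fac g (i - p - r))"
 proof -
  consider (1) "i < p" | (2) "\<not> i < p" "i < p + r" | (3) "\<not> i < p" "\<not> i < p + r" by blast
  then show ?thesis
  proof cases
   case 1
   have "quo (?F g \<otimes>\<^bsub>GG p q B\<^esub> ?F h) i = Ser 1 g i * twist (p + q) (Tg g) (Ser 1 h i)"
    unfolding quo_mult[OF F F 1] q[OF 1] tw ..
   with 1 show ?thesis unfolding mult cser_def by simp
  next
   case 2
   then obtain j where j: "i = p + j" "j < r" by (metis add_less_cancel_left le_add_diff_inverse not_less)
   have "B_subst p q B (?F g) (Ser 0 h i) = twist (p + q) (Tg g) (Ser 0 h i)"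
    unfolding tw_B_subst[OF F Ser_mem(2)] tw ..
   with 2 j show ?thesis unfolding mult cser_def PV_simps by simp
  next
   case 3
   define k where "k = i - p - r"
   have k: "i = p + r + k" "k < s" using 3 i by (simp_all add: k_def)
   have "V_action p q r B (a k) (b k) (?P g, ?F g) (Ser 0 h i) = twist (p + q) (Tg g) (Ser 0 h i) * Fac g k"
    unfolding V_action_eq[OF F Ser_mem(2)] tw fac ..
   with 3 k show ?thesis unfolding mult cser_def PV_simps by simp
  qed
 qed
 then show ?thesis unfolding fm_def cod_apply[OF v] by simp
qed

lemma gs_Ser:
 "gs (pgens XX snd) (%\<omega>. Ser c (fst \<omega>) i)" "gs (pgens XX snd) (%\<omega>. Ser c (snd \<omega>) i)"
proof -
 have g: "pf (pgens XX snd) \<alpha> (%\<omega>. fst \<omega> (i, \<alpha>) :: 'k)" "pf (pgens XX snd) \<alpha> (%\<omega>. snd \<omega> (i, \<alpha>) :: 'k)" if v: "(i, \<alpha>) : XX" for \<alpha>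
 proof -
  have "(snd (i, \<alpha>), %(g :: nat \<times> expo => 'k, g' :: nat \<times> expo => 'k). g (i, \<alpha>)) : pgens XX snd" using v unfolding pgens_def by blast
  from pf.gen[OF this] show "pf (pgens XX snd) \<alpha> (%\<omega>. fst \<omega> (i, \<alpha>) :: 'k)" by (simp add: case_prod_beta')
  have "(snd (i, \<alpha>), %(g :: nat \<times> expo => 'k, g' :: nat \<times> expo => 'k). g' (i, \<alpha>)) : pgens XX snd" using v unfolding pgens_def by blast
  from pf.gen[OF this] show "pf (pgens XX snd) \<alpha> (%\<omega>. snd \<omega> (i, \<alpha>) :: 'k)" by (simp add: case_prod_beta')
 qed
 show "gs (pgens XX snd) (%\<omega>. Ser c (fst \<omega>) i)" unfolding gs_def mcoeff_Ser
 proof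
  fix \<gamma>
  show "pf (pgens XX snd) \<gamma> (%\<omega>. if \<gamma> = 0 then c else if (i, \<gamma>) : XX then fst \<omega> (i, \<gamma>) else 0)"
   by (cases "\<gamma> = 0"; cases "(i, \<gamma>) : XX"; (simp only: if_True if_False pf.zero pf.const simp_thms)?) (rule pf.const g(1) pf.zero | assumption)+
 qed
 show "gs (pgens XX snd) (%\<omega>. Ser c (snd \<omega>) i)" unfolding gs_def mcoeff_Ser
 proof
  fix \<gamma>
  show "pf (pgens XX snd) \<gamma> (%\<omega>. if \<gamma> = 0 then c else if (i, \<gamma>) : XX then snd \<omega> (i, \<gamma>) else 0)"
   by (cases "\<gamma> = 0"; cases "(i, \<gamma>) : XX"; (simp only: if_True if_False pf.zero pf.const simp_thms)?) (rule pf.const g(2) pf.zero | assumption)+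
 qed
qed

lemma gs_Tg: "gs (pgens XX snd) (%\<omega>. Tg (fst \<omega>) v)"
proof (cases "v < p")
 case True then show ?thesis by (simp add: tau_def gs_Ser del: mem_Sigma_iff)
next
 case False
 show ?thesis unfolding tau_neg[OF False] by (intro gs_prod gs_mpow gs_Ser Ser_0)
qed

lemma gs_Fac: "gs (pgens XX snd) (%\<omega>. Fac (fst \<omega>) k)"
 unfolding factor_def by (intro gs_mult gs_prod gs_mpow gs_mexp gs_sum gs_const gs_Ser Ser_0) (simp add: mcoeff_sum)

lemma fm_pf: "v : XX ==> pf (pgens XX snd) (snd v) (%(g, h). fm g h v)"
proof -
 assume v: "v : XX"
 obtain i \<gamma> where vd: "v = (i, \<gamma>)" by (cases v)
 have "gs (pgens XX snd) (%\<omega>. if i < p then Ser 1 (fst \<omega>) i * twist (p + q) (Tg (fst \<omega>)) (Ser 1 (snd \<omega>) i)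
  else if i < p + r then Ser 0 (fst \<omega>) i + twist (p + q) (Tg (fst \<omega>)) (Ser 0 (snd \<omega>) i)
  else Ser 0 (fst \<omega>) i + twist (p + q) (Tg (fst \<omega>)) (Ser 0 (snd \<omega>) i) * Fac (fst \<omega>) (i - p - r))"
 proof -
  have 1: "gs (pgens XX snd) (%\<omega>. twist (p + q) (Tg (fst \<omega>)) (Ser c (snd \<omega>) i))" for c
   by (rule gs_twist[OF gs_Ser(2) gs_Tg])
  show ?thesis
   by (cases "i < p"; cases "i < p + r"; simp only: if_True if_False) (intro gs_add gs_mult gs_Ser gs_Fac 1)+
 qed
 from gsD[OF this, of \<gamma>] show ?thesis using v unfolding vd case_prod_beta' snd_conv by (simp only: fm_apply)
qed

lemma finite_XX: "finite {v : XX. snd v = \<alpha>}"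
 by (rule finite_subset[of _ "{..<p + r + s} \<times> {\<alpha>}"]) auto

lemma cod_one: "cod \<one>\<^bsub>FG\<^esub> = (%_. 0)"
 by (rule ext) (auto simp: cod_def cser_def full_simps PV_simps GG_one(2) simp del: one_product_group)

lemma dec_zero: "dec (%_. 0) = \<one>\<^bsub>FG\<^esub>"
 using dec_cod[OF monoid.one_closed[OF group.is_monoid[OF group_full]]] unfolding cod_one .

text \<open>The coordinate \<open>(i, \<alpha>)\<close> has degree \<open>\<alpha>\<close> in all
  three blocks. For \<open>i < p\<close> this relies on taking coefficients of the quotient by the
  variable instead of the series itself.\<close>

lemma poly_group_FG: "poly_group XX snd (p + q) fm fi"
proof -
 interpret F: group FG by (rule group_full)
 show ?thesis
 proof (rule poly_group.intro)
  fix g h k assume g: "g : FPts" and h: "h : FPts" and k: "k : FPts"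
  show "fm g h : FPts" unfolding fm_def by (rule cod_Pts)
  show "fm (fm g h) k = fm g (fm h k)"
   unfolding fm_def dec_cod[OF F.m_closed[OF dec_closed dec_closed]] F.m_assoc[OF dec_closed dec_closed dec_closed] ..
 next
  fix g assume g: "g : FPts"
  show "fm (%_. 0) g = g" "fm g (%_. 0) = g"
   unfolding fm_def dec_zero F.l_one[OF dec_closed] F.r_one[OF dec_closed] by (rule cod_dec[OF g])+
  show "fi g : FPts" unfolding fi_def by (rule cod_Pts)
  show "fm (fi g) g = (%_. 0)" "fm g (fi g) = (%_. 0)"
   unfolding fm_def fi_def dec_cod[OF F.inv_closed[OF dec_closed]] F.l_inv[OF dec_closed] F.r_inv[OF dec_closed] by (rule cod_one)+
 next
  fix v assume v: "v : XX"
  then show "snd v : exponents (p + q)" "snd v ~= 0" by auto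
  show "pf (pgens XX snd) (snd v) (%(g, h). fm g h v)" by (rule fm_pf[OF v])
 next
  fix \<alpha> show "finite {v : XX. snd v = \<alpha>}" by (rule finite_XX)
 qed
qed

lemma cod_iso:
 "bij_betw cod (carrier FG) FPts"
 "x : carrier FG ==> y : carrier FG ==> cod (x \<otimes>\<^bsub>FG\<^esub> y) = fm (cod x) (cod y)"
proof -
 show "bij_betw cod (carrier FG) FPts"
  by (rule bij_betw_byWitness[of _ dec]; intro ballI image_subsetI) (rule dec_cod cod_dec dec_closed cod_Pts; assumption?)+
qed (simp only: fm_def dec_cod)

end

subsection \<open>Linear parts\<close>

text \<open>\<open>F\<close> has constant term 1 and \<open>\<beta>\<close>-coefficient \<open>c\<close>, and no terms strictly between.\<close>

definition LL :: "expo => 'k => 'k::field_char_0 mfps => bool" where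
 "LL \<beta> c F \<longleftrightarrow> mcoeff F 0 = 1 \<and> mcoeff F \<beta> = c \<and> (\<forall>x y. x + y = \<beta> \<longrightarrow> x ~= 0 \<longrightarrow> y ~= 0 \<longrightarrow> mcoeff F x = 0)"

lemma LL_D: "LL \<beta> c F ==> mcoeff F 0 = 1" "LL \<beta> c F ==> mcoeff F \<beta> = c"
 "LL \<beta> c F ==> x + y = \<beta> ==> x ~= 0 ==> y ~= 0 ==> mcoeff F x = 0"
 by (simp_all add: LL_def)

lemma splits_ends:
 assumes "\<beta> ~= 0" "\<And>x y. x + y = \<beta> ==> x ~= 0 ==> y ~= 0 ==> f x y = 0"
 shows "(\<Sum>(x, y)\<in>splits \<beta>. f x y) = f 0 \<beta> + f \<beta> 0"
proof -
 have "(\<Sum>(x, y)\<in>splits \<beta>. f x y) = (\<Sum>(x, y)\<in>{(0, \<beta>), (\<beta>, 0)}. f x y)"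
 proof (rule sum.mono_neutral_right)
  show "{(0, \<beta>), (\<beta>, 0)} <= splits \<beta>" by (simp add: splits_iff)
  show "\<forall>z\<in>splits \<beta> - {(0, \<beta>), (\<beta>, 0)}. (case z of (x, y) => f x y) = 0"
  proof
   fix z assume z: "z : splits \<beta> - {(0, \<beta>), (\<beta>, 0)}"
   obtain x y where xy: "z = (x, y)" by (cases z)
   have "x + y = \<beta>" "x ~= 0" "y ~= 0" using z by (auto simp: xy splits_iff)
   then show "(case z of (x, y) => f x y) = 0" using assms(2) by (simp add: xy)
  qed
 qed simp
 then show ?thesis using assms(1) by simp
qed

lemma LL_1: "\<beta> ~= 0 ==> LL \<beta> 0 1" by (simp add: LL_def)

text \<open>In the coefficient at \<open>\<beta>\<close> only the two extreme decompositions
  survive, so multiplication becomes addition of the coefficients: the first-order calculus from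
  which the structure constants are read.\<close>

lemma LL_mult:
 assumes b: "\<beta> ~= 0" and F: "LL \<beta> c F" and G: "LL \<beta> d G" shows "LL \<beta> (c + d) (F * G)"
 unfolding LL_def
proof (intro conjI allI impI)
 show "mcoeff (F * G) 0 = 1" by (simp add: LL_D(1)[OF F] LL_D(1)[OF G])
 show "mcoeff (F * G) \<beta> = c + d"
  unfolding mcoeff_mult by (subst splits_ends[OF b]) (simp_all add: LL_D[OF F] LL_D[OF G])
 fix x y assume xy: "x + y = \<beta>" "x ~= 0" "y ~= 0"
 have z: "mcoeff F u * mcoeff G v = 0" if uv: "u + v = x" "u ~= 0" "v ~= 0" for u v
 proof -
  have "u + (v + y) = \<beta>" using uv xy by (simp add: add.assoc[symmetric])
  moreover have "v + y ~= 0" using uv(3) by (simp add: add_eq_0_iff_nat)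
  ultimately show ?thesis using LL_D(3)[OF F _ uv(2)] by simp
 qed
 have e: "(\<Sum>(u, v)\<in>splits x. mcoeff F u * mcoeff G v) = mcoeff F 0 * mcoeff G x + mcoeff F x * mcoeff G 0"
  by (rule splits_ends[OF xy(2)]) (rule z)
 show "mcoeff (F * G) x = 0"
  unfolding mcoeff_mult e using LL_D(3)[OF F xy] LL_D(3)[OF G xy] by simp
qed

lemma LL_power: "\<beta> ~= 0 ==> LL \<beta> c F ==> LL \<beta> (of_nat k * c) (F ^ k)"
proof (induction k)
 case (Suc k)
 from LL_mult[OF Suc.prems(1,2) Suc.IH[OF Suc.prems]] show ?case by (simp add: algebra_simps)
qed (simp add: LL_1)

lemma LL_prod: "\<beta> ~= 0 ==> (\<And>i. i : S ==> LL \<beta> (c i) (F i)) ==> LL \<beta> (\<Sum>i\<in>S. c i) (\<Prod>i\<in>S. F i)"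
 by (induction S rule: infinite_finite_induct) (simp_all add: LL_1 LL_mult)

text \<open>In a product of at least two factors \<open>h\<close>, the first factor is taken at 0,
  at a proper part of \<open>\<beta>\<close>, or leaves 0 for the others; each gives 0. Only the
  constant and linear terms of \<open>f\<close> remain.\<close>

lemma LL_fps_apply:
 assumes b: "\<beta> ~= 0" and h0: "mcoeff h 0 = 0" and hb: "mcoeff h \<beta> = c"
  and h: "\<And>x y. x + y = \<beta> ==> x ~= 0 ==> y ~= 0 ==> mcoeff h x = 0" and f: "fps_nth f 0 = 1"
 shows "LL \<beta> (fps_nth f 1 * c) (fps_apply f h)"
proof -
 have z: "mcoeff (h ^ Suc (Suc k)) \<gamma> = 0" if g: "\<gamma> + \<delta> = \<beta>" for \<gamma> \<delta> k
  unfolding power_Suc[of h "Suc k"] mcoeff_mult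
 proof (rule sum.neutral, clarify)
  fix x y assume "(x, y) : splits \<gamma>"
  then have xy: "x + y = \<gamma>" by (simp add: splits_iff)
  show "mcoeff h x * mcoeff (h ^ Suc k) y = 0"
  proof (cases "x = 0 \<or> y = 0")
   case True then show ?thesis using h0 by auto
  next
   case False
   then have "x + (y + \<delta>) = \<beta>" "y + \<delta> ~= 0" using xy g by (simp_all add: add.assoc[symmetric] add_eq_0_iff_nat)
   with h[of x "y + \<delta>"] False show ?thesis by simp
  qed
 qed
 have e: "mcoeff (fps_apply f h) \<gamma> = mcoeff 1 \<gamma> + fps_nth f 1 * mcoeff h \<gamma>" if g: "\<gamma> + \<delta> = \<beta>" for \<gamma> \<delta>
 proof -
  have "mcoeff (fps_apply f h) \<gamma> = (\<Sum>k\<le>Suc (mlen \<gamma>). fps_nth f k * mcoeff (h ^ k) \<gamma>)"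
   by (subst mcoeff_fps_apply[OF h0, of \<gamma> "Suc (mlen \<gamma>)"]) (simp_all add: mcoeff_sum del: sum.atMost_Suc)
  also have "\<dots> = (\<Sum>k\<in>{0, 1}. fps_nth f k * mcoeff (h ^ k) \<gamma>)"
  proof (rule sum.mono_neutral_right)
   show "\<forall>k\<in>{..Suc (mlen \<gamma>)} - {0, 1}. fps_nth f k * mcoeff (h ^ k) \<gamma> = 0"
   proof
    fix k assume "k : {..Suc (mlen \<gamma>)} - {0, 1}"
    then have "k = Suc (Suc (k - 2))" by auto
    with z[OF g, of "k - 2"] show "fps_nth f k * mcoeff (h ^ k) \<gamma> = 0" by simp
   qed
  qed auto
  finally show ?thesis by (simp add: f)
 qed
 show ?thesis unfolding LL_def using e[of 0 \<beta>] e[of \<beta> 0] e h h0 hb b by simp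
qed

lemma LL_mpow:
 assumes b: "\<beta> ~= 0" and F: "LL \<beta> c F" shows "LL \<beta> (d * c) (mpow F d)"
 unfolding mpow_def using LL_fps_apply[OF b, of "F - 1" c "fps_binomial d"] LL_D[OF F] b by simp

lemma LL_mexp:
 assumes "\<beta> ~= 0" "mcoeff h 0 = 0" "mcoeff h \<beta> = c" "\<And>x y. x + y = \<beta> ==> x ~= 0 ==> y ~= 0 ==> mcoeff h x = 0"
 shows "LL \<beta> c (mexp h)"
 unfolding mexp_def using LL_fps_apply[OF assms, where f = "fps_exp 1"] by simp

subsection \<open>Deg1 algebras\<close>

context
 fixes N M :: nat and A :: "nat => nat => 'k::field vec" and b :: "nat => nat => 'k"
begin

abbreviation "DL \<equiv> deg1_algebra N M A b"
abbreviation "DX \<equiv> {..<M} \<times> (exponents N - {0})"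
text \<open>The product of the basis elements \<open>u\<close> and \<open>w\<close> is
  \<open>st u w\<close> times the basis element \<open>tg u w\<close>. The left factor
  \<open>u\<close> carries the pair (j, \<beta>) and the right factor \<open>w\<close> the pair (i,
  \<alpha>).\<close>

definition "st u w = dot_exponent (A (fst w) (fst u)) (snd w) + b (fst w) (fst u)"
definition "tg u w = (fst w :: nat, snd w + snd u :: expo)" for u w :: "nat \<times> expo"

lemma DL_simps: "carrier DL = {z. keys z <= DX}" "\<zero>\<^bsub>DL\<^esub> = 0" "z \<oplus>\<^bsub>DL\<^esub> w = z + w" "c \<odot>\<^bsub>DL\<^esub> z = pm_scale c z"
 by (simp_all add: deg1_algebra_def)

lemma DL_mult: "z \<otimes>\<^bsub>DL\<^esub> w = (\<Sum>u\<in>keys z. \<Sum>v\<in>keys w.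
  single (tg u v) (lookup z u * lookup w v * st u v))"
 by (simp add: deg1_algebra_def case_prod_beta tg_def st_def)

lemma DL_mult_superset:
 assumes "finite U" "finite V" "keys z <= U" "keys w <= V"
 shows "z \<otimes>\<^bsub>DL\<^esub> w = (\<Sum>u\<in>U. \<Sum>v\<in>V. single (tg u v) (lookup z u * lookup w v * st u v))"
proof -
 have "(\<Sum>v\<in>keys w. single (tg u v) (lookup z u * lookup w v * st u v)) =
   (\<Sum>v\<in>V. single (tg u v) (lookup z u * lookup w v * st u v))" for u
  by (rule sum.mono_neutral_left[OF assms(2,4)]) (auto simp: in_keys_iff)
 then show ?thesis unfolding DL_mult by (simp only:) (rule sum.mono_neutral_left[OF assms(1,3)], auto simp: in_keys_iff)
qed

lemma DL_add: "(z + z') \<otimes>\<^bsub>DL\<^esub> w = z \<otimes>\<^bsub>DL\<^esub> w + z' \<otimes>\<^bsub>DL\<^esub> w" "w \<otimes>\<^bsub>DL\<^esub> (z + z') = w \<otimes>\<^bsub>DL\<^esub> z + w \<otimes>\<^bsub>DL\<^esub> z'"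
proof -
 let ?Z = "keys z \<union> keys z'" and ?W = "keys w"
 have k: "finite ?Z" "finite ?W" "keys z <= ?Z" "keys z' <= ?Z" "keys (z + z') <= ?Z"
  using keys_addI[of z ?Z z'] by auto
 show "(z + z') \<otimes>\<^bsub>DL\<^esub> w = z \<otimes>\<^bsub>DL\<^esub> w + z' \<otimes>\<^bsub>DL\<^esub> w"
  unfolding DL_mult_superset[OF k(1,2,3) order_refl] DL_mult_superset[OF k(1,2,4) order_refl] DL_mult_superset[OF k(1,2,5) order_refl]
  by (simp add: lookup_add distrib_right single_add sum.distrib)
 show "w \<otimes>\<^bsub>DL\<^esub> (z + z') = w \<otimes>\<^bsub>DL\<^esub> z + w \<otimes>\<^bsub>DL\<^esub> z'"
  unfolding DL_mult_superset[OF k(2,1) order_refl k(3)] DL_mult_superset[OF k(2,1) order_refl k(4)] DL_mult_superset[OF k(2,1) order_refl k(5)]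
  by (simp add: lookup_add distrib_right distrib_left single_add sum.distrib)
qed

lemma pm_scale_sum: "pm_scale c (sum f S) = (\<Sum>i\<in>S. pm_scale c (f i))"
 by (induction S rule: infinite_finite_induct) (simp_all add: pm_scale_distrib)

lemma DL_scale: "pm_scale c z \<otimes>\<^bsub>DL\<^esub> w = pm_scale c (z \<otimes>\<^bsub>DL\<^esub> w)" "w \<otimes>\<^bsub>DL\<^esub> pm_scale c z = pm_scale c (w \<otimes>\<^bsub>DL\<^esub> z)"
proof -
 have k: "finite (keys z)" "finite (keys w)" by simp_all
 show "pm_scale c z \<otimes>\<^bsub>DL\<^esub> w = pm_scale c (z \<otimes>\<^bsub>DL\<^esub> w)"
  by (subst DL_mult_superset[OF k keys_pm_scale order_refl]) (simp add: DL_mult pm_scale_sum mult.assoc)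
 show "w \<otimes>\<^bsub>DL\<^esub> pm_scale c z = pm_scale c (w \<otimes>\<^bsub>DL\<^esub> z)"
  by (subst DL_mult_superset[OF k(2,1) order_refl keys_pm_scale]) (simp add: DL_mult pm_scale_sum ac_simps)
qed

lemma DL_zero: "0 \<otimes>\<^bsub>DL\<^esub> z = 0" "z \<otimes>\<^bsub>DL\<^esub> 0 = 0"
 unfolding DL_mult by simp_all

lemma DL_single: "single u c \<otimes>\<^bsub>DL\<^esub> single v d = single (tg u v) (c * d * st u v)"
 by (subst DL_mult_superset[of "{u}" "{v}"]) simp_all

lemma DL_closed: "keys z <= DX ==> keys w <= DX ==> keys (z \<otimes>\<^bsub>DL\<^esub> w) <= DX"
proof -
 assume z: "keys z <= DX" and w: "keys w <= DX"
 have "tg u v : DX" if "u : keys z" "v : keys w" for u v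
  using subsetD[OF z that(1)] subsetD[OF w that(2)] by (auto simp: tg_def exponents_add add_eq_0_iff_nat)
 then show ?thesis unfolding DL_mult by (intro keys_sum_subset) (auto split: if_splits)
qed

lemma kmod_DL: "kmod DL"
proof (rule kmodI)
 show "abelian_group DL"
 proof (rule abelian_groupI)
  fix x assume x: "x : carrier DL"
  then have "- x : carrier DL" unfolding uminus_eq_pm_scale by (simp add: keys_pm_scaleI DL_simps)
  then show "\<exists>y\<in>carrier DL. y \<oplus>\<^bsub>DL\<^esub> x = \<zero>\<^bsub>DL\<^esub>" by (rule rev_bexI) (simp add: DL_simps)
 next
  fix x y assume "x : carrier DL" "y : carrier DL"
  then show "x \<oplus>\<^bsub>DL\<^esub> y : carrier DL" by (simp add: keys_addI DL_simps)
 qed (simp_all add: ac_simps DL_simps)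
qed (simp_all add: keys_pm_scaleI pm_scale_distrib DL_simps)

lemma DL_minus: "y : carrier DL ==> x \<ominus>\<^bsub>DL\<^esub> y = x - y"
 unfolding a_minus_def by (simp add: kmod_uminus[OF kmod_DL] DL_simps uminus_eq_pm_scale[symmetric])

lemma DL_lookup: "lookup (z \<otimes>\<^bsub>DL\<^esub> w) v =
  (\<Sum>u\<in>keys z. \<Sum>t\<in>keys w. lookup z u * lookup w t * (if v = tg u t then st u t else 0))"
 unfolding DL_mult lookup_sum by (intro sum.cong refl) (auto simp: lookup_single when_def)

lemma DL_bracket:
 assumes "x : carrier DL" "y : carrier DL"
 shows "pre_lie_bracket DL x y = x \<otimes>\<^bsub>DL\<^esub> y - y \<otimes>\<^bsub>DL\<^esub> x"
 unfolding pre_lie_bracket_def using DL_closed[of y x] assms by (intro DL_minus) (simp add: DL_simps)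

lemma DL_bracket_lookup:
 assumes "x : carrier DL" "y : carrier DL"
 shows "lookup (pre_lie_bracket DL x y) v = (\<Sum>u\<in>keys x. \<Sum>w\<in>keys y.
  lookup x u * lookup y w * ((if v = tg u w then st u w else 0) - (if v = tg w u then st w u else 0)))"
 unfolding DL_bracket[OF assms] lookup_minus DL_lookup[of y x] DL_lookup[of x y]
 by (subst (2) sum.swap) (simp add: sum_subtractf[symmetric] right_diff_distrib mult.commute)

lemma dot_exponent_add: "dot_exponent v (\<alpha> + \<beta>) = dot_exponent v \<alpha> + dot_exponent v \<beta>"
 by (simp add: dot_exponent_def scalar_prod_def lookup_add distrib_left sum.distrib)

text \<open>As the vectors depend only on the left factor, all terms of the two associators agree
  except for products of a scalar \<open>b\<close> with a structure coefficient, and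
  \<open>bz\<close> makes these vanish.\<close>

lemma pre_lie_DL:
 assumes A: "\<And>i i' j. A i j = A i' j" and bz: "\<And>(u :: nat \<times> expo) (v :: nat \<times> expo) w. b (fst v) (fst u) * st v w = 0"
 shows "pre_lie_algebra DL"
 unfolding pre_lie_algebra_def
proof (intro conjI ballI)
 show "kmod DL" by (rule kmod_DL)
 fix x assume x: "x : carrier DL"
 show "(%y. x \<otimes>\<^bsub>DL\<^esub> y) : lin_hom DL DL" "(%y. y \<otimes>\<^bsub>DL\<^esub> x) : lin_hom DL DL"
  by (rule lin_homI; use x in \<open>simp add: DL_simps DL_add DL_scale DL_closed\<close>)+
 fix y z assume y: "y : carrier DL" and z: "z : carrier DL"
 \<comment> \<open>The defect of the pre-Lie identity; it is additive in each argument and thus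
   determined by scaled basis elements.\<close>
 let ?D = "%x y z. (x \<otimes>\<^bsub>DL\<^esub> y) \<otimes>\<^bsub>DL\<^esub> z - x \<otimes>\<^bsub>DL\<^esub> (y \<otimes>\<^bsub>DL\<^esub> z) - ((y \<otimes>\<^bsub>DL\<^esub> x) \<otimes>\<^bsub>DL\<^esub> z - y \<otimes>\<^bsub>DL\<^esub> (x \<otimes>\<^bsub>DL\<^esub> z))"
 have D: "?D (x + x') y z = ?D x y z + ?D x' y z" "?D x (y + y') z = ?D x y z + ?D x y' z" "?D x y (z + z') = ?D x y z + ?D x y z'"
  for x x' y y' z z' by (simp_all add: DL_add)
 have single: "?D (single u c) (single v d) (single w e) = 0" for u v w c d e
 proof -
  have t: "tg (tg u v) w = tg u (tg v w)" "tg (tg v u) w = tg u (tg v w)" "tg v (tg u w) = tg u (tg v w)"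
   by (simp_all add: tg_def ac_simps)
  define dt where "dt u v = dot_exponent (A 0 (fst u)) (snd v)" for u v :: "nat \<times> expo"
  have s: "st u v = dt u v + b (fst v) (fst u)" for u v unfolding st_def dt_def A[of "fst v" _ 0] ..
  have s1: "st (tg u v) w = st v w" for u v w by (simp add: st_def tg_def)
  have s2: "st u (tg v w) = st u w + dt u v" for u v w
   unfolding s by (simp add: dt_def tg_def dot_exponent_add ac_simps)
  have "c * d * st u v * e * st v w - c * (d * e * st v w) * (st u w + dt u v) - (d * c * st v u * e * st u w - d * (c * e * st u w) * (st v w + dt v u)) =
   c * d * e * (b (fst v) (fst u) * st v w - b (fst u) (fst v) * st u w)"
   by (simp add: s[of u v] s[of v u] algebra_simps)
  also have "\<dots> = 0" unfolding bz by simp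
  finally show ?thesis unfolding DL_single s1 s2 t single_diff[symmetric] by simp
 qed
 have "?D x y z = 0"
 proof -
  have 1: "?D (single u c) (single v d) z = 0" for u v c d
   using subset_UNIV[of "keys z"]
  proof (induction rule: pm_induct)
   case zero show ?case by (simp only: DL_zero diff_self)
  next
   case (add z z') show ?case by (simp only: D(3) add.IH add_0)
  qed (rule single)
  have 2: "?D (single u c) y z = 0" for u c
   using subset_UNIV[of "keys y"]
  proof (induction rule: pm_induct)
   case zero show ?case by (simp only: DL_zero diff_self)
  next
   case (add y y') show ?case by (simp only: D(2) add.IH add_0)
  qed (rule 1)
  show "?D x y z = 0"
   using subset_UNIV[of "keys x"]
  proof (induction rule: pm_induct)
   case zero show ?case by (simp only: DL_zero diff_self)
  next
   case (add x x') show ?case by (simp only: D(1) add.IH add_0)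
  qed (rule 2)
 qed
 then have "(x \<otimes>\<^bsub>DL\<^esub> y) \<otimes>\<^bsub>DL\<^esub> z - x \<otimes>\<^bsub>DL\<^esub> (y \<otimes>\<^bsub>DL\<^esub> z) = (y \<otimes>\<^bsub>DL\<^esub> x) \<otimes>\<^bsub>DL\<^esub> z - y \<otimes>\<^bsub>DL\<^esub> (x \<otimes>\<^bsub>DL\<^esub> z)" by simp
 moreover have "x \<otimes>\<^bsub>DL\<^esub> (y \<otimes>\<^bsub>DL\<^esub> z) : carrier DL" "y \<otimes>\<^bsub>DL\<^esub> (x \<otimes>\<^bsub>DL\<^esub> z) : carrier DL"
  using x y z by (simp_all add: DL_simps DL_closed)
 ultimately show "x \<otimes>\<^bsub>DL\<^esub> y \<otimes>\<^bsub>DL\<^esub> z \<ominus>\<^bsub>DL\<^esub> x \<otimes>\<^bsub>DL\<^esub> (y \<otimes>\<^bsub>DL\<^esub> z) = y \<otimes>\<^bsub>DL\<^esub> x \<otimes>\<^bsub>DL\<^esub> z \<ominus>\<^bsub>DL\<^esub> y \<otimes>\<^bsub>DL\<^esub> (x \<otimes>\<^bsub>DL\<^esub> z)"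
  by (simp only: DL_minus)
qed

end

section \<open>Structure constants of the group\<close>

context
 fixes p q r s :: nat and B :: "'k::field_char_0 mat" and a b :: "nat => 'k vec"
 assumes p: "p \<ge> 1" and B: "B : carrier_mat q p"
begin

abbreviation "cA \<equiv> coeff_A p q B"
abbreviation "cb \<equiv> coeff_b p r a b"
abbreviation "DA1 \<equiv> deg1_algebra (p + q) (p + r + s) cA cb"
abbreviation "X1 \<equiv> {..<p + r + s} \<times> (exponents (p + q) - {0})"
abbreviation "S1 \<equiv> Ser p q r s :: 'k => _"
abbreviation "fm1 \<equiv> fm p q r s B a b"
abbreviation "fi1 \<equiv> fi p q r s B a b"

interpretation PG: poly_group X1 snd "p + q" fm1 fi1 "{g. \<forall>v. v \<notin> X1 \<longrightarrow> g v = 0}" by (rule poly_group_FG)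

lemma cA_indep: "cA i j = cA i' j" by (simp add: coeff_A_def)

lemma cA_carrier: "cA i j : carrier_vec (p + q)"
proof (rule carrier_vecI)
 have "dim_row (1\<^sub>m p @\<^sub>r B) = p + q" using carrier_append_rows[OF one_carrier_mat[of p] B] by (rule carrier_matD)
 then show "dim_vec (cA i j) = p + q" by (simp add: coeff_A_def)
qed

lemma cA_index: "v < p + q ==> cA i j $ v = (if j < p then if v < p then if v = j then 1 else 0 else B $$ (v - p, j) else 0)"
proof -
 assume v: "v < p + q"
 have d: "dim_row (1\<^sub>m p @\<^sub>r B) = p + q" "dim_col (1\<^sub>m p @\<^sub>r B) = p"
  using carrier_append_rows[OF one_carrier_mat[of p] B] by (rule carrier_matD)+
 have "dim_row B = q" "dim_col B = p" using B by (rule carrier_matD)+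
 then show ?thesis using v d by (simp add: coeff_A_def append_rows_def)
qed

lemma dot_cA: "dot_exponent (cA i j) \<alpha> = (\<Sum>v<p + q. of_nat (lookup \<alpha> v) * cA i j $ v)"
proof -
 have "dim_vec (cA i j) = p + q" using cA_carrier by (rule carrier_vecD)
 then show ?thesis by (simp add: dot_exponent_def scalar_prod_def atLeast0LessThan mult.commute)
qed

lemma fundamental: "fundamental_deg1 (p + q) (p + r + s) cA cb"
proof -
 have pl: "pre_lie_algebra DA1"
 proof (rule pre_lie_DL[OF cA_indep])
  fix u v w :: "nat \<times> expo"
  \<comment> \<open>The first scalar can be nonzero only if the index of \<open>v\<close> lies in
    the last block. Basis elements of that block multiply everything from the left to 0, so then the
    second factor vanishes.\<close>
  show "cb (fst v) (fst u) * st cA cb v w = 0"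
   by (auto simp: coeff_b_def st_def dot_cA cA_index)
 qed
 \<comment> \<open>The last block plays the role of the exceptional set with number 0. Every other
   index is a block of its own, numbered one higher, and these have the scalars \<open>b'\<close>
   equal to 0.\<close>
 let ?I = "%m. if m = 0 then {p + r..<p + r + s} else {m - 1}"
 have 1: "disjoint_family_on ?I {0..p + r}" by (auto simp: disjoint_family_on_def)
 have 2: "(\<Union>m\<in>{0..p + r}. ?I m) = {..<p + r + s}"
 proof (intro equalityI subsetI)
  fix i assume "i : (\<Union>m\<in>{0..p + r}. ?I m)"
  then show "i : {..<p + r + s}" by (auto split: if_splits)
 next
  fix i assume i: "i : {..<p + r + s}"
  show "i : (\<Union>m\<in>{0..p + r}. ?I m)"
   by (rule UN_I[of "if i < p + r then Suc i else 0"]) (use i in auto)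
 qed
 have A0: "cA i j = 0\<^sub>v (p + q)" if "p + r \<le> j" for i j using that by (simp add: coeff_A_def)
 show ?thesis unfolding fundamental_deg1_def
  by (intro conjI pl exI[of _ "p + r"] exI[of _ ?I] exI[of _ "%m. cA 0 (m - 1)"] exI[of _ "%_. 0"] exI[of _ "%i m. cb i (m - 1)"] 1 2)
   (auto simp: coeff_b_def A0 intro!: cA_carrier cA_indep)
qed

lemma mcoeff_S1_pt: "u : X1 ==> mcoeff (S1 c (PG.pt u) i) \<alpha> = (if \<alpha> = 0 then c else if (i, \<alpha>) = u then 1 else 0)"
 by (auto simp: mcoeff_Ser PG.pt_def)

lemma S1_pt: "u : X1 ==> S1 c (PG.pt u) i = mconst c + (if i = fst u then mmono (snd u) else 0)"
 by (rule mfps_eqI) (auto simp: mcoeff_S1_pt)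

context
 fixes j :: nat and \<beta> :: "expo"
 assumes u: "(j, \<beta>) : X1"
begin

lemma \<beta>: "\<beta> ~= 0" using u by simp

lemma S1_LL: "LL \<beta> (if i = j then 1 else 0) (S1 1 (PG.pt (j, \<beta>)) i)"
 using u by (auto simp: LL_def mcoeff_S1_pt)

text \<open>At a point with the single coordinate \<open>(j, \<beta>)\<close> the quotient with
  index \<open>j\<close> has linear coefficient 1 and the other quotients 0, while powers multiply
  this coefficient by the entries of \<open>B\<close>. This is how the identity matrix on top of
  \<open>B\<close> arises.\<close>

lemma tau_LL: assumes v: "v < p + q" shows "LL \<beta> (cA i j $ v) (tau p B (S1 1 (PG.pt (j, \<beta>))) v)"
proof (cases "v < p")
 case True
 have "cA i j $ v = (if v = j then 1 else 0)" using True v by (auto simp: cA_index)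
 with True S1_LL[of v] show ?thesis by (simp add: tau_def)
next
 case False
 have "LL \<beta> (\<Sum>i<p. B $$ (v - p, i) * (if i = j then 1 else 0)) (\<Prod>i<p. mpow (S1 1 (PG.pt (j, \<beta>)) i) (B $$ (v - p, i)))"
  by (intro LL_prod LL_mpow \<beta> S1_LL)
 moreover have "(\<Sum>i<p. B $$ (v - p, i) * (if i = j then 1 else 0)) = cA i j $ v"
  using False v by (simp add: cA_index if_distrib[of "(*) _"] cong: if_cong)
 ultimately show ?thesis using False by (simp add: tau_def)
qed

lemma tpow_LL: "LL \<beta> (dot_exponent (cA i j) \<alpha>) (tpow (p + q) (tau p B (S1 1 (PG.pt (j, \<beta>)))) \<alpha>)"
 unfolding tpow_def dot_cA by (intro LL_prod LL_power \<beta> tau_LL) simp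

text \<open>The exponential contributes the entry of \<open>a\<close> if the coordinate belongs to
  the \<open>P\<close> block, and the powers contribute the entry of \<open>b\<close> if it belongs
  to the quotients; this is the origin of the scalars \<open>coeff_b\<close>.\<close>

lemma Fac_LL: "LL \<beta> (if j < p then b k $ j else if j < p + r then a k $ (j - p) else 0)
  (factor p r (a k) (b k) (%i. S1 0 (PG.pt (j, \<beta>)) (p + i)) (S1 1 (PG.pt (j, \<beta>))))"
proof -
 let ?h = "\<Sum>i<r. mconst (a k $ i) * S1 0 (PG.pt (j, \<beta>)) (p + i)"
 have h: "mcoeff ?h \<gamma> = (\<Sum>i<r. if \<gamma> = \<beta> \<and> p + i = j then a k $ i else 0)" for \<gamma>
  using u by (auto simp: mcoeff_sum mcoeff_S1_pt intro!: sum.cong)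
 have e: "(\<Sum>i<r. if p + i = j then a k $ i else 0) = (if j < p then 0 else if j < p + r then a k $ (j - p) else 0)"
 proof (cases "p \<le> j")
  case True
  then have "(\<Sum>i<r. if p + i = j then a k $ i else 0) = (\<Sum>i<r. if i = j - p then a k $ i else 0)"
   by (intro sum.cong) auto
  with True show ?thesis by auto
 qed (auto intro: sum.neutral)
 have "LL \<beta> (\<Sum>i<r. if p + i = j then a k $ i else 0) (mexp ?h)"
 proof (rule LL_mexp[OF \<beta>])
  show "mcoeff ?h 0 = 0" unfolding h using \<beta> by simp
  show "mcoeff ?h \<beta> = (\<Sum>i<r. if p + i = j then a k $ i else 0)" unfolding h by simp
  fix x y assume "x + y = \<beta>" "y ~= 0"
  then have "x ~= \<beta>" by auto
  then show "mcoeff ?h x = 0" unfolding h by simp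
 qed
 moreover have "LL \<beta> (\<Sum>i<p. b k $ i * (if i = j then 1 else 0)) (\<Prod>i<p. mpow (S1 1 (PG.pt (j, \<beta>)) i) (b k $ i))"
  by (intro LL_prod LL_mpow \<beta> S1_LL)
 ultimately have "LL \<beta> ((\<Sum>i<r. if p + i = j then a k $ i else 0) + (\<Sum>i<p. b k $ i * (if i = j then 1 else 0)))
  (factor p r (a k) (b k) (%i. S1 0 (PG.pt (j, \<beta>)) (p + i)) (S1 1 (PG.pt (j, \<beta>))))"
  unfolding factor_def by (rule LL_mult[OF \<beta>])
 moreover have "(\<Sum>i<p. b k $ i * (if i = j then 1 else 0)) = (if j < p then b k $ j else 0)"
  by (simp add: if_distrib[of "(*) _"] cong: if_cong)
 ultimately show ?thesis unfolding e by (auto split: if_splits)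
qed

text \<open>The second point contributes the monomial of exponent \<open>\<alpha>\<close>, so what
  is needed is the coefficient at \<open>\<beta>\<close> of the factors multiplying it. The
  additional 1 for \<open>l = j < p\<close> is the linear part of the leading factor in the
  multiplicative rows; in the other rows the first point only enters additively and through the
  substitution and the multiplier.\<close>

lemma fm_pt:
 assumes w: "(i, \<alpha>) : X1" and l: "l < p + r + s"
 shows "fm1 (PG.pt (j, \<beta>)) (PG.pt (i, \<alpha>)) (l, \<alpha> + \<beta>) =
  (if l = i then dot_exponent (cA i j) \<alpha> + cb i j + (if l = j \<and> l < p then 1 else 0) else 0)"
proof -
 have v: "(l, \<alpha> + \<beta>) : X1" using w u l by (auto simp: exponents_add add_eq_0_iff_nat)
 have ab: "\<alpha> + \<beta> ~= 0" "\<alpha> + \<beta> ~= \<beta>" "\<alpha> ~= 0" using w u by (auto simp: add_eq_0_iff_nat)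
 let ?g = "PG.pt (j, \<beta>)"
 let ?t = "tpow (p + q) (tau p B (S1 1 ?g)) \<alpha>"
 have tw: "twist (p + q) (tau p B (S1 1 ?g)) (S1 c (PG.pt (i, \<alpha>)) l) = mconst c + (if l = i then mmono \<alpha> * ?t else 0)" for c
  unfolding S1_pt[OF w] by (simp add: twist_mmono)
 have S: "mcoeff (S1 c ?g l) (\<alpha> + \<beta>) = 0" for c using ab u by (simp add: mcoeff_S1_pt)
 have m: "mcoeff (F * (mmono \<alpha> * ?t)) (\<alpha> + \<beta>) = mcoeff (F * ?t) \<beta>" for F
  using mcoeff_mmono_mult_add(1)[of \<alpha> "F * ?t" \<beta>] by (simp add: ac_simps)
 note t = tpow_LL[of i \<alpha>]
 consider (1) "l < p" | (2) "\<not> l < p" "l < p + r" | (3) "\<not> l < p" "\<not> l < p + r" by blast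
 then show ?thesis
 proof cases
  case 1
  have "mcoeff (S1 1 ?g l * ?t) \<beta> = (if l = j then 1 else 0) + dot_exponent (cA i j) \<alpha>"
   by (rule LL_D(2)[OF LL_mult[OF \<beta> S1_LL t]])
  then have k: "mcoeff (S1 1 ?g l * (1 + mmono \<alpha> * ?t)) (\<alpha> + \<beta>) = (if l = j then 1 else 0) + dot_exponent (cA i j) \<alpha>"
   unfolding distrib_left mult_1_right mcoeff_simps(1) S m by simp
  show ?thesis
  proof (cases "l = i")
   case True
   show ?thesis unfolding fm_apply[OF v] tw mconst_01 if_P[OF 1] if_P[OF True] k using 1 True by (auto simp: coeff_b_def)
  next
   case False
   show ?thesis unfolding fm_apply[OF v] tw mconst_01 if_P[OF 1] if_not_P[OF False] by (simp add: S)
  qed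
 next
  case 2
  then show ?thesis unfolding fm_apply[OF v] tw mconst_01
   using LL_D(2)[OF t] by (simp add: S coeff_b_def)
 next
  case 3
  let ?f = "factor p r (a (l - p - r)) (b (l - p - r)) (%i. S1 0 ?g (p + i)) (S1 1 ?g)"
  have "mcoeff (?f * ?t) \<beta> = (if j < p then b (l - p - r) $ j else if j < p + r then a (l - p - r) $ (j - p) else 0) + dot_exponent (cA i j) \<alpha>"
   by (rule LL_D(2)[OF LL_mult[OF \<beta> Fac_LL t]])
  then have k: "mcoeff (S1 0 ?g l + (0 + mmono \<alpha> * ?t) * ?f) (\<alpha> + \<beta>) =
    (if j < p then b (l - p - r) $ j else if j < p + r then a (l - p - r) $ (j - p) else 0) + dot_exponent (cA i j) \<alpha>"
   unfolding add_0_left mult.commute[of "mmono \<alpha> * ?t" ?f] mcoeff_simps(1) S m by simp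
  show ?thesis
  proof (cases "l = i")
   case True
   show ?thesis unfolding fm_apply[OF v] tw mconst_01 if_not_P[OF 3(1)] if_not_P[OF 3(2)] if_P[OF True] k
    using 3 True by (auto simp: coeff_b_def diff_diff_left)
  next
   case False
   show ?thesis unfolding fm_apply[OF v] tw mconst_01 if_not_P[OF 3(1)] if_not_P[OF 3(2)] if_not_P[OF False] by (simp add: S)
  qed
 qed
qed

end

text \<open>The additional term occurs for both orders exactly when all three indices are equal and
  below \<open>p\<close>, so it cancels. What remains are the two structure coefficients of the
  pre-Lie product.\<close>

lemma lam_diff:
 assumes u: "u : X1" and w: "w : X1" and v: "v : X1"
 shows "PG.lam v u w - PG.lam v w u = (if v = tg u w then st cA cb u w else 0) - (if v = tg w u then st cA cb w u else 0)"
proof -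
 obtain j \<beta> i \<alpha> l \<gamma> where d: "u = (j, \<beta>)" "w = (i, \<alpha>)" "v = (l, \<gamma>)" by (cases u; cases w; cases v)
 show ?thesis
 proof (cases "\<gamma> = \<alpha> + \<beta>")
  case True
  have l: "l < p + r + s" using v by (simp add: d)
  have "PG.lam v u w = (if l = i then dot_exponent (cA i j) \<alpha> + cb i j + (if l = j \<and> l < p then 1 else 0) else 0)"
   unfolding PG.lam_def using fm_pt[OF u[unfolded d] w[unfolded d] l] True by (simp add: d add.commute)
  moreover have "PG.lam v w u = (if l = j then dot_exponent (cA j i) \<beta> + cb j i + (if l = i \<and> l < p then 1 else 0) else 0)"
   unfolding PG.lam_def using fm_pt[OF w[unfolded d] u[unfolded d] l] True by (simp add: d add.commute)
  ultimately show ?thesis using True by (auto simp: d tg_def st_def add.commute)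
 next
  case False
  then show ?thesis by (auto simp: PG.lam_def d tg_def add.commute)
 qed
qed

lemma env_group_FG: "env_group X1 snd (p + q) fm1 fi1 DA1 (pre_lie_bracket DA1)"
proof (rule env_group.intro[OF poly_group_FG], rule env_group_axioms.intro)
 show "carrier DA1 = {x. keys x <= X1}" "\<And>x y. x \<oplus>\<^bsub>DA1\<^esub> y = x + y" "\<And>c x. c \<odot>\<^bsub>DA1\<^esub> x = pm_scale c x"
  by (simp_all add: DL_simps)
 fix x y :: "nat \<times> expo \<Rightarrow>\<^sub>0 'k" assume k: "keys x <= X1" "keys y <= X1"
 then have c: "x : carrier DA1" "y : carrier DA1" by (simp_all add: DL_simps)
 show "keys (pre_lie_bracket DA1 x y) <= X1"
  unfolding DL_bracket[OF c] diff_conv_add_uminus uminus_eq_pm_scale by (intro keys_addI keys_pm_scaleI DL_closed k)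
 fix v assume v: "v : X1"
 show "lookup (pre_lie_bracket DA1 x y) v = (\<Sum>u\<in>keys x. \<Sum>w\<in>keys y.
  lookup x u * lookup y w * (PG.lam v u w - PG.lam v w u))"
  unfolding DL_bracket_lookup[OF c]
  by (intro sum.cong refl) (simp only: lam_diff[OF subsetD[OF k(1)] subsetD[OF k(2)] v])
qed

lemma main:
 "\<exists>(H :: ('k, ((nat \<times> expo) \<Rightarrow>\<^sub>0 nat) \<Rightarrow>\<^sub>0 'k) hopf) gr.
  commutative_hopf_algebra H \<and> graded_hopf_algebra (p + q) H gr \<and> locally_finite (p + q) H gr \<and>
  group (full_group p q r B s a b) \<and> group (character_group H) \<and> full_group p q r B s a b \<cong> character_group H \<and>
  graded_hopf_isomorphic (p + q) (enveloping_algebra DA1 (pre_lie_bracket DA1))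
   (env_grading DA1 (pre_lie_bracket DA1) (deg1_grading (p + q) (p + r + s))) (graded_dual (p + q) H gr) (dual_grading (p + q) H gr)"
proof -
 interpret EG: env_group "{g. \<forall>v. v \<notin> X1 \<longrightarrow> g v = 0}" X1 snd "p + q" fm1 fi1 DA1 "pre_lie_bracket DA1" by (rule env_group_FG)
 have gr: "deg1_grading (p + q) (p + r + s) = EG.grL"
  by (rule ext) (auto simp: deg1_grading_def)
 have iso: "full_group p q r B s a b \<cong> character_group PG.H" "group (character_group PG.H)"
  by (rule PG.character_iso[OF group_full cod_iso(1) cod_iso(2) cod_one]; assumption)+
 show ?thesis
  unfolding gr by (intro exI[of _ PG.H] exI[of _ "pgr X1 snd"] conjI PG.commutative_hopf_H PG.graded_H PG.locally_finite_H group_full iso EG.graded_dual_iso)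
qed

end

theorem proposition31:
  fixes p q r :: nat
    and B :: "'k::field_char_0 mat"
  assumes "p \<ge> 1" and "B \<in> carrier_mat q p"
  shows
    "(\<forall>a\<in>carrier_vec r. \<forall>b\<in>carrier_vec p.
        group_hom (VG_group p q r B) (AutoGroup (V_group p q))
          (\<lambda>g. \<lambda>Q\<in>carrier (V_group p q). V_action p q r B a b g Q)) \<and>
     (\<forall>s (a :: nat \<Rightarrow> 'k vec) (b :: nat \<Rightarrow> 'k vec).
        (\<forall>k<s. a k \<in> carrier_vec r \<and> b k \<in> carrier_vec p) \<longrightarrow>
        (let L = deg1_algebra (p + q) (p + r + s) (coeff_A p q B) (coeff_b p r a b) in
         fundamental_deg1 (p + q) (p + r + s) (coeff_A p q B) (coeff_b p r a b) \<and>
         (\<exists>(H :: ('k, ((nat \<times> (nat \<Rightarrow>\<^sub>0 nat)) \<Rightarrow>\<^sub>0 nat) \<Rightarrow>\<^sub>0 'k) hopf) gr.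
            commutative_hopf_algebra H \<and>
            graded_hopf_algebra (p + q) H gr \<and>
            locally_finite (p + q) H gr \<and>
            group (full_group p q r B s a b) \<and>
            group (character_group H) \<and>
            full_group p q r B s a b \<cong> character_group H \<and>
            graded_hopf_isomorphic (p + q)
              (enveloping_algebra L (pre_lie_bracket L))
              (env_grading L (pre_lie_bracket L) (deg1_grading (p + q) (p + r + s)))
              (graded_dual (p + q) H gr)
              (dual_grading (p + q) H gr))))"
  unfolding Let_def by (intro conjI ballI allI impI V_action_hom fundamental[OF assms] main[OF assms])

end
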